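(* Let $M\subseteq \mathbb{C}^{n+1}$ be a smooth connected Levi-nondegenerate CR hypersurface with signature $l\leq n/2$. Suppose there is an open connected neighborhood $U$ of $M$ in $\mathbb{C}^{n+1}$ and a holomorphic mapping $f_{0}:U\rightarrow \mathbb{CP}^{N_{0}+1}$ with $f_{0}(M) \subseteq Q_{l}^{N_{0}}$ and $f_{0}$ CR transversal to $Q_{l}^{N_{0}}$ along $M$. Let $f:U \rightarrow \mathbb{CP}^{N+1}$ be a holomorphic mapping with $f(M) \subseteq Q_{l'}^{N}$ and $f$ CR transversal to $Q_{l'}^{N}$ along $M$. Then the following hold. (a) If $l = n/2$ or $f$ is side preserving, then $l' \ge l$ and $N - l' \ge n - l$. If (still under the assumption that $l=n/2$ or $f$ is side preserving) either (i) $(N_{0} - n) + (l' - l) < l$, or (ii) $(N_{0} - n) + \min(l' - l, (N-l')-(n-l)) < n$ and $(N - l') - (n - l) < l$, then $f(M) \subseteq Q_{l'}^{N} \cap P$, where $P$ is a complex plane of dimension $(N_{0} + 1) + \min(l' - l,(N-l')-(n-l))$. (b) If $f$ is side reversing, then $N - l' \ge l$ and $l' \ge n - l$. If (still with $f$ side reversing) $l' < n$ and $(N_{0} - n) + (l' + l -n) < n$, then $f(M) \subseteq Q_{l'}^{N} \cap P$, where $P$ is a complex plane of dimension $(N_{0} + 1) + (l' + l - n)$.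
   Context: **Signature and hyperquadrics.** For a connected Levi-nondegenerate CR manifold $M$ of hypersurface type, of CR dimension $n$ (real dimension $2n+1$), the signature $l\le n/2$ is the minimum of the number of positive and the number of negative eigenvalues of a representative of the Levi form at any point (constant on $M$). For $0\le l'\le N/2$, $Q_{l'}^{N}\subset\mathbb{CP}^{N+1}$ is the hyperquadric $-\sum_{j=0}^{l'}|z_j|^2+\sum_{k=l'+1}^{N+1}|z_k|^2=0$ in homogeneous coordinates $[z_0:\dots:z_{N+1}]$; it is a connected Levi-nondegenerate CR hypersurface of CR dimension $N$ and signature $l'$. The hyperquadric $Q_l^{N_0}\subset\mathbb{CP}^{N_0+1}$ is defined in the same way. **Planes.** $\mathbb{C}^{N+1}$ is viewed as an affine chart of $\mathbb{CP}^{N+1}$; "complex plane of dimension $d$" means a complex projective linear subspace of $\mathbb{CP}^{N+1}$ of complex dimension $d$ (the closure of an affine complex plane of dimension $d$ in $\mathbb{C}^{N+1}$). **CR transversality.** If $\theta$ is a (local) contact form on $M$, and $\hat\theta$ one on a Levi-nondegenerate CR hypersurface $\hat M$, then a CR map $f:M\to\hat M$ satisfies $f^*\hat\theta=a\theta$ with $a$ a real-valued function; $f$ is CR transversal to $\hat M$ along $M$ if $a$ is nowhere zero on $M$. (The restrictions of $f_0,f$ to $M$ are CR maps into the respective hyperquadrics.) **Side preserving / reversing.** Suppose $l<n/2$ and $l'<N/2$. Choose contact forms $\theta$ on $M$ and $\hat\theta$ on $Q^N_{l'}$ (with coframes) such that the Levi form matrix of $M$, defined by $d\theta\equiv ig_{\alpha\bar\beta}\theta^\alpha\wedge\theta^{\bar\beta}$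 mod $\theta$, has $l$ negative and $n-l$ positive eigenvalues, and the Levi form matrix of $Q^N_{l'}$, defined likewise from $\hat\theta$, has $l'$ negative and $N-l'$ positive eigenvalues. The CR transversal map $f$ is side preserving if the nonvanishing function $a$ with $f^*\hat\theta=a\theta$ is strictly positive, and side reversing if $a$ is strictly negative. This does not depend on the choices.
   Formalization: When the stated dimension of the complex plane P exceeds N+1, no such plane exists in CP^{N+1} (e.g. M the affine part of Q_2^4, N_0=5, f the identity), so the dimension of P is taken to be the minimum of the stated number and N+1. *)

theory Defs
  imports
    "HOL-Analysis.Analysis"
    "HOL-Computational_Algebra.Fundamental_Theorem_Algebra"
    "Jordan_Normal_Form.Char_Poly"
begin

no_notation Matrix.vec_index (infixl "$" 100)

section \<open>Smooth and holomorphic maps\<close>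

text \<open>The derivatives of order \<open>k + 1\<close> are expressed as \<open>k\<close>-fold differentiability of all
  directional derivatives; the set \<open>V\<close> is meant to be open.\<close>

fun Ck_on :: "nat \<Rightarrow> 'a::real_normed_vector set \<Rightarrow> ('a \<Rightarrow> 'b::real_normed_vector) \<Rightarrow> bool" where
  "Ck_on 0 V g \<longleftrightarrow> continuous_on V g"
| "Ck_on (Suc k) V g \<longleftrightarrow>
     (\<forall>x\<in>V. g differentiable (at x)) \<and> (\<forall>v. Ck_on k V (\<lambda>x. frechet_derivative g (at x) v))"

definition smooth_on :: "'a::real_normed_vector set \<Rightarrow> ('a \<Rightarrow> 'b::real_normed_vector) \<Rightarrow> bool" where
  "smooth_on V g \<longleftrightarrow> (\<forall>k. Ck_on k V g)"

definition holomorphic_map_on :: "(complex ^ 'm) set \<Rightarrow> (complex ^ 'm \<Rightarrow> complex ^ 'k) \<Rightarrow> bool" where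
  "holomorphic_map_on V F \<longleftrightarrow>
     (\<forall>x\<in>V. \<exists>D. (F has_derivative D) (at x) \<and> Vector_Spaces.linear (*s) (*s) D)"

section \<open>Complex projective space\<close>

text \<open>A point of projective space is a complex line through the origin of \<open>complex ^ 'b\<close>, so
  that \<open>'b cproj\<close> is the projective space of dimension \<open>CARD('b) - 1\<close>.\<close>

typedef ('b::finite) cproj = "{vec.span {z} | z :: complex ^ 'b. z \<noteq> 0}"
  morphisms line_of Abs_cproj
proof -
  have "(1 :: complex ^ 'b) \<noteq> 0" by (simp add: vec_eq_iff)
  then show ?thesis by blast
qed

text \<open>Homogeneous coordinates are numbered \<open>0, 1, \<dots>, CARD('b) - 1\<close> along the order of \<open>'b\<close>.\<close>

definition hcoord :: "complex ^ 'b::{finite,linorder} \<Rightarrow> nat \<Rightarrow> complex" where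
  "hcoord z j = z $ (sorted_list_of_set (UNIV :: 'b set) ! j)"

text \<open>The affine chart where the coordinate \<open>k\<close> does not vanish. Its target is the affine
  hyperplane \<open>w $ k = 1\<close> of \<open>complex ^ 'b\<close>, which is a copy of the complex affine space of
  dimension \<open>CARD('b) - 1\<close>.\<close>

definition chart_domain :: "'b::finite \<Rightarrow> 'b cproj set" where
  "chart_domain k = {L. \<exists>z\<in>line_of L. z $ k \<noteq> 0}"

definition chart :: "'b::finite \<Rightarrow> 'b cproj \<Rightarrow> complex ^ 'b" where
  "chart k L = (THE w. w \<in> line_of L \<and> w $ k = 1)"

definition affine_part :: "'b::finite \<Rightarrow> 'b cproj set \<Rightarrow> (complex ^ 'b) set" where
  "affine_part k S = chart k ` (S \<inter> chart_domain k)"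

definition holomorphic_cproj_on :: "(complex ^ 'm) set \<Rightarrow> (complex ^ 'm \<Rightarrow> 'b::finite cproj) \<Rightarrow> bool" where
  "holomorphic_cproj_on U f \<longleftrightarrow>
     (\<forall>p\<in>U. \<exists>V k. open V \<and> p \<in> V \<and> V \<subseteq> U \<and> f ` V \<subseteq> chart_domain k \<and>
        holomorphic_map_on V (\<lambda>x. chart k (f x)))"

definition hyperquadric :: "nat \<Rightarrow> 'b::{finite,linorder} cproj set" where
  "hyperquadric l = {L. \<forall>z\<in>line_of L.
     - (\<Sum>j=0..l. (cmod (hcoord z j))\<^sup>2) + (\<Sum>k=l+1..CARD('b) - 1. (cmod (hcoord z k))\<^sup>2) = 0}"

definition projective_plane :: "int \<Rightarrow> 'b::finite cproj set \<Rightarrow> bool" where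
  "projective_plane d P \<longleftrightarrow>
     (\<exists>W. vec.subspace W \<and> int (vec.dim W) = d + 1 \<and> P = {L. line_of L \<subseteq> W})"

section \<open>Embedded CR manifolds of hypersurface type\<close>

text \<open>The following notions apply to real hypersurfaces of \<open>complex ^ 'm\<close> and to the affine parts
  of hyperquadrics. The latter lie in a complex affine hyperplane, so their tangent spaces and CR
  structures may be computed in the ambient vector space.\<close>

definition smooth_real_hypersurface :: "(complex ^ 'm) set \<Rightarrow> bool" where
  "smooth_real_hypersurface M \<longleftrightarrow>
     (\<forall>p\<in>M. \<exists>V (\<rho> :: complex ^ 'm \<Rightarrow> real). open V \<and> p \<in> V \<and> smooth_on V \<rho> \<and>
        (\<forall>x\<in>V. frechet_derivative \<rho> (at x) \<noteq> (\<lambda>v. 0)) \<and> M \<inter> V = {x\<in>V. \<rho> x = 0})"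

definition tangent_space :: "(complex ^ 'm) set \<Rightarrow> complex ^ 'm \<Rightarrow> (complex ^ 'm) set" where
  "tangent_space S p = {v. \<exists>(\<gamma> :: real \<Rightarrow> complex ^ 'm) e. e > 0 \<and> smooth_on {-e<..<e} \<gamma> \<and>
     \<gamma> ` {-e<..<e} \<subseteq> S \<and> \<gamma> 0 = p \<and> (\<gamma> has_vector_derivative v) (at 0)}"

definition complex_tangent_space :: "(complex ^ 'm) set \<Rightarrow> complex ^ 'm \<Rightarrow> (complex ^ 'm) set" where
  "complex_tangent_space S p = {v. v \<in> tangent_space S p \<and> \<i> *s v \<in> tangent_space S p}"

text \<open>A contact form on \<open>S \<inter> V\<close> is given by a smooth real one-form on the open set \<open>V\<close>, of which
  only the restriction to the tangent spaces of \<open>S\<close> matters. Locally every smooth form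
  on \<open>S\<close> has such an extension.\<close>

type_synonym 'm form1 = "complex ^ 'm \<Rightarrow> complex ^ 'm \<Rightarrow> real"

definition contact_form_on :: "(complex ^ 'm) set \<Rightarrow> (complex ^ 'm) set \<Rightarrow> 'm form1 \<Rightarrow> bool" where
  "contact_form_on S V \<theta> \<longleftrightarrow> open V \<and> (\<forall>x\<in>V. linear (\<theta> x)) \<and> (\<forall>v. smooth_on V (\<lambda>x. \<theta> x v)) \<and>
     (\<forall>x\<in>S \<inter> V. {v\<in>tangent_space S x. \<theta> x v = 0} = complex_tangent_space S x)"

definition ext_deriv :: "'m form1 \<Rightarrow> complex ^ 'm \<Rightarrow> complex ^ 'm \<Rightarrow> complex ^ 'm \<Rightarrow> real" where
  "ext_deriv \<theta> p u v =
     frechet_derivative (\<lambda>x. \<theta> x v) (at p) u - frechet_derivative (\<lambda>x. \<theta> x u) (at p) v"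

text \<open>A complexified tangent vector \<open>x + i y\<close> is the pair \<open>(x, y)\<close> of real vectors, where the
  formal imaginary unit is unrelated to the complex structure \<open>v \<mapsto> \<i> *s v\<close>.\<close>

definition complexify2 ::
  "('a \<Rightarrow> 'a \<Rightarrow> real) \<Rightarrow> 'a \<times> 'a \<Rightarrow> 'a \<times> 'a \<Rightarrow> complex" where
  "complexify2 \<omega> X Y = Complex (\<omega> (fst X) (fst Y) - \<omega> (snd X) (snd Y))
                               (\<omega> (fst X) (snd Y) + \<omega> (snd X) (fst Y))"

text \<open>The vectors \<open>(v - i J v) / 2\<close> of type (1,0) and \<open>(v + i J v) / 2\<close> of type (0,1).\<close>

definition part10 :: "complex ^ 'm \<Rightarrow> (complex ^ 'm) \<times> (complex ^ 'm)" where
  "part10 v = ((1/2) *\<^sub>R v, - ((1/2) *\<^sub>R (\<i> *s v)))"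

definition part01 :: "complex ^ 'm \<Rightarrow> (complex ^ 'm) \<times> (complex ^ 'm)" where
  "part01 v = ((1/2) *\<^sub>R v, (1/2) *\<^sub>R (\<i> *s v))"

text \<open>\<open>G\<close> is the matrix of the Levi form of \<open>\<theta>\<close> at \<open>p\<close> in some frame \<open>L\<^sub>0, \<dots>, L\<^sub>n\<^sub>-\<^sub>1\<close> of (1,0)-vectors.
  Evaluating \<open>d\<theta> \<equiv> i g\<^sub>\<alpha>\<^sub>\<beta> \<theta>\<^sup>\<alpha> \<and> \<theta>\<^sup>\<beta>\<close> (the second coframe conjugated) on the dual frame
  gives \<open>g\<^sub>\<alpha>\<^sub>\<beta> = - i d\<theta>(L\<^sub>\<alpha>, conj L\<^sub>\<beta>)\<close>.\<close>

definition levi_matrix ::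
  "(complex ^ 'm) set \<Rightarrow> nat \<Rightarrow> 'm form1 \<Rightarrow> complex ^ 'm \<Rightarrow> complex mat \<Rightarrow> bool" where
  "levi_matrix S n \<theta> p G \<longleftrightarrow>
     (\<exists>u. inj_on u {..<n} \<and> vec.independent (u ` {..<n}) \<and>
        vec.span (u ` {..<n}) = complex_tangent_space S p \<and>
        G = mat n n (\<lambda>(\<alpha>, \<beta>). - \<i> * complexify2 (ext_deriv \<theta> p) (part10 (u \<alpha>)) (part01 (u \<beta>))))"

definition levi_representative :: "(complex ^ 'm) set \<Rightarrow> nat \<Rightarrow> complex ^ 'm \<Rightarrow> complex mat \<Rightarrow> bool" where
  "levi_representative S n p G \<longleftrightarrow> (\<exists>V \<theta>. p \<in> V \<and> contact_form_on S V \<theta> \<and> levi_matrix S n \<theta> p G)"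

text \<open>Eigenvalues are counted with multiplicity.\<close>

definition num_pos_eigenvalues :: "complex mat \<Rightarrow> nat" where
  "num_pos_eigenvalues G = size (filter_mset (\<lambda>x. x \<in> \<real> \<and> Re x > 0) (proots (char_poly G)))"

definition num_neg_eigenvalues :: "complex mat \<Rightarrow> nat" where
  "num_neg_eigenvalues G = size (filter_mset (\<lambda>x. x \<in> \<real> \<and> Re x < 0) (proots (char_poly G)))"

definition levi_nondegenerate :: "(complex ^ 'm) set \<Rightarrow> nat \<Rightarrow> bool" where
  "levi_nondegenerate S n \<longleftrightarrow> (\<forall>p\<in>S. \<forall>G. levi_representative S n p G \<longrightarrow> Determinant.det G \<noteq> 0)"

definition has_signature :: "(complex ^ 'm) set \<Rightarrow> nat \<Rightarrow> nat \<Rightarrow> bool" where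
  "has_signature S n l \<longleftrightarrow> (\<forall>p\<in>S. \<forall>G. levi_representative S n p G \<longrightarrow>
     min (num_pos_eigenvalues G) (num_neg_eigenvalues G) = l)"

definition contact_form_of_type ::
  "(complex ^ 'm) set \<Rightarrow> (complex ^ 'm) set \<Rightarrow> nat \<Rightarrow> nat \<Rightarrow> 'm form1 \<Rightarrow> bool" where
  "contact_form_of_type S V n l \<theta> \<longleftrightarrow> contact_form_on S V \<theta> \<and>
     (\<forall>x\<in>S \<inter> V. \<forall>G. levi_matrix S n \<theta> x G \<longrightarrow>
        num_neg_eigenvalues G = l \<and> num_pos_eigenvalues G = n - l)"

section \<open>Transversality, side preserving and side reversing maps\<close>

text \<open>\<open>f\<^sup>*\<theta>' = a \<theta>\<close> on \<open>M \<inter> V\<close>, where \<open>\<theta>'\<close> is a form on the open subset \<open>W\<close> of the \<open>k\<close>-th chart.\<close>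

definition pulls_back_on ::
  "(complex ^ 'm) set \<Rightarrow> (complex ^ 'm) set \<Rightarrow> 'm form1 \<Rightarrow> (complex ^ 'b) set \<Rightarrow> 'b form1 \<Rightarrow> 'b::finite \<Rightarrow>
   (complex ^ 'm \<Rightarrow> 'b cproj) \<Rightarrow> (complex ^ 'm \<Rightarrow> real) \<Rightarrow> bool" where
  "pulls_back_on M V \<theta> W \<theta>' k f a \<longleftrightarrow>
     (\<forall>x\<in>M \<inter> V. f x \<in> chart_domain k \<and> chart k (f x) \<in> W \<and>
        (\<forall>v\<in>tangent_space M x.
           \<theta>' (chart k (f x)) (frechet_derivative (\<lambda>y. chart k (f y)) (at x) v) = a x * \<theta> x v))"

definition cr_transversal ::
  "(complex ^ 'm) set \<Rightarrow> (complex ^ 'm \<Rightarrow> 'b::finite cproj) \<Rightarrow> 'b cproj set \<Rightarrow> bool" where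
  "cr_transversal M f Q \<longleftrightarrow> (\<forall>p\<in>M. \<exists>V \<theta> k W \<theta>' a. p \<in> V \<and>
     contact_form_on M V \<theta> \<and> contact_form_on (affine_part k Q) W \<theta>' \<and>
     pulls_back_on M V \<theta> W \<theta>' k f a \<and> (\<forall>x\<in>M \<inter> V. a x \<noteq> 0))"

text \<open>\<open>M\<close> has CR dimension \<open>n\<close> and signature \<open>l\<close>, the target \<open>Q\<close> has CR dimension \<open>N\<close> and signature \<open>l'\<close>.
  The contact forms are chosen locally. Since \<open>2 * l < n\<close> and \<open>2 * l' < N\<close>, they are determined up
  to positive factors, so that neither condition depends on the choice.\<close>

definition side_preserving ::
  "nat \<Rightarrow> nat \<Rightarrow> nat \<Rightarrow> nat \<Rightarrow> (complex ^ 'm) set \<Rightarrow> (complex ^ 'm \<Rightarrow> 'b::finite cproj) \<Rightarrow> 'b cproj set \<Rightarrow> bool" where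
  "side_preserving n l N l' M f Q \<longleftrightarrow> 2 * l < n \<and> 2 * l' < N \<and>
     (\<forall>p\<in>M. \<exists>V \<theta> k W \<theta>' a. p \<in> V \<and>
        contact_form_of_type M V n l \<theta> \<and> contact_form_of_type (affine_part k Q) W N l' \<theta>' \<and>
        pulls_back_on M V \<theta> W \<theta>' k f a \<and> (\<forall>x\<in>M \<inter> V. a x > 0))"

definition side_reversing ::
  "nat \<Rightarrow> nat \<Rightarrow> nat \<Rightarrow> nat \<Rightarrow> (complex ^ 'm) set \<Rightarrow> (complex ^ 'm \<Rightarrow> 'b::finite cproj) \<Rightarrow> 'b cproj set \<Rightarrow> bool" where
  "side_reversing n l N l' M f Q \<longleftrightarrow> 2 * l < n \<and> 2 * l' < N \<and>
     (\<forall>p\<in>M. \<exists>V \<theta> k W \<theta>' a. p \<in> V \<and>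
        contact_form_of_type M V n l \<theta> \<and> contact_form_of_type (affine_part k Q) W N l' \<theta>' \<and>
        pulls_back_on M V \<theta> W \<theta>' k f a \<and> (\<forall>x\<in>M \<inter> V. a x < 0))"

end

theory Submission
  imports Defs "HOL-Complex_Analysis.Complex_Analysis" "Jordan_Normal_Form.Schur_Decomposition"
begin

text \<open>Let \<open>F\<^sub>0\<close> and \<open>F\<close> be local lifts of \<open>f\<^sub>0\<close> and \<open>f\<close>, and \<open>R(z, w)\<close>, \<open>B(z, w)\<close> the Hermitian forms of the
  two quadrics evaluated at \<open>F\<^sub>0 z, F\<^sub>0 w\<close> and at \<open>F z, F w\<close>. Transversality of both maps gives
  \<open>\<langle>dF, F\<rangle> = \<tau> \<langle>dF\<^sub>0, F\<^sub>0\<rangle>\<close> along \<open>M\<close> with a real nonvanishing \<open>\<tau>\<close>, whose sign tells side preserving from side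
  reversing maps, and comparison of the contact forms gives the same proportionality of the Levi forms.
  By polarization \<open>B\<close> vanishes where \<open>R\<close> does. On the Segre variety \<open>R(\<cdot>, p) = 0\<close> of a point \<open>p \<in> M\<close> the
  difference between \<open>B\<close>, suitably normalized, and \<open>R\<close> still vanishes where \<open>R\<close> does, but under the
  numerical assumptions it has fewer positive (or negative) squares than the Levi form; in the spirit of
  Huang's lemma this forces it to be zero. Hence \<open>B(z, w) = \<phi>(z) cnj (\<phi>(w)) R(z, w)\<close> on
  Segre varieties and then on an open set, which bounds the dimension of the linear span
  of the image of \<open>F\<close>. The identity theorem propagates the resulting plane to all of \<open>U\<close>.\<close>

section \<open>Hermitian forms\<close>

text \<open>The numerical hypotheses are a count of squares. The form \<open>\<tau> s1 - s0\<close>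
  on the direct sum has as many positive squares as \<open>s1\<close> has positive and
  \<open>s0\<close> has negative ones. An isotropic subspace of dimension
  \<open>CARD('m) + 1 = n + 2\<close> uses up \<open>n + 2\<close> of them, and fewer than
  \<open>l\<close> may remain, because the Levi form has at least \<open>l\<close> positive and
  \<open>l\<close> negative directions. For side preserving maps the count reads
  \<open>N - l' < n\<close>; made with both forms negated it is condition (i). For side reversing
  maps the target form is turned around and the count reads \<open>l' < n\<close>. The kernel to be
  annihilated is only a germ, whereas the algebra with null vectors needs a kernel on a whole vector
  space. Its lowest order term is such a kernel; it inherits the bound on positive squares by
  openness of definiteness, and the zeros of the Levi form by Hurwitz's theorem. No complexification
  of \<open>M\<close> is used. The Segre varieties are hyperplane sections of the model quadric
  pulled back by \<open>F0\<close>, and \<open>M\<close> itself enters through its infinitely many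
  points on complex lines in a transversal direction.\<close>

no_notation Matrix.vec_index (infixl "$" 100)
no_notation fps_nth (infixl "$" 75)

lemmas cart_eq_iff = Finite_Cartesian_Product.vec_eq_iff

definition hf :: "('i::finite \<Rightarrow> real) \<Rightarrow> complex^'i \<Rightarrow> complex^'i \<Rightarrow> complex" where
  "hf s x y = (\<Sum>i\<in>UNIV. of_real (s i) * x$i * cnj (y$i))"

locale hermitian_form =
  fixes L :: "complex^'m \<Rightarrow> complex^'m \<Rightarrow> complex"
  assumes add_left: "L (x + y) z = L x z + L y z"
    and scale_left: "L (a *s x) z = a * L x z"
    and hermitian: "L y x = cnj (L x y)"
begin

lemma add_right: "L x (y + z) = L x y + L x z"
  by (metis add_left hermitian complex_cnj_add)

lemma scale_right: "L x (a *s y) = cnj a * L x y"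
  by (metis scale_left hermitian complex_cnj_mult)

lemma zero_left [simp]: "L 0 y = 0"
  using scale_left[of 0 0 y] by simp

lemma zero_right [simp]: "L x 0 = 0"
  by (metis hermitian zero_left complex_cnj_zero)

lemma diff_left: "L (x - y) z = L x z - L y z"
  by (metis add_left add_diff_cancel diff_add_cancel)

lemma diff_right: "L x (y - z) = L x y - L x z"
  by (metis add_right add_diff_cancel diff_add_cancel)

lemma sum_left: "L (\<Sum>i\<in>I. g i) y = (\<Sum>i\<in>I. L (g i) y)"
  by (induction I rule: infinite_finite_induct) (auto simp: add_left)

lemma sum_right: "L x (\<Sum>i\<in>I. g i) = (\<Sum>i\<in>I. L x (g i))"
  by (induction I rule: infinite_finite_induct) (auto simp: add_right)

lemma diag_real: "Im (L x x) = 0"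
  using hermitian[of x x] by (simp add: complex_eq_iff)

lemma diag_of_real: "L x x = of_real (Re (L x x))"
  by (simp add: complex_eq_iff diag_real)

lemma uminus: "hermitian_form (\<lambda>x y. - L x y)"
  by unfold_locales (auto simp: add_left scale_left intro: hermitian)

text \<open>Gram-Schmidt: as long as fewer than \<open>vec.dim W\<close> vectors are chosen, some
  element of \<open>W\<close> lies outside their span, and what remains of it after projection has
  positive square.\<close>

lemma orthonormal_frame:
  assumes "vec.subspace W" and "\<forall>x\<in>W. x \<noteq> 0 \<longrightarrow> Re (L x x) > 0" and "r \<le> vec.dim W"
  shows "\<exists>f. \<forall>i<r. f i \<in> W \<and> (\<forall>j<r. L (f i) (f j) = (if i = j then 1 else 0))"
  using assms(3)
proof (induction r)
  case 0
  then show ?case by auto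
next
  case (Suc r)
  then obtain f where f: "\<forall>i<r. f i \<in> W \<and> (\<forall>j<r. L (f i) (f j) = (if i = j then 1 else 0))"
    by auto
  have "vec.dim (vec.span (f ` {..<r})) \<le> card (f ` {..<r})"
    by (simp add: vec.dim_le_card vec.span_superset)
  also have "\<dots> \<le> r"
    by (metis card_image_le card_lessThan finite_lessThan)
  finally have "\<not> W \<subseteq> vec.span (f ` {..<r})"
    using Suc.prems vec.dim_subset[of W "vec.span (f ` {..<r})"] by linarith
  then obtain x where x: "x \<in> W" "x \<notin> vec.span (f ` {..<r})" by auto
  define y where "y = x - (\<Sum>i<r. L x (f i) *s f i)"
  have s: "(\<Sum>i<r. L x (f i) *s f i) \<in> vec.span (f ` {..<r})"
    by (intro vec.span_sum vec.span_scale vec.span_base) auto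
  have sW: "(\<Sum>i<r. L x (f i) *s f i) \<in> W"
    by (intro vec.subspace_sum assms(1) vec.subspace_scale) (use f in auto)
  have y0: "y \<noteq> 0" using s x unfolding y_def by auto
  have yW: "y \<in> W" unfolding y_def by (intro vec.subspace_diff assms(1) x sW)
  have orth: "L y (f j) = 0" if "j < r" for j
  proof -
    have "(\<Sum>i<r. L x (f i) * L (f i) (f j)) = (\<Sum>i<r. if i = j then L x (f i) else 0)"
      using f that by (intro sum.cong) auto
    also have "\<dots> = L x (f j)" using that by (simp add: sum.delta)
    finally show ?thesis by (simp add: y_def diff_left sum_left scale_left)
  qed
  define c where "c = Re (L y y)"
  have c: "c > 0" using assms(2) yW y0 c_def by auto
  define z where "z = of_real (1 / sqrt c) *s y"
  have Lyy: "L y y = of_real c" unfolding c_def by (rule diag_of_real)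
  have "(1 / sqrt c) * ((1 / sqrt c) * c) = 1" using c by (simp add: field_simps)
  then have zz: "L z z = 1"
    unfolding z_def scale_left scale_right Lyy complex_cnj_complex_of_real of_real_mult[symmetric] by simp
  have zf: "L z (f j) = 0" if "j < r" for j using orth[OF that] by (simp add: z_def scale_left)
  have fz: "L (f j) z = 0" if "j < r" for j using zf[OF that] hermitian[of "f j" z] by simp
  have zW: "z \<in> W" unfolding z_def by (intro vec.subspace_scale assms(1) yW)
  show ?case
    by (rule exI[of _ "f(r := z)"]) (use f zz zf fz zW in \<open>auto simp: less_Suc_eq\<close>)
qed

end

lemma hermitian_form_hf: "hermitian_form (hf s)"
  by unfold_locales (auto simp: hf_def algebra_simps sum.distrib sum_distrib_left intro!: sum.cong)

interpretation hf: hermitian_form "hf s" for s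
  by (rule hermitian_form_hf)

lemma hf_uminus: "hf (\<lambda>i. - s i) x y = - hf s x y"
  by (simp add: hf_def sum_negf)

lemma hf_scale: "hf (\<lambda>i. c * s i) x y = of_real c * hf s x y"
  by (simp add: hf_def sum_distrib_left algebra_simps)

lemma hf_diag: "Re (hf s x x) = (\<Sum>i\<in>UNIV. s i * (cmod (x$i))\<^sup>2)"
proof -
  have "Re (complex_of_real (s i) * x $ i * cnj (x $ i)) = s i * (cmod (x$i))\<^sup>2" for i
    by (simp only: mult.assoc complex_norm_square[symmetric]) simp
  then show ?thesis by (simp add: hf_def)
qed

lemma dim_kernel_functional:
  fixes \<phi> :: "complex^'m \<Rightarrow> complex"
  assumes W: "vec.subspace W" and add: "\<And>x y. \<phi> (x + y) = \<phi> x + \<phi> y"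
    and sc: "\<And>a x. \<phi> (a *s x) = a * \<phi> x"
  shows "vec.subspace {x\<in>W. \<phi> x = 0}" "vec.dim W \<le> vec.dim {x\<in>W. \<phi> x = 0} + 1"
proof -
  have "\<phi> 0 = 0" using sc[of 0 0] by simp
  then show "vec.subspace {x\<in>W. \<phi> x = 0}"
    using W by (auto simp: vec.subspace_def add sc)
  show "vec.dim W \<le> vec.dim {x\<in>W. \<phi> x = 0} + 1"
  proof (cases "\<exists>w\<in>W. \<phi> w \<noteq> 0")
    case True
    then obtain w where w: "w \<in> W" "\<phi> w \<noteq> 0" by auto
    have "W \<subseteq> vec.span (insert w {x\<in>W. \<phi> x = 0})"
    proof
      fix x assume x: "x \<in> W"
      define y where "y = x - (\<phi> x / \<phi> w) *s w"
      have "x = y + (\<phi> x / \<phi> w) *s w" by (simp add: y_def)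
      moreover have "y \<in> W" unfolding y_def by (intro vec.subspace_diff vec.subspace_scale W x w)
      moreover have "\<phi> x = \<phi> y + \<phi> x" using add[of y "(\<phi> x / \<phi> w) *s w"] sc[of "\<phi> x / \<phi> w" w] w
        by (simp add: y_def)
      then have "\<phi> y = 0" by simp
      ultimately show "x \<in> vec.span (insert w {x\<in>W. \<phi> x = 0})"
        by (metis (mono_tags, lifting) insertI1 insertI2 mem_Collect_eq vec.span_add vec.span_base vec.span_scale)
    qed
    then have "vec.dim W \<le> vec.dim (insert w {x\<in>W. \<phi> x = 0})"
      by (metis vec.dim_span vec.dim_subset)
    also have "\<dots> \<le> vec.dim {x\<in>W. \<phi> x = 0} + 1" by (simp add: vec.dim_insert)
    finally show ?thesis .
  next
    case False
    then have "{x\<in>W. \<phi> x = 0} = W" by auto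
    then show ?thesis by simp
  qed
qed

lemma dim_kernel_functionals:
  fixes \<phi> :: "'i \<Rightarrow> complex^'m \<Rightarrow> complex"
  assumes "finite I" and W: "vec.subspace W" and add: "\<And>i x y. \<phi> i (x + y) = \<phi> i x + \<phi> i y"
    and sc: "\<And>i a x. \<phi> i (a *s x) = a * \<phi> i x"
  shows "vec.subspace {x\<in>W. \<forall>i\<in>I. \<phi> i x = 0} \<and>
    vec.dim W \<le> vec.dim {x\<in>W. \<forall>i\<in>I. \<phi> i x = 0} + card I"
  using assms(1)
proof induction
  case empty
  then show ?case using W by simp
next
  case (insert j I)
  let ?K = "{x\<in>W. \<forall>i\<in>I. \<phi> i x = 0}"
  have eq: "{x\<in>W. \<forall>i\<in>insert j I. \<phi> i x = 0} = {x\<in>?K. \<phi> j x = 0}" by auto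
  have K: "vec.subspace ?K" "vec.dim W \<le> vec.dim ?K + card I" using insert by auto
  show ?case
    unfolding eq using dim_kernel_functional[where \<phi> = "\<phi> j", OF K(1) add sc] K(2) insert.hyps by auto
qed

text \<open>Where all positive coordinates vanish the form is negative definite, so that coordinate
  subspace meets \<open>W\<close> only in 0. This is the half of the law of inertia on which all
  dimension counts rest.\<close>

lemma dim_nonneg_le:
  assumes W: "vec.subspace W" and pos: "\<forall>x\<in>W. Re (hf s x x) \<ge> 0" and s: "\<forall>i. s i \<noteq> 0"
  shows "vec.dim W \<le> card {i. s i > 0}"
proof -
  let ?K = "{x\<in>W. \<forall>i\<in>{i. s i > 0}. x$i = 0}"
  have "vec.dim W \<le> vec.dim ?K + card {i. s i > 0}"
    using dim_kernel_functionals[where \<phi> = "\<lambda>i x. x$i" and I = "{i. s i > 0}", OF _ W] by simp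
  moreover have "?K \<subseteq> {0}"
  proof
    fix x assume x: "x \<in> ?K"
    have le: "s i * (cmod (x$i))\<^sup>2 \<le> 0" for i
      using x s by (cases "s i > 0") (auto simp: mult_nonpos_nonneg)
    have "(\<Sum>i\<in>UNIV. s i * (cmod (x$i))\<^sup>2) \<ge> 0" using x pos by (auto simp: hf_diag)
    then have "(\<Sum>i\<in>UNIV. - (s i * (cmod (x$i))\<^sup>2)) = 0"
      using sum_nonpos[of UNIV "\<lambda>i. s i * (cmod (x$i))\<^sup>2"] le by (simp add: sum_negf)
    then have "\<forall>i. s i * (cmod (x$i))\<^sup>2 = 0"
      by (subst (asm) sum_nonneg_eq_0_iff) (use le in auto)
    then show "x \<in> {0}" using s by (auto simp: cart_eq_iff)
  qed
  then have le0: "vec.dim ?K \<le> vec.dim {0 :: complex^'a}" by (rule vec.dim_subset)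
  have d0: "vec.dim {0 :: complex^'a} = 0" using vec.dim_eq_0[of "{0 :: complex^'a}"] by simp
  have "vec.dim ?K = 0" using le0 d0 by linarith
  ultimately show ?thesis by linarith
qed

text \<open>The sum of \<open>E\<close> and the span of the \<open>Y a\<close> is positive
  semidefinite, and it is direct because a nontrivial combination of the \<open>Y a\<close> has
  positive square while elements of \<open>E\<close> have square zero. An isotropic subspace thus
  uses up positive squares as a definite one does.\<close>

lemma isotropic_plus_positive_le:
  assumes s: "\<forall>i. s i \<noteq> 0" and E: "vec.subspace E" "\<forall>x\<in>E. \<forall>y\<in>E. hf s x y = 0"
    and orth: "\<forall>a<r. \<forall>x\<in>E. hf s (Y a) x = 0"
    and pos: "\<forall>d. (\<exists>a<r. d a \<noteq> 0) \<longrightarrow> Re (hf s (\<Sum>a<r. d a *s Y a) (\<Sum>a<r. d a *s Y a)) > 0"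
  shows "vec.dim E + r \<le> card {i. s i > 0}"
proof -
  define W where "W k = {x + (\<Sum>a<k. d a *s Y a) | x d. x \<in> E}" for k :: nat
  have sub: "vec.subspace (W k)" for k
    unfolding vec.subspace_def
  proof (intro conjI allI ballI)
    show "0 \<in> W k" unfolding W_def
      by (auto intro!: exI[of _ 0] exI[of _ "\<lambda>_. 0"] vec.subspace_0[OF E(1)])
  next
    fix u v assume "u \<in> W k" "v \<in> W k"
    then obtain x d y e where *: "x \<in> E" "y \<in> E" "u = x + (\<Sum>a<k. d a *s Y a)" "v = y + (\<Sum>a<k. e a *s Y a)"
      unfolding W_def by auto
    have "u + v = (x + y) + (\<Sum>a<k. (d a + e a) *s Y a)"
      by (simp add: * sum.distrib vector_sadd_rdistrib algebra_simps)
    then show "u + v \<in> W k" unfolding W_def using vec.subspace_add[OF E(1) *(1,2)]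
      by (auto intro!: exI[of _ "x + y"] exI[of _ "\<lambda>a. d a + e a"])
  next
    fix c u assume "u \<in> W k"
    then obtain x d where *: "x \<in> E" "u = x + (\<Sum>a<k. d a *s Y a)" unfolding W_def by auto
    have "c *s u = c *s x + (\<Sum>a<k. (c * d a) *s Y a)"
      by (simp add: * vector_add_ldistrib vec.scale_sum_right)
    then show "c *s u \<in> W k" unfolding W_def using vec.subspace_scale[OF E(1) *(1)]
      by (auto intro!: exI[of _ "c *s x"] exI[of _ "\<lambda>a. c * d a"])
  qed
  have val: "hf s (x + w) (x + w) = hf s w w" if "x \<in> E" "w = (\<Sum>a<r. d a *s Y a)" for x w d
  proof -
    have "hf s w x = 0" using that orth by (simp add: hf.sum_left hf.scale_left)
    moreover have "hf s x w = 0" using hf.hermitian[of s x w] \<open>hf s w x = 0\<close> by simp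
    ultimately show ?thesis using E(2) that by (simp add: hf.add_left hf.add_right)
  qed
  have nonneg: "Re (hf s (\<Sum>a<r. d a *s Y a) (\<Sum>a<r. d a *s Y a)) \<ge> 0" for d
  proof (cases "\<exists>a<r. d a \<noteq> 0")
    case True
    then show ?thesis using pos by (auto intro: less_imp_le)
  next
    case False
    then have "(\<Sum>a<r. d a *s Y a) = 0" by (intro sum.neutral) auto
    then show ?thesis by simp
  qed
  have dim: "k \<le> r \<Longrightarrow> vec.dim E + k \<le> vec.dim (W k)" for k
  proof (induction k)
    case 0
    then show ?case by (simp add: W_def)
  next
    case (Suc k)
    have "Y k \<notin> W k"
    proof
      assume "Y k \<in> W k"
      then obtain x d where x: "x \<in> E" "Y k = x + (\<Sum>a<k. d a *s Y a)" unfolding W_def by auto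
      \<comment> \<open>If \<open>Y k\<close> belonged to \<open>W k\<close>, the combination with
        these coefficients would equal \<open>x \<in> E\<close> and have square zero, although its
        coefficient at \<open>k\<close> is 1.\<close>
      define d' where "d' a = (if a < k then - d a else if a = k then 1 else 0)" for a
      have "(\<Sum>a<r. d' a *s Y a) = (\<Sum>a<Suc k. d' a *s Y a)"
        using Suc.prems by (intro sum.mono_neutral_right) (auto simp: d'_def)
      also have "\<dots> = (\<Sum>a<k. - (d a *s Y a)) + Y k"
        by (simp add: d'_def)
      also have "\<dots> = x" by (simp add: x(2) sum_negf)
      finally have "hf s (\<Sum>a<r. d' a *s Y a) (\<Sum>a<r. d' a *s Y a) = 0" using E(2) x(1) by simp
      moreover have "\<exists>a<r. d' a \<noteq> 0" using Suc.prems by (intro exI[of _ k]) (auto simp: d'_def)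
      ultimately show False using pos by fastforce
    qed
    then have "vec.dim (insert (Y k) (W k)) = vec.dim (W k) + 1"
      using vec.dim_insert[of "Y k" "W k"] unfolding vec.span_eq_iff[THEN iffD2, OF sub[of k]] by (simp only: if_False)
    moreover have "insert (Y k) (W k) \<subseteq> W (Suc k)"
    proof -
      have "Y k = 0 + (\<Sum>a<Suc k. (if a = k then 1 else 0) *s Y a)"
        by (simp add: if_distrib[of "\<lambda>c. c *s _"] cong: if_cong)
      then have "Y k \<in> W (Suc k)" unfolding W_def mem_Collect_eq using vec.subspace_0[OF E(1)] by (intro exI conjI)
      moreover have "W k \<subseteq> W (Suc k)"
      proof
        fix u assume "u \<in> W k"
        then obtain x d where *: "x \<in> E" "u = x + (\<Sum>a<k. d a *s Y a)" unfolding W_def by auto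
        have "u = x + (\<Sum>a<Suc k. (d(k := 0)) a *s Y a)" by (simp add: *)
        then show "u \<in> W (Suc k)" unfolding W_def using *(1) by blast
      qed
      ultimately show ?thesis by auto
    qed
    then have "vec.dim (insert (Y k) (W k)) \<le> vec.dim (W (Suc k))" by (rule vec.dim_subset)
    ultimately show ?case using Suc by auto
  qed
  have "\<forall>x\<in>W r. Re (hf s x x) \<ge> 0"
    unfolding W_def using val nonneg by auto
  from dim_nonneg_le[OF sub this s] dim[of r] show ?thesis by simp
qed

text \<open>The sum type as index set keeps a direct sum of two diagonal forms diagonal, so the
  counts by coordinates apply to it unchanged.\<close>

definition join :: "complex^'i \<Rightarrow> complex^'j \<Rightarrow> complex^('i + 'j)" where
  "join x y = (\<chi> i. case i of Inl a \<Rightarrow> x$a | Inr b \<Rightarrow> y$b)"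

lemma join_add: "join x y + join x' y' = join (x + x') (y + y')"
  by (simp add: join_def cart_eq_iff split: sum.split)

lemma join_scale: "a *s join x y = join (a *s x) (a *s y)"
  by (simp add: join_def cart_eq_iff split: sum.split)

lemma join_0: "join 0 0 = 0"
  by (simp add: join_def cart_eq_iff split: sum.split)

lemma join_eq_iff: "join x y = join x' y' \<longleftrightarrow> x = x' \<and> y = y'"
proof
  assume eq: "join x y = join x' y'"
  have "x $ a = x' $ a" for a using arg_cong[OF eq, of "\<lambda>v. v $ Inl a"] by (simp add: join_def)
  moreover have "y $ b = y' $ b" for b using arg_cong[OF eq, of "\<lambda>v. v $ Inr b"] by (simp add: join_def)
  ultimately show "x = x' \<and> y = y'" by (simp add: cart_eq_iff)
qed simp

lemma hf_join: "hf (case_sum s t) (join x y) (join x' y') = hf s x x' + hf t y y'"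
proof -
  have "hf (case_sum s t) (join x y) (join x' y') =
    (\<Sum>i\<in>UNIV <+> UNIV. of_real (case_sum s t i) * join x y $ i * cnj (join x' y' $ i))"
    by (simp add: hf_def)
  also have "\<dots> = hf s x x' + hf t y y'"
    by (subst sum.Plus) (auto simp: hf_def join_def)
  finally show ?thesis .
qed

lemma card_pos_case_sum:
  fixes s :: "'i::finite \<Rightarrow> real" and t :: "'j::finite \<Rightarrow> real"
  shows "card {i. case_sum s t i > 0} = card {i. s i > 0} + card {i. t i > 0}"
proof -
  have "{i. case_sum s t i > 0} = Inl ` {i. s i > 0} \<union> Inr ` {i. t i > 0}"
    by (auto simp: image_iff split: sum.splits) (metis sum.exhaust)
  also have "\<dots> = {i. s i > 0} <+> {i. t i > 0}" by (simp only: Plus_def)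
  finally have "{i. case_sum s t i > 0} = {i. s i > 0} <+> {i. t i > 0}" .
  then show ?thesis by (simp add: card_Plus)
qed

text \<open>Equal Gram matrices yield a linear map: prescribe \<open>g z \<mapsto> h z\<close> on a
  basis of the span taken from the values of \<open>g\<close>, and extend. It preserves the forms up
  to \<open>c\<close>, hence is injective wherever the first form is definite.\<close>

lemma dim_span_le_of_isometric:
  fixes g :: "'z \<Rightarrow> complex^'i" and h :: "'z \<Rightarrow> complex^'j"
  assumes s: "\<forall>i. s i \<noteq> 0" and t: "\<forall>i. t i \<noteq> 0" and c: "c > 0"
    and iso: "\<forall>z\<in>D. \<forall>w\<in>D. of_real c * hf s (g z) (g w) = hf t (h z) (h w)"
  shows "vec.dim (vec.span (g ` D)) \<le> card {i. s i < 0} + card {i. t i > 0}"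
proof -
  obtain B where B: "B \<subseteq> g ` D" "vec.independent B" "g ` D \<subseteq> vec.span B"
    using vec.maximal_independent_subset[of "g ` D"] by auto
  have spB: "vec.span B = vec.span (g ` D)"
    by (metis B(1,3) vec.span_mono vec.span_span subset_antisym)
  have "\<forall>b\<in>B. \<exists>z\<in>D. b = g z" using B(1) by auto
  then obtain z where z: "\<And>b. b \<in> B \<Longrightarrow> z b \<in> D \<and> b = g (z b)" by metis
  obtain T where T: "Vector_Spaces.linear (*s) (*s) T" "\<forall>b\<in>B. T b = h (z b)"
    using vec.linear_independent_extend[OF B(2), of "\<lambda>b. h (z b)"] by blast
  interpret T: Vector_Spaces.linear "(*s)" "(*s)" T by (rule T(1))
  have 1: "of_real c * hf s b b' = hf t (T b) (T b')" if "b \<in> B" "b' \<in> B" for b b'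
    using iso z[OF that(1)] z[OF that(2)] T(2) that by metis
  have 2: "of_real c * hf s x b' = hf t (T x) (T b')" if "x \<in> vec.span B" "b' \<in> B" for x b'
    using that(1)
  proof (induction rule: vec.span_induct_alt)
    case base
    then show ?case by (simp add: T.zero)
  next
    case (step a x y)
    then show ?case using 1[OF step(1) that(2)]
      by (simp add: T.add T.scale hf.add_left hf.scale_left distrib_left mult.left_commute)
  qed
  have 3: "of_real c * hf s x y = hf t (T x) (T y)" if "x \<in> vec.span B" "y \<in> vec.span B" for x y
    using that(2)
  proof (induction rule: vec.span_induct_alt)
    case base
    then show ?case by (simp add: T.zero)
  next
    case (step a b y)
    then show ?case using 2[OF that(1) step(1)]
      by (simp add: T.add T.scale hf.add_right hf.scale_right distrib_left mult.left_commute)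
  qed
  \<comment> \<open>Dropping the negative coordinates of \<open>s\<close> costs at most their number
    of dimensions and makes the form definite; \<open>T\<close> embeds what is left as a nonnegative
    subspace for \<open>t\<close>.\<close>
  let ?K = "{x\<in>vec.span B. \<forall>i\<in>{i. s i < 0}. x$i = 0}"
  have K: "vec.subspace ?K" "vec.dim (vec.span B) \<le> vec.dim ?K + card {i. s i < 0}"
    using dim_kernel_functionals[where \<phi> = "\<lambda>i x. x$i" and I = "{i. s i < 0}" and W = "vec.span B"] by simp_all
  have nn: "hf s x x = of_real (Re (hf s x x))" "Re (hf s x x) \<ge> 0" "Re (hf s x x) = 0 \<Longrightarrow> x = 0" if "x \<in> ?K" for x
  proof -
    show "hf s x x = of_real (Re (hf s x x))" by (rule hf.diag_of_real)
    have le: "s i * (cmod (x$i))\<^sup>2 \<ge> 0" for i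
      using that by (cases "s i < 0") auto
    show "Re (hf s x x) \<ge> 0" by (simp add: hf_diag sum_nonneg le)
    show "x = 0" if "Re (hf s x x) = 0"
    proof -
      have "\<forall>i. s i * (cmod (x$i))\<^sup>2 = 0"
        using that le by (subst (asm) hf_diag, subst (asm) sum_nonneg_eq_0_iff) auto
      then show ?thesis using s by (auto simp: cart_eq_iff)
    qed
  qed
  have Tv: "Re (hf t (T x) (T x)) = c * Re (hf s x x)" if "x \<in> ?K" for x
  proof -
    have "hf t (T x) (T x) = of_real c * hf s x x" using 3[of x x] that by simp
    then show ?thesis by simp
  qed
  have inj: "inj_on T ?K"
  proof (rule inj_onI)
    fix x y assume xy: "x \<in> ?K" "y \<in> ?K" "T x = T y"
    have d: "x - y \<in> ?K" using K(1) xy vec.subspace_diff by blast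
    have "T (x - y) = 0" using xy by (simp add: T.diff)
    then have "c * Re (hf s (x - y) (x - y)) = 0" using Tv[OF d] by simp
    then show "x = y" using nn(3)[OF d] c by auto
  qed
  have "vec.dim (T ` ?K) = vec.dim ?K"
    using inj by (intro vec.dim_image_eq T(1)) (simp only: vec.span_eq_iff[THEN iffD2, OF K(1)])
  moreover have "vec.dim (T ` ?K) \<le> card {i. t i > 0}"
  proof (rule dim_nonneg_le[OF _ _ t])
    show "vec.subspace (T ` ?K)" by (intro T.subspace_image K)
    show "\<forall>x\<in>T ` ?K. 0 \<le> Re (hf t x x)" using Tv nn(2) c by auto
  qed
  ultimately show ?thesis using K(2) unfolding spB by linarith
qed

section \<open>Sesquiholomorphic kernels\<close>

lemma norm_smult: "norm (c *s (x :: complex^'m)) = cmod c * norm x"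
proof -
  have "norm (c *s x) = L2_set (\<lambda>i. cmod c * norm (x $ i)) UNIV"
    by (simp add: norm_vec_def norm_mult)
  also have "\<dots> = cmod c * norm x"
    by (simp add: norm_vec_def L2_set_right_distrib)
  finally show ?thesis .
qed

lemma bounded_linear_smult: "bounded_linear (\<lambda>c. c *s (x :: complex^'m))"
  by (rule bounded_linear_intro[where K = "norm x"])
    (auto simp: norm_smult vector_sadd_rdistrib cart_eq_iff mult.commute)

lemma bounded_linear_smult_right: "bounded_linear (\<lambda>x :: complex^'m. c *s x)"
  by (rule bounded_linear_intro[where K = "cmod c"])
    (auto simp: norm_smult vector_add_ldistrib cart_eq_iff mult.commute)

lemmas continuous_on_smult [continuous_intros] = bounded_linear.continuous_on[OF bounded_linear_smult]
lemmas tendsto_smult [tendsto_intros] = bounded_linear.tendsto[OF bounded_linear_smult]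

definition slice :: "(complex^'m) set \<Rightarrow> complex^'m \<Rightarrow> complex^'m \<Rightarrow> complex^'m \<Rightarrow> complex^'m \<Rightarrow> complex set" where
  "slice A x d y d' = {\<zeta>. x + \<zeta> *s d \<in> A \<and> y + cnj \<zeta> *s d' \<in> A}"

text \<open>This expresses holomorphy in the first and antiholomorphy in the second argument. The
  conjugated parameter in the second slot makes each restriction an ordinary holomorphic function,
  so one-variable theorems apply to all needed families at once.\<close>

definition sesqui_holomorphic_on :: "(complex^'m) set \<Rightarrow> (complex^'m \<Rightarrow> complex^'m \<Rightarrow> complex) \<Rightarrow> bool" where
  "sesqui_holomorphic_on A k \<longleftrightarrow>
     (\<forall>x d y d'. (\<lambda>\<zeta>. k (x + \<zeta> *s d) (y + cnj \<zeta> *s d')) holomorphic_on slice A x d y d')"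

lemma sesqui_holomorphic_onD:
  "sesqui_holomorphic_on A k \<Longrightarrow> (\<lambda>\<zeta>. k (x + \<zeta> *s d) (y + cnj \<zeta> *s d')) holomorphic_on slice A x d y d'"
  by (simp add: sesqui_holomorphic_on_def)

lemma open_slice: "open A \<Longrightarrow> open (slice A x d y d')"
proof -
  assume A: "open A"
  have "slice A x d y d' = (\<lambda>\<zeta>. x + \<zeta> *s d) -` A \<inter> (\<lambda>\<zeta>. y + cnj \<zeta> *s d') -` A"
    by (auto simp: slice_def)
  then show ?thesis
    by (simp only:) (intro open_Int open_vimage A continuous_intros)
qed

lemma convex_slice: "convex A \<Longrightarrow> convex (slice A x d y d')"
proof (rule convexI)
  fix a b :: complex and u v :: real
  assume A: "convex A" and ab: "a \<in> slice A x d y d'" "b \<in> slice A x d y d'"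
    and uv: "0 \<le> u" "0 \<le> v" "u + v = 1"
  have 1: "x + (u *\<^sub>R a + v *\<^sub>R b) *s d = u *\<^sub>R (x + a *s d) + v *\<^sub>R (x + b *s d)" for x d :: "complex^'a" and a b
  proof -
    have "x = (u + v) *\<^sub>R x" using uv by simp
    then have "x = u *\<^sub>R x + v *\<^sub>R x" by (simp only: scaleR_add_left)
    moreover have "(u *\<^sub>R a + v *\<^sub>R b) *s d = u *\<^sub>R (a *s d) + v *\<^sub>R (b *s d)"
      by (simp add: cart_eq_iff scaleR_conv_of_real[where 'a = complex] algebra_simps)
    ultimately show ?thesis by (simp add: scaleR_add_right algebra_simps)
  qed
  have 2: "cnj (u *\<^sub>R a + v *\<^sub>R b) = u *\<^sub>R cnj a + v *\<^sub>R cnj b" by (simp add: scaleR_conv_of_real)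
  show "u *\<^sub>R a + v *\<^sub>R b \<in> slice A x d y d'"
    using ab convexD[OF A] uv unfolding slice_def mem_Collect_eq 2 1 by blast
qed

lemma zero_of_islimpt:
  assumes "f holomorphic_on S" "open S" "convex S" "U \<subseteq> S" "\<xi> \<in> S" "\<xi> islimpt U" "\<And>z. z \<in> U \<Longrightarrow> f z = 0" "w \<in> S"
  shows "f w = 0"
  using analytic_continuation[OF assms(1,2) convex_connected[OF assms(3)] assms(4-6)] assms(7,8) by blast

lemma islimpt_real_interval: "0 < r \<Longrightarrow> 0 islimpt (complex_of_real ` {-r<..<r})"
  unfolding islimpt_approachable
proof (intro allI impI)
  fix e :: real assume "0 < r" "0 < e"
  then have m: "0 < min r e / 2" "min r e / 2 < r" "min r e / 2 < e" by (auto simp: min_def)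
  show "\<exists>x'\<in>complex_of_real ` {-r<..<r}. x' \<noteq> 0 \<and> dist x' 0 < e"
    by (rule bexI[OF _ imageI[of "min r e / 2"]]) (use m in auto)
qed

text \<open>One-variable identity theorem on the complex line through \<open>v\<close> and
  \<open>x\<close>; the direction 0 in the second slot freezes that argument.\<close>

lemma sesqui_zero_left:
  assumes k: "sesqui_holomorphic_on A k" and A: "open A" "convex A" and v: "v \<in> A" "0 < r"
    and y: "y \<in> A" and z: "\<And>x. x \<in> ball v r \<Longrightarrow> x \<in> A \<Longrightarrow> k x y = 0" and x: "x \<in> A"
  shows "k x y = 0"
proof -
  let ?S = "slice A v (x - v) y 0"
  let ?U = "(\<lambda>\<zeta>. v + \<zeta> *s (x - v)) -` ball v r \<inter> ?S"
  have S: "open ?S" "convex ?S" using A by (auto intro: open_slice convex_slice)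
  have 0: "0 \<in> ?S" "1 \<in> ?S" using v x y by (auto simp: slice_def)
  have "open ?U" by (intro open_Int open_vimage S continuous_intros) auto
  moreover have "0 \<in> ?U" using 0 v by simp
  ultimately have "0 islimpt ?U" by (metis interior_limit_point interior_open)
  then have "k (v + 1 *s (x - v)) (y + cnj 1 *s 0) = 0"
    by (intro zero_of_islimpt[OF sesqui_holomorphic_onD[OF k] S _ 0(1) _ _ 0(2), of ?U])
      (use z in \<open>auto simp: slice_def\<close>)
  then show ?thesis by simp
qed

lemma sesqui_zero_right:
  assumes k: "sesqui_holomorphic_on A k" and A: "open A" "convex A" and v: "v \<in> A" "0 < r"
    and y: "y \<in> A" and z: "\<And>x. x \<in> ball v r \<Longrightarrow> x \<in> A \<Longrightarrow> k y x = 0" and x: "x \<in> A"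
  shows "k y x = 0"
proof -
  let ?S = "slice A y 0 v (x - v)"
  let ?U = "(\<lambda>\<zeta>. v + cnj \<zeta> *s (x - v)) -` ball v r \<inter> ?S"
  have S: "open ?S" "convex ?S" using A by (auto intro: open_slice convex_slice)
  have 0: "0 \<in> ?S" "1 \<in> ?S" using v x y by (auto simp: slice_def)
  have "open ?U" by (intro open_Int open_vimage S continuous_intros) auto
  moreover have "0 \<in> ?U" using 0 v by simp
  ultimately have "0 islimpt ?U" by (metis interior_limit_point interior_open)
  then have "k (y + 1 *s 0) (v + cnj 1 *s (x - v)) = 0"
    by (intro zero_of_islimpt[OF sesqui_holomorphic_onD[OF k] S _ 0(1) _ _ 0(2), of ?U])
      (use z in \<open>auto simp: slice_def\<close>)
  then show ?thesis by simp
qed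

text \<open>Along \<open>\<zeta> \<mapsto> k (x + \<zeta> d) (y + cnj \<zeta> d')\<close> the diagonal is met at the real parameters when \<open>x = y\<close> and
  \<open>d = d'\<close>, so a kernel that is zero on the diagonal is zero by the identity theorem.\<close>

lemma polarization:
  assumes k: "sesqui_holomorphic_on A k" and A: "open A" "convex A" and v: "0 < r" "ball v r \<subseteq> A"
    and z: "\<And>x. x \<in> ball v r \<Longrightarrow> k x x = 0" and xy: "x \<in> A" "y \<in> A"
  shows "k x y = 0"
proof -
  have vA: "v \<in> A" using v by auto
  have near: "k x y = 0" if "x \<in> ball v (r/6)" "y \<in> ball v (r/6)" for x y
  proof -
    \<comment> \<open>With midpoint \<open>u\<close> and half difference \<open>a\<close>, the pair
      \<open>(x, y)\<close> is the value at \<open>\<zeta> = -\<i>\<close> of the family in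
      direction \<open>\<i> *s a\<close>, whose real parameters lie on the diagonal. The disc of
      radius 3/2 contains \<open>-\<i>\<close>, and \<open>r/6 + 3/2 * r/6 < r\<close> keeps the
      family in the ball.\<close>
    define u where "u = (1/2) *\<^sub>R (x + y)"
    define a where "a = (1/2) *\<^sub>R (x - y)"
    have xy: "x = u + a" "y = u - a" by (auto simp: u_def a_def algebra_simps simp flip: scaleR_add_left)
    have d1: "norm (x - v) < r/6" "norm (y - v) < r/6" using that by (auto simp: dist_norm norm_minus_commute)
    have "u - v = (1/2) *\<^sub>R ((x - v) + (y - v))" "a = (1/2) *\<^sub>R ((x - v) - (y - v))"
      by (auto simp: u_def a_def cart_eq_iff scaleR_conv_of_real[where 'a = complex] field_simps)
    then have d2: "norm (u - v) < r/6" "norm a < r/6"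
      using norm_triangle_ineq[of "x - v" "y - v"] norm_triangle_ineq4[of "x - v" "y - v"] d1 by auto
    have in_ball: "u + c *s a \<in> ball v r" if "cmod c < 3/2" for c
    proof -
      have "norm (u + c *s a - v) \<le> norm (u - v) + cmod c * norm a"
        using norm_triangle_ineq[of "u - v" "c *s a"] by (simp add: norm_smult algebra_simps)
      also have "\<dots> \<le> norm (u - v) + 3/2 * norm a" using that by (intro add_left_mono mult_right_mono) auto
      also have "\<dots> < r" using d2 v norm_ge_zero[of a] by linarith
      finally show ?thesis by (simp add: dist_norm norm_minus_commute)
    qed
    let ?f = "\<lambda>\<zeta>. k (u + \<zeta> *s (\<i> *s a)) (u + cnj \<zeta> *s (\<i> *s a))"
    have sub: "ball 0 (3/2) \<subseteq> slice A u (\<i> *s a) u (\<i> *s a)"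
      using in_ball v by (auto simp: slice_def subset_iff vec.scale_scale norm_mult)
    have hol: "?f holomorphic_on ball 0 (3/2)"
      by (rule holomorphic_on_subset[OF sesqui_holomorphic_onD[OF k] sub])
    have "?f (- \<i>) = 0"
    proof (rule zero_of_islimpt[OF hol, of "complex_of_real ` {-1<..<1}" 0])
      show "?f w = 0" if "w \<in> complex_of_real ` {-1<..<1}" for w
      proof -
        from that obtain t where t: "w = complex_of_real t" "\<bar>t\<bar> < 1" by auto
        show ?thesis unfolding t complex_cnj_complex_of_real
          by (rule z) (use in_ball[of "of_real t * \<i>"] t in \<open>simp add: vec.scale_scale norm_mult\<close>)
      qed
    qed (use islimpt_real_interval[of 1] in auto)
    then show ?thesis by (simp add: xy vec.scale_scale)
  qed
  have 1: "k x y = 0" if "x \<in> A" "y \<in> ball v (r/6)" "y \<in> A" for x y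
    by (rule sesqui_zero_left[OF k A vA, of "r/6"]) (use near that v in auto)
  show ?thesis
    by (rule sesqui_zero_right[OF k A vA, of "r/6"]) (use 1 xy v in auto)
qed

text \<open>Cauchy's inequality on the disc of radius \<open>\<rho>/2\<close> bounds the
  coefficients, and for \<open>cmod \<epsilon> \<le> \<rho>/4\<close> the remainder is dominated by
  a geometric series of ratio 1/2. The constant depends on \<open>C\<close>, \<open>\<rho>\<close>
  and \<open>m\<close> alone, which makes the later limits uniform in the points.\<close>

lemma taylor_leading_estimate:
  assumes hol: "\<phi> holomorphic_on ball 0 \<rho>" and \<rho>: "0 < \<rho>" and C: "\<And>z. z \<in> ball 0 \<rho> \<Longrightarrow> cmod (\<phi> z) \<le> C"
    and z: "\<And>j. j < m \<Longrightarrow> (deriv ^^ j) \<phi> 0 = 0" and \<epsilon>: "\<epsilon> \<noteq> 0" "cmod \<epsilon> \<le> \<rho> / 4"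
  shows "cmod (\<phi> \<epsilon> / \<epsilon> ^ m - (deriv ^^ m) \<phi> 0 / fact m) \<le> 2 * C / (\<rho>/2) ^ Suc m * cmod \<epsilon>"
proof -
  define r where "r = \<rho> / 2"
  define a where "a n = (deriv ^^ n) \<phi> 0 / fact n" for n
  have r: "0 < r" "r < \<rho>" using \<rho> by (auto simp: r_def)
  have a_le: "cmod (a n) \<le> C / r ^ n" for n
  proof -
    have "cmod ((deriv ^^ n) \<phi> 0) \<le> fact n * C / r ^ n"
    proof (rule Cauchy_inequality)
      show "\<phi> holomorphic_on ball 0 r" using hol r by (auto intro: holomorphic_on_subset)
      show "continuous_on (cball 0 r) \<phi>"
        using hol r by (intro holomorphic_on_imp_continuous_on) (auto intro: holomorphic_on_subset)
    qed (use r C in auto)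
    then show ?thesis by (simp add: a_def norm_divide field_simps)
  qed
  have s0: "(\<lambda>n. a n * \<epsilon> ^ n) sums \<phi> \<epsilon>"
    using holomorphic_power_series[OF hol, of \<epsilon>] \<epsilon> \<rho> by (auto simp: a_def)
  have s1: "(\<lambda>n. a (n + m) * \<epsilon> ^ (n + m)) sums \<phi> \<epsilon>"
  proof -
    have "(\<Sum>i<m. a i * \<epsilon> ^ i) = 0" by (rule sum.neutral) (auto simp: a_def z)
    then show ?thesis using s0 sums_iff_shift[of "\<lambda>n. a n * \<epsilon> ^ n" m "\<phi> \<epsilon>"] by simp
  qed
  have "(\<lambda>n. a (n + m) * \<epsilon> ^ n) sums (\<phi> \<epsilon> / \<epsilon> ^ m)"
    using sums_divide[OF s1, of "\<epsilon> ^ m"] \<epsilon>(1) by (simp add: power_add)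
  then have s2: "(\<lambda>n. a (Suc n + m) * \<epsilon> ^ Suc n) sums (\<phi> \<epsilon> / \<epsilon> ^ m - a m)"
    by (subst sums_Suc_iff) simp
  define q where "q = cmod \<epsilon> / r"
  have q: "0 \<le> q" "q \<le> 1/2" using \<epsilon> r by (auto simp: q_def r_def field_simps)
  have bound: "cmod (a (Suc n + m) * \<epsilon> ^ Suc n) \<le> C / r ^ Suc m * cmod \<epsilon> * (1/2) ^ n" for n
  proof -
    have C0: "0 \<le> C" using C[of 0] \<rho> norm_ge_zero[of "\<phi> 0"] by (meson centre_in_ball order_trans)
    have "cmod (a (Suc n + m) * \<epsilon> ^ Suc n) = cmod (a (Suc n + m)) * cmod \<epsilon> ^ Suc n"
      by (simp add: norm_mult norm_power)
    also have "\<dots> \<le> C / r ^ (Suc n + m) * cmod \<epsilon> ^ Suc n"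
      by (intro mult_right_mono a_le) auto
    also have "\<dots> = (C / r ^ Suc m * cmod \<epsilon>) * q ^ n"
      using r by (simp add: q_def power_divide power_add field_simps)
    also have "\<dots> \<le> (C / r ^ Suc m * cmod \<epsilon>) * (1/2) ^ n"
      using C0 r q by (intro mult_left_mono power_mono) auto
    finally show ?thesis .
  qed
  have g: "(\<lambda>n. C / r ^ Suc m * cmod \<epsilon> * (1/2) ^ n) sums (C / r ^ Suc m * cmod \<epsilon> * 2)"
  proof -
    have "(\<lambda>n. (1/2 :: real) ^ n) sums 2" using geometric_sums[of "1/2 :: real"] by simp
    from sums_mult[OF this] show ?thesis .
  qed
  have "cmod (\<phi> \<epsilon> / \<epsilon> ^ m - a m) \<le> C / r ^ Suc m * cmod \<epsilon> * 2"
    using suminf_le[OF bound]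
    by (metis (no_types, lifting) bound g s2 sums_unique sums_summable norm_suminf_le)
  then show ?thesis by (simp add: a_def r_def mult.commute mult.left_commute)
qed

text \<open>The homogeneous part of total degree \<open>m\<close> in \<open>x\<close> and the
  conjugate of \<open>y\<close>, read off as a Taylor coefficient along dilations.\<close>

definition leading :: "(complex^'m \<Rightarrow> complex^'m \<Rightarrow> complex) \<Rightarrow> nat \<Rightarrow> complex^'m \<Rightarrow> complex^'m \<Rightarrow> complex" where
  "leading k m x y = (deriv ^^ m) (\<lambda>\<epsilon>. k (\<epsilon> *s x) (cnj \<epsilon> *s y)) 0 / fact m"

locale sesqui_germ =
  fixes k :: "complex^'m \<Rightarrow> complex^'m \<Rightarrow> complex" and R C :: real
  assumes R: "0 < R" and sesqui: "sesqui_holomorphic_on (ball 0 R) k"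
    and bound: "\<lbrakk>x \<in> ball 0 R; y \<in> ball 0 R\<rbrakk> \<Longrightarrow> cmod (k x y) \<le> C"
begin

lemma dilation_holomorphic:
  assumes "\<rho> * norm x \<le> R" "\<rho> * norm y \<le> R" "0 < \<rho>"
  shows "(\<lambda>\<epsilon>. k (\<epsilon> *s x) (cnj \<epsilon> *s y)) holomorphic_on ball 0 \<rho>"
    and "\<epsilon> \<in> ball 0 \<rho> \<Longrightarrow> \<epsilon> *s x \<in> ball 0 R" "\<epsilon> \<in> ball 0 \<rho> \<Longrightarrow> cnj \<epsilon> *s y \<in> ball 0 R"
proof -
  have *: "norm (\<epsilon> *s z) < R" if "\<epsilon> \<in> ball 0 \<rho>" "\<rho> * norm z \<le> R" for \<epsilon> and z :: "complex^'m"
  proof (cases "z = 0")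
    case False
    then have "cmod \<epsilon> * norm z < \<rho> * norm z" using that by (intro mult_strict_right_mono) auto
    then show ?thesis using that by (simp add: norm_smult)
  qed (use R in auto)
  have **: "norm (cnj \<epsilon> *s z) < R" if "\<epsilon> \<in> ball 0 \<rho>" "\<rho> * norm z \<le> R" for \<epsilon> and z :: "complex^'m"
    using *[of "cnj \<epsilon>" z] that by simp
  show "\<epsilon> \<in> ball 0 \<rho> \<Longrightarrow> \<epsilon> *s x \<in> ball 0 R" "\<epsilon> \<in> ball 0 \<rho> \<Longrightarrow> cnj \<epsilon> *s y \<in> ball 0 R"
    using * ** assms by auto
  show "(\<lambda>\<epsilon>. k (\<epsilon> *s x) (cnj \<epsilon> *s y)) holomorphic_on ball 0 \<rho>"
  proof -
    have "ball 0 \<rho> \<subseteq> slice (ball 0 R) 0 x 0 y"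
    proof
      fix \<zeta> assume "\<zeta> \<in> ball (0::complex) \<rho>"
      then show "\<zeta> \<in> slice (ball 0 R) 0 x 0 y"
        using *[OF _ assms(1)] **[OF _ assms(2)] by (simp add: slice_def)
    qed
    from holomorphic_on_subset[OF sesqui_holomorphic_onD[OF sesqui] this] show ?thesis by simp
  qed
qed

text \<open>Once the lower homogeneous parts vanish, the rescaled kernels converge to the leading
  one uniformly on bounded sets. Uniformity serves twice: for the holomorphy of the limit, and for
  Hurwitz's theorem.\<close>

lemma leading_limit_uniform:
  assumes z: "\<And>j x y. j < m \<Longrightarrow> leading k j x y = 0" and e: "0 < e" and B: "0 < B"
  shows "\<exists>\<delta>>0. \<forall>\<epsilon> x y. 0 < \<epsilon> \<and> \<epsilon> < \<delta> \<and> norm x \<le> B \<and> norm y \<le> B \<longrightarrow>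
    of_real \<epsilon> *s x \<in> ball 0 R \<and> of_real \<epsilon> *s y \<in> ball 0 R \<and>
    cmod (k (of_real \<epsilon> *s x) (of_real \<epsilon> *s y) / of_real \<epsilon> ^ m - leading k m x y) < e"
proof -
  define \<rho> where "\<rho> = R / B"
  have \<rho>: "0 < \<rho>" using R B by (simp add: \<rho>_def)
  \<comment> \<open>The constant of \<open>taylor_leading_estimate\<close> for radius
    \<open>\<rho>\<close>, increased by 1 so that dividing by it is safe.\<close>
  define D where "D = 2 * \<bar>C\<bar> / (\<rho>/2) ^ Suc m + 1"
  have D: "0 < D" using \<rho> by (simp add: D_def add_nonneg_pos)
  define \<delta> where "\<delta> = min (\<rho>/4) (e / D)"
  have \<delta>: "0 < \<delta>" using \<rho> e D by (simp add: \<delta>_def)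
  have "of_real \<epsilon> *s x \<in> ball 0 R \<and> of_real \<epsilon> *s y \<in> ball 0 R \<and>
    cmod (k (of_real \<epsilon> *s x) (of_real \<epsilon> *s y) / of_real \<epsilon> ^ m - leading k m x y) < e"
    if \<epsilon>: "0 < \<epsilon>" "\<epsilon> < \<delta>" and xy: "norm x \<le> B" "norm y \<le> B" for \<epsilon> x y
  proof -
    have le: "\<rho> * norm x \<le> R" "\<rho> * norm y \<le> R"
      using xy B R by (auto simp: \<rho>_def field_simps mult_left_mono)
    note d = dilation_holomorphic[OF le \<rho>]
    have eb: "complex_of_real \<epsilon> \<in> ball 0 \<rho>" using \<epsilon> \<rho> by (auto simp: \<delta>_def)
    let ?\<phi> = "\<lambda>\<epsilon>. k (\<epsilon> *s x) (cnj \<epsilon> *s y)"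
    have "cmod (?\<phi> (of_real \<epsilon>) / of_real \<epsilon> ^ m - (deriv ^^ m) ?\<phi> 0 / fact m)
        \<le> 2 * \<bar>C\<bar> / (\<rho>/2) ^ Suc m * cmod (of_real \<epsilon>)"
    proof (rule taylor_leading_estimate[OF d(1) \<rho>])
      fix w assume w: "w \<in> ball (0::complex) \<rho>"
      show "cmod (k (w *s x) (cnj w *s y)) \<le> \<bar>C\<bar>" using bound[OF d(2)[OF w] d(3)[OF w]] by linarith
    next
      fix j assume "j < m"
      then show "(deriv ^^ j) ?\<phi> 0 = 0" using z[of j x y] by (simp add: leading_def)
    qed (use \<epsilon> in \<open>auto simp: \<delta>_def\<close>)
    also have "\<dots> \<le> D * \<epsilon>" using \<epsilon> by (simp add: D_def distrib_right)
    also have "\<dots> < e" using \<epsilon> D by (simp add: \<delta>_def field_simps)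
    finally have "cmod (k (of_real \<epsilon> *s x) (of_real \<epsilon> *s y) / of_real \<epsilon> ^ m - leading k m x y) < e"
      by (simp add: leading_def)
    then show ?thesis using d(2)[OF eb] d(3)[OF eb] by simp
  qed
  then show ?thesis using \<delta> by blast
qed

lemma leading_limit:
  assumes z: "\<And>j x y. j < m \<Longrightarrow> leading k j x y = 0"
  shows "((\<lambda>\<epsilon>. k (of_real \<epsilon> *s x) (of_real \<epsilon> *s y) / of_real \<epsilon> ^ m) \<longlongrightarrow> leading k m x y) (at_right 0)"
proof (rule tendstoI)
  fix e :: real assume "0 < e"
  from leading_limit_uniform[OF z this, where B = "norm x + norm y + 1" and m = m] obtain \<delta> where "\<delta> > 0" and
    d: "\<And>\<epsilon>. 0 < \<epsilon> \<Longrightarrow> \<epsilon> < \<delta> \<Longrightarrow> cmod (k (of_real \<epsilon> *s x) (of_real \<epsilon> *s y) / of_real \<epsilon> ^ m - leading k m x y) < e"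
    by (auto simp: add_nonneg_pos)
  then show "\<forall>\<^sub>F \<epsilon> in at_right 0. dist (k (of_real \<epsilon> *s x) (of_real \<epsilon> *s y) / of_real \<epsilon> ^ m) (leading k m x y) < e"
    unfolding eventually_at_right_field by (auto simp: dist_norm)
qed

text \<open>Locally uniform limits of holomorphic functions are holomorphic. The rescalings are
  taken along a null sequence \<open>E n\<close> so that they form a sequence of functions on a
  fixed disc.\<close>

lemma leading_sesqui:
  assumes z: "\<And>j x y. j < m \<Longrightarrow> leading k j x y = 0"
  shows "sesqui_holomorphic_on UNIV (leading k m)"
  unfolding sesqui_holomorphic_on_def
proof (intro allI)
  fix x d y d' :: "complex^'m"
  have S: "slice UNIV x d y d' = UNIV" by (simp add: slice_def)
  show "(\<lambda>\<zeta>. leading k m (x + \<zeta> *s d) (y + cnj \<zeta> *s d')) holomorphic_on slice UNIV x d y d'"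
    unfolding S
  proof (rule holomorphic_on_open[THEN iffD2, OF open_UNIV])
    show "\<forall>\<zeta>0\<in>UNIV. \<exists>f'. ((\<lambda>\<zeta>. leading k m (x + \<zeta> *s d) (y + cnj \<zeta> *s d')) has_field_derivative f') (at \<zeta>0)"
    proof
      fix \<zeta>0 :: complex
      define B where "B = norm x + norm y + (cmod \<zeta>0 + 1) * (norm d + norm d') + 1"
      have B: "0 < B" by (simp add: B_def add_nonneg_pos)
      have le: "norm (x + \<zeta> *s d) \<le> B \<and> norm (y + cnj \<zeta> *s d') \<le> B" if "cmod \<zeta> \<le> cmod \<zeta>0 + 1" for \<zeta>
      proof -
        have "norm (x + \<zeta> *s d) \<le> norm x + cmod \<zeta> * norm d" using norm_triangle_ineq[of x "\<zeta> *s d"] by (simp add: norm_smult)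
        moreover have "norm (y + cnj \<zeta> *s d') \<le> norm y + cmod \<zeta> * norm d'"
          using norm_triangle_ineq[of y "cnj \<zeta> *s d'"] by (simp add: norm_smult)
        moreover have "cmod \<zeta> * norm d \<le> (cmod \<zeta>0 + 1) * norm d" "cmod \<zeta> * norm d' \<le> (cmod \<zeta>0 + 1) * norm d'"
          using that by (auto intro: mult_right_mono)
        moreover have "0 \<le> (cmod \<zeta>0 + 1) * norm d" "0 \<le> (cmod \<zeta>0 + 1) * norm d'" by auto
        ultimately show ?thesis unfolding B_def distrib_left using norm_ge_zero[of x] norm_ge_zero[of y] by linarith
      qed
      have L: "\<exists>\<delta>>0. \<forall>\<epsilon> x y. 0 < \<epsilon> \<and> \<epsilon> < \<delta> \<and> norm x \<le> B \<and> norm y \<le> B \<longrightarrow>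
        of_real \<epsilon> *s x \<in> ball 0 R \<and> of_real \<epsilon> *s y \<in> ball 0 R \<and>
        cmod (k (of_real \<epsilon> *s x) (of_real \<epsilon> *s y) / of_real \<epsilon> ^ m - leading k m x y) < e" if "0 < e" for e
        by (rule leading_limit_uniform[OF _ that B]) (rule z)
      obtain \<delta> where \<delta>: "0 < \<delta>" "\<And>\<epsilon> x y. 0 < \<epsilon> \<Longrightarrow> \<epsilon> < \<delta> \<Longrightarrow> norm x \<le> B \<Longrightarrow> norm y \<le> B \<Longrightarrow>
          complex_of_real \<epsilon> *s (x::complex^'m) \<in> ball 0 R \<and> complex_of_real \<epsilon> *s (y::complex^'m) \<in> ball 0 R"
        using L[of 1] by auto
      define E where "E n = \<delta> / (real n + 2)" for n
      have E: "0 < E n" "E n < \<delta>" for n using \<delta>(1) by (auto simp: E_def field_simps intro!: add_pos_nonneg)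
      have Elim: "E \<longlonglongrightarrow> 0" unfolding E_def by real_asymp
      define f where "f n \<zeta> = k (of_real (E n) *s (x + \<zeta> *s d)) (of_real (E n) *s (y + cnj \<zeta> *s d')) / of_real (E n) ^ m" for n \<zeta>
      have holf: "f n holomorphic_on ball \<zeta>0 1" for n
      proof -
        have sub: "ball \<zeta>0 1 \<subseteq> slice (ball 0 R) (of_real (E n) *s x) (of_real (E n) *s d) (of_real (E n) *s y) (of_real (E n) *s d')"
        proof
          fix w assume "w \<in> ball \<zeta>0 1"
          then have "cmod w \<le> cmod \<zeta>0 + 1" using norm_triangle_ineq2[of w \<zeta>0] by (simp add: dist_norm norm_minus_commute)
          note l = le[OF this]
          have "of_real (E n) *s (x + w *s d) \<in> ball 0 R \<and> of_real (E n) *s (y + cnj w *s d') \<in> ball 0 R"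
            using l by (intro \<delta>(2) E) auto
          then show "w \<in> slice (ball 0 R) (of_real (E n) *s x) (of_real (E n) *s d) (of_real (E n) *s y) (of_real (E n) *s d')"
            by (simp add: slice_def vector_add_ldistrib vec.scale_scale mult.commute)
        qed
        have eq: "f n = (\<lambda>\<zeta>. k (of_real (E n) *s x + \<zeta> *s (of_real (E n) *s d)) (of_real (E n) *s y + cnj \<zeta> *s (of_real (E n) *s d')) / of_real (E n) ^ m)"
          by (simp add: f_def vector_add_ldistrib vec.scale_scale mult.commute fun_eq_iff)
        show ?thesis unfolding eq
          by (intro holomorphic_on_divide holomorphic_on_subset[OF sesqui_holomorphic_onD[OF sesqui] sub] holomorphic_on_const)
            (use E(1)[of n] in auto)
      qed
      have "uniform_limit (ball \<zeta>0 1) f (\<lambda>\<zeta>. leading k m (x + \<zeta> *s d) (y + cnj \<zeta> *s d')) sequentially"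
      proof (rule uniform_limitI)
        fix e :: real assume "0 < e"
        then obtain \<eta> where \<eta>: "0 < \<eta>" "\<And>\<epsilon> x y. 0 < \<epsilon> \<Longrightarrow> \<epsilon> < \<eta> \<Longrightarrow> norm x \<le> B \<Longrightarrow> norm y \<le> B \<Longrightarrow>
           cmod (k (of_real \<epsilon> *s x) (of_real \<epsilon> *s y) / of_real \<epsilon> ^ m - leading k m x y) < e"
          using L[of e] by blast
        have "\<forall>\<^sub>F n in sequentially. E n < \<eta>" using order_tendstoD(2)[OF Elim \<eta>(1)] .
        then show "\<forall>\<^sub>F n in sequentially. \<forall>w\<in>ball \<zeta>0 1. dist (f n w) (leading k m (x + w *s d) (y + cnj w *s d')) < e"
        proof eventually_elim
          case (elim n)
          show ?case
          proof
            fix w assume "w \<in> ball \<zeta>0 1"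
            then have "cmod w \<le> cmod \<zeta>0 + 1" using norm_triangle_ineq2[of w \<zeta>0] by (simp add: dist_norm norm_minus_commute)
            note l = le[OF this]
            show "dist (f n w) (leading k m (x + w *s d) (y + cnj w *s d')) < e"
              unfolding f_def dist_norm by (rule \<eta>(2)[OF E(1) elim conjunct1[OF l] conjunct2[OF l]])
          qed
        qed
      qed
      then have ex: "\<exists>r>0. cball w r \<subseteq> ball \<zeta>0 1 \<and> uniform_limit (cball w r) f
          (\<lambda>\<zeta>. leading k m (x + \<zeta> *s d) (y + cnj \<zeta> *s d')) sequentially" if "w \<in> ball \<zeta>0 1" for w
        using that open_contains_cball[of "ball \<zeta>0 1"] by (meson open_ball uniform_limit_on_subset)
      have "(\<lambda>\<zeta>. leading k m (x + \<zeta> *s d) (y + cnj \<zeta> *s d')) holomorphic_on ball \<zeta>0 1"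
        by (rule holomorphic_uniform_sequence[OF open_ball holf ex])
      then show "\<exists>f'. ((\<lambda>\<zeta>. leading k m (x + \<zeta> *s d) (y + cnj \<zeta> *s d')) has_field_derivative f') (at \<zeta>0)"
        by (auto simp: holomorphic_on_open)
    qed
  qed
qed

text \<open>The given point is the dilation with parameter 1, and 1 lies inside a disc on which the
  dilation is holomorphic because both points are strictly inside the ball. The power series there
  has only zero coefficients.\<close>

lemma zero_if_leading_zero:
  assumes z: "\<And>m x y. leading k m x y = 0" and xy: "x \<in> ball 0 R" "y \<in> ball 0 R"
  shows "k x y = 0"
proof -
  define M where "M = max (norm x) (norm y)"
  have M: "M < R" "norm x \<le> M" "norm y \<le> M" "0 \<le> M" using xy by (auto simp: M_def le_max_iff_disj)
  define \<rho> where "\<rho> = (if M = 0 then 2 else R / M)"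
  have \<rho>: "1 < \<rho>" using M by (auto simp: \<rho>_def field_simps)
  have "\<rho> * M \<le> R" using M R by (auto simp: \<rho>_def)
  then have le: "\<rho> * norm x \<le> R" "\<rho> * norm y \<le> R"
    using mult_left_mono[OF M(2), of \<rho>] mult_left_mono[OF M(3), of \<rho>] \<rho> by linarith+
  have \<rho>0: "0 < \<rho>" using \<rho> by simp
  note hol = dilation_holomorphic(1)[OF le \<rho>0]
  have one: "1 \<in> ball (0::complex) \<rho>" using \<rho> by simp
  have zz: "(deriv ^^ n) (\<lambda>\<epsilon>. k (\<epsilon> *s x) (cnj \<epsilon> *s y)) 0 = 0" for n
    using z[of n x y] by (simp add: leading_def)
  have "(\<lambda>n. (deriv ^^ n) (\<lambda>\<epsilon>. k (\<epsilon> *s x) (cnj \<epsilon> *s y)) 0 / fact n * (1 - 0) ^ n) sums k (1 *s x) (cnj 1 *s y)"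
    by (rule holomorphic_power_series[OF hol one])
  then have "(\<lambda>n. 0) sums k x y" unfolding zz by simp
  then show ?thesis using sums_unique2 sums_zero by blast
qed

end

section \<open>Kernels vanishing on the zeros of a Hermitian form\<close>

context hermitian_form
begin

lemma continuous_diag: "continuous_on UNIV (\<lambda>x. L x x)"
proof -
  have "L x x = (\<Sum>i\<in>UNIV. \<Sum>j\<in>UNIV. x$i * cnj (x$j) * L (axis i 1) (axis j 1))" for x
  proof -
    have "L x x = L (\<Sum>i\<in>UNIV. x$i *s axis i 1) (\<Sum>j\<in>UNIV. x$j *s axis j 1)"
      by (simp only: basis_expansion)
    also have "\<dots> = (\<Sum>i\<in>UNIV. \<Sum>j\<in>UNIV. x$i * cnj (x$j) * L (axis i 1) (axis j 1))"
      by (subst sum_left, intro sum.cong refl, subst sum_right)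
        (simp only: scale_left scale_right sum_distrib_left ac_simps)
    finally show ?thesis .
  qed
  then show ?thesis by (simp only:) (intro continuous_intros)
qed

lemma linear_combination:
  "Vector_Spaces.linear (*s) (*s) (\<lambda>x. c *s x + (\<Sum>i<k. (a i * L x (u i)) *s w i))"
  unfolding Vector_Spaces.linear_iff
  by (simp add: vec.vector_space_axioms add_left scale_left vector_add_ldistrib vector_sadd_rdistrib
      distrib_left sum.distrib vec.scale_sum_right algebra_simps)

text \<open>Projecting \<open>N\<close> orthogonally to \<open>v\<close> only decreases squares,
  since \<open>v\<close> is positive, and so keeps \<open>N\<close> negative definite. Projecting
  \<open>P\<close> orthogonally to a negative frame only increases squares and keeps
  \<open>P\<close> positive definite. One of the \<open>q + 1\<close> negative vectors is then
  rescaled to balance \<open>v\<close>.\<close>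

lemma adapted_frame:
  assumes P: "vec.subspace P" "\<forall>x\<in>P. x \<noteq> 0 \<longrightarrow> Re (L x x) > 0" "Suc q \<le> vec.dim P"
    and N: "vec.subspace N" "\<forall>x\<in>N. x \<noteq> 0 \<longrightarrow> Re (L x x) < 0" "Suc q \<le> vec.dim N"
    and v: "Re (L v v) > 0"
  obtains e0 f e where "L e0 e0 = - L v v" "L v e0 = 0"
    "\<And>i. i < q \<Longrightarrow> L v (f i) = 0 \<and> L v (e i) = 0 \<and> L e0 (f i) = 0 \<and> L e0 (e i) = 0"
    "\<And>i j. i < q \<Longrightarrow> j < q \<Longrightarrow> L (f i) (f j) = (if i = j then 1 else 0) \<and>
       L (e i) (e j) = (if i = j then -1 else 0) \<and> L (f i) (e j) = 0"
proof -
  define c where "c = Re (L v v)"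
  have c: "c > 0" "L v v = of_real c" using v diag_of_real[of v] by (auto simp: c_def)
  \<comment> \<open>Orthogonal projection along \<open>v\<close>, written as a sum with one term so
    that \<open>linear_combination\<close> applies.\<close>
  define T where "T x = 1 *s x + (\<Sum>i<(1::nat). (- 1 / of_real c * L x v) *s v)" for x
  have T_eq: "T x = x - (L x v / of_real c) *s v" for x by (simp add: T_def)
  interpret T: Vector_Spaces.linear "(*s)" "(*s)" T
    unfolding T_def by (rule linear_combination)
  have Tv: "L (T x) v = 0" for x using c by (simp add: T_eq diff_left scale_left)
  have vT: "L v (T x) = 0" for x using Tv[of x] hermitian[of v "T x"] by simp
  have TT: "L (T x) (T x) = L x x - of_real ((cmod (L x v))\<^sup>2 / c)" for x
  proof -
    have "L (T x) (T x) = L (T x) x - cnj (L x v / of_real c) * L (T x) v"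
      by (subst (2) T_eq) (simp only: diff_right scale_right)
    also have "\<dots> = L x x - L x v * cnj (L x v) / of_real c"
      using Tv[of x] hermitian[of v x] by (simp add: T_eq diff_left scale_left)
    finally show ?thesis by (simp only: complex_norm_square[symmetric] of_real_divide)
  qed
  define N1 where "N1 = T ` N"
  have TTle: "Re (L (T x) (T x)) \<le> Re (L x x)" for x
    using c by (simp add: TT)
  have injT: "inj_on T N"
  proof (rule inj_onI)
    fix x y assume xy: "x \<in> N" "y \<in> N" "T x = T y"
    have d: "x - y \<in> N" by (intro vec.subspace_diff N(1) xy)
    have "T (x - y) = 0" using xy by (simp add: T.diff)
    then have "x - y = (L (x - y) v / of_real c) *s v" by (simp add: T_eq)
    then have "L (x - y) (x - y) = (L (x - y) v / of_real c) * cnj (L (x - y) v / of_real c) * of_real c"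
      using c by (metis (no_types, lifting) mult.assoc mult.commute scale_left scale_right)
    then have "Re (L (x - y) (x - y)) = (cmod (L (x - y) v / of_real c))\<^sup>2 * c"
      by (simp only: complex_norm_square[symmetric] of_real_mult[symmetric] Re_complex_of_real)
    then have "Re (L (x - y) (x - y)) \<ge> 0" using c by simp
    then show "x = y" using N(2) d by force
  qed
  have N1: "vec.subspace N1" "\<forall>x\<in>N1. x \<noteq> 0 \<longrightarrow> Re (- L x x) > 0" "Suc q \<le> vec.dim N1"
  proof -
    show "vec.subspace N1" unfolding N1_def by (rule T.subspace_image[OF N(1)])
    show "\<forall>x\<in>N1. x \<noteq> 0 \<longrightarrow> Re (- L x x) > 0"
    proof (intro ballI impI)
      fix x assume "x \<in> N1" "x \<noteq> 0"
      then obtain y where y: "y \<in> N" "x = T y" "y \<noteq> 0" unfolding N1_def using T.zero by (metis imageE)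
      then have "Re (L y y) < 0" using N(2) by auto
      then show "Re (- L x x) > 0" using TTle[of y] y by simp
    qed
    have "vec.dim N1 = vec.dim N" unfolding N1_def
      using injT by (intro vec.dim_image_eq T.linear_axioms) (simp only: vec.span_eq_iff[THEN iffD2, OF N(1)])
    then show "Suc q \<le> vec.dim N1" using N(3) by simp
  qed
  obtain e where e: "\<forall>i<Suc q. e i \<in> N1 \<and> (\<forall>j<Suc q. - L (e i) (e j) = (if i = j then 1 else 0))"
    using hermitian_form.orthonormal_frame[OF uminus N1(1,2,3)] by blast
  have ee: "L (e i) (e j) = (if i = j then -1 else 0)" if "i < Suc q" "j < Suc q" for i j
  proof -
    have "- L (e i) (e j) = (if i = j then 1 else 0)" using e that by blast
    then show ?thesis by (metis add.inverse_inverse add.inverse_neutral)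
  qed
  have ve: "L v (e i) = 0" if "i < Suc q" for i
  proof -
    have "e i \<in> N1" using e that by blast
    then show ?thesis unfolding N1_def using vT by auto
  qed
  \<comment> \<open>The plus sign is right for a projection here because the \<open>e i\<close> have
    square -1.\<close>
  define S where "S x = 1 *s x + (\<Sum>i<Suc q. (1 * L x (e i)) *s e i)" for x
  interpret S: Vector_Spaces.linear "(*s)" "(*s)" S
    unfolding S_def by (rule linear_combination)
  have Se: "L (S x) (e j) = 0" if "j < Suc q" for x j
  proof -
    have "(\<Sum>i<Suc q. L x (e i) * L (e i) (e j)) = (\<Sum>i<Suc q. if i = j then - L x (e i) else 0)"
      by (intro sum.cong) (use ee that in auto)
    also have "\<dots> = - L x (e j)" using that by (subst sum.delta) auto
    finally show ?thesis unfolding S_def by (simp only: add_left sum_left scale_left) simp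
  qed
  have SS: "Re (L (S x) (S x)) \<ge> Re (L x x)" for x
  proof -
    have "L (S x) (S x) = L (S x) x + (\<Sum>i<Suc q. cnj (L x (e i)) * L (S x) (e i))"
      by (subst (2) S_def) (simp only: add_right sum_right scale_right mult_1_left vector_smult_lid)
    also have "\<dots> = L (S x) x" using Se by (auto intro!: sum.neutral)
    also have "\<dots> = L x x + (\<Sum>i<Suc q. L x (e i) * cnj (L x (e i)))"
      unfolding S_def by (simp only: add_left sum_left scale_left mult_1_left hermitian[of "e _" x])
    also have "(\<Sum>i<Suc q. L x (e i) * cnj (L x (e i))) = of_real (\<Sum>i<Suc q. (cmod (L x (e i)))\<^sup>2)"
      by (simp only: complex_norm_square of_real_sum)
    finally show ?thesis by (simp add: sum_nonneg add_nonneg_nonneg)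
  qed
  define P1 where "P1 = S ` P"
  have P1: "vec.subspace P1" "\<forall>x\<in>P1. x \<noteq> 0 \<longrightarrow> Re (L x x) > 0" "Suc q \<le> vec.dim P1"
  proof -
    show "vec.subspace P1" unfolding P1_def by (rule S.subspace_image[OF P(1)])
    show "\<forall>x\<in>P1. x \<noteq> 0 \<longrightarrow> Re (L x x) > 0"
    proof (intro ballI impI)
      fix x assume "x \<in> P1" "x \<noteq> 0"
      then obtain y where y: "y \<in> P" "x = S y" "y \<noteq> 0" unfolding P1_def using S.zero by (metis imageE)
      then have "Re (L y y) > 0" using P(2) by auto
      then show "Re (L x x) > 0" using SS[of y] y by simp
    qed
    have "inj_on S P"
    proof (rule inj_onI)
      fix x y assume xy: "x \<in> P" "y \<in> P" "S x = S y"
      have d: "x - y \<in> P" by (intro vec.subspace_diff P(1) xy)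
      have "S (x - y) = 0" using xy by (simp add: S.diff)
      then have "Re (L (x - y) (x - y)) \<le> 0" using SS[of "x - y"] by simp
      then show "x = y" using P(2) d by force
    qed
    then have "vec.dim P1 = vec.dim P" unfolding P1_def
      by (intro vec.dim_image_eq S.linear_axioms) (simp only: vec.span_eq_iff[THEN iffD2, OF P(1)])
    then show "Suc q \<le> vec.dim P1" using P(3) by simp
  qed
  \<comment> \<open>Orthogonality to \<open>v\<close> costs one dimension, hence \<open>q\<close>
    vectors \<open>f\<close> out of \<open>q + 1\<close> dimensions.\<close>
  define P2 where "P2 = {x\<in>P1. L x v = 0}"
  have P2: "vec.subspace P2" "vec.dim P1 \<le> vec.dim P2 + 1"
    using dim_kernel_functional[where \<phi> = "\<lambda>x. L x v", OF P1(1)] unfolding P2_def by (auto simp: add_left scale_left)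
  have "\<forall>x\<in>P2. x \<noteq> 0 \<longrightarrow> Re (L x x) > 0" "q \<le> vec.dim P2" using P1 P2 by (auto simp: P2_def)
  from orthonormal_frame[OF P2(1) this] obtain f where
    f: "\<forall>i<q. f i \<in> P2 \<and> (\<forall>j<q. L (f i) (f j) = (if i = j then 1 else 0))" by blast
  have fe: "L (f i) (e j) = 0" if "i < q" "j < Suc q" for i j
  proof -
    have "f i \<in> P1" using f that unfolding P2_def by blast
    then show ?thesis unfolding P1_def using Se that by auto
  qed
  have ef: "L (e j) (f i) = 0" if "i < q" "j < Suc q" for i j
    using fe[OF that] hermitian[of "e j" "f i"] by simp
  have vf: "L v (f i) = 0" if "i < q" for i
  proof -
    have "L (f i) v = 0" using f that unfolding P2_def by blast
    then show ?thesis using hermitian[of v "f i"] by simp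
  qed
  show ?thesis
  proof (rule that[of "of_real (sqrt c) *s e q" f e])
    have "complex_of_real (sqrt c) * complex_of_real (sqrt c) = of_real c"
      using c by (simp flip: of_real_mult)
    then show "L (of_real (sqrt c) *s e q) (of_real (sqrt c) *s e q) = - L v v"
      by (simp add: scale_left scale_right ee c(2) flip: mult.assoc)
  qed (use f ee fe ef vf ve in \<open>auto simp: scale_left scale_right\<close>)
qed

end

text \<open>A kernel \<open>K\<close> that vanishes wherever the Hermitian form \<open>L\<close> does is zero if it cannot have \<open>q + 1\<close>
  hyperbolic planes while \<open>L\<close> has that many. Among dual systems \<open>s, t\<close> of two isotropic subspaces one
  takes as many indices \<open>a\<close> with \<open>K (s a) (t a) \<noteq> 0\<close> as possible; the others can be perturbed freely, which
  forces \<open>K\<close> to vanish between the subspaces, and these can be chosen with \<open>v\<close> as a sum of two elements.\<close>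

locale kernel = hermitian_form L for L :: "complex^'m \<Rightarrow> complex^'m \<Rightarrow> complex" +
  fixes K :: "complex^'m \<Rightarrow> complex^'m \<Rightarrow> complex"
  assumes K_sesqui: "sesqui_holomorphic_on UNIV K"
    and K_hermitian: "K y x = cnj (K x y)"
    and K_zero: "L x y = 0 \<Longrightarrow> K x y = 0"
begin

text \<open>Dual systems up to nonzero factors: the diagonal entries move under perturbation, and
  only their being nonzero matters.\<close>

definition biorthogonal ::
  "(complex^'m) set \<Rightarrow> (complex^'m) set \<Rightarrow> nat \<Rightarrow> (nat \<Rightarrow> complex^'m) \<Rightarrow> (nat \<Rightarrow> complex^'m) \<Rightarrow> bool" where
  "biorthogonal Z W r s t \<longleftrightarrow> (\<forall>a<r. s a \<in> Z \<and> t a \<in> W \<and> (\<forall>b<r. L (s a) (t b) = 0 \<longleftrightarrow> a \<noteq> b))"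

lemma biorthogonal_swap: "biorthogonal Z W r s t \<Longrightarrow> biorthogonal W Z r t s"
  unfolding biorthogonal_def
proof (intro allI impI conjI iffI)
  fix a b :: nat assume *: "\<forall>a<r. s a \<in> Z \<and> t a \<in> W \<and> (\<forall>b<r. (L (s a) (t b) = 0) = (a \<noteq> b))" "a < r" "b < r"
  have "L (t a) (s b) = 0 \<longleftrightarrow> L (s b) (t a) = 0" by (subst hermitian) simp
  then show "L (t a) (s b) = 0 \<Longrightarrow> a \<noteq> b" "a \<noteq> b \<Longrightarrow> L (t a) (s b) = 0" using * by auto
qed auto

lemma slice_UNIV [simp]: "slice UNIV x d y d' = UNIV"
  by (simp add: slice_def)

lemma K_line: "(\<lambda>\<zeta>. K (x + \<zeta> *s d) (y + cnj \<zeta> *s d')) holomorphic_on UNIV"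
  using sesqui_holomorphic_onD[OF K_sesqui] by simp

lemma eventually_nonzero_line:
  assumes "K z y \<noteq> 0" shows "\<forall>\<^sub>F \<zeta> in at 0. K (x + \<zeta> *s (z - x)) y \<noteq> 0"
  using non_zero_neighbour_alt[OF K_line[of x "z - x" y 0] open_UNIV connected_UNIV, of 0 1] assms by simp

text \<open>Moving \<open>s j\<close> towards \<open>z\<close> destroys orthogonality to the other
  \<open>t b\<close>; adding small multiples of \<open>t j\<close> to them restores it. The
  corrections tend to 0 with the parameter, so the finitely many conditions
  \<open>K (s a) (t a) \<noteq> 0\<close> already achieved persist, while \<open>t j\<close> stays
  put.\<close>

lemma perturb:
  assumes ZW: "vec.subspace Z" "vec.subspace W" and bi: "biorthogonal Z W r s t" and j: "j < r" "z \<in> Z"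
    and J: "J \<subseteq> {..<r}" "j \<notin> J" "\<And>a. a \<in> J \<Longrightarrow> K (s a) (t a) \<noteq> 0"
    and Q: "\<forall>\<^sub>F \<zeta> in at 0. Q (s j + \<zeta> *s (z - s j))"
  shows "\<exists>s' t'. biorthogonal Z W r s' t' \<and> t' j = t j \<and> Q (s' j) \<and> (\<forall>a\<in>J. K (s' a) (t' a) \<noteq> 0)"
proof -
  define d where "d = z - s j"
  define D where "D \<zeta> = L (s j) (t j) + \<zeta> * L d (t j)" for \<zeta>
  \<comment> \<open>\<open>D \<zeta>\<close> is the new diagonal entry. The coefficient solves the
    equation that the moved vector be orthogonal to
    \<open>t b - cnj (q b \<zeta>) *s t j\<close>.\<close>
  define q where "q b \<zeta> = \<zeta> * L d (t b) / D \<zeta>" for b \<zeta>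
  have D0: "D 0 \<noteq> 0" using bi j by (auto simp: D_def biorthogonal_def)
  have Dlim: "D \<midarrow>0\<rightarrow> D 0" unfolding D_def by (intro tendsto_eq_intros | simp)+
  have evD: "\<forall>\<^sub>F \<zeta> in at 0. D \<zeta> \<noteq> 0" by (rule tendsto_imp_eventually_ne[OF Dlim D0])
  have qlim: "q b \<midarrow>0\<rightarrow> 0" for b
  proof -
    have "((\<lambda>\<zeta>. \<zeta> * L d (t b)) \<longlongrightarrow> 0 * L d (t b)) (at 0)" by (intro tendsto_intros)
    from tendsto_divide[OF this Dlim D0] show ?thesis by (simp add: q_def[abs_def])
  qed
  have evK: "\<forall>\<^sub>F \<zeta> in at 0. K (s a) (t a - cnj (q a \<zeta>) *s t j) \<noteq> 0" if "a \<in> J" for a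
  proof -
    let ?f = "\<lambda>w. K (s a) (t a - cnj w *s t j)"
    have "?f holomorphic_on UNIV" using K_line[of "s a" 0 "t a" "- t j"] by simp
    then have "isCont ?f 0"
      by (rule continuous_on_interior[OF holomorphic_on_imp_continuous_on]) simp
    then have "((\<lambda>\<zeta>. ?f (q a \<zeta>)) \<longlongrightarrow> ?f 0) (at 0)"
      by (rule isCont_tendsto_compose[OF _ qlim])
    then show ?thesis by (rule tendsto_imp_eventually_ne) (use J that in simp)
  qed
  have finJ: "finite J" using J(1) finite_subset by blast
  have "\<forall>\<^sub>F \<zeta> in at 0. \<forall>a\<in>J. K (s a) (t a - cnj (q a \<zeta>) *s t j) \<noteq> 0"
    using evK by (intro eventually_ball_finite finJ) auto
  then have "\<forall>\<^sub>F \<zeta> in at 0. D \<zeta> \<noteq> 0 \<and> Q (s j + \<zeta> *s d) \<and> (\<forall>a\<in>J. K (s a) (t a - cnj (q a \<zeta>) *s t j) \<noteq> 0)"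
    using evD Q unfolding d_def by eventually_elim auto
  then obtain \<zeta> where \<zeta>: "D \<zeta> \<noteq> 0" "Q (s j + \<zeta> *s d)" "\<forall>a\<in>J. K (s a) (t a - cnj (q a \<zeta>) *s t j) \<noteq> 0"
    using eventually_happens'[of "at (0::complex)"] at_neq_bot by blast
  define s' where "s' = s(j := s j + \<zeta> *s d)"
  define t' where "t' b = (if b = j then t j else t b - cnj (q b \<zeta>) *s t j)" for b
  have dZ: "d \<in> Z" unfolding d_def by (intro vec.subspace_diff ZW j) (use bi j in \<open>auto simp: biorthogonal_def\<close>)
  have "biorthogonal Z W r s' t'"
    unfolding biorthogonal_def
  proof (intro allI impI conjI)
    fix a assume a: "a < r"
    have sa: "s a \<in> Z" "t a \<in> W" "s j \<in> Z" "t j \<in> W" using bi a j by (auto simp: biorthogonal_def)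
    show "s' a \<in> Z" unfolding s'_def using sa dZ by (auto intro: vec.subspace_add vec.subspace_scale ZW)
    show "t' a \<in> W" unfolding t'_def using sa by (auto intro: vec.subspace_diff vec.subspace_scale ZW)
    fix b assume b: "b < r"
    have L0: "L (s a) (t b) = 0 \<longleftrightarrow> a \<noteq> b" "L (s a) (t j) = 0 \<longleftrightarrow> a \<noteq> j" "L (s j) (t b) = 0 \<longleftrightarrow> j \<noteq> b"
      using bi a b j by (auto simp: biorthogonal_def)
    show "L (s' a) (t' b) = 0 \<longleftrightarrow> a \<noteq> b"
    proof (cases "a = j"; cases "b = j")
      assume "a = j" "b = j"
      then show ?thesis using \<zeta>(1) by (simp add: s'_def t'_def D_def add_left scale_left)
    next
      assume ab: "a = j" "b \<noteq> j"
      have "L (s' a) (t' b) = L (s j + \<zeta> *s d) (t b) - q b \<zeta> * L (s j + \<zeta> *s d) (t j)"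
        using ab by (simp add: s'_def t'_def diff_right scale_right)
      also have "\<dots> = \<zeta> * L d (t b) - q b \<zeta> * D \<zeta>"
        using L0 ab by (simp add: add_left scale_left D_def)
      also have "\<dots> = 0" using \<zeta>(1) by (simp add: q_def)
      finally show ?thesis using ab by simp
    next
      assume "a \<noteq> j" "b = j"
      then show ?thesis using L0 by (simp add: s'_def t'_def)
    next
      assume "a \<noteq> j" "b \<noteq> j"
      then show ?thesis using L0 by (simp add: s'_def t'_def diff_right scale_right)
    qed
  qed
  moreover have "t' j = t j" "Q (s' j)" using \<zeta> by (auto simp: t'_def s'_def)
  moreover have "\<forall>a\<in>J. K (s' a) (t' a) \<noteq> 0" using \<zeta>(3) J(2) by (auto simp: s'_def t'_def)
  ultimately show ?thesis by blast
qed

text \<open>If \<open>K z w\<close> were nonzero, the indices could be treated one by one: first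
  \<open>t j\<close> is moved towards \<open>w\<close> until \<open>K z (t j) \<noteq> 0\<close>,
  then \<open>s j\<close> towards \<open>z\<close> until \<open>K (s j) (t j) \<noteq> 0\<close>.
  After \<open>r\<close> rounds all diagonal values would be nonzero, which \<open>no\<close>
  excludes.\<close>

lemma zero_between_isotropic:
  assumes ZW: "vec.subspace Z" "vec.subspace W" and bi: "biorthogonal Z W r s t"
    and no: "\<And>s t. biorthogonal Z W r s t \<Longrightarrow> \<exists>a<r. K (s a) (t a) = 0"
    and z: "z \<in> Z" "w \<in> W"
  shows "K z w = 0"
proof (rule ccontr)
  assume nz: "K z w \<noteq> 0"
  have "j \<le> r \<Longrightarrow> \<exists>s t. biorthogonal Z W r s t \<and> (\<forall>a<j. K (s a) (t a) \<noteq> 0)" for j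
  proof (induction j)
    case 0
    then show ?case using bi by blast
  next
    case (Suc j)
    then obtain s t where st: "biorthogonal Z W r s t" "\<forall>a<j. K (s a) (t a) \<noteq> 0" by auto
    have j: "j < r" "{..<j} \<subseteq> {..<r}" "j \<notin> {..<j}" using Suc.prems by auto
    have "K w z \<noteq> 0" using nz by (subst K_hermitian) simp
    then have ev: "\<forall>\<^sub>F \<zeta> in at 0. K (t j + \<zeta> *s (w - t j)) z \<noteq> 0" by (rule eventually_nonzero_line)
    have "K (t a) (s a) \<noteq> 0" if "a \<in> {..<j}" for a using st(2) that by (subst K_hermitian) simp
    from perturb[where Q = "\<lambda>u. K u z \<noteq> 0", OF ZW(2,1) biorthogonal_swap[OF st(1)] j(1) z(2) j(2,3) this ev]
    obtain t' s' where st': "biorthogonal W Z r t' s'" "K (t' j) z \<noteq> 0" "\<forall>a\<in>{..<j}. K (t' a) (s' a) \<noteq> 0" by blast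
    have "K z (t' j) \<noteq> 0" using st'(2) by (subst K_hermitian) simp
    then have ev: "\<forall>\<^sub>F \<zeta> in at 0. K (s' j + \<zeta> *s (z - s' j)) (t' j) \<noteq> 0" by (rule eventually_nonzero_line)
    have "K (s' a) (t' a) \<noteq> 0" if "a \<in> {..<j}" for a using st'(3) that by (subst K_hermitian) simp
    from perturb[where Q = "\<lambda>u. K u (t' j) \<noteq> 0", OF ZW biorthogonal_swap[OF st'(1)] j(1) z(1) j(2,3) this ev]
    obtain s'' t'' where "biorthogonal Z W r s'' t''" "t'' j = t' j" "K (s'' j) (t' j) \<noteq> 0" "\<forall>a\<in>{..<j}. K (s'' a) (t'' a) \<noteq> 0"
      by blast
    then show ?case by (intro exI[of _ s''] exI[of _ t'']) (auto simp: less_Suc_eq)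
  qed
  from this[of r] obtain s t where "biorthogonal Z W r s t" "\<forall>a<r. K (s a) (t a) \<noteq> 0" by auto
  then show False using no by blast
qed

lemma isotropic_span:
  assumes "\<forall>a<r. \<forall>b<r. L (s a) (s b) = (0::complex)" and "x \<in> vec.span (s ` {..<r::nat})" "y \<in> vec.span (s ` {..<r})"
  shows "L x y = 0"
proof -
  have 1: "L x (s b) = 0" if "b < r" for b
    using assms(2) by (induction rule: vec.span_induct_alt) (use assms(1) that in \<open>auto simp: add_left scale_left\<close>)
  show ?thesis
    using assms(3) by (induction rule: vec.span_induct_alt) (use 1 in \<open>auto simp: add_right scale_right\<close>)
qed

text \<open>Since \<open>e0\<close> has the opposite square of \<open>v\<close> and is orthogonal to
  it, \<open>v + \<sigma> *s e0\<close> is null for every \<open>\<sigma>\<close> on the unit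
  circle. For two such parameters \<open>K\<close> vanishes, and holomorphy in
  \<open>\<sigma>\<close> and antiholomorphy in \<open>\<tau>\<close> carry this from the circle to
  \<open>\<sigma> = \<tau> = 0\<close>.\<close>

lemma zero_at_positive:
  assumes P: "vec.subspace P" "\<forall>x\<in>P. x \<noteq> 0 \<longrightarrow> Re (L x x) > 0" "Suc q \<le> vec.dim P"
    and N: "vec.subspace N" "\<forall>x\<in>N. x \<noteq> 0 \<longrightarrow> Re (L x x) < 0" "Suc q \<le> vec.dim N"
    and no: "\<And>s t. \<lbrakk>\<forall>a<Suc q. \<forall>b<Suc q. K (s a) (s b) = 0 \<and> K (t a) (t b) = 0 \<and> (a \<noteq> b \<longrightarrow> K (s a) (t b) = 0)\<rbrakk>
        \<Longrightarrow> \<exists>a<Suc q. K (s a) (t a) = 0"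
    and v: "Re (L v v) > 0"
  shows "K v v = 0"
proof -
  obtain e0 f e where e0: "L e0 e0 = - L v v" "L v e0 = 0" and
    v0: "\<And>i. i < q \<Longrightarrow> L v (f i) = 0 \<and> L v (e i) = 0 \<and> L e0 (f i) = 0 \<and> L e0 (e i) = 0" and
    fe: "\<And>i j. i < q \<Longrightarrow> j < q \<Longrightarrow> L (f i) (f j) = (if i = j then 1 else 0) \<and>
       L (e i) (e j) = (if i = j then -1 else 0) \<and> L (f i) (e j) = 0"
    using adapted_frame[OF P N v] by blast
  have e0v: "L e0 v = 0" using e0(2) hermitian[of e0 v] by simp
  have v0': "L (f i) v = 0 \<and> L (e i) v = 0 \<and> L (f i) e0 = 0 \<and> L (e i) e0 = 0" if "i < q" for i
    using v0[OF that] hermitian[of "f i" v] hermitian[of "e i" v] hermitian[of "f i" e0] hermitian[of "e i" e0] by simp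
  have ef: "L (e i) (f j) = 0" if "i < q" "j < q" for i j using fe[OF that(2,1)] hermitian[of "e i" "f j"] by simp
  have unit: "\<sigma> * cnj \<sigma> = 1" if "cmod \<sigma> = 1" for \<sigma> using that by (simp only: complex_norm_square[symmetric]) simp
  have key: "K (v + \<sigma> *s e0) (v + \<tau> *s e0) = 0" if \<sigma>\<tau>: "cmod \<sigma> = 1" "cmod \<tau> = 1" for \<sigma> \<tau>
  proof (cases "\<sigma> = \<tau>")
    case True
    have "L (v + \<sigma> *s e0) (v + \<sigma> *s e0) = L v v + (\<sigma> * cnj \<sigma>) * L e0 e0"
      by (simp add: add_left add_right scale_left scale_right e0(2) e0v)
    then show ?thesis using True unit[OF \<sigma>\<tau>(1)] e0(1) by (intro K_zero) simp
  next
    case False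
    \<comment> \<open>The null vectors \<open>f i + e i\<close> and \<open>f i - e i\<close> pair to
      2 with each other; together with the two null vectors over \<open>v\<close> they give
      biorthogonal isotropic systems of length \<open>q + 1\<close>.\<close>
    define s where "s a = (case a of 0 \<Rightarrow> v + \<sigma> *s e0 | Suc i \<Rightarrow> f i + e i)" for a
    define t where "t a = (case a of 0 \<Rightarrow> v + \<tau> *s e0 | Suc i \<Rightarrow> f i - e i)" for a
    have ne: "\<sigma> * cnj \<tau> \<noteq> 1"
    proof
      assume "\<sigma> * cnj \<tau> = 1"
      then have "\<sigma> * cnj \<tau> * \<tau> = \<tau>" by simp
      then show False using False unit[OF \<sigma>\<tau>(2)] by (simp add: mult.assoc mult.commute[of "cnj \<tau>"])
    qed
    have Lvv: "L v v \<noteq> 0" using v by auto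
    have 0: "L (v + \<alpha> *s e0) (v + \<beta> *s e0) = (1 - \<alpha> * cnj \<beta>) * L v v" for \<alpha> \<beta>
      by (simp add: add_left add_right scale_left scale_right e0 e0v algebra_simps)
    have ss: "L (s a) (s b) = 0" "L (t a) (t b) = 0" "L (s a) (t b) = 0 \<longleftrightarrow> a \<noteq> b" if "a < Suc q" "b < Suc q" for a b
      using that unit[OF \<sigma>\<tau>(1)] unit[OF \<sigma>\<tau>(2)] ne Lvv
      by (cases a; cases b; simp add: s_def t_def 0; simp add: add_left add_right diff_left diff_right scale_left scale_right v0 v0' fe ef)+
    let ?Z = "vec.span (s ` {..<Suc q})" and ?W = "vec.span (t ` {..<Suc q})"
    have bi: "biorthogonal ?Z ?W (Suc q) s t"
      unfolding biorthogonal_def using ss by (auto intro!: vec.span_base)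
    have "K (s 0) (t 0) = 0"
    proof (rule zero_between_isotropic[OF vec.subspace_span vec.subspace_span bi])
      fix s' t' assume bi': "biorthogonal ?Z ?W (Suc q) s' t'"
      show "\<exists>a<Suc q. K (s' a) (t' a) = 0"
      proof (rule no, intro allI impI)
        fix a b assume ab: "a < Suc q" "b < Suc q"
        have mem: "s' a \<in> ?Z" "s' b \<in> ?Z" "t' a \<in> ?W" "t' b \<in> ?W" using bi' ab by (auto simp: biorthogonal_def)
        have 1: "K (s' a) (s' b) = 0" by (rule K_zero, rule isotropic_span[OF _ mem(1,2)]) (use ss in auto)
        have 2: "K (t' a) (t' b) = 0" by (rule K_zero, rule isotropic_span[OF _ mem(3,4)]) (use ss in auto)
        have "a \<noteq> b \<longrightarrow> K (s' a) (t' b) = 0"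
          by (intro impI K_zero) (use bi' ab in \<open>auto simp: biorthogonal_def\<close>)
        with 1 2 show "K (s' a) (s' b) = 0 \<and> K (t' a) (t' b) = 0 \<and> (a \<noteq> b \<longrightarrow> K (s' a) (t' b) = 0)"
          by blast
      qed
    qed (auto intro!: vec.span_base)
    then show ?thesis by (simp add: s_def t_def)
  qed
  have lim: "1 islimpt sphere (0::complex) 1"
  proof -
    have c: "connected (sphere (0::complex) 1)" by (intro connected_sphere) simp
    have m: "1 \<in> sphere (0::complex) 1" "-1 \<in> sphere (0::complex) 1" by auto
    have "sphere (0::complex) 1 \<noteq> {a}" for a
      using m by (metis one_neq_neg_one singletonD)
    then show ?thesis using connected_imp_perfect[OF c m(1)] by blast
  qed
  have A: "K v (v + \<tau> *s e0) = 0" if "cmod \<tau> = 1" for \<tau>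
  proof -
    have "K (v + 0 *s e0) ((v + \<tau> *s e0) + cnj 0 *s 0) = 0"
      by (rule zero_of_islimpt[OF K_line open_UNIV convex_UNIV _ _ lim]) (use key that in auto)
    then show ?thesis by simp
  qed
  have "K (v + 0 *s 0) (v + cnj 0 *s e0) = 0"
    by (rule zero_of_islimpt[OF K_line open_UNIV convex_UNIV _ _ lim]) (use A in auto)
  then show ?thesis by simp
qed

text \<open>The positive vectors form a nonempty open cone, so vanishing on their diagonal polarizes
  to the whole space.\<close>

lemma kernel_zero:
  assumes P: "vec.subspace P" "\<forall>x\<in>P. x \<noteq> 0 \<longrightarrow> Re (L x x) > 0" "Suc q \<le> vec.dim P"
    and N: "vec.subspace N" "\<forall>x\<in>N. x \<noteq> 0 \<longrightarrow> Re (L x x) < 0" "Suc q \<le> vec.dim N"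
    and no: "\<And>s t. \<lbrakk>\<forall>a<Suc q. \<forall>b<Suc q. K (s a) (s b) = 0 \<and> K (t a) (t b) = 0 \<and> (a \<noteq> b \<longrightarrow> K (s a) (t b) = 0)\<rbrakk>
        \<Longrightarrow> \<exists>a<Suc q. K (s a) (t a) = 0"
  shows "K x y = 0"
proof -
  obtain v where v: "v \<in> P" "v \<noteq> 0"
  proof -
    have "vec.dim P \<noteq> 0" using P(3) by linarith
    then have "\<not> P \<subseteq> {0}" unfolding vec.dim_eq_0 .
    then show ?thesis using that by blast
  qed
  let ?O = "{x. Re (L x x) > 0}"
  have "open ?O" by (intro open_Collect_less continuous_intros continuous_diag)
  moreover have "v \<in> ?O" using P v by auto
  ultimately obtain r where r: "0 < r" "ball v r \<subseteq> ?O" by (meson open_contains_ball)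
  show ?thesis
    by (rule polarization[OF K_sesqui open_UNIV convex_UNIV r(1) subset_UNIV])
      (use r zero_at_positive[OF P N no] in auto)
qed

end

text \<open>Since \<open>\<bar>d a\<bar> * \<bar>d b\<bar>\<close> is at most half the sum of the
  squares, entries of size \<open>\<eta>\<close> contribute at most \<open>r * \<eta>\<close> times
  the sum of the squares of the coefficients.\<close>

lemma positive_of_near_diagonal:
  fixes d :: "nat \<Rightarrow> complex" and H :: "nat \<Rightarrow> nat \<Rightarrow> complex"
  assumes near: "\<And>a b. a < r \<Longrightarrow> b < r \<Longrightarrow> cmod (H a b - (if a = b then of_real (D a) else 0)) < \<eta>"
    and D: "\<And>a. a < r \<Longrightarrow> real r * \<eta> < D a" and \<eta>: "0 < \<eta>" and d: "\<exists>a<r. d a \<noteq> 0"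
  shows "Re (\<Sum>a<r. \<Sum>b<r. d a * cnj (d b) * H a b) > 0"
proof -
  define E where "E a b = H a b - (if a = b then of_real (D a) else 0)" for a b
  define m where "m a = cmod (d a)" for a
  have split: "(\<Sum>a<r. \<Sum>b<r. d a * cnj (d b) * H a b)
      = of_real (\<Sum>a<r. D a * (m a)\<^sup>2) + (\<Sum>a<r. \<Sum>b<r. d a * cnj (d b) * E a b)"
  proof -
    have "(\<Sum>b<r. d a * cnj (d b) * H a b) = of_real (D a * (m a)\<^sup>2) + (\<Sum>b<r. d a * cnj (d b) * E a b)"
      if "a < r" for a
    proof -
      have "(\<Sum>b<r. d a * cnj (d b) * H a b) =
          (\<Sum>b<r. (if a = b then d a * cnj (d b) * of_real (D a) else 0) + d a * cnj (d b) * E a b)"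
        by (intro sum.cong) (auto simp: E_def algebra_simps)
      also have "\<dots> = d a * cnj (d a) * of_real (D a) + (\<Sum>b<r. d a * cnj (d b) * E a b)"
        using that by (simp add: sum.distrib)
      finally show ?thesis
        by (simp only: m_def complex_norm_square of_real_mult mult.commute)
    qed
    then show ?thesis by (simp add: sum.distrib)
  qed
  have "cmod (\<Sum>a<r. \<Sum>b<r. d a * cnj (d b) * E a b) \<le> (\<Sum>a<r. \<Sum>b<r. ((m a)\<^sup>2 + (m b)\<^sup>2) / 2 * \<eta>)"
  proof (intro order_trans[OF norm_sum] sum_mono)
    fix a b assume ab: "a \<in> {..<r}" "b \<in> {..<r}"
    have "cmod (d a * cnj (d b) * E a b) = (m a * m b) * cmod (E a b)" by (simp add: norm_mult m_def)
    also have "\<dots> \<le> ((m a)\<^sup>2 + (m b)\<^sup>2) / 2 * \<eta>"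
    proof (intro mult_mono)
      show "m a * m b \<le> ((m a)\<^sup>2 + (m b)\<^sup>2) / 2" using sum_squares_bound[of "m a" "m b"] by simp
      show "cmod (E a b) \<le> \<eta>" using near ab unfolding E_def by (intro less_imp_le) auto
    qed auto
    finally show "cmod (d a * cnj (d b) * E a b) \<le> ((m a)\<^sup>2 + (m b)\<^sup>2) / 2 * \<eta>" .
  qed
  also have "\<dots> = real r * \<eta> * (\<Sum>a<r. (m a)\<^sup>2)"
    by (simp add: add_divide_distrib distrib_right sum.distrib flip: sum_divide_distrib sum_distrib_right sum_distrib_left)
  finally have le: "- (real r * \<eta> * (\<Sum>a<r. (m a)\<^sup>2)) \<le> Re (\<Sum>a<r. \<Sum>b<r. d a * cnj (d b) * E a b)"
    using abs_Re_le_cmod[of "\<Sum>a<r. \<Sum>b<r. d a * cnj (d b) * E a b"] by linarith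
  have "(\<Sum>a<r. (D a - real r * \<eta>) * (m a)\<^sup>2) > 0"
  proof -
    obtain a where a: "a < r" "d a \<noteq> 0" using d by blast
    show ?thesis
      by (rule sum_pos2[where i = a]) (use a D in \<open>auto simp: m_def less_imp_le\<close>)
  qed
  then have "(\<Sum>a<r. D a * (m a)\<^sup>2) > real r * \<eta> * (\<Sum>a<r. (m a)\<^sup>2)"
    by (simp add: left_diff_distrib sum_subtractf sum_distrib_left)
  then show ?thesis unfolding split using le by simp
qed

lemma limit_multiply_zero:
  fixes f :: "real \<Rightarrow> complex"
  assumes "((\<lambda>\<epsilon>. f \<epsilon> / of_real \<epsilon> ^ 2) \<longlongrightarrow> l) (at_right 0)" "j < 2"
  shows "((\<lambda>\<epsilon>. f \<epsilon> / of_real \<epsilon> ^ j) \<longlongrightarrow> 0) (at_right 0)"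
proof -
  have "((\<lambda>\<epsilon>. f \<epsilon> / of_real \<epsilon> ^ 2 * of_real \<epsilon> ^ (2 - j)) \<longlongrightarrow> l * of_real 0 ^ (2 - j)) (at_right (0::real))"
    by (intro tendsto_intros assms)
  then have lim: "((\<lambda>\<epsilon>. f \<epsilon> / of_real \<epsilon> ^ 2 * of_real \<epsilon> ^ (2 - j)) \<longlongrightarrow> 0) (at_right (0::real))"
    using assms(2) by (simp add: power_0_left)
  have ev: "\<forall>\<^sub>F \<epsilon> in at_right (0::real). f \<epsilon> / of_real \<epsilon> ^ 2 * of_real \<epsilon> ^ (2 - j) = f \<epsilon> / of_real \<epsilon> ^ j"
  proof (rule eventually_at_rightI[of 0 1])
    fix \<epsilon> :: real assume "\<epsilon> \<in> {0<..<1}"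
    then show "f \<epsilon> / of_real \<epsilon> ^ 2 * of_real \<epsilon> ^ (2 - j) = f \<epsilon> / of_real \<epsilon> ^ j"
      using assms(2) by (cases "j = 0") (auto simp: less_2_cases_iff power2_eq_square)
  qed simp
  show ?thesis by (rule tendsto_cong[THEN iffD1, OF ev lim])
qed

text \<open>The lowest order term of \<open>k\<close> at the origin inherits the zeros and the signature bound of \<open>k\<close>, hence is
  zero; so \<open>k\<close> vanishes to infinite order.\<close>

theorem sesqui_vanishing:
  fixes L k \<rho> :: "complex^'m \<Rightarrow> complex^'m \<Rightarrow> complex"
  assumes L: "hermitian_form L"
    and P: "vec.subspace P" "\<forall>x\<in>P. x \<noteq> 0 \<longrightarrow> Re (L x x) > 0" "Suc q \<le> vec.dim P"
    and N: "vec.subspace N" "\<forall>x\<in>N. x \<noteq> 0 \<longrightarrow> Re (L x x) < 0" "Suc q \<le> vec.dim N"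
    and k: "sesqui_germ k R C" and \<rho>: "sesqui_germ \<rho> R C'"
    and k_herm: "\<And>x y. k y x = cnj (k x y)"
    and lim: "\<And>x y. ((\<lambda>\<epsilon>. \<rho> (of_real \<epsilon> *s x) (of_real \<epsilon> *s y) / of_real \<epsilon> ^ 2) \<longlongrightarrow> L x y) (at_right 0)"
    and van: "\<And>x y. x \<in> ball 0 R \<Longrightarrow> y \<in> ball 0 R \<Longrightarrow> \<rho> x y = 0 \<Longrightarrow> k x y = 0"
    and deg: "\<And>x y. x \<in> ball 0 R \<Longrightarrow> y \<in> ball 0 R \<Longrightarrow> (\<forall>x. L x y = 0) \<Longrightarrow> k x y = 0"
    and npos: "\<And>s t \<beta>. (\<forall>a<Suc q. s a \<in> ball 0 R \<and> t a \<in> ball 0 R) \<Longrightarrow>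
      \<exists>d. (\<exists>a<Suc q. d a \<noteq> 0) \<and> Re (\<Sum>a<Suc q. \<Sum>b<Suc q. d a * cnj (d b) *
        (k (s a) (s b) + cnj (\<beta> b) * k (s a) (t b) + \<beta> a * k (t a) (s b) + \<beta> a * cnj (\<beta> b) * k (t a) (t b))) \<le> 0"
    and xy: "x \<in> ball 0 R" "y \<in> ball 0 R"
  shows "k x y = 0"
proof -
  interpret hermitian_form L by (rule L)
  interpret k: sesqui_germ k R C by (rule k)
  interpret \<rho>: sesqui_germ \<rho> R C' by (rule \<rho>)
  have \<rho>0: "leading \<rho> j x y = 0" if "j < 2" for j x y
    using that
  proof (induction j arbitrary: x y rule: less_induct)
    case (less j)
    have "((\<lambda>\<epsilon>. \<rho> (of_real \<epsilon> *s x) (of_real \<epsilon> *s y) / of_real \<epsilon> ^ j) \<longlongrightarrow> leading \<rho> j x y) (at_right 0)"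
      by (rule \<rho>.leading_limit) (use less in auto)
    then show ?case
      by (rule tendsto_unique[OF _ _ limit_multiply_zero[OF lim less.prems], rotated]) simp
  qed
  have \<rho>2: "leading \<rho> 2 x y = L x y" for x y
    by (rule tendsto_unique[OF _ \<rho>.leading_limit[of 2] lim]) (use \<rho>0 in auto)
  have "leading k m x y = 0" for m x y
  proof (induction m arbitrary: x y rule: less_induct)
    case (less m)
    note z = less.IH
    define K where "K = leading k m"
    have Klim: "((\<lambda>\<epsilon>. k (of_real \<epsilon> *s x) (of_real \<epsilon> *s y) / of_real \<epsilon> ^ m) \<longlongrightarrow> K x y) (at_right 0)" for x y
      unfolding K_def by (rule k.leading_limit) (rule z)
    have Kunif: "\<exists>\<delta>>0. \<forall>\<epsilon> x y. 0 < \<epsilon> \<and> \<epsilon> < \<delta> \<and> norm x \<le> B \<and> norm y \<le> B \<longrightarrow>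
      complex_of_real \<epsilon> *s x \<in> ball 0 R \<and> complex_of_real \<epsilon> *s y \<in> ball 0 R \<and>
      cmod (k (of_real \<epsilon> *s x) (of_real \<epsilon> *s y) / of_real \<epsilon> ^ m - K x y) < e" if "0 < e" "0 < B" for e B
      unfolding K_def by (rule k.leading_limit_uniform[OF _ that]) (rule z)
    have \<rho>unif: "\<exists>\<delta>>0. \<forall>\<epsilon> x y. 0 < \<epsilon> \<and> \<epsilon> < \<delta> \<and> norm x \<le> B \<and> norm y \<le> B \<longrightarrow>
      complex_of_real \<epsilon> *s x \<in> ball 0 R \<and> complex_of_real \<epsilon> *s y \<in> ball 0 R \<and>
      cmod (\<rho> (of_real \<epsilon> *s x) (of_real \<epsilon> *s y) / of_real \<epsilon> ^ 2 - L x y) < e" if "0 < e" "0 < B" for e B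
      unfolding \<rho>2[symmetric] by (rule \<rho>.leading_limit_uniform[OF _ that]) (rule \<rho>0)
    have Kh: "K y x = cnj (K x y)" for x y
    proof (rule tendsto_unique[OF _ Klim])
      have "((\<lambda>\<epsilon>. cnj (k (of_real \<epsilon> *s x) (of_real \<epsilon> *s y) / of_real \<epsilon> ^ m)) \<longlongrightarrow> cnj (K x y)) (at_right 0)"
        by (intro tendsto_cnj Klim)
      moreover have "(\<lambda>\<epsilon>. cnj (k (of_real \<epsilon> *s x) (of_real \<epsilon> *s y) / of_real \<epsilon> ^ m))
          = (\<lambda>\<epsilon>. k (of_real \<epsilon> *s y) (of_real \<epsilon> *s x) / of_real \<epsilon> ^ m)"
        by (simp only: complex_cnj_divide complex_cnj_power complex_cnj_complex_of_real k_herm[symmetric])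
      ultimately show "((\<lambda>\<epsilon>. k (of_real \<epsilon> *s y) (of_real \<epsilon> *s x) / of_real \<epsilon> ^ m) \<longlongrightarrow> cnj (K x y)) (at_right 0)"
        by simp
    qed simp
    have Ks: "sesqui_holomorphic_on UNIV K" unfolding K_def by (rule k.leading_sesqui) (rule z)
    \<comment> \<open>If \<open>y\<close> is in the radical of \<open>L\<close>, hypothesis
      \<open>deg\<close> applies at every scale. Otherwise choose \<open>d\<close> with
      \<open>L d y \<noteq> 0\<close>: were \<open>K x y\<close> nonzero, the rescaled
      \<open>k\<close> and hence, by \<open>van\<close>, the rescaled \<open>\<rho>\<close> would
      have no zero on a disc in direction \<open>d\<close>. But these functions converge to
      \<open>\<zeta> * L d y\<close>, which vanishes at 0 without being constant, against Hurwitz's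
      theorem.\<close>
    have K0: "K x y = 0" if Lxy: "L x y = 0" for x y
    proof (cases "\<forall>d. L d y = 0")
      case True
      obtain \<delta> where \<delta>: "\<delta> > 0" "\<And>\<epsilon>. 0 < \<epsilon> \<Longrightarrow> \<epsilon> < \<delta> \<Longrightarrow>
         complex_of_real \<epsilon> *s x \<in> ball 0 R \<and> complex_of_real \<epsilon> *s y \<in> ball 0 R"
      proof -
        have B: "0 < norm x + norm y + 1" by (simp add: add_nonneg_pos)
        have le: "norm x \<le> norm x + norm y + 1" "norm y \<le> norm x + norm y + 1" by auto
        from Kunif[of 1, OF _ B] obtain \<delta> where "\<delta> > 0" "\<forall>\<epsilon> x' y'. 0 < \<epsilon> \<and> \<epsilon> < \<delta> \<and> norm x' \<le> norm x + norm y + 1 \<and> norm y' \<le> norm x + norm y + 1 \<longrightarrow>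
            complex_of_real \<epsilon> *s x' \<in> ball 0 R \<and> complex_of_real \<epsilon> *s y' \<in> ball 0 R \<and>
            cmod (k (of_real \<epsilon> *s x') (of_real \<epsilon> *s y') / of_real \<epsilon> ^ m - K x' y') < 1" by auto
        then show ?thesis using that le by blast
      qed
      have "\<forall>\<^sub>F \<epsilon> in at_right 0. k (of_real \<epsilon> *s x) (of_real \<epsilon> *s y) / of_real \<epsilon> ^ m = 0"
      proof (rule eventually_at_rightI[of 0 \<delta>])
        fix \<epsilon> assume "\<epsilon> \<in> {0<..<\<delta>}"
        then have b: "complex_of_real \<epsilon> *s x \<in> ball 0 R" "complex_of_real \<epsilon> *s y \<in> ball 0 R" using \<delta>(2) by auto
        have "k (of_real \<epsilon> *s x) (of_real \<epsilon> *s y) = 0"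
          by (rule deg[OF b]) (use True in \<open>simp add: scale_right\<close>)
        then show "k (of_real \<epsilon> *s x) (of_real \<epsilon> *s y) / of_real \<epsilon> ^ m = 0" by simp
      qed (rule \<delta>(1))
      then show ?thesis
        using tendsto_unique[OF _ Klim tendsto_eventually] by simp
    next
      case False
      then obtain d where d: "L d y \<noteq> 0" by blast
      show ?thesis
      proof (rule ccontr)
        assume nz: "K x y \<noteq> 0"
        define c where "c = cmod (K x y) / 2"
        have c: "0 < c" using nz by (simp add: c_def)
        let ?h = "\<lambda>\<zeta>. K (x + \<zeta> *s d) (y + cnj \<zeta> *s 0)"
        have "?h holomorphic_on UNIV" using sesqui_holomorphic_onD[OF Ks, of x d y 0] by (simp add: slice_def)
        then have "isCont ?h 0" by (rule continuous_on_interior[OF holomorphic_on_imp_continuous_on]) simp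
        then obtain \<eta>' where "0 < \<eta>'" "\<forall>\<zeta>. dist \<zeta> 0 < \<eta>' \<longrightarrow> dist (?h \<zeta>) (?h 0) < c"
          unfolding continuous_at_eps_delta using c by blast
        then have \<eta>': "0 < \<eta>'" "\<And>\<zeta>. cmod \<zeta> < \<eta>' \<Longrightarrow> cmod (?h \<zeta> - ?h 0) < c"
          by (simp_all add: dist_norm)
        define \<eta> where "\<eta> = min \<eta>' 1"
        have \<eta>: "0 < \<eta>" "\<eta> \<le> 1" "\<And>\<zeta>. cmod \<zeta> < \<eta> \<Longrightarrow> cmod (K (x + \<zeta> *s d) y - K x y) < c"
          using \<eta>' by (auto simp: \<eta>_def)
        define B where "B = norm x + norm y + norm d + 1"
        have B: "0 < B" by (simp add: B_def add_nonneg_pos)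
        have le: "norm (x + \<zeta> *s d) \<le> B" "norm y \<le> B" if "cmod \<zeta> < \<eta>" for \<zeta>
        proof -
          have "cmod \<zeta> * norm d \<le> 1 * norm d" using that \<eta>(2) by (intro mult_right_mono) auto
          then show "norm (x + \<zeta> *s d) \<le> B"
            using norm_triangle_ineq[of x "\<zeta> *s d"] norm_ge_zero[of y] norm_smult[of \<zeta> d] unfolding B_def by linarith
          show "norm y \<le> B" using norm_ge_zero[of x] norm_ge_zero[of d] by (simp add: B_def)
        qed
        obtain \<delta> where \<delta>: "0 < \<delta>" "\<And>\<epsilon> x y. 0 < \<epsilon> \<Longrightarrow> \<epsilon> < \<delta> \<Longrightarrow> norm x \<le> B \<Longrightarrow> norm y \<le> B \<Longrightarrow>
            complex_of_real \<epsilon> *s x \<in> ball 0 R \<and> complex_of_real \<epsilon> *s y \<in> ball 0 R \<and>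
            cmod (k (of_real \<epsilon> *s x) (of_real \<epsilon> *s y) / of_real \<epsilon> ^ m - K x y) < c"
          using Kunif[OF c B] by auto
        define E where "E n = \<delta> / (real n + 2)" for n
        have E: "0 < E n" "E n < \<delta>" for n using \<delta>(1) by (auto simp: E_def field_simps intro!: add_pos_nonneg)
        have Elim: "E \<longlonglongrightarrow> 0" unfolding E_def by real_asymp
        define f where "f n \<zeta> = \<rho> (of_real (E n) *s (x + \<zeta> *s d)) (of_real (E n) *s y) / of_real (E n) ^ 2" for n \<zeta>
        have fnz: "f n \<zeta> \<noteq> 0" if "\<zeta> \<in> ball 0 \<eta>" for n \<zeta>
        proof
          assume "f n \<zeta> = 0"
          then have r0: "\<rho> (of_real (E n) *s (x + \<zeta> *s d)) (of_real (E n) *s y) = 0" using E(1)[of n] by (simp add: f_def)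
          have z: "cmod \<zeta> < \<eta>" using that by simp
          note dd = \<delta>(2)[OF E le(1)[OF z] le(2)[OF z]]
          have "k (of_real (E n) *s (x + \<zeta> *s d)) (of_real (E n) *s y) = 0"
            using van[OF _ _ r0] dd by blast
          then have "cmod (K (x + \<zeta> *s d) y) < c" using conjunct2[OF conjunct2[OF dd[of n]]] by simp
          then have "cmod (K x y) < c + c" using \<eta>(3)[OF z] norm_triangle_ineq4[of "K (x + \<zeta> *s d) y" "K (x + \<zeta> *s d) y - K x y"] by simp
          then show False by (simp add: c_def)
        qed
        have holf: "f n holomorphic_on ball 0 \<eta>" for n
        proof -
          have sub: "ball 0 \<eta> \<subseteq> slice (ball 0 R) (of_real (E n) *s x) (of_real (E n) *s d) (of_real (E n) *s y) 0"
          proof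
            fix w assume "w \<in> ball (0::complex) \<eta>"
            then have z: "cmod w < \<eta>" by simp
            show "w \<in> slice (ball 0 R) (of_real (E n) *s x) (of_real (E n) *s d) (of_real (E n) *s y) 0"
              using \<delta>(2)[OF E le(1)[OF z] le(2)[OF z], of n]
              by (simp add: slice_def vector_add_ldistrib vec.scale_scale mult.commute)
          qed
          have eq: "f n = (\<lambda>\<zeta>. \<rho> (of_real (E n) *s x + \<zeta> *s (of_real (E n) *s d)) (of_real (E n) *s y + cnj \<zeta> *s 0) / of_real (E n) ^ 2)"
            by (simp add: f_def vector_add_ldistrib vec.scale_scale mult.commute fun_eq_iff)
          show ?thesis unfolding eq
            by (intro holomorphic_on_divide holomorphic_on_subset[OF sesqui_holomorphic_onD[OF \<rho>.sesqui] sub] holomorphic_on_const)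
              (use E(1)[of n] in auto)
        qed
        have ul: "uniform_limit (ball 0 \<eta>) f (\<lambda>\<zeta>. \<zeta> * L d y) sequentially"
        proof (rule uniform_limitI)
          fix e :: real assume "0 < e"
          then obtain \<mu> where \<mu>: "0 < \<mu>" "\<And>\<epsilon> x y. 0 < \<epsilon> \<Longrightarrow> \<epsilon> < \<mu> \<Longrightarrow> norm x \<le> B \<Longrightarrow> norm y \<le> B \<Longrightarrow>
             cmod (\<rho> (of_real \<epsilon> *s x) (of_real \<epsilon> *s y) / of_real \<epsilon> ^ 2 - L x y) < e"
            using \<rho>unif[OF _ B, of e] by auto
          have "\<forall>\<^sub>F n in sequentially. E n < \<mu>" using order_tendstoD(2)[OF Elim \<mu>(1)] .
          then show "\<forall>\<^sub>F n in sequentially. \<forall>w\<in>ball 0 \<eta>. dist (f n w) (w * L d y) < e"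
          proof eventually_elim
            case (elim n)
            show ?case
            proof
              fix w assume "w \<in> ball (0::complex) \<eta>"
              then have z: "cmod w < \<eta>" by simp
              have "L (x + w *s d) y = w * L d y" using Lxy by (simp add: add_left scale_left)
              then show "dist (f n w) (w * L d y) < e"
                using \<mu>(2)[OF E(1) elim le(1)[OF z] le(2)[OF z]] by (simp add: f_def dist_norm)
            qed
          qed
        qed
        have nconst: "\<not> (\<lambda>\<zeta>. \<zeta> * L d y) constant_on ball 0 \<eta>"
          proof
            assume "(\<lambda>\<zeta>. \<zeta> * L d y) constant_on ball 0 \<eta>"
            then obtain c where c: "\<And>\<zeta>. \<zeta> \<in> ball 0 \<eta> \<Longrightarrow> \<zeta> * L d y = c" unfolding constant_on_def by blast
            have "complex_of_real (\<eta>/2) * L d y = 0 * L d y" using c[of 0] c[of "complex_of_real (\<eta>/2)"] \<eta>(1) by simp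
            then show False using d \<eta>(1) by simp
        qed
        have holg: "(\<lambda>\<zeta>. \<zeta> * L d y) holomorphic_on ball 0 \<eta>" by (intro holomorphic_intros)
        have "0 \<in> ball (0::complex) \<eta>" using \<eta>(1) by simp
        from Hurwitz_no_zeros[OF open_ball connected_ball holf holg uniform_limit_on_subset[OF ul] nconst fnz this]
        show False by simp
      qed
    qed
    interpret kernel L K by unfold_locales (rule Ks, rule Kh, rule K0)
    have "K x y = 0"
    proof (rule kernel_zero[OF P N])
      fix s t assume st: "\<forall>a<Suc q. \<forall>b<Suc q. K (s a) (s b) = 0 \<and> K (t a) (t b) = 0 \<and> (a \<noteq> b \<longrightarrow> K (s a) (t b) = 0)"
      show "\<exists>a<Suc q. K (s a) (t a) = 0"
      proof (rule ccontr)
        assume "\<not> (\<exists>a<Suc q. K (s a) (t a) = 0)"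
        then have nz: "K (s a) (t a) \<noteq> 0" if "a < Suc q" for a using that by blast
        \<comment> \<open>A unimodular factor that turns \<open>K (s a) (t a)\<close> into its
          modulus. Then \<open>G K\<close> below is the Gram matrix of the formal vectors
          \<open>s a + \<beta> a t a\<close>: the diagonal is
          \<open>2 * cmod (K (s a) (t a))\<close> and all other entries vanish.\<close>
        define \<beta> where "\<beta> a = sgn (K (s a) (t a))" for a
        define D where "D a = 2 * cmod (K (s a) (t a))" for a
        have cb: "cnj (\<beta> a) * K (s a) (t a) = of_real (cmod (K (s a) (t a)))" for a
        proof -
          have "cnj (K (s a) (t a)) * K (s a) (t a) = of_real ((cmod (K (s a) (t a)))\<^sup>2)"
            using complex_norm_square[of "K (s a) (t a)"] by (simp add: mult.commute)
          then show ?thesis by (simp add: \<beta>_def sgn_eq power2_eq_square)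
        qed
        define m0 where "m0 = Min (D ` {..<Suc q})"
        have m0: "0 < m0" "\<And>a. a < Suc q \<Longrightarrow> m0 \<le> D a"
          unfolding m0_def using nz by (subst Min_gr_iff, auto simp: D_def intro!: Min_le)
        \<comment> \<open>A tolerance for which \<open>Suc q * \<eta>\<close> is half the smallest
          diagonal entry.\<close>
        define \<eta> where "\<eta> = m0 / (2 * real (Suc q))"
        have "real (Suc q) * \<eta> = m0 / 2" by (simp add: \<eta>_def del: of_nat_Suc)
        then have \<eta>: "0 < \<eta>" "\<And>a. a < Suc q \<Longrightarrow> real (Suc q) * \<eta> < D a"
          using m0(1) less_le_trans[of "m0 / 2" m0, OF _ m0(2)] by (simp_all only:) (simp_all add: \<eta>_def)
        define G where "G \<kappa> a b = \<kappa> (s a) (s b) + cnj (\<beta> b) * \<kappa> (s a) (t b) + \<beta> a * \<kappa> (t a) (s b) + \<beta> a * cnj (\<beta> b) * \<kappa> (t a) (t b)"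
          for \<kappa> :: "complex^'m \<Rightarrow> complex^'m \<Rightarrow> complex" and a b
        define k' where "k' \<epsilon> x y = k (of_real \<epsilon> *s x) (of_real \<epsilon> *s y) / of_real \<epsilon> ^ m" for \<epsilon> :: real and x y
        have GK: "G K a b = (if a = b then of_real (D a) else 0)" if "a < Suc q" "b < Suc q" for a b
        proof -
          have ts: "K (t a) (s b) = cnj (K (s b) (t a))" by (rule Kh)
          have s0: "K (s a) (s b) = 0" "K (t a) (t b) = 0" using st that by auto
          show ?thesis
          proof (cases "a = b")
            case True
            have "\<beta> a * K (t a) (s a) = cnj (cnj (\<beta> a) * K (s a) (t a))"
              using ts True by simp
            then have "\<beta> a * K (t a) (s a) = of_real (cmod (K (s a) (t a)))" unfolding cb by simp
            then show ?thesis using True s0 cb[of a] by (simp add: G_def D_def)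
          next
            case False
            have "K (s a) (t b) = 0" "K (s b) (t a) = 0" using st that False by auto
            then show ?thesis using False s0 ts by (simp add: G_def)
          qed
        qed
        have "((\<lambda>\<epsilon>. G (k' \<epsilon>) a b) \<longlongrightarrow> G K a b) (at_right 0)" for a b
          unfolding G_def k'_def by (intro tendsto_intros Klim)
        then have "\<forall>\<^sub>F \<epsilon> in at_right 0. cmod (G (k' \<epsilon>) a b - G K a b) < \<eta>" for a b
          using \<eta>(1) by (simp add: tendsto_iff dist_norm)
        then have ev1: "\<forall>\<^sub>F \<epsilon> in at_right 0. \<forall>a\<in>{..<Suc q}. \<forall>b\<in>{..<Suc q}. cmod (G (k' \<epsilon>) a b - G K a b) < \<eta>"
          by (intro eventually_ball_finite ballI) auto
        define B where "B = (\<Sum>a<Suc q. norm (s a) + norm (t a)) + 1"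
        have B: "0 < B" unfolding B_def by (intro add_nonneg_pos sum_nonneg) auto
        have Ble: "norm (s a) \<le> B" "norm (t a) \<le> B" if "a < Suc q" for a
        proof -
          have "norm (s a) + norm (t a) \<le> (\<Sum>a<Suc q. norm (s a) + norm (t a))"
            using that by (intro member_le_sum) auto
          then show "norm (s a) \<le> B" "norm (t a) \<le> B"
            unfolding B_def using norm_ge_zero[of "s a"] norm_ge_zero[of "t a"] by linarith+
        qed
        obtain \<delta> where \<delta>: "0 < \<delta>" "\<And>\<epsilon> (x::complex^'m) (y::complex^'m). 0 < \<epsilon> \<Longrightarrow> \<epsilon> < \<delta> \<Longrightarrow> norm x \<le> B \<Longrightarrow> norm y \<le> B \<Longrightarrow>
            complex_of_real \<epsilon> *s x \<in> ball 0 R \<and> complex_of_real \<epsilon> *s y \<in> ball 0 R"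
          using Kunif[of 1, OF _ B] by auto
        have ev2: "\<forall>\<^sub>F \<epsilon> in at_right 0. \<epsilon> \<in> {0<..<\<delta>}" by (rule eventually_at_rightI[OF _ \<delta>(1)])
        obtain \<epsilon> where \<epsilon>: "0 < \<epsilon>" "\<epsilon> < \<delta>" and near: "\<And>a b. a < Suc q \<Longrightarrow> b < Suc q \<Longrightarrow> cmod (G (k' \<epsilon>) a b - G K a b) < \<eta>"
          using eventually_happens'[OF _ eventually_conj[OF ev1 ev2]] by auto
        let ?s = "\<lambda>a. complex_of_real \<epsilon> *s s a" and ?t = "\<lambda>a. complex_of_real \<epsilon> *s t a"
        have "\<forall>a<Suc q. ?s a \<in> ball 0 R \<and> ?t a \<in> ball 0 R"
          using \<delta>(2)[OF \<epsilon> Ble(1) Ble(2)] by blast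
        from npos[OF this, of \<beta>] obtain d where d: "\<exists>a<Suc q. d a \<noteq> 0" and
          le: "Re (\<Sum>a<Suc q. \<Sum>b<Suc q. d a * cnj (d b) *
        (k (?s a) (?s b) + cnj (\<beta> b) * k (?s a) (?t b) + \<beta> a * k (?t a) (?s b) + \<beta> a * cnj (\<beta> b) * k (?t a) (?t b))) \<le> 0"
          by blast
        \<comment> \<open>At a sufficiently small scale the Gram matrix of \<open>k\<close> itself
          is close enough to the positive diagonal one, contradicting \<open>npos\<close>; dividing
          by the positive number \<open>\<epsilon> ^ m\<close> does not affect the sign.\<close>
        have pos: "Re (\<Sum>a<Suc q. \<Sum>b<Suc q. d a * cnj (d b) * G (k' \<epsilon>) a b) > 0"
          by (rule positive_of_near_diagonal[OF _ \<eta>(2,1) d]) (use near GK in auto)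
        have "(\<Sum>a<Suc q. \<Sum>b<Suc q. d a * cnj (d b) * G (k' \<epsilon>) a b) =
          (\<Sum>a<Suc q. \<Sum>b<Suc q. d a * cnj (d b) *
        (k (?s a) (?s b) + cnj (\<beta> b) * k (?s a) (?t b) + \<beta> a * k (?t a) (?s b) + \<beta> a * cnj (\<beta> b) * k (?t a) (?t b))) / of_real (\<epsilon> ^ m)"
          unfolding G_def k'_def sum_divide_distrib by (intro sum.cong refl) (simp add: distrib_left add_divide_distrib)
        then have "Re (\<Sum>a<Suc q. \<Sum>b<Suc q. d a * cnj (d b) * G (k' \<epsilon>) a b) \<le> 0"
          using le \<epsilon>(1) by (simp only: Re_divide_of_real) (simp add: divide_nonpos_pos)
        then show False using pos by simp
      qed
    qed
    then show ?case by (simp add: K_def)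
  qed
  then show ?thesis using k.zero_if_leading_zero xy by blast
qed

section \<open>Holomorphic maps of several variables\<close>

definition fd :: "('a::real_normed_vector \<Rightarrow> 'b::real_normed_vector) \<Rightarrow> 'a \<Rightarrow> 'a \<Rightarrow> 'b" where
  "fd F x v = frechet_derivative F (at x) v"

lemma fd_eq: "(F has_derivative D) (at x) \<Longrightarrow> fd F x = D"
  unfolding fd_def using frechet_derivative_at by metis

lemma holomorphic_mapD:
  assumes "holomorphic_map_on V F" "x \<in> V"
  shows holomorphic_map_has_derivative: "(F has_derivative fd F x) (at x)"
    and fd_add: "fd F x (u + v) = fd F x u + fd F x v"
    and fd_scale: "fd F x (a *s v) = a *s fd F x v"
    and fd_zero: "fd F x 0 = 0"
    and fd_diff: "fd F x (u - v) = fd F x u - fd F x v"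
proof -
  obtain D where D: "(F has_derivative D) (at x)" "Vector_Spaces.linear (*s) (*s) D"
    using assms unfolding holomorphic_map_on_def by blast
  interpret D: Vector_Spaces.linear "(*s)" "(*s)" D by (rule D(2))
  show "(F has_derivative fd F x) (at x)" using D(1) fd_eq by metis
  show "fd F x (u + v) = fd F x u + fd F x v" "fd F x (a *s v) = a *s fd F x v" "fd F x 0 = 0"
    "fd F x (u - v) = fd F x u - fd F x v"
    using fd_eq[OF D(1)] D.add D.scale D.zero D.diff by auto
qed

lemma holomorphic_map_onI:
  assumes "\<And>x. x \<in> V \<Longrightarrow> (F has_derivative D x) (at x)" "\<And>x a v. x \<in> V \<Longrightarrow> D x (a *s v) = a *s D x v"
  shows "holomorphic_map_on V F"
  unfolding holomorphic_map_on_def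
proof
  fix x assume x: "x \<in> V"
  have "linear (D x)" using assms(1)[OF x] by (rule has_derivative_linear)
  then have "Vector_Spaces.linear (*s) (*s) (D x)"
    unfolding Vector_Spaces.linear_iff using assms(2)[OF x] by (simp add: vec.vector_space_axioms linear_add)
  then show "\<exists>D. (F has_derivative D) (at x) \<and> Vector_Spaces.linear (*s) (*s) D"
    using assms(1)[OF x] by blast
qed

lemma holomorphic_map_on_subset: "holomorphic_map_on V F \<Longrightarrow> W \<subseteq> V \<Longrightarrow> holomorphic_map_on W F"
  unfolding holomorphic_map_on_def by blast

lemma holomorphic_map_continuous: "holomorphic_map_on V F \<Longrightarrow> continuous_on V F"
  by (meson continuous_at_imp_continuous_on has_derivative_continuous holomorphic_map_has_derivative)

lemma holomorphic_map_line:
  assumes F: "holomorphic_map_on V F" and x: "x + \<zeta> *s v \<in> V"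
  shows "((\<lambda>\<zeta>. F (x + \<zeta> *s v) $ i) has_field_derivative fd F (x + \<zeta> *s v) v $ i) (at \<zeta>)"
proof -
  have 1: "((\<lambda>\<zeta>. x + \<zeta> *s v) has_derivative (\<lambda>h. h *s v)) (at \<zeta>)"
    by (rule derivative_eq_intros bounded_linear.has_derivative[OF bounded_linear_smult] has_derivative_ident | simp)+
  have "((\<lambda>\<zeta>. F (x + \<zeta> *s v)) has_derivative (\<lambda>h. fd F (x + \<zeta> *s v) (h *s v))) (at \<zeta>)"
    by (rule has_derivative_compose[OF 1 holomorphic_map_has_derivative[OF F x]])
  then have "((\<lambda>\<zeta>. F (x + \<zeta> *s v) $ i) has_derivative (\<lambda>h. fd F (x + \<zeta> *s v) (h *s v) $ i)) (at \<zeta>)"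
    by (rule bounded_linear.has_derivative[OF bounded_linear_vec_nth])
  then show ?thesis
    by (simp add: has_field_derivative_def fd_scale[OF F x] mult.commute[of _ "fd F (x + \<zeta> *s v) v $ i"])
qed

lemma holomorphic_map_line_on:
  assumes F: "holomorphic_map_on V F" and "\<And>\<zeta>. \<zeta> \<in> S \<Longrightarrow> x + \<zeta> *s v \<in> V"
  shows "(\<lambda>\<zeta>. F (x + \<zeta> *s v) $ i) holomorphic_on S"
  unfolding holomorphic_on_def field_differentiable_def
  using holomorphic_map_line[OF F] assms(2) by (blast intro: has_field_derivative_at_within)

text \<open>Holomorphy means complex differentiability at each point, so continuity of the
  derivative needs proof: Cauchy's inequality, applied on a circle in direction \<open>v\<close> to
  the difference of the restrictions through \<open>x\<close> and \<open>x0\<close>, bounds the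
  difference of derivatives by the uniformly small difference of values.\<close>

lemma continuous_on_fd:
  assumes V: "open V" and F: "holomorphic_map_on V F"
  shows "continuous_on V (\<lambda>x. fd F x v)"
proof -
  have "continuous_on V (\<lambda>x. fd F x v $ i)" for i
  proof (rule continuous_at_imp_continuous_on, rule ballI)
    fix x0 assume x0: "x0 \<in> V"
    obtain \<rho> where \<rho>: "0 < \<rho>" "cball x0 (2 * \<rho>) \<subseteq> V"
    proof -
      obtain e where "e > 0" "cball x0 e \<subseteq> V" using V x0 open_contains_cball by blast
      then show ?thesis using that[of "e/2"] by simp
    qed
    define r where "r = \<rho> / (norm v + 1)"
    have r: "0 < r" using \<rho> by (simp add: r_def add_nonneg_pos)
    have rv: "r * norm v \<le> \<rho>" using \<rho> by (simp add: r_def divide_le_eq mult_left_mono add_nonneg_pos)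
    have inb: "x + \<zeta> *s v \<in> cball x0 (2 * \<rho>)" if "cmod \<zeta> \<le> r" "x \<in> cball x0 \<rho>" for x \<zeta>
    proof -
      have "norm (\<zeta> *s v) \<le> \<rho>" using mult_right_mono[OF that(1), of "norm v"] rv by (simp add: norm_smult)
      moreover have "norm (x - x0) \<le> \<rho>" using that(2) by (simp add: dist_norm norm_minus_commute)
      ultimately have "norm (x + \<zeta> *s v - x0) \<le> 2 * \<rho>"
        using norm_triangle_ineq[of "x - x0" "\<zeta> *s v"] by (simp add: algebra_simps)
      then show ?thesis by (simp add: dist_norm norm_minus_commute)
    qed
    have uc: "uniformly_continuous_on (cball x0 (2 * \<rho>)) F"
      using holomorphic_map_continuous[OF F] \<rho>(2) by (intro compact_uniformly_continuous compact_cball) (rule continuous_on_subset)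
    show "isCont (\<lambda>x. fd F x v $ i) x0"
      unfolding continuous_at_eps_delta
    proof (intro allI impI)
      fix e :: real assume e: "0 < e"
      obtain \<delta> where \<delta>: "0 < \<delta>" "\<And>x y. x \<in> cball x0 (2*\<rho>) \<Longrightarrow> y \<in> cball x0 (2*\<rho>) \<Longrightarrow> dist x y < \<delta> \<Longrightarrow> dist (F x) (F y) < e * r / 2"
        using uc e r unfolding uniformly_continuous_on_def by (metis dist_commute half_gt_zero mult_pos_pos)
      have "dist (fd F x v $ i) (fd F x0 v $ i) < e" if x: "dist x x0 < min \<delta> \<rho>" for x
      proof -
        have xb: "x \<in> cball x0 \<rho>" "x0 \<in> cball x0 \<rho>" using x \<rho> by (auto simp: dist_commute)
        let ?g = "\<lambda>\<zeta>. F (x + \<zeta> *s v) $ i - F (x0 + \<zeta> *s v) $ i"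
        have hol: "?g holomorphic_on cball 0 r"
          by (intro holomorphic_on_diff holomorphic_map_line_on[OF F]) (use inb xb \<rho>(2) in auto)
        have V0: "x + 0 *s v \<in> V" "x0 + 0 *s v \<in> V" using inb[of 0 x] inb[of 0 x0] xb r \<rho>(2) by auto
        have dg: "(?g has_field_derivative (fd F x v $ i - fd F x0 v $ i)) (at 0)"
          using DERIV_diff[OF holomorphic_map_line[OF F V0(1), of i] holomorphic_map_line[OF F V0(2), of i]] by simp
        have "cmod ((deriv ^^ 1) ?g 0) \<le> fact 1 * (e * r / 2) / r ^ 1"
        proof (rule Cauchy_inequality)
          show "?g holomorphic_on ball 0 r" using hol by (rule holomorphic_on_subset) auto
          show "continuous_on (cball 0 r) ?g" using hol by (rule holomorphic_on_imp_continuous_on)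
          fix \<zeta> :: complex assume "cmod (0 - \<zeta>) = r"
          then have \<zeta>: "cmod \<zeta> \<le> r" by simp
          have "dist (F (x + \<zeta> *s v)) (F (x0 + \<zeta> *s v)) < e * r / 2"
            by (rule \<delta>(2)[OF inb[OF \<zeta> xb(1)] inb[OF \<zeta> xb(2)]]) (use x in \<open>simp add: dist_norm\<close>)
          then show "cmod (?g \<zeta>) \<le> e * r / 2"
            using Finite_Cartesian_Product.norm_nth_le[of "F (x + \<zeta> *s v) - F (x0 + \<zeta> *s v)" i] by (simp add: dist_norm)
        qed (use r in auto)
        also have "\<dots> < e" using r e by simp
        finally show ?thesis using DERIV_imp_deriv[OF dg] by (simp add: dist_norm)
      qed
      then show "\<exists>d>0. \<forall>x'. dist x' x0 < d \<longrightarrow> dist (fd F x' v $ i) (fd F x0 v $ i) < e"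
        using \<delta>(1) \<rho>(1) by (intro exI[of _ "min \<delta> \<rho>"]) auto
    qed
  qed
  then have "continuous_on V (\<lambda>x. \<chi> i. fd F x v $ i)" by (intro continuous_on_vec_lambda)
  then show ?thesis by (simp only: vec_lambda_eta)
qed

lemma continuous_on_scale:
  fixes g :: "'x::topological_space \<Rightarrow> complex^'k"
  assumes "continuous_on S f" "continuous_on S g"
  shows "continuous_on S (\<lambda>x. f x *s g x)"
proof -
  have "(\<lambda>x. f x *s g x) = (\<lambda>x. \<chi> i. f x * g x $ i)" by (simp add: fun_eq_iff cart_eq_iff)
  moreover have "continuous_on S (\<lambda>x. \<chi> i. f x * g x $ i)" by (intro continuous_intros assms)
  ultimately show ?thesis by (simp only:)
qed

section \<open>Cauchy's formula for directional derivatives and symmetry of second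
  derivatives\<close>

definition circ :: "real \<Rightarrow> real \<Rightarrow> complex" where
  "circ r \<theta> = of_real r * exp (2 * of_real pi * \<i> * of_real \<theta>)"

lemma norm_circ [simp]: "0 < r \<Longrightarrow> cmod (circ r \<theta>) = r"
proof -
  have "2 * of_real pi * \<i> * of_real \<theta> = \<i> * of_real (2 * pi * \<theta>)" by simp
  then show "0 < r \<Longrightarrow> cmod (circ r \<theta>) = r" unfolding circ_def by (simp only: norm_mult norm_exp_i_times) simp
qed

lemma circ_nonzero [simp]: "0 < r \<Longrightarrow> circ r \<theta> \<noteq> 0"
  using norm_circ[of r \<theta>] by fastforce

lemma continuous_on_circ [continuous_intros]: "continuous_on S f \<Longrightarrow> continuous_on S (\<lambda>x. circ r (f x))"
  unfolding circ_def by (intro continuous_intros)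

text \<open>Cauchy's formula on the circle in direction \<open>v\<close>, as a vector valued
  integral over a fixed interval; in this form the base point can be differentiated under the
  integral sign.\<close>

lemma fd_integral:
  assumes F: "holomorphic_map_on V F" and V: "open V" and r: "0 < r" and x: "\<And>\<zeta>. cmod \<zeta> \<le> r \<Longrightarrow> x + \<zeta> *s v \<in> V"
  shows "fd F x v = integral {0..1} (\<lambda>\<theta>. (1 / circ r \<theta>) *s F (x + circ r \<theta> *s v))"
    and "(\<lambda>\<theta>. (1 / circ r \<theta>) *s F (x + circ r \<theta> *s v)) integrable_on {0..1}"
proof -
  let ?f = "\<lambda>\<theta>. (1 / circ r \<theta>) *s F (x + circ r \<theta> *s v)"
  have cont: "continuous_on {0..1} ?f"
  proof -
    have "continuous_on {0..1} (\<lambda>\<theta>. F (x + circ r \<theta> *s v))"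
      by (rule continuous_on_compose2[OF holomorphic_map_continuous[OF F]]) (use x r in \<open>auto intro!: continuous_intros\<close>)
    then show ?thesis using r by (intro continuous_on_scale continuous_intros) auto
  qed
  then show int: "?f integrable_on {0..1}" by (rule integrable_continuous_real)
  have "fd F x v $ i = integral {0..1} ?f $ i" for i
  proof -
    let ?g = "\<lambda>\<zeta>. F (x + \<zeta> *s v) $ i"
    have hol: "?g holomorphic_on cball 0 r" by (intro holomorphic_map_line_on[OF F]) (use x in auto)
    have V0: "x + 0 *s v \<in> V" using x[of 0] r by simp
    have dg: "deriv ?g 0 = fd F x v $ i" using DERIV_imp_deriv[OF holomorphic_map_line[OF F V0]] by simp
    have "2 * pi * \<i> / fact 1 * (deriv ^^ 1) ?g 0 = 2 * pi * \<i> * fd F x v $ i" by (simp add: dg)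
    moreover have "((\<lambda>u. ?g u / (u - 0) ^ Suc 1) has_contour_integral (2 * pi * \<i> / fact 1 * (deriv ^^ 1) ?g 0)) (circlepath 0 r)"
      by (rule Cauchy_has_contour_integral_higher_derivative_circlepath)
        (use hol r in \<open>auto intro: holomorphic_on_imp_continuous_on holomorphic_on_subset\<close>)
    ultimately have "((\<lambda>\<theta>. ?g (circ r \<theta>) / (circ r \<theta>)\<^sup>2 * (2 * pi * \<i> * circ r \<theta>)) has_integral (2 * pi * \<i> * fd F x v $ i)) {0..1}"
    proof -
      assume eq: "2 * pi * \<i> / fact 1 * (deriv ^^ 1) ?g 0 = 2 * pi * \<i> * fd F x v $ i"
        and ci: "((\<lambda>u. ?g u / (u - 0) ^ Suc 1) has_contour_integral (2 * pi * \<i> / fact 1 * (deriv ^^ 1) ?g 0)) (circlepath 0 r)"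
      have cp: "circlepath 0 r \<theta> = circ r \<theta>" for \<theta> by (simp add: circlepath circ_def)
      have vd: "vector_derivative (circlepath 0 r) (at \<theta> within {0..1}) = 2 * pi * \<i> * circ r \<theta>" if "\<theta> \<in> {0..1}" for \<theta>
        using that by (simp add: vector_derivative_circlepath01 circ_def)
      have "((\<lambda>\<theta>. ?g (circ r \<theta>) / (circ r \<theta> - 0) ^ Suc 1 * vector_derivative (circlepath 0 r) (at \<theta> within {0..1})) has_integral (2 * pi * \<i> * fd F x v $ i)) {0..1}"
        using ci unfolding has_contour_integral_def cp eq .
      then show ?thesis
        by (rule has_integral_eq[rotated]) (simp only: vd diff_zero power2_eq_square power_Suc power_0 One_nat_def mult_1_right)
    qed
    then have "((\<lambda>\<theta>. 1 / (2 * pi * \<i>) * (?g (circ r \<theta>) / (circ r \<theta>)\<^sup>2 * (2 * pi * \<i> * circ r \<theta>))) has_integral (1 / (2 * pi * \<i>) * (2 * pi * \<i> * fd F x v $ i))) {0..1}"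
      by (rule has_integral_mult_right)
    moreover have "1 / (2 * pi * \<i>) * (?g (circ r \<theta>) / (circ r \<theta>)\<^sup>2 * (2 * pi * \<i> * circ r \<theta>)) = ?f \<theta> $ i" for \<theta>
      using circ_nonzero[OF r, of \<theta>] by (simp add: power2_eq_square field_simps)
    ultimately have "((\<lambda>\<theta>. ?f \<theta> $ i) has_integral fd F x v $ i) {0..1}" by simp
    moreover have "((\<lambda>\<theta>. ?f \<theta> $ i) has_integral (integral {0..1} ?f $ i)) {0..1}"
      using has_integral_linear[OF integrable_integral[OF int] bounded_linear_vec_nth] by (simp add: o_def)
    ultimately show ?thesis by (rule has_integral_unique)
  qed
  then show "fd F x v = integral {0..1} ?f" by (simp add: cart_eq_iff)
qed

text \<open>Differentiation under the integral in Cauchy's formula. The integral representation is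
  kept in the conclusion because it is what makes the second derivative symmetric.\<close>

lemma fd_differentiable:
  fixes F :: "complex^'m \<Rightarrow> complex^'k"
  assumes F: "holomorphic_map_on V F" and V: "open V" and x0: "x0 \<in> V"
  shows "\<exists>D. ((\<lambda>x. fd F x v) has_derivative D) (at x0) \<and>
      (\<forall>a u. D (a *s u) = a *s D u) \<and>
      (\<exists>\<rho>>0. \<forall>r. 0 < r \<and> r \<le> \<rho> \<longrightarrow> (\<forall>\<zeta>. cmod \<zeta> \<le> r \<longrightarrow> x0 + \<zeta> *s v \<in> V) \<and>
         (\<forall>u. D u = integral {0..1} (\<lambda>\<theta>. (1 / circ r \<theta>) *s fd F (x0 + circ r \<theta> *s v) u)))"
proof -
    obtain \<rho> where \<rho>: "0 < \<rho>" "cball x0 (2 * \<rho>) \<subseteq> V"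
    proof -
      obtain e where "e > 0" "cball x0 e \<subseteq> V" using V x0 open_contains_cball by blast
      then show ?thesis using that[of "e/2"] by simp
    qed
    define \<rho>' where "\<rho>' = \<rho> / (norm v + 1)"
    have \<rho>': "0 < \<rho>'" using \<rho> by (simp add: \<rho>'_def add_nonneg_pos)
    have \<rho>v: "\<rho>' * norm v \<le> \<rho>" using \<rho> by (simp add: \<rho>'_def divide_le_eq mult_left_mono add_nonneg_pos)
    have inV: "x + \<zeta> *s v \<in> V" if "cmod \<zeta> \<le> \<rho>'" "x \<in> ball x0 \<rho>" for x \<zeta>
    proof -
      have "norm (\<zeta> *s v) \<le> \<rho>" using mult_right_mono[OF that(1), of "norm v"] \<rho>v by (simp add: norm_smult)
      moreover have "norm (x - x0) \<le> \<rho>" using that(2) by (simp add: dist_norm norm_minus_commute less_imp_le)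
      ultimately have "norm (x + \<zeta> *s v - x0) \<le> 2 * \<rho>"
        using norm_triangle_ineq[of "x - x0" "\<zeta> *s v"] by (simp add: algebra_simps)
      then show ?thesis using \<rho>(2) by (auto simp: dist_norm norm_minus_commute)
    qed
    have x0b: "x0 \<in> ball x0 \<rho>" using \<rho> by simp
    have der: "((\<lambda>x. fd F x v) has_derivative (\<lambda>u. integral {0..1} (\<lambda>\<theta>. (1 / circ r \<theta>) *s fd F (x0 + circ r \<theta> *s v) u))) (at x0)"
      if r: "0 < r" "r \<le> \<rho>'" for r
    proof -
      have inV': "x + circ r \<theta> *s v \<in> V" if "x \<in> ball x0 \<rho>" for x \<theta> using inV[OF _ that, of "circ r \<theta>"] r by simp
      \<comment> \<open>\<open>leibniz_rule\<close> expects the derivative of the integrand as a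
        continuous family of bounded linear maps.\<close>
      define fx where "fx x \<theta> = Blinfun (\<lambda>u. (1 / circ r \<theta>) *s fd F (x + circ r \<theta> *s v) u)" for x \<theta>
      have bl: "bounded_linear (\<lambda>u. (1 / circ r \<theta>) *s fd F (x + circ r \<theta> *s v) u)" if "x \<in> ball x0 \<rho>" for x \<theta>
        using bounded_linear_compose[OF bounded_linear_smult_right has_derivative_bounded_linear[OF holomorphic_map_has_derivative[OF F inV'[OF that]]]] .
      have fx: "blinfun_apply (fx x \<theta>) u = (1 / circ r \<theta>) *s fd F (x + circ r \<theta> *s v) u" if "x \<in> ball x0 \<rho>" for x \<theta> u
        unfolding fx_def by (subst bounded_linear_Blinfun_apply[OF bl[OF that]]) simp
      have cont0: "continuous_on (ball x0 \<rho> \<times> {0..1}) (\<lambda>(x, \<theta>). (1 / circ r \<theta>) *s fd F (x + circ r \<theta> *s v) u)" for u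
      proof -
        have c1: "continuous_on (ball x0 \<rho> \<times> {0..1}) (\<lambda>p. fd F (fst p + circ r (snd p) *s v) u)"
          by (rule continuous_on_compose2[OF continuous_on_fd[OF V F]]) (use inV' in \<open>auto intro!: continuous_intros\<close>)
        then have "continuous_on (ball x0 \<rho> \<times> {0..1}) (\<lambda>p. (1 / circ r (snd p)) *s fd F (fst p + circ r (snd p) *s v) u)"
          using r by (intro continuous_on_scale continuous_intros) auto
        then show ?thesis by (simp only: case_prod_unfold)
      qed
      have cont: "continuous_on (ball x0 \<rho> \<times> cbox 0 1) (\<lambda>(x, \<theta>). fx x \<theta>)"
      proof (rule continuous_on_blinfun_componentwise)
        fix b :: "complex^'m"
        show "continuous_on (ball x0 \<rho> \<times> cbox 0 1) (\<lambda>p. blinfun_apply (case p of (x, \<theta>) \<Rightarrow> fx x \<theta>) b)"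
          by (rule continuous_on_eq[OF cont0[of b, unfolded cbox_interval[symmetric]]]) (auto simp: fx)
      qed
      have "((\<lambda>x. integral (cbox 0 1) (\<lambda>\<theta>. (1 / circ r \<theta>) *s F (x + circ r \<theta> *s v))) has_derivative integral (cbox 0 1) (fx x0)) (at x0 within ball x0 \<rho>)"
      proof (rule leibniz_rule[OF _ _ cont x0b convex_ball])
        fix x \<theta> assume x: "x \<in> ball x0 \<rho>"
        have "((\<lambda>x. x + circ r \<theta> *s v) has_derivative (\<lambda>h. h)) (at x)" by (rule derivative_eq_intros | simp)+
        from has_derivative_compose[OF this holomorphic_map_has_derivative[OF F inV'[OF x]]]
        have "((\<lambda>x. F (x + circ r \<theta> *s v)) has_derivative (\<lambda>h. fd F (x + circ r \<theta> *s v) h)) (at x)" .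
        then have "((\<lambda>x. (1 / circ r \<theta>) *s F (x + circ r \<theta> *s v)) has_derivative (\<lambda>h. (1 / circ r \<theta>) *s fd F (x + circ r \<theta> *s v) h)) (at x)"
          by (rule bounded_linear.has_derivative[OF bounded_linear_smult_right])
        then show "((\<lambda>x. (1 / circ r \<theta>) *s F (x + circ r \<theta> *s v)) has_derivative blinfun_apply (fx x \<theta>)) (at x within ball x0 \<rho>)"
          using fx[OF x] by (simp add: has_derivative_at_withinI[of _ _ x] ext[where f = "blinfun_apply (fx x \<theta>)"])
        show "(\<lambda>\<theta>. (1 / circ r \<theta>) *s F (x + circ r \<theta> *s v)) integrable_on cbox 0 1"
          unfolding cbox_interval by (rule fd_integral(2)[OF F V r(1)]) (use inV[OF _ x] r in auto)
      qed
      then have "((\<lambda>x. fd F x v) has_derivative integral (cbox 0 1) (fx x0)) (at x0 within ball x0 \<rho>)"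
        by (rule has_derivative_transform[OF x0b, rotated]) (unfold cbox_interval, rule fd_integral(1)[OF F V r(1)], use inV r in auto)
      then have d: "((\<lambda>x. fd F x v) has_derivative integral (cbox 0 1) (fx x0)) (at x0)"
        using at_within_open[OF x0b open_ball] by simp
      have intg: "fx x0 integrable_on {0..1}"
      proof (rule integrable_continuous_real)
        show "continuous_on {0..1} (fx x0)"
        proof -
          have "continuous_on {0..1} (\<lambda>\<theta>. case (x0, \<theta>) of (x, \<theta>) \<Rightarrow> fx x \<theta>)"
            by (rule continuous_on_compose2[OF cont]) (use x0b in \<open>auto intro!: continuous_on_Pair continuous_on_const continuous_on_id\<close>)
          then show ?thesis by simp
        qed
      qed
      have "blinfun_apply (integral (cbox 0 1) (fx x0)) u = integral {0..1} (\<lambda>\<theta>. (1 / circ r \<theta>) *s fd F (x0 + circ r \<theta> *s v) u)" for u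
        unfolding cbox_interval blinfun_apply_integral[OF intg] fx[OF x0b] ..
      then have "blinfun_apply (integral (cbox 0 1) (fx x0)) = (\<lambda>u. integral {0..1} (\<lambda>\<theta>. (1 / circ r \<theta>) *s fd F (x0 + circ r \<theta> *s v) u))" by auto
      with d show ?thesis by simp
    qed
    define D where "D u = integral {0..1} (\<lambda>\<theta>. (1 / circ \<rho>' \<theta>) *s fd F (x0 + circ \<rho>' \<theta> *s v) u)" for u
    have D: "((\<lambda>x. fd F x v) has_derivative D) (at x0)" unfolding D_def[abs_def] by (rule der) (use \<rho>' in auto)
    have in0: "x0 + circ \<rho>' \<theta> *s v \<in> V" for \<theta> using inV[OF _ x0b, of "circ \<rho>' \<theta>"] \<rho>' by simp
    have sc: "D (a *s u) = a *s D u" for a u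
    proof -
      have "(\<lambda>\<theta>. (1 / circ \<rho>' \<theta>) *s fd F (x0 + circ \<rho>' \<theta> *s v) u) integrable_on {0..1}"
      proof (rule integrable_continuous_real)
        have c1: "continuous_on {0..1} (\<lambda>\<theta>. fd F (x0 + circ \<rho>' \<theta> *s v) u)"
          by (rule continuous_on_compose2[OF continuous_on_fd[OF V F]]) (use in0 in \<open>auto intro!: continuous_intros\<close>)
        then show "continuous_on {0..1} (\<lambda>\<theta>. (1 / circ \<rho>' \<theta>) *s fd F (x0 + circ \<rho>' \<theta> *s v) u)"
          using \<rho>' by (intro continuous_on_scale continuous_intros) auto
      qed
      from integral_linear[OF this bounded_linear_smult_right[of a]]
      show ?thesis by (simp add: D_def o_def fd_scale[OF F in0] vec.scale_left_commute mult.commute)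
    qed
    have "D u = integral {0..1} (\<lambda>\<theta>. (1 / circ r \<theta>) *s fd F (x0 + circ r \<theta> *s v) u)" if "0 < r" "r \<le> \<rho>'" for r u
      using has_derivative_unique[OF D der[OF that]] by meson
    moreover have "x0 + \<zeta> *s v \<in> V" if "cmod \<zeta> \<le> r" "r \<le> \<rho>'" for \<zeta> r
      by (rule inV[OF _ x0b]) (use that in linarith)
    ultimately show ?thesis using D sc \<rho>' by blast
qed

lemma holomorphic_fd:
  fixes F :: "complex^'m \<Rightarrow> complex^'k"
  assumes F: "holomorphic_map_on V F" and V: "open V"
  shows "holomorphic_map_on V (\<lambda>x. fd F x v)"
proof (rule holomorphic_map_onI)
  fix x0 assume "x0 \<in> V"
  then obtain D where D: "((\<lambda>x. fd F x v) has_derivative D) (at x0)" "\<And>a u. D (a *s u) = a *s D u"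
    using fd_differentiable[OF F V] by blast
  then show "((\<lambda>x. fd F x v) has_derivative fd (\<lambda>x. fd F x v) x0) (at x0)"
    and "fd (\<lambda>x. fd F x v) x0 (a *s u) = a *s fd (\<lambda>x. fd F x v) x0 u" for a u
    using fd_eq[OF D(1)] by simp_all
qed

text \<open>The derivative in direction \<open>u\<close> of \<open>fd F x v\<close> is an integral
  of \<open>fd F\<close> in direction \<open>u\<close> over a circle in direction \<open>v\<close>,
  and that integral is Cauchy's formula for the derivative of \<open>fd F x u\<close> in direction
  \<open>v\<close>.\<close>

lemma fd_commute:
  fixes F :: "complex^'m \<Rightarrow> complex^'k"
  assumes F: "holomorphic_map_on V F" and V: "open V" and x0: "x0 \<in> V"
  shows "fd (\<lambda>x. fd F x v) x0 u = fd (\<lambda>x. fd F x u) x0 v"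
proof -
  obtain D \<rho> where D: "((\<lambda>x. fd F x v) has_derivative D) (at x0)" and \<rho>: "0 < \<rho>" "\<And>\<zeta>. cmod \<zeta> \<le> \<rho> \<Longrightarrow> x0 + \<zeta> *s v \<in> V"
    and Du: "\<And>u. D u = integral {0..1} (\<lambda>\<theta>. (1 / circ \<rho> \<theta>) *s fd F (x0 + circ \<rho> \<theta> *s v) u)"
    using fd_differentiable[OF F V x0, of v] by blast
  show ?thesis
    unfolding fd_eq[OF D] Du by (rule fd_integral(1)[OF holomorphic_fd[OF F V] V \<rho>, symmetric])
qed

section \<open>Segre varieties\<close>

lemma scaleR_eq_smult: "r *\<^sub>R (x :: complex^'m) = of_real r *s x"
  by (simp add: cart_eq_iff scaleR_conv_of_real[where 'a = complex])

lemma bounded_bilinear_hf: "bounded_bilinear (hf s)"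
proof -
  have "linear (hf s x)" for x
    by (rule linearI) (auto simp: hf.add_right scaleR_eq_smult hf.scale_right scaleR_conv_of_real)
  moreover have "linear (\<lambda>x. hf s x y)" for y
    by (rule linearI) (auto simp: hf.add_left scaleR_eq_smult hf.scale_left scaleR_conv_of_real)
  ultimately show ?thesis unfolding bilinear_conv_bounded_bilinear[symmetric] bilinear_def by blast
qed

lemmas has_derivative_hf = bounded_bilinear.FDERIV[OF bounded_bilinear_hf]
lemmas continuous_on_hf [continuous_intros] = bounded_bilinear.continuous_on[OF bounded_bilinear_hf]
lemmas tendsto_hf [tendsto_intros] = bounded_bilinear.tendsto[OF bounded_bilinear_hf]

text \<open>An antiholomorphic second entry is conjugated once more by the form, so the total
  derivative is complex linear in \<open>h\<close>.\<close>

lemma hf_field_derivative: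
  assumes f: "(f has_derivative f') (at \<zeta>)" "\<And>h. f' h = h *s f' 1"
    and g: "(g has_derivative g') (at \<zeta>)" "\<And>h. g' h = cnj h *s g' 1"
  shows "(\<lambda>\<zeta>. hf s (f \<zeta>) (g \<zeta>)) field_differentiable (at \<zeta>)"
proof -
  have "((\<lambda>\<zeta>. hf s (f \<zeta>) (g \<zeta>)) has_derivative (\<lambda>h. hf s (f \<zeta>) (g' h) + hf s (f' h) (g \<zeta>))) (at \<zeta>)"
    by (rule has_derivative_hf[OF f(1) g(1)])
  moreover have "(\<lambda>h. hf s (f \<zeta>) (g' h) + hf s (f' h) (g \<zeta>)) = (*) (hf s (f \<zeta>) (g' 1) + hf s (f' 1) (g \<zeta>))"
  proof
    show "hf s (f \<zeta>) (g' h) + hf s (f' h) (g \<zeta>) = (hf s (f \<zeta>) (g' 1) + hf s (f' 1) (g \<zeta>)) * h" for h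
      by (simp only: f(2)[of h] g(2)[of h] hf.scale_left hf.scale_right complex_cnj_cnj) (simp add: distrib_left mult.commute)
  qed
  ultimately have "((\<lambda>\<zeta>. hf s (f \<zeta>) (g \<zeta>)) has_field_derivative (hf s (f \<zeta>) (g' 1) + hf s (f' 1) (g \<zeta>))) (at \<zeta>)"
    unfolding has_field_derivative_def by (simp only:)
  then show ?thesis unfolding field_differentiable_def by (rule exI)
qed

lemma has_derivative_affine_line:
  "((\<lambda>\<zeta>. x + \<zeta> *s d) has_derivative (\<lambda>h. h *s d)) (at (\<zeta>::complex))"
  "((\<lambda>\<zeta>. x + cnj \<zeta> *s d) has_derivative (\<lambda>h. cnj h *s d)) (at \<zeta>)"
  by (rule derivative_eq_intros bounded_linear.has_derivative[OF bounded_linear_smult] has_derivative_ident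
      bounded_linear.has_derivative[OF bounded_linear_cnj] | simp)+

text \<open>Write \<open>R(w, z) = hf s (F w) (F z)\<close>. The map \<open>\<Omega>\<close> comes from the inverse function theorem for
  \<open>(z, w) \<mapsto> (z, w + (R(w, z) - c p0 (w - p0)) e)\<close>; for \<open>\<nu> \<in> p0 + ker (c p0)\<close> the point \<open>\<Omega>(z, \<nu>)\<close> runs
  through the Segre variety \<open>{w. R(w, z) = 0}\<close>.\<close>

lemma segre_implicit:
  fixes F :: "complex^'m \<Rightarrow> complex^'a" and s :: "'a \<Rightarrow> real"
  defines "c p v \<equiv> hf s (fd F p v) (F p)"
  assumes V: "open V" "p0 \<in> V" and F: "holomorphic_map_on V F" and null: "hf s (F p0) (F p0) = 0"
    and e: "c p0 e = 1"
  obtains r \<Omega> where "0 < r" "ball p0 r \<subseteq> V"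
    "\<And>z \<nu>. z \<in> ball p0 r \<Longrightarrow> \<nu> \<in> ball p0 r \<Longrightarrow> \<Omega> (z, \<nu>) \<in> V \<and> (\<exists>t. \<Omega> (z, \<nu>) = \<nu> + t *s e) \<and>
       hf s (F (\<Omega> (z, \<nu>))) (F z) = c p0 (\<nu> - p0)"
    "\<And>z w. z \<in> ball p0 r \<Longrightarrow> w \<in> ball p0 r \<Longrightarrow> \<Omega> (z, w + (hf s (F w) (F z) - c p0 (w - p0)) *s e) = w"
    "\<And>z \<nu>. z \<in> ball p0 r \<Longrightarrow> \<nu> \<in> ball p0 r \<Longrightarrow>
       \<exists>D. (\<Omega> has_derivative D) (at (z, \<nu>)) \<and> (\<forall>a u v. D (cnj a *s u, a *s v) = a *s D (u, v))"
proof -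
  have c_add: "c p0 (u + v) = c p0 u + c p0 v" and c_scale: "c p0 (a *s u) = a * c p0 u" and c_diff: "c p0 (u - v) = c p0 u - c p0 v"
    and c0: "c p0 0 = 0" for u v a
    using F V by (auto simp: c_def fd_add fd_scale fd_diff fd_zero hf.add_left hf.scale_left hf.diff_left)
  have bc: "bounded_linear (c p0)"
    unfolding c_def using F V
    by (intro bounded_linear_compose[OF bounded_bilinear.bounded_linear_left[OF bounded_bilinear_hf]] has_derivative_bounded_linear[OF holomorphic_map_has_derivative])
  define \<Phi> where "\<Phi> q = (fst q, snd q + (hf s (F (snd q)) (F (fst q)) - c p0 (snd q - p0)) *s e)" for q
  define \<Phi>' where "\<Phi>' q h = (fst h, snd h + (hf s (F (snd q)) (fd F (fst q) (fst h)) + hf s (fd F (snd q) (snd h)) (F (fst q)) - c p0 (snd h)) *s e)"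
    for q h
  have der: "(\<Phi> has_derivative \<Phi>' q) (at q)" if q: "q \<in> V \<times> V" for q
  proof -
    have 1: "fst q \<in> V" "snd q \<in> V" using q by auto
    have f: "((\<lambda>q. F (fst q)) has_derivative (\<lambda>h. fd F (fst q) (fst h))) (at q)"
      by (rule has_derivative_compose[OF has_derivative_fst[OF has_derivative_ident] holomorphic_map_has_derivative[OF F 1(1)]])
    have g: "((\<lambda>q. F (snd q)) has_derivative (\<lambda>h. fd F (snd q) (snd h))) (at q)"
      by (rule has_derivative_compose[OF has_derivative_snd[OF has_derivative_ident] holomorphic_map_has_derivative[OF F 1(2)]])
    have h: "((\<lambda>q. c p0 (snd q - p0)) has_derivative (\<lambda>h. c p0 (snd h - 0))) (at q)"
      by (intro bounded_linear.has_derivative[OF bc] derivative_intros)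
    show ?thesis
      unfolding \<Phi>_def[abs_def] \<Phi>'_def[abs_def]
      by (rule derivative_eq_intros bounded_linear.has_derivative[OF bounded_linear_smult] has_derivative_hf[OF g f] h refl | simp)+
  qed
  define f' where "f' q = Blinfun (\<Phi>' q)" for q
  have f': "blinfun_apply (f' q) = \<Phi>' q" if "q \<in> V \<times> V" for q
    unfolding f'_def by (rule bounded_linear_Blinfun_apply[OF has_derivative_bounded_linear[OF der[OF that]]])
  have cont: "continuous_on (V \<times> V) f'"
  proof (rule continuous_on_blinfun_componentwise)
    fix b :: "(complex^'m) \<times> (complex^'m)"
    note [continuous_intros] = continuous_on_compose2[OF holomorphic_map_continuous[OF F]] continuous_on_compose2[OF continuous_on_fd[OF V(1) F]]
    have "continuous_on (V \<times> V) (\<lambda>q. \<Phi>' q b)"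
      unfolding \<Phi>'_def by (intro continuous_intros) auto
    then show "continuous_on (V \<times> V) (\<lambda>q. blinfun_apply (f' q) b)"
      by (rule continuous_on_eq) (simp only: f')
  qed
  \<comment> \<open>At \<open>(p0, p0)\<close> the terms with \<open>c p0 (snd h)\<close> cancel and
    the derivative is a shear, which changes the second component by
    \<open>cnj (c p0 (fst h)) *s e\<close>; its inverse subtracts the same vector.\<close>
  define inv0 where "inv0 h = (fst h, snd h - cnj (c p0 (fst h)) *s e)" for h :: "(complex^'m) \<times> (complex^'m)"
  have bl0: "bounded_linear inv0"
    unfolding inv0_def
    by (intro bounded_linear_Pair bounded_linear_fst bounded_linear_sub bounded_linear_snd
        bounded_linear_compose[OF bounded_linear_smult] bounded_linear_compose[OF bounded_linear_cnj]
        bounded_linear_compose[OF bc])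
  have q0: "(p0, p0) \<in> V \<times> V" using V by auto
  have "Blinfun inv0 o\<^sub>L f' (p0, p0) = id_blinfun"
  proof (rule blinfun_eqI)
    fix h :: "(complex^'m) \<times> (complex^'m)"
    have "hf s (F p0) (fd F p0 (fst h)) = cnj (c p0 (fst h))"
      unfolding c_def by (rule hf.hermitian)
    then have eq: "\<Phi>' (p0, p0) h = (fst h, snd h + cnj (c p0 (fst h)) *s e)" unfolding \<Phi>'_def c_def by simp
    have "blinfun_apply (Blinfun inv0 o\<^sub>L f' (p0, p0)) h = inv0 (\<Phi>' (p0, p0) h)"
      by (simp only: blinfun_apply_blinfun_compose bounded_linear_Blinfun_apply[OF bl0] f'[OF q0])
    also have "\<dots> = h" unfolding eq inv0_def by simp
    finally show "blinfun_apply (Blinfun inv0 o\<^sub>L f' (p0, p0)) h = blinfun_apply id_blinfun h" by simp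
  qed
  from inverse_function_theorem[of "V \<times> V" \<Phi> f' "(p0, p0)", OF open_Times[OF V(1) V(1)] _ cont q0 this]
  obtain U' W g g' where U': "open U'" "U' \<subseteq> V \<times> V" "(p0, p0) \<in> U'" and W: "open W" "\<Phi> (p0, p0) \<in> W"
    and hom: "homeomorphism U' W \<Phi> g" and gd: "\<And>y. y \<in> W \<Longrightarrow> (g has_derivative (g' y)) (at y)"
    and g': "\<And>y. y \<in> W \<Longrightarrow> g' y = inv_into UNIV (blinfun_apply (f' (g y)))"
    and bij: "\<And>y. y \<in> W \<Longrightarrow> bij (blinfun_apply (f' (g y)))"
    using der f' by (metis (no_types, lifting))
  have \<Phi>0: "\<Phi> (p0, p0) = (p0, p0)" using null c0 by (simp add: \<Phi>_def)
  obtain r1 where r1: "0 < r1" "ball p0 r1 \<times> ball p0 r1 \<subseteq> U' \<inter> W"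
  proof -
    have "open (U' \<inter> W)" "(p0, p0) \<in> U' \<inter> W" using U' W \<Phi>0 by auto
    then obtain A B where AB: "open A" "open B" "p0 \<in> A" "p0 \<in> B" "A \<times> B \<subseteq> U' \<inter> W" by (elim open_prod_elim) auto
    then have "open (A \<inter> B)" "p0 \<in> A \<inter> B" by auto
    then obtain r where "0 < r" "ball p0 r \<subseteq> A \<inter> B" by (meson open_contains_ball)
    then show ?thesis using that AB(5) by blast
  qed
  define \<Omega> where "\<Omega> q = snd (g q)" for q
  have gfst: "fst (g (z, \<nu>)) = z" and \<Omega>eq: "\<Omega> (z, \<nu>) + (hf s (F (\<Omega> (z, \<nu>))) (F z) - c p0 (\<Omega> (z, \<nu>) - p0)) *s e = \<nu>"
    and gU: "g (z, \<nu>) \<in> U'" if "(z, \<nu>) \<in> W" for z \<nu>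
  proof -
    have "\<Phi> (g (z, \<nu>)) = (z, \<nu>)" "g (z, \<nu>) \<in> U'" using hom that by (auto simp: homeomorphism_def)
    then show "fst (g (z, \<nu>)) = z" "g (z, \<nu>) \<in> U'"
      "\<Omega> (z, \<nu>) + (hf s (F (\<Omega> (z, \<nu>))) (F z) - c p0 (\<Omega> (z, \<nu>) - p0)) *s e = \<nu>"
      unfolding \<Phi>_def \<Omega>_def by auto
  qed
  show ?thesis
  proof (rule that[of r1 \<Omega>])
    show "0 < r1" by (rule r1)
    show sub: "ball p0 r1 \<subseteq> V" using r1 U' by auto
    fix z \<nu> assume z: "z \<in> ball p0 r1" and \<nu>: "\<nu> \<in> ball p0 r1"
    then have zW: "(z, \<nu>) \<in> W" using r1 by blast
    define t where "t = - (hf s (F (\<Omega> (z, \<nu>))) (F z) - c p0 (\<Omega> (z, \<nu>) - p0))"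
    have eq: "\<Omega> (z, \<nu>) = \<nu> + t *s e" using \<Omega>eq[OF zW] by (simp add: t_def algebra_simps vec.scale_left_diff_distrib)
    have "c p0 (\<Omega> (z, \<nu>) - p0) = c p0 (\<nu> - p0) + t"
    proof -
      have "\<Omega> (z, \<nu>) - p0 = (\<nu> - p0) + t *s e" using eq by simp
      then show ?thesis by (simp only: c_add c_scale e mult_1_right)
    qed
    then have "hf s (F (\<Omega> (z, \<nu>))) (F z) = c p0 (\<nu> - p0)" by (simp add: t_def)
    moreover have "\<Omega> (z, \<nu>) \<in> V" using gU[OF zW] U'(2) by (auto simp: \<Omega>_def)
    ultimately show "\<Omega> (z, \<nu>) \<in> V \<and> (\<exists>t. \<Omega> (z, \<nu>) = \<nu> + t *s e) \<and> hf s (F (\<Omega> (z, \<nu>))) (F z) = c p0 (\<nu> - p0)"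
      using eq by blast
    show "\<exists>D. (\<Omega> has_derivative D) (at (z, \<nu>)) \<and> (\<forall>a u v. D (cnj a *s u, a *s v) = a *s D (u, v))"
    proof (intro exI conjI allI)
      show "(\<Omega> has_derivative (\<lambda>h. snd (g' (z, \<nu>) h))) (at (z, \<nu>))"
        unfolding \<Omega>_def[abs_def] by (rule has_derivative_snd[OF gd[OF zW]])
      fix a u v
      let ?A = "blinfun_apply (f' (g (z, \<nu>)))"
      let ?q = "g (z, \<nu>)"
      have qV: "?q \<in> V \<times> V" using gU[OF zW] U'(2) by auto
      have qV': "fst ?q \<in> V" "snd ?q \<in> V" using qV by auto
      have b: "bij ?A" by (rule bij[OF zW])
      \<comment> \<open>The derivative is antilinear in \<open>z\<close> and linear in
        \<open>w\<close>, because the form is; the inverse and therefore the derivative of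
        \<open>\<Omega>\<close> inherit this mixed homogeneity.\<close>
      have eqv: "?A (cnj a *s fst h, a *s snd h) = (cnj a *s fst (?A h), a *s snd (?A h))" for h
        unfolding f'[OF qV] \<Phi>'_def
        by (simp add: fd_scale[OF F qV'(1)] fd_scale[OF F qV'(2)] hf.scale_left hf.scale_right c_scale
            vector_add_ldistrib vec.scale_scale distrib_left right_diff_distrib)
      define h where "h = inv_into UNIV ?A (u, v)"
      have Ah: "?A h = (u, v)" unfolding h_def using b by (simp add: bij_is_surj surj_f_inv_f)
      have Dh: "inv_into UNIV ?A (u, v) = h" by (simp only: h_def)
      have eq: "inv_into UNIV ?A (cnj a *s u, a *s v) = (cnj a *s fst h, a *s snd h)"
      proof -
        have "?A (cnj a *s fst h, a *s snd h) = (cnj a *s u, a *s v)" using eqv[of h] unfolding Ah fst_conv snd_conv .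
        then show ?thesis using inv_f_f[OF bij_is_inj[OF b], of "(cnj a *s fst h, a *s snd h)"] by (simp only:)
      qed
      show "snd (g' (z, \<nu>) (cnj a *s u, a *s v)) = a *s snd (g' (z, \<nu>) (u, v))"
        unfolding g'[OF zW] eq Dh snd_conv ..
    qed
  next
    fix z w assume "z \<in> ball p0 r1" "w \<in> ball p0 r1"
    then have "(z, w) \<in> U'" using r1 by blast
    then have "g (\<Phi> (z, w)) = (z, w)" using hom by (auto simp: homeomorphism_def)
    then show "\<Omega> (z, w + (hf s (F w) (F z) - c p0 (w - p0)) *s e) = w"
      unfolding \<Omega>_def \<Phi>_def by simp
  qed
qed

text \<open>Signs are already arranged so that the ratio \<open>\<tau>\<close> is positive.
  \<open>signs\<close> is the count that leaves fewer than \<open>Suc q\<close> positive squares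
  after an isotropic subspace of dimension \<open>CARD('m) + 1\<close>, to be compared with the
  \<open>Suc q\<close> definite directions in \<open>levi_pos\<close> and \<open>levi_neg\<close>.
  \<open>many\<close> makes \<open>M\<close> a uniqueness set along the lines in direction
  \<open>e\<close>.\<close>

locale segre_pair =
  fixes s0 :: "'a::finite \<Rightarrow> real" and s1 :: "'b::finite \<Rightarrow> real"
    and F0 :: "complex^'m \<Rightarrow> complex^'a" and F1 :: "complex^'m \<Rightarrow> complex^'b"
    and V M :: "(complex^'m) set" and p0 e :: "complex^'m" and q :: nat and \<tau> :: "complex^'m \<Rightarrow> real"
  assumes V: "open V" "p0 \<in> V" and F0: "holomorphic_map_on V F0" and F1: "holomorphic_map_on V F1"
    and p0M: "p0 \<in> M"
    and null0: "\<And>x. x \<in> M \<Longrightarrow> x \<in> V \<Longrightarrow> hf s0 (F0 x) (F0 x) = 0"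
    and null1: "\<And>x. x \<in> M \<Longrightarrow> x \<in> V \<Longrightarrow> hf s1 (F1 x) (F1 x) = 0"
    and tau_pos: "\<And>x. x \<in> M \<Longrightarrow> x \<in> V \<Longrightarrow> \<tau> x > 0"
    and tau: "\<And>x v. x \<in> M \<Longrightarrow> x \<in> V \<Longrightarrow> hf s1 (fd F1 x v) (F1 x) = of_real (\<tau> x) * hf s0 (fd F0 x v) (F0 x)"
    and e: "hf s0 (fd F0 p0 e) (F0 p0) = 1"
    and nonzero: "\<And>x. x \<in> M \<Longrightarrow> x \<in> V \<Longrightarrow> \<exists>v. hf s0 (fd F0 x v) (F0 x) \<noteq> 0"
    and levi: "\<And>x u v. x \<in> M \<Longrightarrow> x \<in> V \<Longrightarrow> hf s0 (fd F0 x u) (F0 x) = 0 \<Longrightarrow> hf s0 (fd F0 x v) (F0 x) = 0 \<Longrightarrow>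
        hf s1 (fd F1 x u) (fd F1 x v) = of_real (\<tau> x) * hf s0 (fd F0 x u) (fd F0 x v)"
    and levi_nondeg: "\<And>x u. x \<in> M \<Longrightarrow> x \<in> V \<Longrightarrow> hf s0 (fd F0 x u) (F0 x) = 0 \<Longrightarrow>
        (\<And>v. hf s0 (fd F0 x v) (F0 x) = 0 \<Longrightarrow> hf s0 (fd F0 x u) (fd F0 x v) = 0) \<Longrightarrow> u = 0"
    and levi_pos: "\<And>x. x \<in> M \<Longrightarrow> x \<in> V \<Longrightarrow> \<exists>P. vec.subspace P \<and> Suc q \<le> vec.dim P \<and>
        (\<forall>u\<in>P. hf s0 (fd F0 x u) (F0 x) = 0 \<and> (u \<noteq> 0 \<longrightarrow> Re (hf s0 (fd F0 x u) (fd F0 x u)) > 0))"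
    and levi_neg: "\<And>x. x \<in> M \<Longrightarrow> x \<in> V \<Longrightarrow> \<exists>P. vec.subspace P \<and> Suc q \<le> vec.dim P \<and>
        (\<forall>u\<in>P. hf s0 (fd F0 x u) (F0 x) = 0 \<and> (u \<noteq> 0 \<longrightarrow> Re (hf s0 (fd F0 x u) (fd F0 x u)) < 0))"
    and many: "\<And>\<rho>. 0 < \<rho> \<Longrightarrow> \<exists>\<delta>>0. \<forall>h. hf s0 (fd F0 p0 h) (F0 p0) = 0 \<and> norm h < \<delta> \<longrightarrow>
        infinite {t. cmod t < \<rho> \<and> p0 + h + t *s e \<in> M}"
    and s0: "\<forall>i. s0 i \<noteq> 0" and s1: "\<forall>i. s1 i \<noteq> 0"
    and signs: "card {i. s1 i > 0} + card {i. s0 i < 0} < CARD('m) + 1 + Suc q"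
begin

definition c :: "complex^'m \<Rightarrow> complex^'m \<Rightarrow> complex" where "c p v = hf s0 (fd F0 p v) (F0 p)"
abbreviation R :: "complex^'m \<Rightarrow> complex^'m \<Rightarrow> complex" where "R z w \<equiv> hf s0 (F0 z) (F0 w)"
abbreviation B :: "complex^'m \<Rightarrow> complex^'m \<Rightarrow> complex" where "B z w \<equiv> hf s1 (F1 z) (F1 w)"
definition pr :: "complex^'m \<Rightarrow> complex^'m" where "pr x = x - c p0 x *s e"

lemma c_linear: "p \<in> V \<Longrightarrow> c p (u + v) = c p u + c p v" "p \<in> V \<Longrightarrow> c p (a *s u) = a * c p u"
    "p \<in> V \<Longrightarrow> c p (u - v) = c p u - c p v" "p \<in> V \<Longrightarrow> c p 0 = 0"
  using F0 by (auto simp: c_def fd_add fd_scale fd_diff fd_zero hf.add_left hf.scale_left hf.diff_left)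

lemma c_e: "c p0 e = 1"
  using e by (simp add: c_def)

lemma bounded_linear_c: "p \<in> V \<Longrightarrow> bounded_linear (c p)"
  unfolding c_def using F0
  by (intro bounded_linear_compose[OF bounded_bilinear.bounded_linear_left[OF bounded_bilinear_hf]] has_derivative_bounded_linear[OF holomorphic_map_has_derivative])

lemma bounded_linear_pr: "bounded_linear pr"
  unfolding pr_def
  by (intro bounded_linear_sub bounded_linear_ident bounded_linear_compose[OF bounded_linear_smult] bounded_linear_c V)

lemma c_pr [simp]: "c p0 (pr x) = 0"
  by (simp add: pr_def c_linear V c_e)

lemma pr_linear: "pr (u + v) = pr u + pr v" "pr (a *s u) = a *s pr u" "pr (u - v) = pr u - pr v" "pr 0 = 0"
  by (auto simp: pr_def c_linear V vector_sadd_rdistrib vec.scale_right_diff_distrib vec.scale_scale vec.scale_left_diff_distrib)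

lemma pr_e [simp]: "pr e = 0"
  by (simp add: pr_def c_e)

lemma pr_ker: "c p0 x = 0 \<Longrightarrow> pr x = x"
  by (simp add: pr_def)

lemma pr_line: "x = pr x + c p0 x *s e"
  by (simp add: pr_def)

lemma pr_bound: obtains \<kappa> where "1 \<le> \<kappa>" "\<And>x. norm (pr x) \<le> \<kappa> * norm x"
proof -
  obtain K where K: "\<And>x. norm (pr x) \<le> norm x * K" using bounded_linear.bounded[OF bounded_linear_pr] by blast
  have "norm (pr x) \<le> max 1 K * norm x" for x
    using K[of x] mult_right_mono[of K "max 1 K" "norm x"] by (simp add: mult.commute)
  then show ?thesis using that[of "max 1 K"] by simp
qed

lemma p0_null: "R p0 p0 = 0"
  using null0 p0M V by blast

lemma segre_implicit_map:
  obtains r \<Omega> where "0 < r" "ball p0 r \<subseteq> V"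
    "\<And>z \<nu>. z \<in> ball p0 r \<Longrightarrow> \<nu> \<in> ball p0 r \<Longrightarrow> \<Omega> (z, \<nu>) \<in> V \<and> pr (\<Omega> (z, \<nu>)) = pr \<nu> \<and> R (\<Omega> (z, \<nu>)) z = c p0 (\<nu> - p0)"
    "\<And>z w. z \<in> ball p0 r \<Longrightarrow> w \<in> ball p0 r \<Longrightarrow> \<Omega> (z, w + (R w z - c p0 (w - p0)) *s e) = w"
    "\<And>z \<nu>. z \<in> ball p0 r \<Longrightarrow> \<nu> \<in> ball p0 r \<Longrightarrow>
       \<exists>D. (\<Omega> has_derivative D) (at (z, \<nu>)) \<and> (\<forall>a u v. D (cnj a *s u, a *s v) = a *s D (u, v))"
proof -
  obtain r \<Omega> where r: "0 < r" "ball p0 r \<subseteq> V"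
    and 1: "\<And>z \<nu>. z \<in> ball p0 r \<Longrightarrow> \<nu> \<in> ball p0 r \<Longrightarrow> \<Omega> (z, \<nu>) \<in> V \<and> (\<exists>t. \<Omega> (z, \<nu>) = \<nu> + t *s e) \<and> R (\<Omega> (z, \<nu>)) z = c p0 (\<nu> - p0)"
    and 2: "\<And>z w. z \<in> ball p0 r \<Longrightarrow> w \<in> ball p0 r \<Longrightarrow> \<Omega> (z, w + (R w z - c p0 (w - p0)) *s e) = w"
    and 3: "\<And>z \<nu>. z \<in> ball p0 r \<Longrightarrow> \<nu> \<in> ball p0 r \<Longrightarrow>
       \<exists>D. (\<Omega> has_derivative D) (at (z, \<nu>)) \<and> (\<forall>a u v. D (cnj a *s u, a *s v) = a *s D (u, v))"
    using segre_implicit[OF V F0 p0_null e] unfolding c_def by blast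
  show ?thesis
  proof (rule that[OF r _ 2 3])
    fix z \<nu> assume zn: "z \<in> ball p0 r" "\<nu> \<in> ball p0 r"
    from 1[OF zn] obtain t where t: "\<Omega> (z, \<nu>) = \<nu> + t *s e" by blast
    have "pr (\<Omega> (z, \<nu>)) = pr \<nu>" unfolding t by (simp add: pr_linear)
    then show "\<Omega> (z, \<nu>) \<in> V \<and> pr (\<Omega> (z, \<nu>)) = pr \<nu> \<and> R (\<Omega> (z, \<nu>)) z = c p0 (\<nu> - p0)" using 1[OF zn] by blast
  qed
qed

text \<open>On the diagonal points of \<open>M\<close> both forms vanish. Each complex line in direction \<open>e\<close> near \<open>p0\<close> meets \<open>M\<close>
  infinitely often, so that \<open>B(\<Omega>(z, \<nu>), z)\<close>, which is antiholomorphic in \<open>z\<close> and holomorphic in \<open>\<nu>\<close>, vanishes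
  identically for \<open>\<nu> \<in> p0 + ker (c p0)\<close>.\<close>

lemma segre_vanishing:
  obtains r where "0 < r" "ball p0 r \<subseteq> V" "\<And>z w. z \<in> ball p0 r \<Longrightarrow> w \<in> ball p0 r \<Longrightarrow> R w z = 0 \<Longrightarrow> B w z = 0"
proof -
  obtain r \<Omega> where r: "0 < r" "ball p0 r \<subseteq> V"
    and 1: "\<And>z \<nu>. z \<in> ball p0 r \<Longrightarrow> \<nu> \<in> ball p0 r \<Longrightarrow> \<Omega> (z, \<nu>) \<in> V \<and> pr (\<Omega> (z, \<nu>)) = pr \<nu> \<and> R (\<Omega> (z, \<nu>)) z = c p0 (\<nu> - p0)"
    and 2: "\<And>z w. z \<in> ball p0 r \<Longrightarrow> w \<in> ball p0 r \<Longrightarrow> \<Omega> (z, w + (R w z - c p0 (w - p0)) *s e) = w"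
    and 3: "\<And>z \<nu>. z \<in> ball p0 r \<Longrightarrow> \<nu> \<in> ball p0 r \<Longrightarrow>
       \<exists>D. (\<Omega> has_derivative D) (at (z, \<nu>)) \<and> (\<forall>a u v. D (cnj a *s u, a *s v) = a *s D (u, v))"
    using segre_implicit_map by blast
  obtain \<kappa> where \<kappa>: "1 \<le> \<kappa>" "\<And>x. norm (pr x) \<le> \<kappa> * norm x" using pr_bound by blast
  define \<rho> where "\<rho> = r / \<kappa>"
  have \<rho>: "0 < \<rho>" "\<rho> \<le> r" using r \<kappa> by (auto simp: \<rho>_def divide_le_eq mult_le_cancel_left1)
  have in1: "p0 + x \<in> ball p0 r" if "x \<in> ball 0 \<rho>" for x using that \<rho> by (simp add: dist_norm)
  have in2: "p0 + pr x \<in> ball p0 r" if "x \<in> ball 0 \<rho>" for x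
  proof -
    have "\<kappa> * norm x < r" using that \<kappa>(1) by (simp add: \<rho>_def field_simps)
    then show ?thesis using \<kappa>(2)[of x] by (simp add: dist_norm)
  qed
  \<comment> \<open>The first argument enters through \<open>\<nu>\<close> and is holomorphic, the
    second is the base point of the Segre variety and is antiholomorphic. Through \<open>pr\<close>
    the kernel lives on a ball of the full space.\<close>
  define K where "K h x = B (\<Omega> (p0 + x, p0 + pr h)) (p0 + x)" for h x
  have sesq: "sesqui_holomorphic_on (ball 0 \<rho>) K"
    unfolding sesqui_holomorphic_on_def
  proof (intro allI)
    fix x d y d' :: "complex^'m"
    have "(\<lambda>\<zeta>. K (x + \<zeta> *s d) (y + cnj \<zeta> *s d')) field_differentiable (at \<zeta>)" if \<zeta>: "\<zeta> \<in> slice (ball 0 \<rho>) x d y d'" for \<zeta>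
    proof -
      have b: "x + \<zeta> *s d \<in> ball 0 \<rho>" "y + cnj \<zeta> *s d' \<in> ball 0 \<rho>" using \<zeta> by (auto simp: slice_def)
      let ?z = "p0 + (y + cnj \<zeta> *s d')" and ?\<nu> = "p0 + pr (x + \<zeta> *s d)"
      obtain D where D: "(\<Omega> has_derivative D) (at (?z, ?\<nu>))" "\<And>a u v. D (cnj a *s u, a *s v) = a *s D (u, v)"
        using 3[OF in1[OF b(2)] in2[OF b(1)]] by blast
      have zV: "?z \<in> V" "\<Omega> (?z, ?\<nu>) \<in> V" using in1[OF b(2)] r(2) 1[OF in1[OF b(2)] in2[OF b(1)]] by auto
      have dz: "((\<lambda>\<zeta>. p0 + (y + cnj \<zeta> *s d')) has_derivative (\<lambda>h. cnj h *s d')) (at \<zeta>)"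
        using has_derivative_affine_line(2)[of "p0 + y" d' \<zeta>] by (simp add: add.assoc)
      have dn: "((\<lambda>\<zeta>. p0 + pr (x + \<zeta> *s d)) has_derivative (\<lambda>h. h *s pr d)) (at \<zeta>)"
        using has_derivative_affine_line(1)[of "p0 + pr x" "pr d" \<zeta>] by (simp add: add.assoc pr_linear)
      have d\<Omega>: "((\<lambda>\<zeta>. \<Omega> (p0 + (y + cnj \<zeta> *s d'), p0 + pr (x + \<zeta> *s d))) has_derivative (\<lambda>h. D (cnj h *s d', h *s pr d))) (at \<zeta>)"
        by (rule has_derivative_compose[OF has_derivative_Pair[OF dz dn] D(1)])
      show ?thesis
        unfolding K_def
      proof (rule hf_field_derivative)
        show "((\<lambda>\<zeta>. F1 (\<Omega> (p0 + (y + cnj \<zeta> *s d'), p0 + pr (x + \<zeta> *s d)))) has_derivative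
            (\<lambda>h. fd F1 (\<Omega> (?z, ?\<nu>)) (D (cnj h *s d', h *s pr d)))) (at \<zeta>)"
          by (rule has_derivative_compose[OF d\<Omega> holomorphic_map_has_derivative[OF F1 zV(2)]])
        show "((\<lambda>\<zeta>. F1 (p0 + (y + cnj \<zeta> *s d'))) has_derivative (\<lambda>h. fd F1 ?z (cnj h *s d'))) (at \<zeta>)"
          by (rule has_derivative_compose[OF dz holomorphic_map_has_derivative[OF F1 zV(1)]])
      qed (simp_all only: D(2) fd_scale[OF F1 zV(2)] fd_scale[OF F1 zV(1)] complex_cnj_one vector_smult_lid D(2)[of 1, simplified])
    qed
    then show "(\<lambda>\<zeta>. K (x + \<zeta> *s d) (y + cnj \<zeta> *s d')) holomorphic_on slice (ball 0 \<rho>) x d y d'"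
      by (simp add: holomorphic_on_def field_differentiable_at_within)
  qed
  define \<rho>1 where "\<rho>1 = \<rho> / (4 * (norm e + 1))"
  have \<rho>1: "0 < \<rho>1" "\<rho>1 * norm e \<le> \<rho> / 4"
  proof -
    have pos: "0 < norm e + 1" by (simp add: add_nonneg_pos)
    then show "0 < \<rho>1" using \<rho> by (simp add: \<rho>1_def)
    have "\<rho>1 * norm e = \<rho> / 4 * (norm e / (norm e + 1))" by (simp add: \<rho>1_def)
    also have "\<dots> \<le> \<rho> / 4 * 1" using \<rho> pos by (intro mult_left_mono) (auto simp: divide_le_eq)
    finally show "\<rho>1 * norm e \<le> \<rho> / 4" by simp
  qed
  obtain \<delta> where \<delta>: "0 < \<delta>" "\<And>h. c p0 h = 0 \<Longrightarrow> norm h < \<delta> \<Longrightarrow> infinite {t. cmod t < \<rho>1 \<and> p0 + h + t *s e \<in> M}"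
    using many[OF \<rho>1(1)] unfolding c_def by blast
  define \<sigma> where "\<sigma> = min \<rho> (min \<delta> (\<rho>/2) / \<kappa>)"
  have \<sigma>: "0 < \<sigma>" "\<sigma> \<le> \<rho>" using \<rho> \<delta> \<kappa> by (auto simp: \<sigma>_def)
  have diag: "K x x = 0" if x: "x \<in> ball 0 \<sigma>" for x
  proof -
    have "norm x < min \<delta> (\<rho>/2) / \<kappa>" using x by (simp add: \<sigma>_def)
    then have "\<kappa> * norm x < min \<delta> (\<rho>/2)" using \<kappa>(1) by (simp add: pos_less_divide_eq mult.commute)
    then have prx: "norm (pr x) < \<delta>" "norm (pr x) < \<rho>/2" using \<kappa>(2)[of x] by auto
    let ?S = "slice (ball 0 \<rho>) x 0 (pr x) e"
    \<comment> \<open>Conjugated because the second slot of a slice carries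
      \<open>cnj \<zeta>\<close>.\<close>
    let ?U = "cnj ` {t. cmod t < \<rho>1 \<and> p0 + pr x + t *s e \<in> M}"
    have xb: "x \<in> ball 0 \<rho>" using x \<sigma> by auto
    have cb: "cball 0 \<rho>1 \<subseteq> ?S"
    proof
      fix t :: complex assume "t \<in> cball 0 \<rho>1"
      then have "norm (cnj t *s e) \<le> \<rho>1 * norm e" by (simp add: norm_smult mult_right_mono)
      then have "norm (pr x + cnj t *s e) < \<rho>" using norm_triangle_ineq[of "pr x" "cnj t *s e"] prx(2) \<rho>1(2) \<rho>(1) by linarith
      then show "t \<in> ?S" using xb by (simp add: slice_def)
    qed
    have "infinite {t. cmod t < \<rho>1 \<and> p0 + pr x + t *s e \<in> M}" by (rule \<delta>(2)) (use prx in auto)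
    then have inf: "infinite ?U" by (subst finite_image_iff) (auto intro: inj_onI)
    have Ub: "?U \<subseteq> cball 0 \<rho>1" by auto
    obtain \<xi> where \<xi>: "\<xi> \<in> cball 0 \<rho>1" "\<xi> islimpt ?U"
      using compact_eq_Bolzano_Weierstrass[THEN iffD1, OF compact_cball, rule_format, OF conjI[OF inf Ub]] by blast
    \<comment> \<open>At a point \<open>z\<close> of \<open>M\<close> on this line
      \<open>R z z = 0\<close>, so \<open>\<Omega>\<close> sends \<open>(z, p0 + pr x)\<close> back
      to \<open>z\<close> and the kernel reduces to \<open>B z z\<close>.\<close>
    have zero: "K (x + \<zeta> *s 0) (pr x + cnj \<zeta> *s e) = 0" if "\<zeta> \<in> ?U" for \<zeta>
    proof -
      from that obtain t where t: "\<zeta> = cnj t" "cmod t < \<rho>1" "p0 + pr x + t *s e \<in> M" by blast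
      define z where "z = p0 + (pr x + t *s e)"
      have zM: "z \<in> M" using t(3) by (simp add: z_def add.assoc)
      have "cnj t \<in> ?S" using cb t(2) by auto
      then have zb: "z \<in> ball p0 r" using in1[of "pr x + t *s e"] by (auto simp: slice_def z_def)
      have zV: "z \<in> V" using zb r by blast
      have "c p0 (z - p0) = t" by (simp add: z_def c_linear V c_e)
      then have "z + (R z z - c p0 (z - p0)) *s e = p0 + pr x" using null0[OF zM zV] by (simp add: z_def)
      then have "\<Omega> (z, p0 + pr x) = z" using 2[OF zb zb] by simp
      then show ?thesis using null1[OF zM zV] by (simp add: K_def t(1) z_def[symmetric])
    qed
    \<comment> \<open>The parameter \<open>cnj (c p0 x)\<close> moves the second argument from
      \<open>pr x\<close> back to \<open>x\<close>; the first one only matters through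
      \<open>pr x\<close>. Thus the zeros on the line give the diagonal value.\<close>
    have "K (x + cnj (c p0 x) *s 0) (pr x + cnj (cnj (c p0 x)) *s e) = 0"
    proof (rule zero_of_islimpt[OF sesqui_holomorphic_onD[OF sesq]])
      show "open ?S" "convex ?S" by (auto intro: open_slice convex_slice)
      show "?U \<subseteq> ?S" using Ub cb by blast
      show "\<xi> \<in> ?S" using \<xi>(1) cb by blast
      show "cnj (c p0 x) \<in> ?S" using xb pr_line[of x] by (simp add: slice_def)
    qed (use \<xi> zero in auto)
    then show ?thesis using pr_line[of x] by simp
  qed
  have K0: "K x y = 0" if "x \<in> ball 0 \<rho>" "y \<in> ball 0 \<rho>" for x y
    by (rule polarization[OF sesq open_ball convex_ball \<sigma>(1) subset_ball[OF \<sigma>(2)] diag that])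
  show ?thesis
  proof (rule that[of \<rho>])
    show "0 < \<rho>" "ball p0 \<rho> \<subseteq> V" using \<rho> r by auto
    fix z w assume zw: "z \<in> ball p0 \<rho>" "w \<in> ball p0 \<rho>" "R w z = 0"
    have b: "z - p0 \<in> ball 0 \<rho>" "w - p0 \<in> ball 0 \<rho>" using zw by (auto simp: dist_norm norm_minus_commute)
    have zr: "z \<in> ball p0 r" "w \<in> ball p0 r" using zw \<rho>(2) by auto
    have "w + (R w z - c p0 (w - p0)) *s e = p0 + pr (w - p0)" using zw(3) by (simp add: pr_def)
    then have "\<Omega> (z, p0 + pr (w - p0)) = w" using 2[OF zr] by simp
    then show "B w z = 0" using K0[OF b(2,1)] by (simp add: K_def)
  qed
qed

end

section \<open>Composite maps and their forms to second order\<close>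

lemma (in hermitian_form) span_orthogonal:
  assumes "\<forall>x\<in>S. \<forall>y\<in>T. L x y = 0" "x \<in> vec.span S" "y \<in> vec.span T"
  shows "L x y = 0"
proof -
  have 1: "L x b = 0" if "b \<in> T" for b
    using assms(2) by (induction rule: vec.span_induct_alt) (use assms(1) that in \<open>auto simp: add_left scale_left\<close>)
  show ?thesis
    using assms(3) by (induction rule: vec.span_induct_alt) (use 1 in \<open>auto simp: add_right scale_right\<close>)
qed

lemma holomorphic_map_compose:
  assumes F: "holomorphic_map_on V F" and G: "holomorphic_map_on A G" "\<And>x. x \<in> A \<Longrightarrow> G x \<in> V"
  shows "holomorphic_map_on A (\<lambda>x. F (G x))"
    and "x \<in> A \<Longrightarrow> fd (\<lambda>x. F (G x)) x v = fd F (G x) (fd G x v)"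
proof -
  have d: "((\<lambda>x. F (G x)) has_derivative (\<lambda>v. fd F (G x) (fd G x v))) (at x)" if "x \<in> A" for x
    by (rule has_derivative_compose[OF holomorphic_map_has_derivative[OF G(1) that] holomorphic_map_has_derivative[OF F G(2)[OF that]]])
  show "holomorphic_map_on A (\<lambda>x. F (G x))"
    by (rule holomorphic_map_onI[OF d]) (simp_all add: fd_scale[OF G(1)] fd_scale[OF F G(2)])
  show "x \<in> A \<Longrightarrow> fd (\<lambda>x. F (G x)) x v = fd F (G x) (fd G x v)" using fd_eq[OF d] by metis
qed

lemma holomorphic_map_scale:
  fixes F :: "complex^'m \<Rightarrow> complex^'k"
  assumes F: "holomorphic_map_on V F" and \<phi>: "\<And>x. x \<in> V \<Longrightarrow> (\<phi> has_derivative \<phi>' x) (at x)"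
    and sc: "\<And>x a v. x \<in> V \<Longrightarrow> \<phi>' x (a *s v) = a * \<phi>' x v"
  shows "holomorphic_map_on V (\<lambda>x. \<phi> x *s F x)"
    and "x \<in> V \<Longrightarrow> fd (\<lambda>x. \<phi> x *s F x) x v = \<phi> x *s fd F x v + \<phi>' x v *s F x"
proof -
  have "bounded_bilinear (\<lambda>(a::complex) (x::complex^'k). a *s x)"
    by (rule bounded_bilinear.intro)
      (auto simp: vector_sadd_rdistrib vector_add_ldistrib scaleR_eq_smult vec.scale_scale norm_smult scaleR_conv_of_real mult.commute intro!: exI[of _ 1])
  from bounded_bilinear.FDERIV[OF this \<phi> holomorphic_map_has_derivative[OF F]]
  have d: "((\<lambda>x. \<phi> x *s F x) has_derivative (\<lambda>v. \<phi> x *s fd F x v + \<phi>' x v *s F x)) (at x)" if "x \<in> V" for x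
    using that by blast
  show "holomorphic_map_on V (\<lambda>x. \<phi> x *s F x)"
    by (rule holomorphic_map_onI[OF d])
      (simp_all add: fd_scale[OF F] sc vector_add_ldistrib vec.scale_scale mult.commute)
  show "x \<in> V \<Longrightarrow> fd (\<lambda>x. \<phi> x *s F x) x v = \<phi> x *s fd F x v + \<phi>' x v *s F x" using fd_eq[OF d] by metis
qed

lemma holomorphic_map_hf_scale:
  fixes F :: "complex^'m \<Rightarrow> complex^'k" and G :: "complex^'m \<Rightarrow> complex^'j"
  assumes F: "holomorphic_map_on V F" and G: "holomorphic_map_on V G"
  shows "holomorphic_map_on V (\<lambda>x. hf s (G x) w *s F x)"
  by (rule holomorphic_map_scale(1)[OF F bounded_linear.has_derivative[OF
        bounded_bilinear.bounded_linear_left[OF bounded_bilinear_hf] holomorphic_map_has_derivative[OF G]]])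
    (simp_all add: fd_scale[OF G] hf.scale_left)

lemma bounded_linear_join: "bounded_linear (\<lambda>x. join x (0 :: complex^'j))" "bounded_linear (\<lambda>y. join (0 :: complex^'i) y)"
  by (auto intro!: linear_conv_bounded_linear[THEN iffD1] linearI
      simp: join_add scaleR_eq_smult join_scale)

lemma holomorphic_map_join:
  assumes F: "holomorphic_map_on V F" and G: "holomorphic_map_on V G"
  shows "holomorphic_map_on V (\<lambda>x. join (F x) (G x))"
proof -
  have eq: "join x y = join x 0 + join 0 y" for x :: "complex^'x" and y :: "complex^'y" by (simp add: join_add)
  have d: "((\<lambda>x. join (F x) (G x)) has_derivative (\<lambda>v. join (fd F x v) (fd G x v))) (at x)" if "x \<in> V" for x
    by (subst eq, subst (3) eq)
      (intro has_derivative_add bounded_linear.has_derivative[OF bounded_linear_join(1)] bounded_linear.has_derivative[OF bounded_linear_join(2)]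
        holomorphic_map_has_derivative[OF F that] holomorphic_map_has_derivative[OF G that])
  show ?thesis by (rule holomorphic_map_onI[OF d]) (simp_all add: fd_scale[OF F] fd_scale[OF G] join_scale)
qed

lemma sesqui_holomorphic_hf:
  assumes G: "holomorphic_map_on A G" and H: "holomorphic_map_on A H"
  shows "sesqui_holomorphic_on A (\<lambda>x y. hf s (G x) (H y))"
  unfolding sesqui_holomorphic_on_def
proof (intro allI)
  fix x d y d' :: "complex^'a"
  have "(\<lambda>\<zeta>. hf s (G (x + \<zeta> *s d)) (H (y + cnj \<zeta> *s d'))) field_differentiable (at \<zeta>)" if "\<zeta> \<in> slice A x d y d'" for \<zeta>
  proof -
    have m: "x + \<zeta> *s d \<in> A" "y + cnj \<zeta> *s d' \<in> A" using that by (auto simp: slice_def)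
    show ?thesis
    proof (rule hf_field_derivative)
      show "((\<lambda>\<zeta>. G (x + \<zeta> *s d)) has_derivative (\<lambda>h. fd G (x + \<zeta> *s d) (h *s d))) (at \<zeta>)"
        by (rule has_derivative_compose[OF has_derivative_affine_line(1) holomorphic_map_has_derivative[OF G m(1)]])
      show "((\<lambda>\<zeta>. H (y + cnj \<zeta> *s d')) has_derivative (\<lambda>h. fd H (y + cnj \<zeta> *s d') (cnj h *s d'))) (at \<zeta>)"
        by (rule has_derivative_compose[OF has_derivative_affine_line(2) holomorphic_map_has_derivative[OF H m(2)]])
    qed (simp_all add: fd_scale[OF G m(1)] fd_scale[OF H m(2)])
  qed
  then show "(\<lambda>\<zeta>. hf s (G (x + \<zeta> *s d)) (H (y + cnj \<zeta> *s d'))) holomorphic_on slice A x d y d'"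
    by (simp add: holomorphic_on_def field_differentiable_at_within)
qed

lemma difference_quotient_limit:
  fixes f :: "complex \<Rightarrow> complex^'k"
  assumes "(f has_derivative (\<lambda>h. h *s w)) (at 0)"
  shows "((\<lambda>\<epsilon>. (1 / complex_of_real \<epsilon>) *s (f (of_real \<epsilon>) - f 0)) \<longlongrightarrow> w) (at_right 0)"
proof (rule vec_tendstoI)
  fix i
  have "((\<lambda>\<zeta>. f \<zeta> $ i) has_derivative (\<lambda>h. (h *s w) $ i)) (at 0)"
    by (rule bounded_linear.has_derivative[OF bounded_linear_vec_nth assms])
  moreover have "(\<lambda>h. (h *s w) $ i) = (*) (w $ i)" by (simp add: fun_eq_iff mult.commute)
  ultimately have "((\<lambda>\<zeta>. f \<zeta> $ i) has_field_derivative w $ i) (at 0)" by (simp add: has_field_derivative_def)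
  then have l: "((\<lambda>h. (f h $ i - f 0 $ i) / h) \<longlongrightarrow> w $ i) (at 0)" by (simp add: DERIV_def)
  have f: "filterlim complex_of_real (at 0) (at_right 0)"
    unfolding filterlim_at by (auto intro!: tendsto_eq_intros eventually_at_rightI[of 0 1])
  show "((\<lambda>\<epsilon>. ((1 / complex_of_real \<epsilon>) *s (f (of_real \<epsilon>) - f 0)) $ i) \<longlongrightarrow> w $ i) (at_right 0)"
    using filterlim_compose[OF l f] by (simp add: diff_divide_distrib)
qed

text \<open>As \<open>G 0\<close> is orthogonal to every value of \<open>G\<close>, subtracting it
  does not change the form, and the quotient by the square of the scale is the form of two
  difference quotients.\<close>

lemma hf_second_difference:
  assumes G: "holomorphic_map_on A G" and A: "0 \<in> A"
    and z: "\<And>x. x \<in> A \<Longrightarrow> hf s (G x) (G 0) = 0" and op: "open A"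
  shows "((\<lambda>\<epsilon>. hf s (G (of_real \<epsilon> *s x)) (G (of_real \<epsilon> *s y)) / of_real \<epsilon> ^ 2) \<longlongrightarrow> hf s (fd G 0 x) (fd G 0 y)) (at_right 0)"
proof -
  have quot: "((\<lambda>\<epsilon>. (1 / complex_of_real \<epsilon>) *s (G (of_real \<epsilon> *s x) - G 0)) \<longlongrightarrow> fd G 0 x) (at_right 0)" for x
  proof -
    have "((\<lambda>\<zeta>. G (0 + \<zeta> *s x)) has_derivative (\<lambda>h. fd G 0 (h *s x))) (at 0)"
      using has_derivative_compose[OF has_derivative_affine_line(1)[of 0 x 0], of G "fd G 0"] holomorphic_map_has_derivative[OF G A] by simp
    then have "((\<lambda>\<zeta>. G (\<zeta> *s x)) has_derivative (\<lambda>h. h *s fd G 0 x)) (at 0)" by (simp add: fd_scale[OF G A])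
    from difference_quotient_limit[OF this] show ?thesis by simp
  qed
  have "((\<lambda>\<epsilon>. hf s ((1 / complex_of_real \<epsilon>) *s (G (of_real \<epsilon> *s x) - G 0)) ((1 / complex_of_real \<epsilon>) *s (G (of_real \<epsilon> *s y) - G 0)))
     \<longlongrightarrow> hf s (fd G 0 x) (fd G 0 y)) (at_right 0)"
    by (intro tendsto_hf quot)
  moreover have "\<forall>\<^sub>F \<epsilon> in at_right 0. hf s ((1 / complex_of_real \<epsilon>) *s (G (of_real \<epsilon> *s x) - G 0)) ((1 / complex_of_real \<epsilon>) *s (G (of_real \<epsilon> *s y) - G 0))
      = hf s (G (of_real \<epsilon> *s x)) (G (of_real \<epsilon> *s y)) / of_real \<epsilon> ^ 2"
  proof -
    have "\<forall>\<^sub>F \<epsilon> in at_right 0. complex_of_real \<epsilon> *s x \<in> A" for x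
    proof -
      have "((\<lambda>\<epsilon>. complex_of_real \<epsilon> *s x) \<longlongrightarrow> of_real 0 *s x) (at_right 0)" by (intro tendsto_intros)
      then show ?thesis using op A by (intro topological_tendstoD) auto
    qed
    from eventually_conj[OF this[of x] this[of y]] show ?thesis
    proof eventually_elim
      case (elim \<epsilon>)
      have 1: "hf s (G (of_real \<epsilon> *s x)) (G 0) = 0" "hf s (G 0) (G (of_real \<epsilon> *s y)) = 0" "hf s (G 0) (G 0) = 0"
        using z elim A hf.hermitian[of s "G 0" "G (of_real \<epsilon> *s y)"] by auto
      show ?case by (simp add: hf.scale_left hf.scale_right hf.diff_left hf.diff_right 1 power2_eq_square)
    qed
  qed
  ultimately show ?thesis by (rule Lim_transform_eventually)
qed

context segre_pair
begin

text \<open>Let \<open>a z = \<langle>F0 z, dF0\<^sub>p e\<rangle>\<close> and \<open>b z = \<langle>F1 z, dF1\<^sub>p e\<rangle>\<close>. On the Segre variety of \<open>p\<close> the kernel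
  \<open>\<tau> a (cnj a) B - b (cnj b) R\<close> vanishes where \<open>R\<close> does. It is the form \<open>\<tau> s1 \<oplus> (- s0)\<close> evaluated at vectors
  \<open>(a F1, b F0)\<close> orthogonal to an isotropic subspace of dimension \<open>CARD('m) + 1\<close>, spanned by \<open>(F1 p, 0)\<close>, \<open>(0, F0 p)\<close>
  and the \<open>(dF1\<^sub>p u / \<tau>, dF0\<^sub>p u)\<close> with \<open>c p u = 0\<close>. This leaves too few positive squares for a nonzero kernel.\<close>

lemma local_identity:
  obtains \<delta> where "0 < \<delta>" "ball p0 \<delta> \<subseteq> V"
    "\<And>p. p \<in> M \<Longrightarrow> p \<in> ball p0 \<delta> \<Longrightarrow> \<exists>\<phi>. \<forall>z\<in>ball p0 \<delta>. \<forall>w\<in>ball p0 \<delta>. R z p = 0 \<and> R w p = 0 \<longrightarrow>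
       \<phi> z \<noteq> 0 \<and> B z w = \<phi> z * cnj (\<phi> w) * R z w"
    "\<And>p. p \<in> ball p0 \<delta> \<Longrightarrow> c p e \<noteq> 0"
proof -
  obtain r1 where r1: "0 < r1" "ball p0 r1 \<subseteq> V" and van: "\<And>z w. z \<in> ball p0 r1 \<Longrightarrow> w \<in> ball p0 r1 \<Longrightarrow> R w z = 0 \<Longrightarrow> B w z = 0"
    using segre_vanishing by blast
  obtain r \<Omega> where r: "0 < r" "ball p0 r \<subseteq> V"
    and \<Omega>1: "\<And>z \<nu>. z \<in> ball p0 r \<Longrightarrow> \<nu> \<in> ball p0 r \<Longrightarrow> \<Omega> (z, \<nu>) \<in> V \<and> pr (\<Omega> (z, \<nu>)) = pr \<nu> \<and> R (\<Omega> (z, \<nu>)) z = c p0 (\<nu> - p0)"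
    and \<Omega>2: "\<And>z w. z \<in> ball p0 r \<Longrightarrow> w \<in> ball p0 r \<Longrightarrow> \<Omega> (z, w + (R w z - c p0 (w - p0)) *s e) = w"
    and \<Omega>3: "\<And>z \<nu>. z \<in> ball p0 r \<Longrightarrow> \<nu> \<in> ball p0 r \<Longrightarrow>
       \<exists>D. (\<Omega> has_derivative D) (at (z, \<nu>)) \<and> (\<forall>a u v. D (cnj a *s u, a *s v) = a *s D (u, v))"
    using segre_implicit_map by blast
  obtain \<kappa> where \<kappa>: "1 \<le> \<kappa>" "\<And>x. norm (pr x) \<le> \<kappa> * norm x" using pr_bound by blast
  define a where "a p z = hf s0 (F0 z) (fd F0 p e)" for p z
  define b where "b p z = hf s1 (F1 z) (fd F1 p e)" for p z
  obtain r3 where r3: "0 < r3" and ab: "\<And>p z. p \<in> ball p0 r3 \<Longrightarrow> z \<in> ball p0 r3 \<Longrightarrow> a p z \<noteq> 0 \<and> b p z \<noteq> 0"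
  proof -
    let ?f = "\<lambda>q. a (fst q) (snd q) * b (fst q) (snd q)"
    note [continuous_intros] = continuous_on_compose2[OF holomorphic_map_continuous[OF F0]] continuous_on_compose2[OF continuous_on_fd[OF V(1) F0]]
       continuous_on_compose2[OF holomorphic_map_continuous[OF F1]] continuous_on_compose2[OF continuous_on_fd[OF V(1) F1]]
    have "continuous_on (V \<times> V) ?f" unfolding a_def b_def by (intro continuous_intros) auto
    then have "open (?f -` (- {0}) \<inter> (V \<times> V))" using V by (subst (asm) continuous_on_open_vimage) (auto intro: open_Times)
    moreover have "(p0, p0) \<in> ?f -` (- {0}) \<inter> (V \<times> V)"
    proof -
      have "a p0 p0 = 1" using e hf.hermitian[of s0 "F0 p0" "fd F0 p0 e"] by (simp add: a_def)
      moreover have "b p0 p0 = of_real (\<tau> p0)"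
        using tau[OF p0M V(2), of e] e hf.hermitian[of s1 "F1 p0" "fd F1 p0 e"] by (simp add: b_def)
      ultimately show ?thesis using V tau_pos[OF p0M V(2)] by auto
    qed
    ultimately obtain A C where AC: "open A" "open C" "p0 \<in> A" "p0 \<in> C" "A \<times> C \<subseteq> ?f -` (- {0}) \<inter> (V \<times> V)" by (elim open_prod_elim) auto
    then have "open (A \<inter> C)" "p0 \<in> A \<inter> C" by auto
    then obtain r where "0 < r" "ball p0 r \<subseteq> A \<inter> C" by (meson open_contains_ball)
    then have "a p z * b p z \<noteq> 0" if "p \<in> ball p0 r" "z \<in> ball p0 r" for p z
      using AC(5) that by (auto simp: subset_iff)
    then show ?thesis using that[of r] \<open>0 < r\<close> by simp
  qed
  obtain r4 where r4: "0 < r4" "cball p0 r4 \<subseteq> V" using V open_contains_cball by blast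
  define r5 where "r5 = min (min r r1) (min r3 r4)"
  have r5: "0 < r5" "r5 \<le> r" "r5 \<le> r1" "r5 \<le> r3" "r5 \<le> r4" using r r1 r3 r4 by (auto simp: r5_def)
  obtain r2 where r2: "0 < r2" "r2 \<le> r5" and \<Omega>r: "\<And>z \<nu>. z \<in> ball p0 r2 \<Longrightarrow> \<nu> \<in> ball p0 r2 \<Longrightarrow> \<Omega> (z, \<nu>) \<in> ball p0 r5"
  proof -
    have eq: "p0 + (R p0 p0 - c p0 (p0 - p0)) *s e = p0" using p0_null by (simp add: c_linear V)
    have "p0 \<in> ball p0 r" using r by simp
    from \<Omega>2[OF this this] have O0: "\<Omega> (p0, p0) = p0" unfolding eq .
    have "isCont \<Omega> (p0, p0)" using \<Omega>3[of p0 p0] r has_derivative_continuous by auto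
    then obtain d where d: "0 < d" "\<And>q. dist q (p0, p0) < d \<Longrightarrow> dist (\<Omega> q) p0 < r5"
      unfolding continuous_at_eps_delta using O0 r5(1) by metis
    show ?thesis
    proof (rule that[of "min r5 (d / 2)"])
      fix z \<nu> assume "z \<in> ball p0 (min r5 (d / 2))" "\<nu> \<in> ball p0 (min r5 (d / 2))"
      then have "dist z p0 < d / 2" "dist \<nu> p0 < d / 2" by (auto simp: dist_commute)
      moreover have "dist (z, \<nu>) (p0, p0) \<le> dist z p0 + dist \<nu> p0"
        unfolding dist_prod_def using sqrt_sum_squares_le_sum[of "dist z p0" "dist \<nu> p0"] by simp
      ultimately show "\<Omega> (z, \<nu>) \<in> ball p0 r5" using d(2)[of "(z, \<nu>)"] by (simp add: dist_commute)
    qed (use r5 d in auto)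
  qed
  define \<rho> where "\<rho> = r2 / (2 * \<kappa>)"
  have \<rho>: "0 < \<rho>" "\<rho> \<le> r2" using r2 \<kappa> by (auto simp: \<rho>_def divide_le_eq mult_le_cancel_left1)
  \<comment> \<open>Each factor \<open>2 * \<kappa>\<close> pays for a sum of two vectors passed
    through \<open>pr\<close>: two vectors of norm below \<open>\<rho>\<close> stay within
    \<open>r2\<close>, and the difference of two points of the ball of radius
    \<open>\<delta>\<close> is projected into the ball of radius \<open>\<rho>\<close>.\<close>
  define \<delta> where "\<delta> = \<rho> / (2 * \<kappa>)"
  have \<delta>: "0 < \<delta>" "\<delta> \<le> \<rho>" using \<rho> \<kappa> by (auto simp: \<delta>_def divide_le_eq mult_le_cancel_left1)
  have ce: "c p e \<noteq> 0" if "p \<in> ball p0 \<delta>" for p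
  proof -
    have "p \<in> ball p0 r3" using that \<delta> \<rho> r2 r5 by auto
    then have "a p p \<noteq> 0" using ab by blast
    then show ?thesis using hf.hermitian[of s0 "F0 p" "fd F0 p e"] by (simp add: a_def c_def)
  qed
  show ?thesis
  proof (rule that[OF \<delta>(1) _ _ ce])
    show "ball p0 \<delta> \<subseteq> V" using \<delta> \<rho> r2 r5 r by (meson dual_order.trans subset_ball)
    fix p assume pM: "p \<in> M" and p\<delta>: "p \<in> ball p0 \<delta>"
    have pr: "p \<in> ball p0 r" "p \<in> ball p0 r1" "p \<in> ball p0 r2" "p \<in> ball p0 r3" using p\<delta> \<delta> \<rho> r2 r5 by auto
    have pV: "p \<in> V" using pr(1) r(2) by blast
    define \<nu> where "\<nu> = p0 + pr (p - p0)"
    have \<nu>in: "\<nu> + pr x \<in> ball p0 r2" if "norm x < \<rho>" for x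
    proof -
      have "norm (pr (p - p0) + pr x) \<le> \<kappa> * norm (p - p0) + \<kappa> * norm x"
        using norm_triangle_ineq[of "pr (p - p0)" "pr x"] \<kappa>(2)[of "p - p0"] \<kappa>(2)[of x] by linarith
      also have "\<dots> < \<kappa> * \<rho> + \<kappa> * \<rho>"
      proof -
        have "norm (p - p0) < \<rho>" using p\<delta> \<delta> by (auto simp: dist_norm norm_minus_commute)
        then show ?thesis using that \<kappa>(1) by (intro add_strict_mono mult_strict_left_mono) auto
      qed
      also have "\<dots> = r2" using \<kappa>(1) by (simp add: \<rho>_def)
      finally have lt: "norm (pr (p - p0) + pr x) < r2" .
      have "p0 - (\<nu> + pr x) = - (pr (p - p0) + pr x)" by (simp add: \<nu>_def)
      then show ?thesis unfolding mem_ball dist_norm using lt by (simp only: norm_minus_cancel)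
    qed
    have \<nu>r2: "\<nu> \<in> ball p0 r2" using \<nu>in[of 0] \<rho> by (simp add: pr_linear)
    have \<nu>r: "\<nu> \<in> ball p0 r" using \<nu>r2 r2 r5 by auto
    define \<psi> where "\<psi> x = \<Omega> (p, \<nu> + pr x)" for x
    let ?A = "ball (0::complex^'m) \<rho>"
    have \<psi>r5: "\<psi> x \<in> ball p0 r5" if "x \<in> ?A" for x
      unfolding \<psi>_def by (rule \<Omega>r[OF pr(3) \<nu>in]) (use that in simp)
    have inr: "\<nu> + pr x \<in> ball p0 r" if "x \<in> ?A" for x using \<nu>in[of x] that r2 r5 by auto
    have Rpp: "R p p = 0" by (rule null0[OF pM pV])
    have c\<nu>: "c p0 (\<nu> + pr x - p0) = 0" for x
    proof -
      have "\<nu> + pr x - p0 = pr (p - p0) + pr x" by (simp add: \<nu>_def)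
      then show ?thesis by (simp only: c_linear(1)[OF V(2)] c_pr add_0)
    qed
    have \<psi>R: "R (\<psi> x) p = 0" if "x \<in> ?A" for x
      using \<Omega>1[OF pr(1) inr[OF that]] c\<nu> by (simp add: \<psi>_def)
    have \<psi>pr: "pr (\<psi> x) = pr (\<nu> + pr x)" if "x \<in> ?A" for x
      using \<Omega>1[OF pr(1) inr[OF that]] by (simp add: \<psi>_def)
    have \<psi>B: "B (\<psi> x) p = 0" if "x \<in> ?A" for x
      by (rule van[OF pr(2) _ \<psi>R[OF that]]) (use \<psi>r5[OF that] r5 in auto)
    have recover: "\<Omega> (p, p0 + pr (z - p0)) = z" if "z \<in> ball p0 r" "R z p = 0" for z
    proof -
      have "z + (R z p - c p0 (z - p0)) *s e = p0 + pr (z - p0)" using that(2) by (simp add: pr_def)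
      then show ?thesis using \<Omega>2[OF pr(1) that(1)] by simp
    qed
    have \<psi>0: "\<psi> x = p" if "pr x = 0" for x
      using recover[OF pr(1) Rpp] that by (simp add: \<psi>_def \<nu>_def)
    have \<psi>hol: "holomorphic_map_on ?A \<psi>"
    proof -
      have "\<exists>D. (\<psi> has_derivative D) (at x) \<and> (\<forall>a v. D (a *s v) = a *s D v)" if x: "x \<in> ?A" for x
      proof -
        obtain D where D: "(\<Omega> has_derivative D) (at (p, \<nu> + pr x))" "\<And>a u v. D (cnj a *s u, a *s v) = a *s D (u, v)"
          using \<Omega>3[OF pr(1) inr[OF x]] by blast
        have d1: "((\<lambda>x. (p, \<nu> + pr x)) has_derivative (\<lambda>v. (0, pr v))) (at x)"
          by (rule derivative_eq_intros bounded_linear.has_derivative[OF bounded_linear_pr] refl | simp)+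
        have "((\<lambda>x. \<Omega> (p, \<nu> + pr x)) has_derivative (\<lambda>v. D (0, pr v))) (at x)"
          by (rule has_derivative_compose[OF d1 D(1)])
        moreover have "D (0, pr (a *s v)) = a *s D (0, pr v)" for a v
          using D(2)[of a 0 "pr v"] by (simp add: pr_linear)
        ultimately show ?thesis unfolding \<psi>_def[abs_def] by blast
      qed
      then have "\<exists>D. \<forall>x\<in>?A. (\<psi> has_derivative D x) (at x) \<and> (\<forall>a v. D x (a *s v) = a *s D x v)" by metis
      then obtain D where "\<forall>x\<in>?A. (\<psi> has_derivative D x) (at x) \<and> (\<forall>a v. D x (a *s v) = a *s D x v)" by blast
      then show ?thesis by (intro holomorphic_map_onI[where D = D]) auto
    qed
    have A0: "0 \<in> ?A" using \<rho> by simp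
    \<comment> \<open>\<open>E\<close> turns out to be the projection along \<open>e\<close> onto
      the kernel of \<open>c p\<close>, the complex tangent space at \<open>p\<close>.\<close>
    define E where "E = fd \<psi> 0"
    have Ed: "(\<psi> has_derivative E) (at 0)" unfolding E_def by (rule holomorphic_map_has_derivative[OF \<psi>hol A0])
    have \<psi>00: "\<psi> 0 = p" by (rule \<psi>0) (simp add: pr_linear)
    have prE: "pr (E x) = pr x" for x
    proof -
      have "((\<lambda>x. pr (\<psi> x)) has_derivative (\<lambda>x. pr (E x))) (at 0)"
        by (rule bounded_linear.has_derivative[OF bounded_linear_pr Ed])
      then have "((\<lambda>x. pr (\<nu> + pr x)) has_derivative (\<lambda>x. pr (E x))) (at 0)"
        by (rule has_derivative_transform_within_open[OF _ open_ball A0 \<psi>pr])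
      moreover have "((\<lambda>x. pr (\<nu> + pr x)) has_derivative (\<lambda>x. pr (0 + pr x))) (at 0)"
        by (intro bounded_linear.has_derivative[OF bounded_linear_pr] has_derivative_add has_derivative_const has_derivative_ident)
      ultimately have "(\<lambda>x. pr (E x)) = (\<lambda>x. pr (0 + pr x))" by (rule has_derivative_unique)
      from fun_cong[OF this, of x] show ?thesis by (simp add: pr_ker)
    qed
    have F0E: "((\<lambda>x. F0 (\<psi> x)) has_derivative (\<lambda>x. fd F0 p (E x))) (at 0)"
      using has_derivative_compose[OF Ed holomorphic_map_has_derivative[OF F0]] \<psi>00 pV by simp
    have cE: "c p (E x) = 0" for x
    proof -
      have "((\<lambda>x. R (\<psi> x) p) has_derivative (\<lambda>x. hf s0 (fd F0 p (E x)) (F0 p))) (at 0)"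
        by (rule bounded_linear.has_derivative[OF bounded_bilinear.bounded_linear_left[OF bounded_bilinear_hf] F0E])
      then have "((\<lambda>x. 0) has_derivative (\<lambda>x. hf s0 (fd F0 p (E x)) (F0 p))) (at 0)"
        by (rule has_derivative_transform_within_open[OF _ open_ball A0 \<psi>R])
      from has_derivative_unique[OF this has_derivative_const] show ?thesis unfolding c_def by meson
    qed
    have cpe: "c p e \<noteq> 0" by (rule ce[OF p\<delta>])
    have Eid: "E u = u" if "c p u = 0" for u
    proof -
      have "pr (E u - u) = 0" by (simp add: pr_linear prE)
      then have eq: "E u - u = c p0 (E u - u) *s e" using pr_line[of "E u - u"] by simp
      have "c p (E u - u) = 0" using that cE by (simp add: c_linear pV)
      then have "c p0 (E u - u) * c p e = 0" by (subst (asm) eq) (simp add: c_linear pV)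
      then show ?thesis using cpe eq by simp
    qed
    \<comment> \<open>A curve through \<open>p\<close> in the Segre variety of \<open>z\<close> has
      a tangent \<open>u + l *s e\<close>. Both \<open>R\<close> and \<open>B\<close> vanish along
      it, which gives two linear equations with the same unknown \<open>l\<close>; eliminating
      \<open>l\<close> leaves this relation.\<close>
    have orth: "b p z * hf s0 (F0 z) (fd F0 p u) = a p z * hf s1 (F1 z) (fd F1 p u)" if z: "z \<in> ball p0 r5" "R z p = 0" for z u
    proof -
      have zr: "z \<in> ball p0 r" "z \<in> ball p0 r1" using z r5 by auto
      have zV: "z \<in> V" using zr r by blast
      have Rpz: "R p z = 0" using z(2) hf.hermitian[of s0 "F0 p" "F0 z"] by simp
      obtain D where D: "(\<Omega> has_derivative D) (at (z, \<nu>))" "\<And>a u v. D (cnj a *s u, a *s v) = a *s D (u, v)"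
        using \<Omega>3[OF zr(1) \<nu>r] by blast
      define w where "w t = \<Omega> (z, \<nu> + t *s pr u)" for t
      have "p + (R p z - c p0 (p - p0)) *s e = \<nu>" using Rpz by (simp add: \<nu>_def pr_def)
      then have w0: "w 0 = p" using \<Omega>2[OF zr(1) pr(1)] by (simp add: w_def)
      have D': "(\<Omega> has_derivative D) (at (z, \<nu> + 0 *s pr u))" using D(1) by simp
      define W where "W = D (0, pr u)"
      have wd: "(w has_derivative (\<lambda>h. h *s W)) (at 0)"
      proof -
        have "(w has_derivative (\<lambda>h. D (0, h *s pr u))) (at 0)"
          unfolding w_def[abs_def]
          by (rule has_derivative_compose[OF has_derivative_Pair[OF has_derivative_const has_derivative_affine_line(1)] D'])
        moreover have "D (0, h *s pr u) = h *s W" for h using D(2)[of h 0 "pr u"] by (simp add: W_def)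
        ultimately show ?thesis by simp
      qed
      obtain \<eta> where \<eta>: "0 < \<eta>" "\<And>t. t \<in> ball 0 \<eta> \<Longrightarrow> \<nu> + t *s pr u \<in> ball p0 r \<and> w t \<in> ball p0 r1"
      proof -
        have "isCont (\<lambda>t. \<nu> + t *s pr u) 0" using has_derivative_continuous[OF has_derivative_affine_line(1)] .
        then have "((\<lambda>t. \<nu> + t *s pr u) \<longlongrightarrow> \<nu>) (at 0)" by (simp add: isCont_def)
        then have 1: "\<forall>\<^sub>F t in at 0. \<nu> + t *s pr u \<in> ball p0 r" using \<nu>r by (intro topological_tendstoD) auto
        have "isCont w 0" using has_derivative_continuous[OF wd] .
        then have "(w \<longlongrightarrow> p) (at 0)" using w0 by (simp add: isCont_def)
        then have 2: "\<forall>\<^sub>F t in at 0. w t \<in> ball p0 r1" using pr by (intro topological_tendstoD) auto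
        from eventually_conj[OF 1 2] obtain d where d: "0 < d" "\<And>t. t \<noteq> 0 \<Longrightarrow> dist t 0 < d \<Longrightarrow> \<nu> + t *s pr u \<in> ball p0 r \<and> w t \<in> ball p0 r1"
          unfolding eventually_at by blast
        have "\<nu> + 0 *s pr u \<in> ball p0 r \<and> w 0 \<in> ball p0 r1" using \<nu>r w0 pr by simp
        then have "\<nu> + t *s pr u \<in> ball p0 r \<and> w t \<in> ball p0 r1" if "t \<in> ball 0 d" for t
          using d(2)[of t] that by (cases "t = 0") (auto simp: dist_commute)
        then show ?thesis using that d(1) by blast
      qed
      have Rw: "R (w t) z = 0" if "t \<in> ball 0 \<eta>" for t
      proof -
        have "\<nu> + t *s pr u = \<nu> + pr (t *s u)" by (simp add: pr_linear)
        then have "c p0 (\<nu> + t *s pr u - p0) = 0" using c\<nu> by simp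
        then show ?thesis using \<Omega>1[OF zr(1) conjunct1[OF \<eta>(2)[OF that]]] by (simp add: w_def)
      qed
      have Bw: "B (w t) z = 0" if "t \<in> ball 0 \<eta>" for t
        by (rule van[OF zr(2) conjunct2[OF \<eta>(2)[OF that]] Rw[OF that]])
      have t0: "0 \<in> ball (0::complex) \<eta>" using \<eta> by simp
      have W0: "hf s0 (fd F0 p W) (F0 z) = 0"
      proof -
        have "((\<lambda>t. F0 (w t)) has_derivative (\<lambda>h. fd F0 p (h *s W))) (at 0)"
          using has_derivative_compose[OF wd holomorphic_map_has_derivative[OF F0]] w0 pV by simp
        then have "((\<lambda>t. R (w t) z) has_derivative (\<lambda>h. hf s0 (fd F0 p (h *s W)) (F0 z))) (at 0)"
          by (rule bounded_linear.has_derivative[OF bounded_bilinear.bounded_linear_left[OF bounded_bilinear_hf]])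
        then have "((\<lambda>t. 0) has_derivative (\<lambda>h. hf s0 (fd F0 p (h *s W)) (F0 z))) (at 0)"
          by (rule has_derivative_transform_within_open[OF _ open_ball t0 Rw])
        from fun_cong[OF has_derivative_unique[OF this has_derivative_const], of 1] show ?thesis by simp
      qed
      have W1: "hf s1 (fd F1 p W) (F1 z) = 0"
      proof -
        have "((\<lambda>t. F1 (w t)) has_derivative (\<lambda>h. fd F1 p (h *s W))) (at 0)"
          using has_derivative_compose[OF wd holomorphic_map_has_derivative[OF F1]] w0 pV by simp
        then have "((\<lambda>t. B (w t) z) has_derivative (\<lambda>h. hf s1 (fd F1 p (h *s W)) (F1 z))) (at 0)"
          by (rule bounded_linear.has_derivative[OF bounded_bilinear.bounded_linear_left[OF bounded_bilinear_hf]])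
        then have "((\<lambda>t. 0) has_derivative (\<lambda>h. hf s1 (fd F1 p (h *s W)) (F1 z))) (at 0)"
          by (rule has_derivative_transform_within_open[OF _ open_ball t0 Bw])
        from fun_cong[OF has_derivative_unique[OF this has_derivative_const], of 1] show ?thesis by simp
      qed
      have prW: "pr W = pr u"
      proof -
        have "((\<lambda>t. pr (w t)) has_derivative (\<lambda>h. pr (h *s W))) (at 0)"
          by (rule bounded_linear.has_derivative[OF bounded_linear_pr wd])
        then have "((\<lambda>t. pr (\<nu> + t *s pr u)) has_derivative (\<lambda>h. pr (h *s W))) (at 0)"
          by (rule has_derivative_transform_within_open[OF _ open_ball t0]) (use \<Omega>1[OF zr(1)] \<eta>(2) in \<open>simp add: w_def\<close>)
        moreover have "((\<lambda>t. pr (\<nu> + t *s pr u)) has_derivative (\<lambda>h. pr (h *s pr u))) (at 0)"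
          by (rule bounded_linear.has_derivative[OF bounded_linear_pr has_derivative_affine_line(1)])
        ultimately have "(\<lambda>h. pr (h *s W)) = (\<lambda>h. pr (h *s pr u))" by (rule has_derivative_unique)
        from fun_cong[OF this, of 1] show ?thesis by (simp add: pr_ker)
      qed
      define l where "l = c p0 (W - u)"
      have "W = u + l *s e" using pr_line[of "W - u"] prW by (simp add: pr_linear l_def algebra_simps)
      then have "hf s0 (fd F0 p u) (F0 z) + l * hf s0 (fd F0 p e) (F0 z) = 0" "hf s1 (fd F1 p u) (F1 z) + l * hf s1 (fd F1 p e) (F1 z) = 0"
        using W0 W1 by (simp_all add: fd_add[OF F0 pV] fd_scale[OF F0 pV] fd_add[OF F1 pV] fd_scale[OF F1 pV] hf.add_left hf.scale_left)
      then have "cnj (hf s0 (fd F0 p u) (F0 z) + l * hf s0 (fd F0 p e) (F0 z)) = 0" "cnj (hf s1 (fd F1 p u) (F1 z) + l * hf s1 (fd F1 p e) (F1 z)) = 0"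
        by simp_all
      then have "hf s0 (F0 z) (fd F0 p u) + cnj l * a p z = 0" "hf s1 (F1 z) (fd F1 p u) + cnj l * b p z = 0"
        by (simp_all only: complex_cnj_add complex_cnj_mult hf.hermitian[symmetric] a_def b_def)
      then show ?thesis by (simp add: add_eq_0_iff2 mult.commute mult.left_commute)
    qed
    define \<sigma> where "\<sigma> = case_sum (\<lambda>i. \<tau> p * s1 i) (\<lambda>i. - s0 i)"
    have tp: "\<tau> p > 0" by (rule tau_pos[OF pM pV])
    have h\<sigma>: "hf \<sigma> (join x y) (join x' y') = of_real (\<tau> p) * hf s1 x x' - hf s0 y y'" for x y x' y'
      by (simp add: \<sigma>_def hf_join hf_scale hf_uminus)
    \<comment> \<open>The weights \<open>a p z\<close> and \<open>b p z\<close> are interchanged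
      between the two components so that \<open>orth\<close> says exactly that
      \<open>\<Gamma> z\<close> is orthogonal to the vectors \<open>T u\<close> below.\<close>
    define \<Gamma> where "\<Gamma> z = join (a p z *s F1 z) (b p z *s F0 z)" for z
    define G where "G x = \<Gamma> (\<psi> x)" for x
    have \<Gamma>hol: "holomorphic_map_on V \<Gamma>"
      unfolding \<Gamma>_def a_def b_def by (intro holomorphic_map_join holomorphic_map_hf_scale F0 F1)
    have \<psi>V: "\<psi> x \<in> V" if "x \<in> ?A" for x using \<psi>r5[OF that] r5 r by auto
    have Ghol: "holomorphic_map_on ?A G" unfolding G_def by (rule holomorphic_map_compose(1)[OF \<Gamma>hol \<psi>hol \<psi>V])
    have F0hol: "holomorphic_map_on ?A (\<lambda>x. F0 (\<psi> x))" by (rule holomorphic_map_compose(1)[OF F0 \<psi>hol \<psi>V])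
    have bnd: "\<exists>C. \<forall>x\<in>?A. \<forall>y\<in>?A. cmod (hf s (H (\<psi> x)) (H (\<psi> y))) \<le> C" if H: "holomorphic_map_on V H" for s and H :: "complex^'m \<Rightarrow> complex^'k"
    proof -
      have "bounded (H ` cball p0 r4)"
        by (intro compact_imp_bounded compact_continuous_image continuous_on_subset[OF holomorphic_map_continuous[OF H] r4(2)] compact_cball)
      then obtain C where C: "\<And>z. z \<in> cball p0 r4 \<Longrightarrow> norm (H z) \<le> C" unfolding bounded_iff by blast
      obtain K where K: "0 \<le> K" "\<And>x y. norm (hf s x y) \<le> norm x * norm y * K"
        using bounded_bilinear.nonneg_bounded[OF bounded_bilinear_hf] by blast
      have C\<psi>: "norm (H (\<psi> x)) \<le> C" if "x \<in> ?A" for x using C \<psi>r5[OF that] r5 by auto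
      have "cmod (hf s (H (\<psi> x)) (H (\<psi> y))) \<le> C * C * K" if "x \<in> ?A" "y \<in> ?A" for x y
        using K(2)[of "H (\<psi> x)" "H (\<psi> y)"] mult_mono[OF C\<psi>[OF that(1)] C\<psi>[OF that(2)]] K(1)
        by (meson dual_order.trans mult_right_mono norm_ge_zero C\<psi> that)
      then show ?thesis by blast
    qed
    obtain C where C: "\<forall>x\<in>?A. \<forall>y\<in>?A. cmod (hf \<sigma> (G x) (G y)) \<le> C" using bnd[OF \<Gamma>hol, of \<sigma>] unfolding G_def by blast
    obtain C' where C': "\<forall>x\<in>?A. \<forall>y\<in>?A. cmod (R (\<psi> x) (\<psi> y)) \<le> C'" using bnd[OF F0, of s0] by blast
    define k where "k x y = hf \<sigma> (G x) (G y)" for x y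
    have kgerm: "sesqui_germ k \<rho> C"
      unfolding k_def by unfold_locales (use \<rho> C sesqui_holomorphic_hf[OF Ghol Ghol] in auto)
    have \<rho>germ: "sesqui_germ (\<lambda>x y. R (\<psi> x) (\<psi> y)) \<rho> C'"
      by unfold_locales (use \<rho> C' sesqui_holomorphic_hf[OF F0hol F0hol] in auto)
    have k_eq: "k x y = of_real (\<tau> p) * (a p (\<psi> x) * cnj (a p (\<psi> y)) * B (\<psi> x) (\<psi> y)) - b p (\<psi> x) * cnj (b p (\<psi> y)) * R (\<psi> x) (\<psi> y)" for x y
      by (simp add: k_def G_def \<Gamma>_def h\<sigma> hf.scale_left hf.scale_right)
    define L where "L x y = hf s0 (fd F0 p (E x)) (fd F0 p (E y))" for x y
    have herm: "hermitian_form L"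
      by unfold_locales (auto simp: L_def E_def fd_add[OF \<psi>hol A0] fd_scale[OF \<psi>hol A0] fd_add[OF F0 pV] fd_scale[OF F0 pV] hf.add_left hf.scale_left intro: hf.hermitian)
    obtain P where P: "vec.subspace P" "Suc q \<le> vec.dim P" "\<And>u. u \<in> P \<Longrightarrow> c p u = 0" "\<And>u. u \<in> P \<Longrightarrow> u \<noteq> 0 \<Longrightarrow> Re (hf s0 (fd F0 p u) (fd F0 p u)) > 0"
      using levi_pos[OF pM pV] unfolding c_def by blast
    obtain N where N: "vec.subspace N" "Suc q \<le> vec.dim N" "\<And>u. u \<in> N \<Longrightarrow> c p u = 0" "\<And>u. u \<in> N \<Longrightarrow> u \<noteq> 0 \<Longrightarrow> Re (hf s0 (fd F0 p u) (fd F0 p u)) < 0"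
      using levi_neg[OF pM pV] unfolding c_def by blast
    have LP: "\<forall>x\<in>P. x \<noteq> 0 \<longrightarrow> Re (L x x) > 0" using P(3,4) Eid by (auto simp: L_def)
    have LN: "\<forall>x\<in>N. x \<noteq> 0 \<longrightarrow> Re (L x x) < 0" using N(3,4) Eid by (auto simp: L_def)
    have lim: "((\<lambda>\<epsilon>. R (\<psi> (of_real \<epsilon> *s x)) (\<psi> (of_real \<epsilon> *s y)) / of_real \<epsilon> ^ 2) \<longlongrightarrow> L x y) (at_right 0)" for x y
    proof -
      have "fd (\<lambda>x. F0 (\<psi> x)) 0 = (\<lambda>x. fd F0 p (E x))" by (rule fd_eq[OF F0E])
      then show ?thesis
        using hf_second_difference[OF F0hol A0 _ open_ball, of s0 x y] \<psi>R by (simp add: L_def \<psi>00)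
    qed
    have deg: "k x y = 0" if "x \<in> ?A" "y \<in> ?A" "\<forall>x. L x y = 0" for x y
    proof -
      have "E y = 0"
      proof (rule levi_nondeg[OF pM pV])
        show "hf s0 (fd F0 p (E y)) (F0 p) = 0" using cE[of y] by (simp add: c_def)
        fix v assume "hf s0 (fd F0 p v) (F0 p) = 0"
        then have "E v = v" by (intro Eid) (simp add: c_def)
        then have "hf s0 (fd F0 p v) (fd F0 p (E y)) = 0" using that(3) by (metis L_def)
        then show "hf s0 (fd F0 p (E y)) (fd F0 p v) = 0" using hf.hermitian[of s0 "fd F0 p (E y)" "fd F0 p v"] by simp
      qed
      then have "pr y = 0" using prE[of y] by (simp add: pr_linear)
      then have "\<psi> y = p" by (rule \<psi>0)
      then show ?thesis using \<psi>R[OF that(1)] \<psi>B[OF that(1)] by (simp add: k_eq)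
    qed
    have kvan: "k x y = 0" if "x \<in> ?A" "y \<in> ?A" "R (\<psi> x) (\<psi> y) = 0" for x y
    proof -
      have "B (\<psi> x) (\<psi> y) = 0" by (rule van[OF _ _ that(3)]) (use \<psi>r5[OF that(1)] \<psi>r5[OF that(2)] r5 in auto)
      then show ?thesis using that(3) by (simp add: k_eq)
    qed
    \<comment> \<open>The factor \<open>1 / \<tau> p\<close> makes these vectors isotropic: by
      \<open>levi\<close> the first component contributes to \<open>hf \<sigma>\<close> what the
      second one subtracts.\<close>
    define T where "T u = join ((1 / of_real (\<tau> p)) *s fd F1 p u) (fd F0 p u)" for u
    define H where "H = {u. c p u = 0}"
    define J1 where "J1 = join (F1 p) (0 :: complex^'a)"
    define J0 where "J0 = join (0 :: complex^'b) (F0 p)"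
    define gen where "gen = insert J0 (insert J1 (T ` H))"
    have F0p: "F0 p \<noteq> 0" using cpe by (auto simp: c_def)
    have F1p: "F1 p \<noteq> 0" using tau[OF pM pV, of e] cpe tp by (auto simp: c_def)
    have Hsub: "vec.subspace H" and Hdim: "CARD('m) \<le> vec.dim H + 1"
    proof -
      have "H = {u\<in>UNIV. c p u = 0}" by (simp add: H_def)
      then show "vec.subspace H" "CARD('m) \<le> vec.dim H + 1"
        using dim_kernel_functional[of UNIV "c p"] by (auto simp: c_linear pV vec.subspace_UNIV vec.dim_UNIV vec_dim_card card_cart_basis)
    qed
    have TL: "Vector_Spaces.linear (*s) (*s) T"
      unfolding Vector_Spaces.linear_iff
      by (auto simp: vec.vector_space_axioms T_def fd_add[OF F0 pV] fd_scale[OF F0 pV] fd_add[OF F1 pV] fd_scale[OF F1 pV] join_add join_scale vector_add_ldistrib vec.scale_scale mult.commute)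
    interpret T: Vector_Spaces.linear "(*s)" "(*s)" T by (rule TL)
    have inj0: "u = 0" if "c p u = 0" "\<And>v. c p v = 0 \<Longrightarrow> hf s0 (fd F0 p u) (fd F0 p v) = 0" for u
      by (rule levi_nondeg[OF pM pV]) (use that in \<open>auto simp: c_def\<close>)
    have Tsub: "vec.subspace (T ` H)" by (rule T.subspace_image[OF Hsub])
    have Tinj: "inj_on T H"
    proof (rule inj_onI)
      fix u v assume uv: "u \<in> H" "v \<in> H" "T u = T v"
      then have "fd F0 p (u - v) = 0" by (simp add: T_def join_eq_iff fd_diff[OF F0 pV])
      then have "u - v = 0" using uv by (intro inj0) (auto simp: H_def c_linear pV)
      then show "u = v" by simp
    qed
    have dimT: "vec.dim (T ` H) = vec.dim H"
      using Tinj by (intro vec.dim_image_eq TL) (simp only: vec.span_eq_iff[THEN iffD2, OF Hsub])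
    have J1n: "J1 \<notin> vec.span (T ` H)"
    proof
      assume "J1 \<in> vec.span (T ` H)"
      then have "J1 \<in> T ` H" unfolding vec.span_eq_iff[THEN iffD2, OF Tsub] .
      then obtain u where u: "u \<in> H" "J1 = T u" by blast
      then have "fd F0 p u = 0" "F1 p = (1 / of_real (\<tau> p)) *s fd F1 p u" by (auto simp: J1_def T_def join_eq_iff)
      then have "u = 0" using u by (intro inj0) (auto simp: H_def)
      then show False using u(2) F1p T.zero by (simp add: J1_def join_0[symmetric] join_eq_iff)
    qed
    have J0n: "J0 \<notin> vec.span (insert J1 (T ` H))"
    proof
      assume "J0 \<in> vec.span (insert J1 (T ` H))"
      then obtain k where "J0 - k *s J1 \<in> vec.span (T ` H)" using vec.span_breakdown_eq by blast
      then have "J0 - k *s J1 \<in> T ` H" unfolding vec.span_eq_iff[THEN iffD2, OF Tsub] .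
      then obtain u where u: "u \<in> H" "J0 - k *s J1 = T u" by blast
      then have "J0 = T u + k *s J1" by (simp add: algebra_simps)
      then have "F0 p = fd F0 p u" by (simp add: J0_def J1_def T_def join_eq_iff join_scale join_add)
      moreover have "u = 0"
      proof (rule inj0)
        show "c p u = 0" using u by (simp add: H_def)
        fix v assume "c p v = 0"
        then have "hf s0 (F0 p) (fd F0 p v) = 0" using hf.hermitian[of s0 "F0 p" "fd F0 p v"] by (simp add: c_def)
        then show "hf s0 (fd F0 p u) (fd F0 p v) = 0" using \<open>F0 p = fd F0 p u\<close> by simp
      qed
      ultimately show False using F0p by (simp add: fd_zero[OF F0 pV])
    qed
    have dimE: "CARD('m) + 1 \<le> vec.dim (vec.span gen)"
    proof -
      have "vec.dim (insert J1 (T ` H)) = vec.dim (T ` H) + 1" using J1n by (simp add: vec.dim_insert)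
      moreover have "vec.dim gen = vec.dim (insert J1 (T ` H)) + 1" unfolding gen_def using J0n by (simp add: vec.dim_insert)
      ultimately show ?thesis using Hdim dimT by simp
    qed
    have Bpp: "B p p = 0" by (rule null1[OF pM pV])
    have F1H: "hf s1 (fd F1 p u) (F1 p) = 0" "hf s0 (fd F0 p u) (F0 p) = 0" "hf s1 (F1 p) (fd F1 p u) = 0" "hf s0 (F0 p) (fd F0 p u) = 0" if "u \<in> H" for u
      using that tau[OF pM pV, of u] hf.hermitian[of s1 "F1 p" "fd F1 p u"] hf.hermitian[of s0 "F0 p" "fd F0 p u"] by (auto simp: H_def c_def)
    have iso_gen: "\<forall>x\<in>gen. \<forall>y\<in>gen. hf \<sigma> x y = 0"
    proof -
      have "hf \<sigma> (T u) (T v) = 0" if "u \<in> H" "v \<in> H" for u v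
        using levi[OF pM pV F1H(2)[OF that(1)] F1H(2)[OF that(2)]] tp by (simp add: T_def h\<sigma> hf.scale_left hf.scale_right)
      then show ?thesis
        unfolding gen_def J0_def J1_def using F1H Rpp Bpp by (auto simp: h\<sigma> T_def hf.scale_left hf.scale_right)
    qed
    have orth_gen: "hf \<sigma> (G x) y = 0" if "x \<in> ?A" "y \<in> gen" for x y
    proof -
      have "hf \<sigma> (G x) (T u) = 0" for u
        using orth[OF \<psi>r5[OF that(1)] \<psi>R[OF that(1)], of u] tp by (simp add: G_def \<Gamma>_def T_def h\<sigma> hf.scale_left hf.scale_right)
      then show ?thesis
        using that(2) \<psi>R[OF that(1)] \<psi>B[OF that(1)] unfolding gen_def J0_def J1_def by (auto simp: G_def \<Gamma>_def h\<sigma> hf.scale_left)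
    qed
    have npos: "\<exists>d. (\<exists>a<Suc q. d a \<noteq> 0) \<and> Re (\<Sum>a<Suc q. \<Sum>b<Suc q. d a * cnj (d b) *
        (k (s a) (s b) + cnj (\<beta> b) * k (s a) (t b) + \<beta> a * k (t a) (s b) + \<beta> a * cnj (\<beta> b) * k (t a) (t b))) \<le> 0"
      if st: "\<forall>a<Suc q. s a \<in> ?A \<and> t a \<in> ?A" for s t \<beta>
    proof (rule ccontr)
      assume neg: "\<not> ?thesis"
      \<comment> \<open>The matrix in question is the Gram matrix of these \<open>Suc q\<close>
        vectors. Were it positive definite, they and the isotropic span of \<open>gen\<close>, to
        which they are orthogonal, would need more positive squares than \<open>signs\<close>
        provides.\<close>
      define Y where "Y a = G (s a) + \<beta> a *s G (t a)" for a
      have val: "hf \<sigma> (\<Sum>a<Suc q. d a *s Y a) (\<Sum>a<Suc q. d a *s Y a) = (\<Sum>a<Suc q. \<Sum>b<Suc q. d a * cnj (d b) *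
        (k (s a) (s b) + cnj (\<beta> b) * k (s a) (t b) + \<beta> a * k (t a) (s b) + \<beta> a * cnj (\<beta> b) * k (t a) (t b)))" for d
      proof -
        have inner: "hf \<sigma> (d a *s Y a) (d b *s Y b) = d a * cnj (d b) *
        (k (s a) (s b) + cnj (\<beta> b) * k (s a) (t b) + \<beta> a * k (t a) (s b) + \<beta> a * cnj (\<beta> b) * k (t a) (t b))" for a b
          by (simp add: Y_def k_def hf.add_left hf.add_right hf.scale_left hf.scale_right algebra_simps)
        have "hf \<sigma> (\<Sum>a<Suc q. d a *s Y a) (\<Sum>a<Suc q. d a *s Y a) = (\<Sum>a<Suc q. hf \<sigma> (d a *s Y a) (\<Sum>a<Suc q. d a *s Y a))"
          by (rule hf.sum_left)
        also have "\<dots> = (\<Sum>a<Suc q. \<Sum>b<Suc q. hf \<sigma> (d a *s Y a) (d b *s Y b))"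
          by (intro sum.cong refl hf.sum_right)
        finally show ?thesis unfolding inner .
      qed
      have "vec.dim (vec.span gen) + Suc q \<le> card {i. \<sigma> i > 0}"
      proof (rule isotropic_plus_positive_le)
        show "\<forall>i. \<sigma> i \<noteq> 0" using s0 s1 tp by (auto simp: \<sigma>_def split: sum.split)
        show "\<forall>x\<in>vec.span gen. \<forall>y\<in>vec.span gen. hf \<sigma> x y = 0" using hf.span_orthogonal[OF iso_gen] by blast
        show "\<forall>a<Suc q. \<forall>x\<in>vec.span gen. hf \<sigma> (Y a) x = 0"
        proof (intro allI impI ballI)
          fix a x assume a: "a < Suc q" and x: "x \<in> vec.span gen"
          have "hf \<sigma> (G (s a)) x = 0"
            by (rule hf.span_orthogonal[of "{G (s a)}" gen]) (use orth_gen st a x in \<open>auto intro: vec.span_base\<close>)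
          moreover have "hf \<sigma> (G (t a)) x = 0"
            by (rule hf.span_orthogonal[of "{G (t a)}" gen]) (use orth_gen st a x in \<open>auto intro: vec.span_base\<close>)
          ultimately show "hf \<sigma> (Y a) x = 0" by (simp add: Y_def hf.add_left hf.scale_left)
        qed
        show "\<forall>d. (\<exists>a<Suc q. d a \<noteq> 0) \<longrightarrow> 0 < Re (hf \<sigma> (\<Sum>a<Suc q. d a *s Y a) (\<Sum>a<Suc q. d a *s Y a))"
          unfolding val using neg by (meson linorder_not_le)
      qed (rule vec.subspace_span)
      moreover have "card {i. \<sigma> i > 0} = card {i. s1 i > 0} + card {i. s0 i < 0}"
        unfolding \<sigma>_def card_pos_case_sum using tp by (simp add: zero_less_mult_iff)
      ultimately show False using dimE signs by linarith
    qed
    have k0: "k x y = 0" if "x \<in> ?A" "y \<in> ?A" for x y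
      by (rule sesqui_vanishing[OF herm P(1) LP P(2) N(1) LN N(2) kgerm \<rho>germ _ lim kvan deg npos that])
        (simp_all add: k_def hf.hermitian[symmetric])
    have main: "of_real (\<tau> p) * (a p z * cnj (a p w) * B z w) = b p z * cnj (b p w) * R z w"
      if zw: "z \<in> ball p0 \<delta>" "w \<in> ball p0 \<delta>" "R z p = 0" "R w p = 0" for z w
    proof -
      have *: "\<psi> (pr (z - p)) = z \<and> pr (z - p) \<in> ?A" if z: "z \<in> ball p0 \<delta>" "R z p = 0" for z
      proof -
        have "\<nu> + pr (pr (z - p)) = p0 + pr (z - p0)" by (simp add: \<nu>_def pr_ker pr_linear)
        moreover have "z \<in> ball p0 r" using z(1) \<delta> \<rho> r2 r5 by auto
        ultimately have "\<psi> (pr (z - p)) = z" using recover z(2) by (simp add: \<psi>_def)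
        moreover have "norm (pr (z - p)) < \<rho>"
        proof -
          have "norm (z - p) < \<delta> + \<delta>"
            using z(1) p\<delta> dist_triangle_less_add[of z p0 \<delta> p \<delta>] by (simp add: dist_norm norm_minus_commute)
          then have "\<kappa> * norm (z - p) < \<kappa> * (\<delta> + \<delta>)" using \<kappa>(1) by (intro mult_strict_left_mono) auto
          also have "\<dots> = \<rho>" using \<kappa>(1) by (simp add: \<delta>_def)
          finally show ?thesis using \<kappa>(2)[of "z - p"] by linarith
        qed
        ultimately show ?thesis by simp
      qed
      show ?thesis using k0[of "pr (z - p)" "pr (w - p)"] *[OF zw(1,3)] *[OF zw(2,4)] by (simp add: k_eq)
    qed
    \<comment> \<open>The positive real \<open>\<tau> p\<close> is split as a square so that the
      factor becomes a product \<open>\<phi> z * cnj (\<phi> w)\<close>.\<close>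
    define \<phi> where "\<phi> z = b p z / (of_real (sqrt (\<tau> p)) * a p z)" for z
    have "\<phi> z \<noteq> 0 \<and> B z w = \<phi> z * cnj (\<phi> w) * R z w"
      if zw: "z \<in> ball p0 \<delta>" "w \<in> ball p0 \<delta>" "R z p = 0" "R w p = 0" for z w
    proof -
      have nz: "a p z \<noteq> 0" "b p z \<noteq> 0" "a p w \<noteq> 0" using ab[OF pr(4)] zw \<delta> \<rho> r2 r5 by (auto simp: subset_iff)
      have sq: "complex_of_real (sqrt (\<tau> p)) * complex_of_real (sqrt (\<tau> p)) = of_real (\<tau> p)" using tp by (simp flip: of_real_mult)
      have t0: "complex_of_real (\<tau> p) \<noteq> 0" using tp by simp
      have "\<phi> z * cnj (\<phi> w) * R z w = b p z * cnj (b p w) * R z w / ((of_real (sqrt (\<tau> p)) * of_real (sqrt (\<tau> p))) * (a p z * cnj (a p w)))"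
        by (simp add: \<phi>_def)
      also have "\<dots> = B z w" unfolding sq main[OF zw, symmetric] using t0 nz by simp
      finally show ?thesis using nz tp by (simp add: \<phi>_def)
    qed
    then show "\<exists>\<phi>. \<forall>z\<in>ball p0 \<delta>. \<forall>w\<in>ball p0 \<delta>. R z p = 0 \<and> R w p = 0 \<longrightarrow> \<phi> z \<noteq> 0 \<and> B z w = \<phi> z * cnj (\<phi> w) * R z w"
      by blast
  qed
qed

end

section \<open>From the factorization on Segre varieties to the span of the image\<close>

lemma holomorphic_map_const: "holomorphic_map_on V (\<lambda>x. w)"
  by (rule holomorphic_map_onI[where D = "\<lambda>x v. 0"]) auto

lemma sesqui_holomorphic_mult:
  "sesqui_holomorphic_on A f \<Longrightarrow> sesqui_holomorphic_on A g \<Longrightarrow> sesqui_holomorphic_on A (\<lambda>x y. f x y * g x y)"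
  unfolding sesqui_holomorphic_on_def by (auto intro: holomorphic_on_mult)

lemma sesqui_holomorphic_diff:
  "sesqui_holomorphic_on A f \<Longrightarrow> sesqui_holomorphic_on A g \<Longrightarrow> sesqui_holomorphic_on A (\<lambda>x y. f x y - g x y)"
  unfolding sesqui_holomorphic_on_def by (auto intro: holomorphic_on_diff)

text \<open>The derivative of \<open>\<rho>\<close> is prescribed at \<open>p0\<close> only and
  elsewhere continuity is asked for; this matches the open mapping theorem applied in
  \<open>span_bound\<close>.\<close>

locale segre_hypersurface = segre_pair +
  fixes \<rho> :: "complex^'c \<Rightarrow> real" and W :: "(complex^'c) set" and \<kappa> :: real
  assumes W: "open W" "p0 \<in> W" and M_W: "M \<inter> W = {x\<in>W. \<rho> x = 0}" and \<rho>_cont: "continuous_on W \<rho>"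
    and \<rho>_der: "(\<rho> has_derivative (\<lambda>v. \<kappa> * Re (hf s0 (fd F0 p0 v) (F0 p0)))) (at p0)" and \<kappa>: "\<kappa> \<noteq> 0"
begin

text \<open>Take \<open>\<Omega>\<close> along the line in direction \<open>v\<close>. Its velocity
  has the same image under \<open>pr\<close> as \<open>v\<close>, and it is annihilated by
  \<open>c p0\<close> because \<open>R\<close> vanishes along the curve; these two data determine
  it.\<close>

lemma segre_curve:
  assumes v: "c p0 v = 0"
  shows "\<exists>z r. 0 < r \<and> (\<forall>t. cmod t < r \<longrightarrow> R (z t) p0 = 0) \<and> z 0 = p0 \<and> (z has_derivative (\<lambda>h. h *s v)) (at (0::complex))"
proof -
  obtain r \<Omega> where r: "0 < r" "ball p0 r \<subseteq> V"
    and \<Omega>1: "\<And>z \<nu>. z \<in> ball p0 r \<Longrightarrow> \<nu> \<in> ball p0 r \<Longrightarrow> \<Omega> (z, \<nu>) \<in> V \<and> pr (\<Omega> (z, \<nu>)) = pr \<nu> \<and> R (\<Omega> (z, \<nu>)) z = c p0 (\<nu> - p0)"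
    and \<Omega>2: "\<And>z w. z \<in> ball p0 r \<Longrightarrow> w \<in> ball p0 r \<Longrightarrow> \<Omega> (z, w + (R w z - c p0 (w - p0)) *s e) = w"
    and \<Omega>3: "\<And>z \<nu>. z \<in> ball p0 r \<Longrightarrow> \<nu> \<in> ball p0 r \<Longrightarrow>
       \<exists>D. (\<Omega> has_derivative D) (at (z, \<nu>)) \<and> (\<forall>a u v. D (cnj a *s u, a *s v) = a *s D (u, v))"
    using segre_implicit_map by blast
  have p0: "p0 \<in> ball p0 r" using r by simp
  obtain D where D: "(\<Omega> has_derivative D) (at (p0, p0))" "\<And>a u v. D (cnj a *s u, a *s v) = a *s D (u, v)"
    using \<Omega>3[OF p0 p0] by blast
  define z where "z t = \<Omega> (p0, p0 + t *s v)" for t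
  define r' where "r' = r / (norm v + 1)"
  have r': "0 < r'" using r by (simp add: r'_def add_nonneg_pos)
  have inb: "p0 + t *s v \<in> ball p0 r" if "cmod t < r'" for t
  proof -
    have "cmod t * (norm v + 1) < r" using that by (simp add: r'_def pos_less_divide_eq add_nonneg_pos)
    then have "cmod t * norm v < r" using norm_ge_zero[of t] unfolding distrib_left mult_1_right by linarith
    then show ?thesis by (simp add: dist_norm norm_smult)
  qed
  have eq: "p0 + (R p0 p0 - c p0 (p0 - p0)) *s e = p0" using p0_null by (simp add: c_linear V)
  have z0: "z 0 = p0" using \<Omega>2[OF p0 p0] unfolding eq by (simp add: z_def)
  have Rz: "R (z t) p0 = 0" if "cmod t < r'" for t
    using \<Omega>1[OF p0 inb[OF that]] v by (simp add: z_def c_linear V)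
  define Wv where "Wv = D (0, v)"
  have D': "(\<Omega> has_derivative D) (at (p0, p0 + 0 *s v))" using D(1) by simp
  have zd: "(z has_derivative (\<lambda>h. h *s Wv)) (at 0)"
  proof -
    have "(z has_derivative (\<lambda>h. D (0, h *s v))) (at 0)"
      unfolding z_def[abs_def]
      by (rule has_derivative_compose[OF has_derivative_Pair[OF has_derivative_const has_derivative_affine_line(1)] D'])
    moreover have "D (0, h *s v) = h *s Wv" for h using D(2)[of h 0 v] by (simp add: Wv_def)
    ultimately show ?thesis by simp
  qed
  have t0: "0 \<in> ball (0::complex) r'" using r' by simp
  have "pr Wv = pr v"
  proof -
    have "((\<lambda>t. pr (z t)) has_derivative (\<lambda>h. pr (h *s Wv))) (at 0)"
      by (rule bounded_linear.has_derivative[OF bounded_linear_pr zd])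
    then have "((\<lambda>t. pr (p0 + t *s v)) has_derivative (\<lambda>h. pr (h *s Wv))) (at 0)"
      by (rule has_derivative_transform_within_open[OF _ open_ball t0]) (use \<Omega>1[OF p0 inb] in \<open>simp add: z_def\<close>)
    moreover have "((\<lambda>t. pr (p0 + t *s v)) has_derivative (\<lambda>h. pr (h *s v))) (at 0)"
      by (rule bounded_linear.has_derivative[OF bounded_linear_pr has_derivative_affine_line(1)])
    ultimately have "(\<lambda>h. pr (h *s Wv)) = (\<lambda>h. pr (h *s v))" by (rule has_derivative_unique)
    from fun_cong[OF this, of 1] show ?thesis by simp
  qed
  moreover have "c p0 Wv = 0"
  proof -
    have "((\<lambda>t. F0 (z t)) has_derivative (\<lambda>h. fd F0 p0 (h *s Wv))) (at 0)"
      using has_derivative_compose[OF zd holomorphic_map_has_derivative[OF F0]] z0 V by simp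
    then have "((\<lambda>t. R (z t) p0) has_derivative (\<lambda>h. hf s0 (fd F0 p0 (h *s Wv)) (F0 p0))) (at 0)"
      by (rule bounded_linear.has_derivative[OF bounded_bilinear.bounded_linear_left[OF bounded_bilinear_hf]])
    then have "((\<lambda>t. 0) has_derivative (\<lambda>h. hf s0 (fd F0 p0 (h *s Wv)) (F0 p0))) (at 0)"
      by (rule has_derivative_transform_within_open[OF _ open_ball t0]) (simp add: Rz)
    from fun_cong[OF has_derivative_unique[OF this has_derivative_const], of 1] show ?thesis by (simp add: c_def)
  qed
  ultimately have "Wv = v" using v by (simp add: pr_ker)
  then show ?thesis using r' Rz z0 zd by blast
qed

text \<open>If \<open>R(z, p) = R(z\<^sub>2, p) = 0\<close> for some \<open>p \<in> M\<close> then the factorization of \<open>B\<close> on the Segre variety of \<open>p\<close> gives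
  \<open>\<bar>B(z, z\<^sub>2)\<bar>\<^sup>2 R(z, z) R(z\<^sub>2, z\<^sub>2) = B(z, z) B(z\<^sub>2, z\<^sub>2) \<bar>R(z, z\<^sub>2)\<bar>\<^sup>2\<close>. With \<open>z\<^sub>2\<close> fixed, the submersion
  \<open>(z, p) \<mapsto> (z, R(z, p), R(z\<^sub>2, p), \<rho> p)\<close> shows that this holds for \<open>z\<close> in an open set, and polarization
  makes \<open>F1\<close> isometric to \<open>\<phi> F0\<close> with \<open>\<phi> z = B(z, z\<^sub>2) / R(z, z\<^sub>2)\<close>.\<close>

lemma span_bound:
  obtains D where "open D" "D \<noteq> {}" "D \<subseteq> V"
    "vec.dim (vec.span (F1 ` D)) \<le> card {i. s1 i < 0} + card {i. s0 i > 0}"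
    "vec.dim (vec.span (F1 ` D)) \<le> card {i. s1 i > 0} + card {i. s0 i < 0}"
proof -
  obtain \<delta> where \<delta>: "0 < \<delta>" "ball p0 \<delta> \<subseteq> V"
    and id: "\<And>p. p \<in> M \<Longrightarrow> p \<in> ball p0 \<delta> \<Longrightarrow> \<exists>\<phi>. \<forall>z\<in>ball p0 \<delta>. \<forall>w\<in>ball p0 \<delta>. R z p = 0 \<and> R w p = 0 \<longrightarrow>
       \<phi> z \<noteq> 0 \<and> B z w = \<phi> z * cnj (\<phi> w) * R z w"
    using local_identity by metis
  define Lv where "Lv u v = hf s0 (fd F0 p0 u) (fd F0 p0 v)" for u v
  \<comment> \<open>One positive and one negative Levi direction: the 2 by 2 Gram determinant
    \<open>Lv v1 v1 * Lv v2 v2 - \<bar>Lv v2 v1\<bar>\<^sup>2\<close> is then negative, whatever the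
    mixed entry is.\<close>
  obtain v1 where v1: "c p0 v1 = 0" "Re (Lv v1 v1) > 0"
  proof -
    obtain P where P: "Suc q \<le> vec.dim P" "\<And>u. u \<in> P \<Longrightarrow> c p0 u = 0 \<and> (u \<noteq> 0 \<longrightarrow> Re (Lv u u) > 0)"
      using levi_pos[OF p0M V(2)] unfolding c_def Lv_def by blast
    have "vec.dim P \<noteq> 0" using P(1) by linarith
    then have "\<not> P \<subseteq> {0}" unfolding vec.dim_eq_0 .
    then show ?thesis using that P(2) by blast
  qed
  obtain v2 where v2: "c p0 v2 = 0" "Re (Lv v2 v2) < 0"
  proof -
    obtain P where P: "Suc q \<le> vec.dim P" "\<And>u. u \<in> P \<Longrightarrow> c p0 u = 0 \<and> (u \<noteq> 0 \<longrightarrow> Re (Lv u u) < 0)"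
      using levi_neg[OF p0M V(2)] unfolding c_def Lv_def by blast
    have "vec.dim P \<noteq> 0" using P(1) by linarith
    then have "\<not> P \<subseteq> {0}" unfolding vec.dim_eq_0 .
    then show ?thesis using that P(2) by blast
  qed
  obtain Z1 r1 where Z1: "0 < r1" "\<And>t. cmod t < r1 \<Longrightarrow> R (Z1 t) p0 = 0" "Z1 0 = p0" "(Z1 has_derivative (\<lambda>h. h *s v1)) (at 0)"
    using segre_curve[OF v1(1)] by (elim exE conjE) (rule that, auto)
  obtain Z2 r2 where Z2: "0 < r2" "\<And>t. cmod t < r2 \<Longrightarrow> R (Z2 t) p0 = 0" "Z2 0 = p0" "(Z2 has_derivative (\<lambda>h. h *s v2)) (at 0)"
    using segre_curve[OF v2(1)] by (elim exE conjE) (rule that, auto)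
  have quot: "((\<lambda>\<epsilon>. (1 / complex_of_real \<epsilon>) *s (F0 (Z (of_real \<epsilon>)) - F0 p0)) \<longlongrightarrow> fd F0 p0 v) (at_right 0)"
    if Z: "Z 0 = p0" "(Z has_derivative (\<lambda>h. h *s v)) (at 0)" for Z v
  proof -
    have "((\<lambda>t. F0 (Z t)) has_derivative (\<lambda>h. fd F0 p0 (h *s v))) (at 0)"
      using has_derivative_compose[OF Z(2) holomorphic_map_has_derivative[OF F0]] Z(1) V by simp
    then have "((\<lambda>t. F0 (Z t)) has_derivative (\<lambda>h. h *s fd F0 p0 v)) (at 0)" by (simp add: fd_scale[OF F0 V(2)])
    from difference_quotient_limit[OF this] show ?thesis by (simp add: Z)
  qed
  have A_lim: "((\<lambda>\<epsilon>. hf s0 (fd F0 p0 u) (F0 (Z (of_real \<epsilon>))) / of_real \<epsilon>) \<longlongrightarrow> Lv u v) (at_right 0)"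
    if Z: "Z 0 = p0" "(Z has_derivative (\<lambda>h. h *s v)) (at 0)" and u: "c p0 u = 0" for Z u v
  proof -
    have "((\<lambda>\<epsilon>. hf s0 (fd F0 p0 u) ((1 / complex_of_real \<epsilon>) *s (F0 (Z (of_real \<epsilon>)) - F0 p0))) \<longlongrightarrow> Lv u v) (at_right 0)"
      unfolding Lv_def by (intro tendsto_hf tendsto_const quot[OF Z])
    then show ?thesis using u by (simp add: hf.scale_right hf.diff_right c_def)
  qed
  define det where "det a11 a12 a21 a22 = a11 * a22 - a12 * a21" for a11 a12 a21 a22 :: complex
  define A where "A Z u \<epsilon> = hf s0 (fd F0 p0 u) (F0 (Z (complex_of_real \<epsilon>))) / of_real \<epsilon>" for Z u \<epsilon>
  have "((\<lambda>\<epsilon>. det (A Z1 v1 \<epsilon>) (A Z1 v2 \<epsilon>) (A Z2 v1 \<epsilon>) (A Z2 v2 \<epsilon>)) \<longlongrightarrow> det (Lv v1 v1) (Lv v2 v1) (Lv v1 v2) (Lv v2 v2)) (at_right 0)"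
    unfolding det_def A_def by (intro tendsto_intros A_lim Z1 Z2 v1 v2)
  moreover have "det (Lv v1 v1) (Lv v2 v1) (Lv v1 v2) (Lv v2 v2) \<noteq> 0"
  proof -
    have h: "Lv v1 v2 = cnj (Lv v2 v1)" "Lv v1 v1 = of_real (Re (Lv v1 v1))" "Lv v2 v2 = of_real (Re (Lv v2 v2))"
      unfolding Lv_def by (rule hf.hermitian hf.diag_of_real)+
    have "det (Lv v1 v1) (Lv v2 v1) (Lv v1 v2) (Lv v2 v2) = of_real (Re (Lv v1 v1) * Re (Lv v2 v2) - (cmod (Lv v2 v1))\<^sup>2)"
      unfolding det_def by (subst h(2), subst h(3), subst h(1)) (simp only: complex_norm_square of_real_diff of_real_mult)
    moreover have "Re (Lv v1 v1) * Re (Lv v2 v2) < 0" using v1(2) v2(2) by (rule mult_pos_neg)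
    then have "Re (Lv v1 v1) * Re (Lv v2 v2) - (cmod (Lv v2 v1))\<^sup>2 \<noteq> 0" using zero_le_power2[of "cmod (Lv v2 v1)"] by linarith
    ultimately show ?thesis by (simp only: of_real_eq_0_iff not_False_eq_True)
  qed
  ultimately have ev1: "\<forall>\<^sub>F \<epsilon> in at_right 0. det (A Z1 v1 \<epsilon>) (A Z1 v2 \<epsilon>) (A Z2 v1 \<epsilon>) (A Z2 v2 \<epsilon>) \<noteq> 0"
    by (rule tendsto_imp_eventually_ne)
  have "((\<lambda>\<epsilon>. hf s0 ((1 / complex_of_real \<epsilon>) *s (F0 (Z2 (of_real \<epsilon>)) - F0 p0)) ((1 / complex_of_real \<epsilon>) *s (F0 (Z2 (of_real \<epsilon>)) - F0 p0)))
      \<longlongrightarrow> Lv v2 v2) (at_right 0)"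
    unfolding Lv_def by (intro tendsto_hf quot Z2)
  moreover have "Lv v2 v2 \<noteq> 0" using v2 by auto
  ultimately have ev2: "\<forall>\<^sub>F \<epsilon> in at_right 0. hf s0 ((1 / complex_of_real \<epsilon>) *s (F0 (Z2 (of_real \<epsilon>)) - F0 p0)) ((1 / complex_of_real \<epsilon>) *s (F0 (Z2 (of_real \<epsilon>)) - F0 p0)) \<noteq> 0"
    by (rule tendsto_imp_eventually_ne)
  have ev3: "\<forall>\<^sub>F \<epsilon> in at_right 0. Z (complex_of_real \<epsilon>) \<in> ball p0 \<delta>" if Z: "Z 0 = p0" "(Z has_derivative (\<lambda>h. h *s v)) (at 0)" for Z v
  proof -
    have "isCont Z 0" using has_derivative_continuous[OF Z(2)] .
    moreover have "((\<lambda>\<epsilon>. complex_of_real \<epsilon>) \<longlongrightarrow> 0) (at_right 0)" by (auto intro!: tendsto_eq_intros)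
    ultimately have "((\<lambda>\<epsilon>. Z (complex_of_real \<epsilon>)) \<longlongrightarrow> Z 0) (at_right 0)" by (rule isCont_tendsto_compose)
    then show ?thesis using Z(1) \<delta>(1) by (intro topological_tendstoD) auto
  qed
  have ev4: "\<forall>\<^sub>F \<epsilon> in at_right 0. \<epsilon> \<in> {0<..<min r1 r2}" using Z1 Z2 by (intro eventually_at_rightI[of 0 "min r1 r2"]) auto
  have "\<forall>\<^sub>F \<epsilon> in at_right 0. det (A Z1 v1 \<epsilon>) (A Z1 v2 \<epsilon>) (A Z2 v1 \<epsilon>) (A Z2 v2 \<epsilon>) \<noteq> 0 \<and>
     hf s0 ((1 / complex_of_real \<epsilon>) *s (F0 (Z2 (of_real \<epsilon>)) - F0 p0)) ((1 / complex_of_real \<epsilon>) *s (F0 (Z2 (of_real \<epsilon>)) - F0 p0)) \<noteq> 0 \<and>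
     Z1 (complex_of_real \<epsilon>) \<in> ball p0 \<delta> \<and> Z2 (complex_of_real \<epsilon>) \<in> ball p0 \<delta> \<and> \<epsilon> \<in> {0<..<min r1 r2}"
    using ev1 ev2 ev3[OF Z1(3,4)] ev3[OF Z2(3,4)] ev4 by eventually_elim auto
  then obtain \<epsilon> where \<epsilon>: "det (A Z1 v1 \<epsilon>) (A Z1 v2 \<epsilon>) (A Z2 v1 \<epsilon>) (A Z2 v2 \<epsilon>) \<noteq> 0"
     "hf s0 ((1 / complex_of_real \<epsilon>) *s (F0 (Z2 (of_real \<epsilon>)) - F0 p0)) ((1 / complex_of_real \<epsilon>) *s (F0 (Z2 (of_real \<epsilon>)) - F0 p0)) \<noteq> 0"
     "Z1 (complex_of_real \<epsilon>) \<in> ball p0 \<delta>" "Z2 (complex_of_real \<epsilon>) \<in> ball p0 \<delta>" "0 < \<epsilon>" "\<epsilon> < r1" "\<epsilon> < r2"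
    using eventually_happens'[of "at_right (0::real)"] by auto
  define z1 where "z1 = Z1 (of_real \<epsilon>)"
  define z2 where "z2 = Z2 (of_real \<epsilon>)"
  have z12: "z1 \<in> ball p0 \<delta>" "z2 \<in> ball p0 \<delta>" using \<epsilon> by (auto simp: z1_def z2_def)
  have Rz: "R z1 p0 = 0" "R z2 p0 = 0" using Z1(2)[of "of_real \<epsilon>"] Z2(2)[of "of_real \<epsilon>"] \<epsilon> by (auto simp: z1_def z2_def)
  have Rz': "R p0 z1 = 0" "R p0 z2 = 0" using Rz hf.hermitian[of s0 "F0 p0"] by auto
  have zV: "z1 \<in> V" "z2 \<in> V" using z12 \<delta> by auto
  have R22: "R z2 z2 \<noteq> 0"
    using \<epsilon>(2) Rz Rz' p0_null by (auto simp: z2_def[symmetric] hf.scale_left hf.scale_right hf.diff_left hf.diff_right)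
  define a where "a z u = hf s0 (F0 z) (fd F0 p0 u)" for z u
  have detn: "det (a z1 v1) (a z1 v2) (a z2 v1) (a z2 v2) \<noteq> 0"
  proof -
    have "hf s0 (fd F0 p0 u) (F0 (Z (complex_of_real \<epsilon>))) = of_real \<epsilon> * A Z u \<epsilon>" for Z u using \<epsilon>(5) by (simp add: A_def)
    then have "a (Z (of_real \<epsilon>)) u = of_real \<epsilon> * cnj (A Z u \<epsilon>)" for Z u
      using hf.hermitian[of s0 "F0 (Z (complex_of_real \<epsilon>))" "fd F0 p0 u"] by (simp add: a_def)
    then have "det (a z1 v1) (a z1 v2) (a z2 v1) (a z2 v2) = of_real (\<epsilon> * \<epsilon>) * cnj (det (A Z1 v1 \<epsilon>) (A Z1 v2 \<epsilon>) (A Z2 v1 \<epsilon>) (A Z2 v2 \<epsilon>))"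
      by (simp add: z1_def z2_def det_def algebra_simps)
    then show ?thesis using \<epsilon>(1,5) by simp
  qed
  \<comment> \<open>A fibre over \<open>(z, 0, 0, 0)\<close> is a point \<open>p\<close> of
    \<open>M\<close> whose Segre variety contains both \<open>z\<close> and \<open>z2\<close>.
    Openness of this map at \<open>(z1, p0)\<close> supplies such a \<open>p\<close> for every
    \<open>z\<close> near \<open>z1\<close>.\<close>
  define \<Phi> where "\<Phi> x = (fst x, (hf s0 (F0 (fst x)) (F0 (snd x)), (hf s0 (F0 z2) (F0 (snd x)), \<rho> (snd x))))" for x
  define \<Phi>' where "\<Phi>' h = (fst h, (hf s0 (F0 z1) (fd F0 p0 (snd h)) + hf s0 (fd F0 z1 (fst h)) (F0 p0),
      (hf s0 (F0 z2) (fd F0 p0 (snd h)), \<kappa> * Re (hf s0 (fd F0 p0 (snd h)) (F0 p0)))))" for h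
  let ?S = "ball p0 \<delta> \<times> (ball p0 \<delta> \<inter> W)"
  have der: "(\<Phi> has_derivative \<Phi>') (at (z1, p0))"
  proof -
    have f: "((\<lambda>x. F0 (fst x)) has_derivative (\<lambda>h. fd F0 z1 (fst h))) (at (z1, p0))"
      using has_derivative_compose[OF has_derivative_fst[OF has_derivative_ident], of F0 "fd F0 z1" "(z1, p0)" UNIV]
        holomorphic_map_has_derivative[OF F0 zV(1)] by simp
    have g: "((\<lambda>x. F0 (snd x)) has_derivative (\<lambda>h. fd F0 p0 (snd h))) (at (z1, p0))"
      using has_derivative_compose[OF has_derivative_snd[OF has_derivative_ident], of F0 "fd F0 p0" "(z1, p0)" UNIV]
        holomorphic_map_has_derivative[OF F0 V(2)] by simp
    have r: "((\<lambda>x. \<rho> (snd x)) has_derivative (\<lambda>h. \<kappa> * Re (hf s0 (fd F0 p0 (snd h)) (F0 p0)))) (at (z1, p0))"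
      using has_derivative_compose[OF has_derivative_snd[OF has_derivative_ident], of \<rho> _ "(z1, p0)" UNIV] \<rho>_der by simp
    have h: "((\<lambda>x. hf s0 (F0 (fst x)) (F0 (snd x))) has_derivative (\<lambda>h. hf s0 (F0 z1) (fd F0 p0 (snd h)) + hf s0 (fd F0 z1 (fst h)) (F0 p0))) (at (z1, p0))"
      using has_derivative_hf[OF f g] by simp
    show ?thesis
      unfolding \<Phi>_def[abs_def] \<Phi>'_def[abs_def]
      by (intro has_derivative_Pair has_derivative_fst has_derivative_ident h r
          bounded_linear.has_derivative[OF bounded_bilinear.bounded_linear_right[OF bounded_bilinear_hf] g])
  qed
  have surj: "surj \<Phi>'"
  proof -
    have "\<exists>h. \<Phi>' h = (x, (\<alpha>, (\<beta>, \<gamma>)))" for x \<alpha> \<beta> \<gamma>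
    proof -
      \<comment> \<open>\<open>w\<close> adjusts the value of the derivative of
        \<open>\<rho>\<close>. The correction by \<open>v1\<close> and \<open>v2\<close> leaves it
        alone, as \<open>c p0\<close> kills both, and solves the remaining two equations by Cramer's
        rule; the coefficients are conjugated because \<open>a z\<close> is antilinear.\<close>
      define w where "w = of_real (\<gamma> / \<kappa>) *s e"
      define A1 where "A1 = \<alpha> - hf s0 (fd F0 z1 x) (F0 p0) - a z1 w"
      define A2 where "A2 = \<beta> - a z2 w"
      define dt where "dt = det (a z1 v1) (a z1 v2) (a z2 v1) (a z2 v2)"
      define c1 where "c1 = (A1 * a z2 v2 - A2 * a z1 v2) / dt"
      define c2 where "c2 = (a z1 v1 * A2 - a z2 v1 * A1) / dt"
      define y where "y = w + cnj c1 *s v1 + cnj c2 *s v2"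
      have ay: "a z y = a z w + c1 * a z v1 + c2 * a z v2" for z
        by (simp add: a_def y_def fd_add[OF F0 V(2)] fd_scale[OF F0 V(2)] hf.add_right hf.scale_right)
      have cr: "c1 * a z1 v1 + c2 * a z1 v2 = A1" "c1 * a z2 v1 + c2 * a z2 v2 = A2"
      proof -
        have "dt \<noteq> 0" using detn by (simp add: dt_def)
        have "c1 * a z1 v1 + c2 * a z1 v2 = ((A1 * a z2 v2 - A2 * a z1 v2) * a z1 v1 + (a z1 v1 * A2 - a z2 v1 * A1) * a z1 v2) / dt"
          by (simp add: c1_def c2_def add_divide_distrib)
        also have "(A1 * a z2 v2 - A2 * a z1 v2) * a z1 v1 + (a z1 v1 * A2 - a z2 v1 * A1) * a z1 v2 = A1 * dt"
          by (simp add: dt_def det_def algebra_simps)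
        finally have "c1 * a z1 v1 + c2 * a z1 v2 = (A1 * dt) / dt" .
        then show "c1 * a z1 v1 + c2 * a z1 v2 = A1" using \<open>dt \<noteq> 0\<close> by simp
        have "c1 * a z2 v1 + c2 * a z2 v2 = ((A1 * a z2 v2 - A2 * a z1 v2) * a z2 v1 + (a z1 v1 * A2 - a z2 v1 * A1) * a z2 v2) / dt"
          by (simp add: c1_def c2_def add_divide_distrib)
        also have "(A1 * a z2 v2 - A2 * a z1 v2) * a z2 v1 + (a z1 v1 * A2 - a z2 v1 * A1) * a z2 v2 = A2 * dt"
          by (simp add: dt_def det_def algebra_simps)
        finally have "c1 * a z2 v1 + c2 * a z2 v2 = (A2 * dt) / dt" .
        then show "c1 * a z2 v1 + c2 * a z2 v2 = A2" using \<open>dt \<noteq> 0\<close> by simp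
      qed
      have "c p0 y = of_real (\<gamma> / \<kappa>)" using v1(1) v2(1) by (simp add: y_def w_def c_linear V c_e)
      then have "\<kappa> * Re (hf s0 (fd F0 p0 y) (F0 p0)) = \<gamma>" using \<kappa> by (simp add: c_def)
      moreover have "hf s0 (F0 z1) (fd F0 p0 y) + hf s0 (fd F0 z1 x) (F0 p0) = \<alpha>" "hf s0 (F0 z2) (fd F0 p0 y) = \<beta>"
        using ay[of z1] ay[of z2] cr by (simp_all add: a_def[symmetric] add.assoc A1_def A2_def)
      ultimately show ?thesis by (intro exI[of _ "(x, y)"]) (simp add: \<Phi>'_def)
    qed
    then show ?thesis unfolding surj_def by (metis prod.exhaust)
  qed
  have "linear \<Phi>'" by (rule has_derivative_linear[OF der])
  from linear_surjective_right_inverse[OF this surj] obtain g' where g': "linear g'" "\<Phi>' \<circ> g' = id" by blast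
  have S: "open ?S" by (intro open_Times open_Int open_ball W)
  have xS: "(z1, p0) \<in> ?S" using z12 \<delta> W by simp
  have contS: "continuous_on ?S \<Phi>"
    unfolding \<Phi>_def using \<delta>(2)
    by (intro continuous_intros continuous_on_compose2[OF holomorphic_map_continuous[OF F0]] continuous_on_compose2[OF \<rho>_cont]) auto
  \<comment> \<open>This open mapping theorem needs continuity near the point, and differentiability
    with a right inverse at the point itself.\<close>
  have "\<Phi> (z1, p0) \<in> interior (\<Phi> ` ?S)"
    by (rule sussmann_open_mapping[OF S contS xS der _ g'(2) order_refl])
      (use g'(1) S xS in \<open>auto simp: linear_conv_bounded_linear interior_open\<close>)
  moreover have "\<rho> p0 = 0" using p0M W M_W by blast
  then have "\<Phi> (z1, p0) = (z1, (0, (0, 0)))" by (simp add: \<Phi>_def Rz)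
  ultimately obtain d where d: "0 < d" "ball (z1, (0, (0, 0))) d \<subseteq> \<Phi> ` ?S"
    using mem_interior by metis
  \<comment> \<open>Substituting the factorization with the function \<open>\<phi>\<close> belonging
    to \<open>p\<close> makes both products equal; \<open>\<phi>\<close> itself drops out, so its
    dependence on \<open>p\<close> is harmless.\<close>
  have diag: "B z z * B z2 z2 * R z z2 * R z2 z - B z z2 * B z2 z * R z z * R z2 z2 = 0" if z: "z \<in> ball z1 (min d (\<delta> - dist p0 z1))" for z
  proof -
    have "(z, (0, (0, 0))) \<in> ball (z1, (0::complex, (0::complex, 0::real))) d" using z by (simp add: dist_Pair_Pair)
    then obtain z' p where p: "z' \<in> ball p0 \<delta>" "p \<in> ball p0 \<delta>" "p \<in> W" "\<Phi> (z', p) = (z, (0, (0, 0)))" using d(2) by auto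
    then have eq: "z' = z" "R z p = 0" "R z2 p = 0" "\<rho> p = 0" by (auto simp: \<Phi>_def)
    have zb: "z \<in> ball p0 \<delta>" using p(1) eq(1) by simp
    have pM: "p \<in> M" using eq(4) p(3) M_W by blast
    obtain \<phi> where \<phi>: "\<And>z w. z \<in> ball p0 \<delta> \<Longrightarrow> w \<in> ball p0 \<delta> \<Longrightarrow> R z p = 0 \<Longrightarrow> R w p = 0 \<Longrightarrow> B z w = \<phi> z * cnj (\<phi> w) * R z w"
      using id[OF pM p(2)] by blast
    show ?thesis
      unfolding \<phi>[OF zb zb eq(2,2)] \<phi>[OF z12(2,2) eq(3,3)] \<phi>[OF zb z12(2) eq(2,3)] \<phi>[OF z12(2) zb eq(3,2)]
      by (simp add: algebra_simps)
  qed
  have F1b: "holomorphic_map_on (ball p0 \<delta>) F1" "holomorphic_map_on (ball p0 \<delta>) F0"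
    using holomorphic_map_on_subset[OF F1 \<delta>(2)] holomorphic_map_on_subset[OF F0 \<delta>(2)] .
  have sesq: "sesqui_holomorphic_on (ball p0 \<delta>) (\<lambda>z w. B z w * B z2 z2 * R z z2 * R z2 w - B z z2 * B z2 w * R z w * R z2 z2)"
    by (intro sesqui_holomorphic_diff sesqui_holomorphic_mult sesqui_holomorphic_hf holomorphic_map_const F1b)
  have rad: "0 < min d (\<delta> - dist p0 z1)" using d z12 by simp
  have sub: "ball z1 (min d (\<delta> - dist p0 z1)) \<subseteq> ball p0 \<delta>"
  proof
    fix x assume "x \<in> ball z1 (min d (\<delta> - dist p0 z1))"
    then show "x \<in> ball p0 \<delta>" using dist_triangle[of p0 x z1] by simp
  qed
  have Q: "B z w * B z2 z2 * R z z2 * R z2 w - B z z2 * B z2 w * R z w * R z2 z2 = 0" if "z \<in> ball p0 \<delta>" "w \<in> ball p0 \<delta>" for z w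
    by (rule polarization[OF sesq open_ball convex_ball rad sub diag that])
  obtain \<phi>0 where \<phi>0: "\<phi>0 \<noteq> 0" "B z2 z2 = \<phi>0 * cnj \<phi>0 * R z2 z2"
    using id[OF p0M] \<delta>(1) z12(2) Rz(2) by (metis centre_in_ball)
  define \<kappa>' where "\<kappa>' = (cmod \<phi>0)\<^sup>2"
  have \<kappa>': "0 < \<kappa>'" "B z2 z2 = of_real \<kappa>' * R z2 z2"
  proof -
    have "of_real \<kappa>' = \<phi>0 * cnj \<phi>0" unfolding \<kappa>'_def by (rule complex_norm_square)
    then show "B z2 z2 = of_real \<kappa>' * R z2 z2" using \<phi>0(2) by simp
  qed (use \<phi>0 in \<open>simp add: \<kappa>'_def\<close>)
  have B22: "B z2 z2 \<noteq> 0" using \<kappa>' R22 by simp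
  define D where "D = {z \<in> ball p0 \<delta>. R z z2 * B z z2 \<noteq> 0}"
  have "open D"
  proof -
    have "continuous_on (ball p0 \<delta>) (\<lambda>z. R z z2 * B z z2)"
      by (intro continuous_intros holomorphic_map_continuous F1b)
    then have "open (ball p0 \<delta> \<inter> (\<lambda>z. R z z2 * B z z2) -` (- {0}))"
      by (rule continuous_open_preimage) auto
    moreover have "D = ball p0 \<delta> \<inter> (\<lambda>z. R z z2 * B z z2) -` (- {0})" by (auto simp: D_def)
    ultimately show ?thesis by simp
  qed
  moreover have "z2 \<in> D" using z12 R22 B22 by (simp add: D_def)
  moreover have "D \<subseteq> V" using \<delta>(2) by (auto simp: D_def)
  \<comment> \<open>With \<open>z2\<close> fixed, the polarized identity can be solved for
    \<open>B z w\<close>, and this quotient is the scaling that turns \<open>F1\<close> into an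
    isometric copy of \<open>F0\<close> up to the constant \<open>\<kappa>'\<close>.\<close>
  moreover define \<phi> where "\<phi> z = B z z2 / R z z2" for z
  have iso: "of_real \<kappa>' * hf s1 ((1 / \<phi> z) *s F1 z) ((1 / \<phi> w) *s F1 w) = hf s0 (F0 z) (F0 w)" if zw: "z \<in> D" "w \<in> D" for z w
  proof -
    have nz: "R z z2 \<noteq> 0" "B z z2 \<noteq> 0" "R w z2 \<noteq> 0" "B w z2 \<noteq> 0" "z \<in> ball p0 \<delta>" "w \<in> ball p0 \<delta>" using zw by (auto simp: D_def)
    have h: "cnj (R w z2) = R z2 w" "cnj (B w z2) = B z2 w" by (simp_all only: hf.hermitian[symmetric])
    have nz': "R z2 w \<noteq> 0" "B z2 w \<noteq> 0" using nz h by (metis complex_cnj_zero_iff)+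
    have "of_real \<kappa>' * hf s1 ((1 / \<phi> z) *s F1 z) ((1 / \<phi> w) *s F1 w) = of_real \<kappa>' * (R z z2 / B z z2) * (R z2 w / B z2 w) * B z w"
      by (simp add: hf.scale_left hf.scale_right \<phi>_def h ac_simps)
    also have "\<dots> = (B z w * B z2 z2 * R z z2 * R z2 w) / (B z z2 * B z2 w * R z2 z2)"
      unfolding \<kappa>'(2) using R22 by simp
    also have "\<dots> = (B z z2 * B z2 w * R z w * R z2 z2) / (B z z2 * B z2 w * R z2 z2)" using Q[OF nz(5,6)] by simp
    also have "\<dots> = R z w" using nz nz' R22 by simp
    finally show ?thesis .
  qed
  have sp: "vec.span ((\<lambda>z. (1 / \<phi> z) *s F1 z) ` D) = vec.span (F1 ` D)"
  proof (rule vec.span_eq[THEN iffD2], intro conjI subsetI)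
    fix x assume "x \<in> (\<lambda>z. (1 / \<phi> z) *s F1 z) ` D"
    then obtain z where "z \<in> D" "x = (1 / \<phi> z) *s F1 z" by blast
    then show "x \<in> vec.span (F1 ` D)" by (simp add: vec.span_scale vec.span_base)
  next
    fix x assume "x \<in> F1 ` D"
    then obtain z where z: "z \<in> D" "x = F1 z" by blast
    then have "\<phi> z \<noteq> 0" by (auto simp: D_def \<phi>_def)
    then have x: "x = \<phi> z *s ((1 / \<phi> z) *s F1 z)" by (simp add: z vec.scale_scale)
    show "x \<in> vec.span ((\<lambda>z. (1 / \<phi> z) *s F1 z) ` D)"
      unfolding x by (intro vec.span_scale vec.span_base) (use z(1) in blast)
  qed
  have "vec.dim (vec.span (F1 ` D)) \<le> card {i. s1 i < 0} + card {i. s0 i > 0}"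
    unfolding sp[symmetric] by (rule dim_span_le_of_isometric[OF s1 s0 \<kappa>'(1), where h = F0]) (use iso in blast)
  \<comment> \<open>The second bound is the first one for both forms negated.\<close>
  moreover have "vec.dim (vec.span (F1 ` D)) \<le> card {i. s1 i > 0} + card {i. s0 i < 0}"
  proof -
    have "\<forall>z\<in>D. \<forall>w\<in>D. of_real \<kappa>' * hf (\<lambda>i. - s1 i) ((1 / \<phi> z) *s F1 z) ((1 / \<phi> w) *s F1 w) = hf (\<lambda>i. - s0 i) (F0 z) (F0 w)"
      using iso by (simp add: hf_uminus)
    from dim_span_le_of_isometric[OF _ _ \<kappa>'(1) this] show ?thesis
      using s0 s1 unfolding sp by simp
  qed
  ultimately show ?thesis using that[of D] by blast
qed

end

section \<open>Tangent spaces of real hypersurfaces\<close>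

lemma Ck_on_cong:
  assumes V: "open V" and eq: "\<And>x. x \<in> V \<Longrightarrow> f x = g x"
  shows "Ck_on k V f \<longleftrightarrow> Ck_on k V g"
  using eq
proof (induction k arbitrary: f g)
  case 0
  then show ?case by (simp cong: continuous_on_cong)
next
  case (Suc k)
  have d: "(f has_derivative D) (at x) \<longleftrightarrow> (g has_derivative D) (at x)" if "x \<in> V" for x D
    using has_derivative_transform_within_open[OF _ V that, of f D UNIV g] has_derivative_transform_within_open[OF _ V that, of g D UNIV f] Suc.prems
    by auto
  then have "frechet_derivative f (at x) = frechet_derivative g (at x)" if "x \<in> V" for x
    using that by (simp add: frechet_derivative_def)
  then have "Ck_on k V (\<lambda>x. frechet_derivative f (at x) v) \<longleftrightarrow> Ck_on k V (\<lambda>x. frechet_derivative g (at x) v)" for v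
    by (intro Suc.IH) simp
  moreover have "f differentiable (at x) \<longleftrightarrow> g differentiable (at x)" if "x \<in> V" for x
    using d[OF that] by (simp add: differentiable_def)
  ultimately show ?case by simp
qed

lemma Ck_on_SucI:
  assumes V: "open V" and d: "\<And>x. x \<in> V \<Longrightarrow> (f has_derivative D x) (at x)" and "\<And>v. Ck_on k V (\<lambda>x. D x v)"
  shows "Ck_on (Suc k) V f"
proof -
  have "Ck_on k V (\<lambda>x. frechet_derivative f (at x) v) \<longleftrightarrow> Ck_on k V (\<lambda>x. D x v)" for v
    by (rule Ck_on_cong[OF V]) (metis d frechet_derivative_at)
  then show ?thesis using assms by (auto simp: differentiable_def)
qed

lemma smooth_on_has_derivative: "smooth_on V f \<Longrightarrow> x \<in> V \<Longrightarrow> (f has_derivative fd f x) (at x)"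
proof -
  assume "smooth_on V f" "x \<in> V"
  then have "Ck_on (Suc 0) V f" unfolding smooth_on_def by blast
  then have "f differentiable (at x)" using \<open>x \<in> V\<close> by simp
  then show ?thesis unfolding fd_def[abs_def] using frechet_derivative_works by metis
qed

lemma smooth_on_fd: "smooth_on V f \<Longrightarrow> smooth_on V (\<lambda>x. fd f x v)"
  unfolding smooth_on_def fd_def by (metis Ck_on.simps(2))

lemma smooth_on_continuous: "smooth_on V f \<Longrightarrow> continuous_on V f"
  unfolding smooth_on_def by (metis Ck_on.simps(1))

lemma smooth_on_subset:
  assumes "smooth_on V f" "W \<subseteq> V" shows "smooth_on W f"
proof -
  have "Ck_on k V f \<Longrightarrow> Ck_on k W f" for k
    by (induction k arbitrary: f) (use assms(2) in \<open>auto intro: continuous_on_subset\<close>)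
  then show ?thesis using assms(1) by (simp add: smooth_on_def)
qed

lemma Ck_on_const: "Ck_on k V (\<lambda>x. c)"
  by (induction k arbitrary: c) (auto simp: frechet_derivative_const)

lemma smooth_on_const: "smooth_on V (\<lambda>x. c)"
  by (simp add: smooth_on_def Ck_on_const)

lemma smooth_on_linear:
  assumes "open V" "bounded_linear L" shows "smooth_on V L"
  unfolding smooth_on_def
proof
  fix k show "Ck_on k V L"
  proof (cases k)
    case 0
    then show ?thesis using assms(2) by (simp add: linear_continuous_on)
  next
    case (Suc j)
    have "Ck_on (Suc j) V L"
      by (rule Ck_on_SucI[OF assms(1) bounded_linear_imp_has_derivative[OF assms(2)] Ck_on_const])
    then show ?thesis using Suc by simp
  qed
qed

lemma Ck_on_add:
  assumes V: "open V"
  shows "Ck_on k V f \<Longrightarrow> Ck_on k V g \<Longrightarrow> Ck_on k V (\<lambda>x. f x + g x)"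
proof (induction k arbitrary: f g)
  case 0
  then show ?case by (simp add: continuous_on_add)
next
  case (Suc k)
  show ?case
  proof (rule Ck_on_SucI[OF V])
    show "((\<lambda>x. f x + g x) has_derivative (\<lambda>v. frechet_derivative f (at x) v + frechet_derivative g (at x) v)) (at x)" if "x \<in> V" for x
      using Suc.prems that by (intro has_derivative_add) (auto simp: frechet_derivative_works)
  qed (use Suc in auto)
qed

lemma smooth_on_add: "open V \<Longrightarrow> smooth_on V f \<Longrightarrow> smooth_on V g \<Longrightarrow> smooth_on V (\<lambda>x. f x + g x)"
  by (simp add: smooth_on_def Ck_on_add)

lemma smooth_on_mult:
  fixes f g :: "'a::real_normed_vector \<Rightarrow> real"
  assumes V: "open V" and "smooth_on V f" "smooth_on V g"
  shows "smooth_on V (\<lambda>x. f x * g x)"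
proof -
  have "Ck_on k V (\<lambda>x. f x * g x)" for k
    using assms(2,3)
  proof (induction k arbitrary: f g)
    case 0
    then show ?case by (simp add: continuous_on_mult smooth_on_continuous)
  next
    case (Suc k)
    show ?case
    proof (rule Ck_on_SucI[OF V])
      show "((\<lambda>x. f x * g x) has_derivative (\<lambda>v. f x * fd g x v + fd f x v * g x)) (at x)" if "x \<in> V" for x
        using Suc.prems that by (intro has_derivative_mult smooth_on_has_derivative)
      show "Ck_on k V (\<lambda>x. f x * fd g x v + fd f x v * g x)" for v
        by (intro Ck_on_add V Suc.IH smooth_on_fd Suc.prems)
    qed
  qed
  then show ?thesis by (simp add: smooth_on_def)
qed

lemma smooth_on_inverse:
  fixes f :: "'a::real_normed_vector \<Rightarrow> real"
  assumes V: "open V" and f: "smooth_on V f" "\<And>x. x \<in> V \<Longrightarrow> f x \<noteq> 0"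
  shows "smooth_on V (\<lambda>x. inverse (f x))"
proof -
  \<comment> \<open>The claim is stated for all products of a smooth function with a power of the
    reciprocal, a family that differentiation reproduces up to sums; the reciprocal alone would not
    carry the induction.\<close>
  have "Ck_on k V (\<lambda>x. g x * inverse (f x) ^ m)" if "smooth_on V g" for k m g
    using that
  proof (induction k arbitrary: g m)
    case 0
    have "continuous_on V (\<lambda>x. g x * inverse (f x) ^ m)"
      by (intro continuous_on_mult continuous_on_power continuous_on_inverse smooth_on_continuous 0 f(1)) (use f(2) in blast)
    then show ?case by simp
  next
    case (Suc k)
    show ?case
    proof (rule Ck_on_SucI[OF V])
      fix x assume x: "x \<in> V"
      have "((\<lambda>x. inverse (f x)) has_derivative (\<lambda>v. - (inverse (f x) * fd f x v * inverse (f x)))) (at x)"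
        by (rule Deriv.has_derivative_inverse[OF f(2)[OF x] smooth_on_has_derivative[OF f(1) x]])
      from has_derivative_power[OF this, of m]
      have "((\<lambda>x. inverse (f x) ^ m) has_derivative (\<lambda>v. of_nat m * - (inverse (f x) * fd f x v * inverse (f x)) * inverse (f x) ^ (m - 1))) (at x)" .
      from has_derivative_mult[OF smooth_on_has_derivative[OF Suc.prems x] this]
      have d: "((\<lambda>x. g x * inverse (f x) ^ m) has_derivative (\<lambda>v. g x * (of_nat m * - (inverse (f x) * fd f x v * inverse (f x)) * inverse (f x) ^ (m - 1)) + fd g x v * inverse (f x) ^ m)) (at x)" .
      have eq: "g x * (of_nat m * - (inverse (f x) * fd f x v * inverse (f x)) * inverse (f x) ^ (m - 1)) + fd g x v * inverse (f x) ^ m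
         = (- of_nat m * (g x * fd f x v)) * inverse (f x) ^ Suc m + fd g x v * inverse (f x) ^ m" for v
        by (cases m) (simp_all add: algebra_simps)
      show "((\<lambda>x. g x * inverse (f x) ^ m) has_derivative (\<lambda>v. (- of_nat m * (g x * fd f x v)) * inverse (f x) ^ Suc m + fd g x v * inverse (f x) ^ m)) (at x)"
        using d unfolding eq .
    next
      fix v
      show "Ck_on k V (\<lambda>x. (- of_nat m * (g x * fd f x v)) * inverse (f x) ^ Suc m + fd g x v * inverse (f x) ^ m)"
        by (intro Ck_on_add V Suc.IH smooth_on_mult smooth_on_const smooth_on_fd Suc.prems f)
    qed
  qed
  from this[OF smooth_on_const[of V 1], of _ 1] show ?thesis by (simp add: smooth_on_def)
qed

lemma Ck_on_scaleR_affine: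
  assumes I: "open I"
  shows "Ck_on k I f \<Longrightarrow> Ck_on k I (\<lambda>t. a + f t *\<^sub>R b)"
proof (induction k arbitrary: f a)
  case 0
  then show ?case by (auto intro!: continuous_intros)
next
  case (Suc k)
  show ?case
  proof (rule Ck_on_SucI[OF I])
    show "((\<lambda>t. a + f t *\<^sub>R b) has_derivative (\<lambda>w. 0 + frechet_derivative f (at t) w *\<^sub>R b)) (at t)" if "t \<in> I" for t
      using Suc.prems that by (auto intro!: derivative_eq_intros simp: frechet_derivative_works)
  qed (rule Suc.IH, use Suc.prems in auto)
qed

text \<open>The inverse function theorem provides \<open>s\<close> with one derivative only.
  Differentiating \<open>\<rho> (\<gamma> t) = 0\<close> gives \<open>s' = G0 (\<gamma> t)\<close>
  with \<open>G0\<close> smooth, and this equation is bootstrapped to smoothness of all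
  orders.\<close>

lemma hypersurface_curve:
  fixes \<rho> :: "'x::euclidean_space \<Rightarrow> real"
  assumes V: "open V" "p \<in> V" and \<rho>: "smooth_on V \<rho>" "\<rho> p = 0" and u: "fd \<rho> p u \<noteq> 0" and v: "fd \<rho> p v = 0"
  shows "\<exists>s e. 0 < e \<and> smooth_on {-e<..<e} (\<lambda>t. (p + t *\<^sub>R v) + s t *\<^sub>R u) \<and> s 0 = 0 \<and>
    (\<forall>t\<in>{-e<..<e}. (p + t *\<^sub>R v) + s t *\<^sub>R u \<in> V \<and> \<rho> ((p + t *\<^sub>R v) + s t *\<^sub>R u) = 0) \<and>
    ((\<lambda>t. (p + t *\<^sub>R v) + s t *\<^sub>R u) has_vector_derivative v) (at 0)"
proof -
  define V' where "V' = V \<inter> {x \<in> V. fd \<rho> x u \<noteq> 0}"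
  have "open {x \<in> V. fd \<rho> x u \<noteq> 0}"
  proof -
    have "continuous_on V (\<lambda>x. fd \<rho> x u)" by (intro smooth_on_continuous smooth_on_fd \<rho>)
    from continuous_open_preimage[OF this V(1), of "- {0}"] have "open (V \<inter> (\<lambda>x. fd \<rho> x u) -` (- {0}))" by auto
    moreover have "{x \<in> V. fd \<rho> x u \<noteq> 0} = V \<inter> (\<lambda>x. fd \<rho> x u) -` (- {0})" by auto
    ultimately show ?thesis by simp
  qed
  then have V': "open V'" "p \<in> V'" "V' \<subseteq> V" "\<And>x. x \<in> V' \<Longrightarrow> fd \<rho> x u \<noteq> 0" using V u by (auto simp: V'_def)
  have \<rho>': "smooth_on V' \<rho>" by (rule smooth_on_subset[OF \<rho>(1) V'(3)])
  have lin: "fd g x (a *\<^sub>R y + b *\<^sub>R z) = a * fd g x y + b * fd g x z" if "smooth_on V' g" "x \<in> V'" for g :: "'x \<Rightarrow> real" and x a b y z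
    using has_derivative_linear[OF smooth_on_has_derivative[OF that]] by (simp add: linear_add linear_cmul)
  define q where "q x = (p + fst x *\<^sub>R v) + snd x *\<^sub>R u" for x :: "real \<times> real"
  define \<Phi> where "\<Phi> x = (fst x, \<rho> (q x))" for x
  define \<Phi>' where "\<Phi>' x h = (fst h, fst h * fd \<rho> (q x) v + snd h * fd \<rho> (q x) u)" for x h :: "real \<times> real"
  let ?U = "q -` V'"
  have qc: "continuous_on UNIV q" unfolding q_def by (intro continuous_intros)
  have U: "open ?U" using V'(1) qc by (intro open_vimage) auto
  have q0: "q (0, 0) = p" by (simp add: q_def)
  have der: "(\<Phi> has_derivative \<Phi>' x) (at x)" if "x \<in> ?U" for x
  proof -
    have dq: "(q has_derivative (\<lambda>h. fst h *\<^sub>R v + snd h *\<^sub>R u)) (at x)"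
      unfolding q_def[abs_def] by (rule derivative_eq_intros refl | simp)+
    have "((\<lambda>x. \<rho> (q x)) has_derivative (\<lambda>h. fd \<rho> (q x) (fst h *\<^sub>R v + snd h *\<^sub>R u))) (at x)"
      by (rule has_derivative_compose[OF dq smooth_on_has_derivative[OF \<rho>']]) (use that in auto)
    then have "((\<lambda>x. \<rho> (q x)) has_derivative (\<lambda>h. fst h * fd \<rho> (q x) v + snd h * fd \<rho> (q x) u)) (at x)"
      using lin[OF \<rho>'] that by simp
    then show ?thesis unfolding \<Phi>_def[abs_def] \<Phi>'_def[abs_def] by (intro has_derivative_Pair has_derivative_fst has_derivative_ident)
  qed
  define f' where "f' x = Blinfun (\<Phi>' x)" for x
  have f': "blinfun_apply (f' x) = \<Phi>' x" if "x \<in> ?U" for x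
    unfolding f'_def by (rule bounded_linear_Blinfun_apply[OF has_derivative_bounded_linear[OF der[OF that]]])
  have cont: "continuous_on ?U f'"
  proof (rule continuous_on_blinfun_componentwise)
    fix b :: "real \<times> real"
    have c: "continuous_on ?U (\<lambda>x. fd \<rho> (q x) w)" for w
      by (rule continuous_on_compose2[OF smooth_on_continuous[OF smooth_on_fd[OF \<rho>']]]) (auto intro: continuous_on_subset[OF qc])
    have "continuous_on ?U (\<lambda>x. \<Phi>' x b)"
      unfolding \<Phi>'_def by (intro continuous_intros c)
    then show "continuous_on ?U (\<lambda>x. blinfun_apply (f' x) b)" by (rule continuous_on_eq) (simp only: f')
  qed
  define i0 where "i0 h = (fst h, snd h / fd \<rho> p u)" for h :: "real \<times> real"
  have bl0: "bounded_linear i0" unfolding i0_def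
    by (intro bounded_linear_Pair bounded_linear_fst bounded_linear_compose[OF bounded_linear_divide bounded_linear_snd])
  have z: "(0, 0) \<in> ?U" using V' q0 by simp
  have inv: "Blinfun i0 o\<^sub>L f' (0, 0) = id_blinfun"
    by (rule blinfun_eqI) (simp add: bounded_linear_Blinfun_apply[OF bl0] f'[OF z] \<Phi>'_def i0_def q0 v u)
  obtain U' W g g' where U': "open U'" "U' \<subseteq> ?U" "(0, 0) \<in> U'" and W: "open W" "\<Phi> (0, 0) \<in> W"
    and hom: "homeomorphism U' W \<Phi> g" and gd: "\<And>y. y \<in> W \<Longrightarrow> (g has_derivative (g' y)) (at y)"
    using inverse_function_theorem[OF U _ cont z inv, of \<Phi>] der f' by (metis (no_types, lifting))
  have \<Phi>0: "\<Phi> (0, 0) = (0, 0)" using \<rho> by (simp add: \<Phi>_def q0)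
  define s where "s t = snd (g (t, 0))" for t
  have "open ((\<lambda>t. (t, 0::real)) -` W)" using W(1) by (intro open_vimage continuous_intros)
  moreover have "0 \<in> (\<lambda>t. (t, 0::real)) -` W" using W \<Phi>0 by simp
  ultimately obtain e where e: "0 < e" "ball 0 e \<subseteq> (\<lambda>t. (t, 0::real)) -` W" by (meson open_contains_ball)
  define I where "I = {-e<..<e}"
  have I: "open I" "0 \<in> I" "\<And>t. t \<in> I \<Longrightarrow> (t, 0) \<in> W"
    using e by (auto simp: I_def dist_real_def subset_iff)
  define \<gamma> where "\<gamma> t = (p + t *\<^sub>R v) + s t *\<^sub>R u" for t
  have g: "g (t, 0) = (t, s t)" "\<gamma> t \<in> V'" "\<rho> (\<gamma> t) = 0" if "t \<in> I" for t
  proof -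
    have "\<Phi> (g (t, 0)) = (t, 0)" "g (t, 0) \<in> ?U" using hom I(3)[OF that] U'(2) by (auto simp: homeomorphism_def)
    then have *: "fst (g (t, 0)) = t" "\<rho> (q (g (t, 0))) = 0" "q (g (t, 0)) \<in> V'" by (auto simp: \<Phi>_def)
    then show eq: "g (t, 0) = (t, s t)" by (metis s_def prod.collapse)
    show "\<gamma> t \<in> V'" "\<rho> (\<gamma> t) = 0" using * unfolding eq by (auto simp: q_def \<gamma>_def)
  qed
  have s0: "s 0 = 0"
  proof -
    have "g (\<Phi> (0, 0)) = (0, 0)" using hom U'(3) by (auto simp: homeomorphism_def)
    then show ?thesis using g(1)[OF I(2)] \<Phi>0 by simp
  qed
  define G0 where "G0 x = - fd \<rho> x v * inverse (fd \<rho> x u)" for x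
  have G0: "smooth_on V' G0"
  proof -
    have "smooth_on V' (\<lambda>x. (- 1 * fd \<rho> x v) * inverse (fd \<rho> x u))"
      by (intro smooth_on_mult smooth_on_const smooth_on_inverse smooth_on_fd \<rho>' V')
    then show ?thesis by (simp add: G0_def[abs_def])
  qed
  have sd: "(s has_real_derivative G0 (\<gamma> t)) (at t)" if t: "t \<in> I" for t
  proof -
    have "((\<lambda>t. (t, 0::real)) has_derivative (\<lambda>h. (h, 0))) (at t)" by (rule derivative_eq_intros refl | simp)+
    from has_derivative_snd[OF has_derivative_compose[OF this gd[OF I(3)[OF t]]]]
    have "(s has_derivative (\<lambda>h. snd (g' (t, 0) (h, 0)))) (at t)" by (simp add: s_def[abs_def])
    then have "s differentiable (at t)" by (auto simp: differentiable_def)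
    then obtain D where D: "(s has_real_derivative D) (at t)" using real_differentiableE by blast
    then have "(s has_derivative (\<lambda>h. h * D)) (at t)" by (simp add: has_field_derivative_def mult_commute_abs)
    then have "(\<gamma> has_derivative (\<lambda>h. h *\<^sub>R v + (h * D) *\<^sub>R u)) (at t)"
      unfolding \<gamma>_def[abs_def] by (auto intro!: derivative_eq_intros)
    from has_derivative_compose[OF this smooth_on_has_derivative[OF \<rho>' g(2)[OF t]]]
    have "((\<lambda>t. \<rho> (\<gamma> t)) has_derivative (\<lambda>h. h * fd \<rho> (\<gamma> t) v + (h * D) * fd \<rho> (\<gamma> t) u)) (at t)"
      by (simp only: lin[OF \<rho>' g(2)[OF t]])
    then have "((\<lambda>t. 0) has_derivative (\<lambda>h. h * fd \<rho> (\<gamma> t) v + (h * D) * fd \<rho> (\<gamma> t) u)) (at t)"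
      by (rule has_derivative_transform_within_open[OF _ I(1) t]) (use g(3) in auto)
    from fun_cong[OF has_derivative_unique[OF this has_derivative_const], of 1]
    have "fd \<rho> (\<gamma> t) v + D * fd \<rho> (\<gamma> t) u = 0" by simp
    then have "D = G0 (\<gamma> t)" using V'(4)[OF g(2)[OF t]] by (simp add: G0_def field_simps add_eq_0_iff)
    then show ?thesis using D by simp
  qed
  have \<gamma>d: "(\<gamma> has_derivative (\<lambda>h. h *\<^sub>R v + (h * G0 (\<gamma> t)) *\<^sub>R u)) (at t)" if "t \<in> I" for t
  proof -
    have "(s has_derivative (\<lambda>h. h * G0 (\<gamma> t))) (at t)" using sd[OF that] by (simp add: has_field_derivative_def mult_commute_abs)
    then show ?thesis unfolding \<gamma>_def[abs_def] by (auto intro!: derivative_eq_intros)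
  qed
  have \<gamma>c: "continuous_on I \<gamma>" by (meson \<gamma>d continuous_at_imp_continuous_on has_derivative_continuous)
  \<comment> \<open>Each derivative of \<open>h (\<gamma> t)\<close> is again a smooth function
    evaluated along \<open>\<gamma>\<close>, by the equation for the velocity; quantifying over
    \<open>h\<close> lets the induction close.\<close>
  have comp: "Ck_on k I (\<lambda>t. h (\<gamma> t))" if "smooth_on V' h" for k and h :: "'x \<Rightarrow> real"
    using that
  proof (induction k arbitrary: h)
    case 0
    then show ?case using g(2) by (auto intro!: continuous_on_compose2[OF smooth_on_continuous \<gamma>c])
  next
    case (Suc k)
    show ?case
    proof (rule Ck_on_SucI[OF I(1)])
      show "((\<lambda>t. h (\<gamma> t)) has_derivative (\<lambda>w. w * (fd h (\<gamma> t) v + G0 (\<gamma> t) * fd h (\<gamma> t) u))) (at t)" if t: "t \<in> I" for t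
      proof -
        have "((\<lambda>t. h (\<gamma> t)) has_derivative (\<lambda>w. w * fd h (\<gamma> t) v + (w * G0 (\<gamma> t)) * fd h (\<gamma> t) u)) (at t)"
          using has_derivative_compose[OF \<gamma>d[OF t] smooth_on_has_derivative[OF Suc.prems g(2)[OF t]]]
          by (simp only: lin[OF Suc.prems g(2)[OF t]])
        then show ?thesis by (simp add: algebra_simps)
      qed
      fix w :: real
      have "smooth_on V' (\<lambda>x. w * (fd h x v + G0 x * fd h x u))"
        by (intro smooth_on_mult smooth_on_add smooth_on_const smooth_on_fd Suc.prems G0 V')
      then show "Ck_on k I (\<lambda>t. w * (fd h (\<gamma> t) v + G0 (\<gamma> t) * fd h (\<gamma> t) u))" by (rule Suc.IH)
    qed
  qed
  have "smooth_on I \<gamma>"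
    unfolding smooth_on_def
  proof
    fix k show "Ck_on k I \<gamma>"
    proof (cases k)
      case 0
      then show ?thesis using \<gamma>c by simp
    next
      case (Suc j)
      have "Ck_on (Suc j) I \<gamma>"
      proof (rule Ck_on_SucI[OF I(1) \<gamma>d])
        fix w :: real
        have "smooth_on V' (\<lambda>x. w * G0 x)" by (intro smooth_on_mult smooth_on_const G0 V')
        then show "Ck_on j I (\<lambda>t. w *\<^sub>R v + (w * G0 (\<gamma> t)) *\<^sub>R u)"
          by (intro Ck_on_scaleR_affine I(1)) (rule comp)
      qed
      then show ?thesis using Suc by simp
    qed
  qed
  moreover have "(\<gamma> has_vector_derivative v) (at 0)"
  proof -
    have "\<gamma> 0 = p" using s0 by (simp add: \<gamma>_def)
    then have "G0 (\<gamma> 0) = 0" using v by (simp add: G0_def)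
    then show ?thesis using \<gamma>d[OF I(2)] by (simp add: has_vector_derivative_def)
  qed
  ultimately show ?thesis
    using e(1) s0 g(2,3) V'(3) unfolding I_def \<gamma>_def by (intro exI[of _ s] exI[of _ e]) auto
qed

lemma tangent_space_hypersurface:
  fixes M V :: "(complex^'m) set" and \<rho> :: "complex^'m \<Rightarrow> real"
  assumes V: "open V" and \<rho>: "smooth_on V \<rho>" and nz: "\<And>x. x \<in> V \<Longrightarrow> fd \<rho> x \<noteq> (\<lambda>v. 0)"
    and M: "M \<inter> V = {x\<in>V. \<rho> x = 0}" and x: "x \<in> M" "x \<in> V"
  shows "tangent_space M x = {v. fd \<rho> x v = 0}"
proof (intro Set.equalityI subsetI)
  fix v assume "v \<in> tangent_space M x"
  then obtain \<gamma> e where \<gamma>: "e > 0" "\<gamma> ` {-e<..<e} \<subseteq> M" "\<gamma> 0 = x" "(\<gamma> has_vector_derivative v) (at 0)"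
    unfolding tangent_space_def by blast
  have d: "(\<gamma> has_derivative (\<lambda>h. h *\<^sub>R v)) (at 0)" using \<gamma>(4) by (simp add: has_vector_derivative_def)
  have "((\<lambda>t. \<rho> (\<gamma> t)) has_derivative (\<lambda>h. fd \<rho> x (h *\<^sub>R v))) (at 0)"
    using has_derivative_compose[OF d smooth_on_has_derivative[OF \<rho>]] \<gamma>(3) x by simp
  moreover have "((\<lambda>t. \<rho> (\<gamma> t)) has_derivative (\<lambda>h. 0)) (at 0)"
  proof -
    have "isCont \<gamma> 0" using has_derivative_continuous[OF d] .
    then have "\<forall>\<^sub>F t in at 0. \<gamma> t \<in> V" using V x \<gamma>(3) by (intro topological_tendstoD) (auto simp: isCont_def)
    moreover have "\<forall>\<^sub>F t in at 0. t \<in> {-e<..<e}" using \<gamma>(1) by (intro eventually_at_in_open') auto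
    ultimately have "\<forall>\<^sub>F t in at 0. \<rho> (\<gamma> t) = 0"
    proof eventually_elim
      case (elim t)
      then have "\<gamma> t \<in> M \<inter> V" using \<gamma>(2) by blast
      then show ?case unfolding M by simp
    qed
    moreover have "\<rho> (\<gamma> 0) = 0" using x M \<gamma>(3) by blast
    ultimately show ?thesis by (intro has_derivative_transform_eventually[OF has_derivative_const]) (auto elim: eventually_mono)
  qed
  ultimately have "(\<lambda>h. fd \<rho> x (h *\<^sub>R v)) = (\<lambda>h. 0)" by (rule has_derivative_unique)
  from fun_cong[OF this, of 1] show "v \<in> {v. fd \<rho> x v = 0}" by simp
next
  fix v assume v: "v \<in> {v. fd \<rho> x v = 0}"
  obtain u where u: "fd \<rho> x u \<noteq> 0" using nz[OF x(2)] by fastforce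
  have "\<rho> x = 0" using x M by blast
  from hypersurface_curve[OF V x(2) \<rho> this u] v obtain s e where
    e: "0 < e" "smooth_on {-e<..<e} (\<lambda>t. (x + t *\<^sub>R v) + s t *\<^sub>R u)" "s 0 = 0"
    "\<forall>t\<in>{-e<..<e}. (x + t *\<^sub>R v) + s t *\<^sub>R u \<in> V \<and> \<rho> ((x + t *\<^sub>R v) + s t *\<^sub>R u) = 0"
    "((\<lambda>t. (x + t *\<^sub>R v) + s t *\<^sub>R u) has_vector_derivative v) (at 0)" by blast
  have "(\<lambda>t. (x + t *\<^sub>R v) + s t *\<^sub>R u) ` {-e<..<e} \<subseteq> M" using e(4) M by blast
  then show "v \<in> tangent_space M x"
    unfolding tangent_space_def mem_Collect_eq using e by (intro exI[of _ "\<lambda>t. (x + t *\<^sub>R v) + s t *\<^sub>R u"] exI[of _ e]) auto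
qed

section \<open>Eigenvalues of Hermitian matrices\<close>

lemma in_span_imageE:
  assumes "finite I" "y \<in> vec.span (x ` I)"
  obtains c where "y = (\<Sum>i\<in>I. c i *s x i)"
proof -
  have "\<exists>c. y = (\<Sum>i\<in>I. c i *s x i)"
    using assms(2)
  proof (induction rule: vec.span_induct_alt)
    case base
    show ?case by (rule exI[of _ "\<lambda>_. 0"]) simp
  next
    case (step a z y)
    then obtain i c where i: "i \<in> I" "z = x i" "y = (\<Sum>i\<in>I. c i *s x i)" by auto
    have "a *s z + y = (\<Sum>j\<in>I. (if j = i then a *s x j else 0) + c j *s x j)"
      using i assms(1) by (simp add: sum.distrib)
    also have "\<dots> = (\<Sum>j\<in>I. (c(i := a + c i)) j *s x j)"
      by (intro sum.cong) (auto simp: vector_sadd_rdistrib)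
    finally show ?case by blast
  qed
  then show ?thesis using that by blast
qed

context hermitian_form
begin

lemma positive_span:
  assumes I: "finite I" and orth: "\<And>i j. i \<in> I \<Longrightarrow> j \<in> I \<Longrightarrow> i \<noteq> j \<Longrightarrow> L (x i) (x j) = 0"
    and pos: "\<And>i. i \<in> I \<Longrightarrow> Re (L (x i) (x i)) > 0"
  shows "y \<in> vec.span (x ` I) \<Longrightarrow> y \<noteq> 0 \<Longrightarrow> Re (L y y) > 0"
    and "vec.dim (vec.span (x ` I)) = card I"
proof -
  have val: "L (x j) (\<Sum>i\<in>I. c i *s x i) = cnj (c j) * L (x j) (x j)" if "j \<in> I" for j c
  proof -
    have "L (x j) (\<Sum>i\<in>I. c i *s x i) = (\<Sum>i\<in>I. if i = j then cnj (c j) * L (x j) (x j) else 0)"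
      unfolding sum_right by (intro sum.cong refl) (use orth[OF that] in \<open>auto simp: scale_right\<close>)
    then show ?thesis using that I by simp
  qed
  show "Re (L y y) > 0" if y: "y \<in> vec.span (x ` I)" "y \<noteq> 0"
  proof -
    obtain c where c: "y = (\<Sum>i\<in>I. c i *s x i)" using in_span_imageE[OF I y(1)] by blast
    have "L y y = (\<Sum>j\<in>I. c j * L (x j) y)" by (subst (1) c) (simp only: sum_left scale_left)
    also have "\<dots> = (\<Sum>j\<in>I. c j * (cnj (c j) * L (x j) (x j)))" unfolding c by (intro sum.cong refl) (simp only: val)
    also have "\<dots> = (\<Sum>j\<in>I. of_real ((cmod (c j))\<^sup>2) * L (x j) (x j))"
      by (simp only: complex_norm_square mult.assoc)
    finally have eq: "Re (L y y) = (\<Sum>j\<in>I. (cmod (c j))\<^sup>2 * Re (L (x j) (x j)))" by simp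
    obtain j where j: "j \<in> I" "c j \<noteq> 0"
    proof -
      have "\<exists>j\<in>I. c j \<noteq> 0"
      proof (rule ccontr)
        assume "\<not> (\<exists>j\<in>I. c j \<noteq> 0)"
        then have "y = 0" unfolding c by (intro sum.neutral) auto
        then show False using y(2) by simp
      qed
      then show ?thesis using that by blast
    qed
    show ?thesis unfolding eq
    proof (rule sum_pos2[OF I j(1)])
      show "0 < (cmod (c j))\<^sup>2 * Re (L (x j) (x j))" using j pos by simp
      show "0 \<le> (cmod (c i))\<^sup>2 * Re (L (x i) (x i))" if "i \<in> I" for i
        using pos[OF that] by (intro mult_nonneg_nonneg) auto
    qed
  qed
  have notin: "x i \<notin> vec.span (x ` (I - {i}))" if "i \<in> I" for i
  proof
    assume "x i \<in> vec.span (x ` (I - {i}))"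
    then obtain c where c: "x i = (\<Sum>j\<in>I - {i}. c j *s x j)" using in_span_imageE[of "I - {i}" "x i" x] I by blast
    have "L (x i) (x i) = L (x i) (\<Sum>j\<in>I - {i}. c j *s x j)" by (rule arg_cong[OF c, of "L (x i)"])
    also have "\<dots> = (\<Sum>j\<in>I - {i}. cnj (c j) * L (x i) (x j))" by (simp only: sum_right scale_right)
    also have "\<dots> = 0" using orth[OF that] by (intro sum.neutral) auto
    finally show False using pos[OF that] by simp
  qed
  have inj: "inj_on x I"
  proof (rule inj_onI, rule ccontr)
    fix i j assume ij: "i \<in> I" "j \<in> I" "x i = x j" "i \<noteq> j"
    then have "x i \<in> x ` (I - {i})" by auto
    then have "x i \<in> vec.span (x ` (I - {i}))" by (rule vec.span_base)
    then show False using notin[OF ij(1)] by contradiction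
  qed
  have "vec.independent (x ` I)"
    unfolding vec.dependent_def
  proof
    assume "\<exists>a\<in>x ` I. a \<in> vec.span (x ` I - {a})"
    then obtain i where i: "i \<in> I" "x i \<in> vec.span (x ` I - {x i})" by blast
    have "x ` I - {x i} \<subseteq> x ` (I - {i})" by auto
    then show False using notin[OF i(1)] i(2) vec.span_mono by blast
  qed
  then have "vec.dim (vec.span (x ` I)) = card (x ` I)" by (simp add: vec.dim_eq_card_independent)
  then show "vec.dim (vec.span (x ` I)) = card I" using card_image[OF inj] by simp
qed

end

section \<open>Orthogonal projection and the signs of eigenvalues\<close>

lemma inner_eq_Re_hf: "x \<bullet> y = Re (hf (\<lambda>_. 1) x y)"
  by (simp add: inner_vec_def hf_def inner_complex_def)

text \<open>A complex subspace contains \<open>\<i> *s w\<close> with \<open>w\<close>, so the real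
  orthogonal decomposition is already orthogonal for the Hermitian product.\<close>

lemma hermitian_projection:
  fixes W :: "(complex^'m) set"
  assumes W: "vec.subspace W"
  obtains y z where "x = y + z" "y \<in> W" "\<And>w. w \<in> W \<Longrightarrow> hf (\<lambda>_. 1) z w = 0"
proof -
  have sub: "Real_Vector_Spaces.subspace W"
    using W unfolding vec.subspace_def real_vector.subspace_def by (auto simp: scaleR_eq_smult)
  obtain y z where yz: "y \<in> Real_Vector_Spaces.span W" "\<And>w. w \<in> Real_Vector_Spaces.span W \<Longrightarrow> Linear_Algebra.orthogonal z w" "x = y + z"
    using orthogonal_subspace_decomp_exists[of W x] by blast
  have sp: "Real_Vector_Spaces.span W = W" using sub by (rule real_vector.span_eq_iff[THEN iffD2])
  have "hf (\<lambda>_. 1) z w = 0" if w: "w \<in> W" for w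
  proof -
    have "\<i> *s w \<in> W" by (rule vec.subspace_scale[OF W w])
    then have "Re (hf (\<lambda>_. 1) z w) = 0" "Re (hf (\<lambda>_. 1) z (\<i> *s w)) = 0"
      using yz(2) w unfolding sp Linear_Algebra.orthogonal_def inner_eq_Re_hf by auto
    then show ?thesis by (simp add: complex_eq_iff hf.scale_right)
  qed
  then show ?thesis using that[of y z] yz(1,3) sp by simp
qed

lemma proots_prod_linear: "proots (\<Prod>a\<leftarrow>as. [:- a, 1:]) = mset (as :: complex list)"
proof (induction as)
  case (Cons a as)
  have "(\<Prod>a\<leftarrow>as. [:- a, 1:]) \<noteq> (0 :: complex poly)" by (auto simp: prod_list_zero_iff)
  then have "proots ([:- a, 1:] * (\<Prod>a\<leftarrow>as. [:- a, 1:])) = proots [:- a, 1:] + proots (\<Prod>a\<leftarrow>as. [:- a, 1:])"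
    by (intro proots_mult) auto
  then show ?case unfolding list.map prod_list.Cons Cons by simp
qed simp

lemma size_filter_diag: "size (filter_mset P (mset (map f [0..<n]))) = card {i. i < n \<and> P (f i)}"
proof -
  have "size (filter_mset P (mset (map f [0..<n]))) = length (filter P (map f [0..<n]))"
    by (metis mset_filter size_mset)
  also have "\<dots> = length (filter (\<lambda>i. P (f i)) [0..<n])" by (simp add: filter_map o_def)
  also have "\<dots> = card {i. i < n \<and> P (f i)}"
    by (subst distinct_card[symmetric]) (auto intro!: arg_cong[of _ _ card])
  finally show ?thesis .
qed

text \<open>The eigenvalues are counted as roots of the characteristic polynomial, so the link to
  squares goes through a Schur triangularization. Its flag is invariant under the Hermitian
  operator, hence orthogonalizing along the flag diagonalizes; the new diagonal entries are
  eigenvalues times positive norms and have the same signs. The type \<open>'m\<close> is just an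
  ambient space in which the product \<open>hf\<close> and projections are available.\<close>

lemma hermitian_diagonalization:
  fixes G :: "complex Matrix.mat" and dummy :: "'m::finite itself"
  assumes G: "G \<in> carrier_mat n n" and herm: "\<And>i j. i < n \<Longrightarrow> j < n \<Longrightarrow> G $$ (j, i) = cnj (G $$ (i, j))"
    and n: "n \<le> CARD('m)"
  obtains w :: "nat \<Rightarrow> nat \<Rightarrow> complex" and ev :: "nat \<Rightarrow> real" where
    "\<forall>i<n. \<forall>j<n. (\<Sum>\<alpha><n. \<Sum>\<beta><n. w i \<alpha> * cnj (w j \<beta>) * G $$ (\<alpha>, \<beta>)) = (if i = j then of_real (ev i) else 0)"
    "num_pos_eigenvalues G = card {i. i < n \<and> ev i > 0}" "num_neg_eigenvalues G = card {i. i < n \<and> ev i < 0}"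
    "Determinant.det G \<noteq> 0 \<longrightarrow> num_pos_eigenvalues G + num_neg_eigenvalues G = n"
proof -
  obtain as where as: "char_poly G = (\<Prod>a\<leftarrow>as. [:- a, 1:])" using char_poly_factorized[OF G] by blast
  obtain B P Q where BPQ: "schur_decomposition G as = (B, P, Q)" by (metis prod.exhaust)
  from schur_decomposition[OF G as BPQ] have sim: "similar_mat_wit G B P Q" and ut: "upper_triangular B" and dg: "diag_mat B = as" by auto
  have car: "B \<in> carrier_mat n n" "P \<in> carrier_mat n n" "Q \<in> carrier_mat n n" and QP: "Q * P = 1\<^sub>m n" and PQ: "P * Q = 1\<^sub>m n" and GPBQ: "G = P * B * Q"
    using similar_mat_witD2[OF G sim] by auto
  have GP: "G * P = P * B"
  proof -
    have "G * P = P * B * (Q * P)" unfolding GPBQ using car by (simp add: assoc_mult_mat[of _ n n _ n _ n])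
    then show ?thesis using car by (simp add: QP)
  qed
  obtain \<iota> :: "nat \<Rightarrow> 'm" where \<iota>: "inj_on \<iota> {..<n}"
  proof -
    have "card {..<n} \<le> card (UNIV :: 'm set)" using n by simp
    then show ?thesis using that card_le_inj[of "{..<n}" "UNIV :: 'm set"] by auto
  qed
  define emb :: "(nat \<Rightarrow> complex) \<Rightarrow> complex^'m" where "emb x = (\<Sum>\<alpha><n. x \<alpha> *s axis (\<iota> \<alpha>) 1)" for x
  have emb_nth: "emb x $ \<iota> \<alpha> = x \<alpha>" if "\<alpha> < n" for x \<alpha>
  proof -
    have "emb x $ \<iota> \<alpha> = (\<Sum>\<beta><n. if \<beta> = \<alpha> then x \<beta> else 0)"
      unfolding emb_def sum_component using that \<iota> by (intro sum.cong refl) (auto simp: axis_def inj_on_def)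
    then show ?thesis using that by simp
  qed
  define A where "A x = emb (\<lambda>\<alpha>. \<Sum>\<beta><n. G $$ (\<alpha>, \<beta>) * x $ \<iota> \<beta>)" for x
  define p where "p j = emb (\<lambda>\<alpha>. P $$ (\<alpha>, j))" for j
  define W where "W j = vec.span (p ` {..<j})" for j
  have emb_add: "emb x + emb y = emb (\<lambda>\<alpha>. x \<alpha> + y \<alpha>)" and emb_scale: "a *s emb x = emb (\<lambda>\<alpha>. a * x \<alpha>)" for x y a
    by (simp_all add: emb_def sum.distrib vector_sadd_rdistrib vec.scale_sum_right vec.scale_scale)
  have emb_sum: "(\<Sum>i\<in>I. emb (f i)) = emb (\<lambda>\<alpha>. \<Sum>i\<in>I. f i \<alpha>)" for I :: "nat set" and f
  proof -
    have "(\<Sum>i\<in>I. emb (f i)) = (\<Sum>\<alpha><n. \<Sum>i\<in>I. f i \<alpha> *s axis (\<iota> \<alpha>) 1)" unfolding emb_def by (rule sum.swap)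
    then show ?thesis by (simp add: emb_def vec.scale_sum_left)
  qed
  have A_add: "A (x + y) = A x + A y" and A_scale: "A (a *s x) = a *s A x" for x y a
    by (simp_all add: A_def emb_add emb_scale sum.distrib distrib_left sum_distrib_left mult.left_commute)
  let ?ip = "hf (\<lambda>_. 1 :: real)"
  have ip_emb: "?ip (emb x) y = (\<Sum>\<alpha><n. x \<alpha> * cnj (y $ \<iota> \<alpha>))" for x and y :: "complex^'m"
  proof -
    have "?ip (axis i 1) y = cnj (y $ i)" for i
    proof -
      have "?ip (axis i 1) y = (\<Sum>j\<in>UNIV. if j = i then cnj (y $ j) else 0)"
        unfolding hf_def by (intro sum.cong refl) (auto simp: axis_def)
      then show ?thesis by simp
    qed
    then show ?thesis by (simp add: emb_def hf.sum_left hf.scale_left)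
  qed
  have ip_A: "?ip (A x) y = (\<Sum>\<alpha><n. \<Sum>\<beta><n. cnj (y $ \<iota> \<alpha>) * x $ \<iota> \<beta> * G $$ (\<alpha>, \<beta>))" for x y
    unfolding A_def ip_emb by (simp add: sum_distrib_right sum_distrib_left ac_simps)
  have A_herm: "?ip (A x) y = cnj (?ip (A y) x)" for x y
  proof -
    have "cnj (?ip (A y) x) = (\<Sum>\<alpha><n. \<Sum>\<beta><n. x $ \<iota> \<alpha> * cnj (y $ \<iota> \<beta>) * cnj (G $$ (\<alpha>, \<beta>)))"
      by (simp add: ip_A)
    also have "\<dots> = (\<Sum>\<alpha><n. \<Sum>\<beta><n. x $ \<iota> \<alpha> * cnj (y $ \<iota> \<beta>) * G $$ (\<beta>, \<alpha>))"
    proof (intro sum.cong refl)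
      fix \<alpha> \<beta> assume "\<alpha> \<in> {..<n}" "\<beta> \<in> {..<n}"
      then have "cnj (G $$ (\<alpha>, \<beta>)) = G $$ (\<beta>, \<alpha>)" using herm[of \<alpha> \<beta>] by simp
      then show "x $ \<iota> \<alpha> * cnj (y $ \<iota> \<beta>) * cnj (G $$ (\<alpha>, \<beta>)) = x $ \<iota> \<alpha> * cnj (y $ \<iota> \<beta>) * G $$ (\<beta>, \<alpha>)" by simp
    qed
    also have "\<dots> = (\<Sum>\<beta><n. \<Sum>\<alpha><n. x $ \<iota> \<alpha> * cnj (y $ \<iota> \<beta>) * G $$ (\<beta>, \<alpha>))" by (rule sum.swap)
    also have "\<dots> = ?ip (A x) y" unfolding ip_A by (intro sum.cong refl arg_cong2[of _ _ _ _ "(*)"] mult.commute)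
    finally show ?thesis by (rule sym)
  qed
  have Ap: "A (p j) - B $$ (j, j) *s p j \<in> W j" if j: "j < n" for j
  proof -
    have "(\<Sum>\<beta><n. G $$ (\<alpha>, \<beta>) * P $$ (\<beta>, j)) = (\<Sum>i<n. P $$ (\<alpha>, i) * B $$ (i, j))" if "\<alpha> < n" for \<alpha>
    proof -
      have "(G * P) $$ (\<alpha>, j) = (P * B) $$ (\<alpha>, j)" by (simp add: GP)
      then show ?thesis using that j G car by (simp add: scalar_prod_def lessThan_atLeast0)
    qed
    moreover have "p j $ \<iota> \<beta> = P $$ (\<beta>, j)" if "\<beta> < n" for \<beta> using that by (simp add: p_def emb_nth)
    ultimately have "A (p j) = emb (\<lambda>\<alpha>. \<Sum>i<n. P $$ (\<alpha>, i) * B $$ (i, j))"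
      unfolding A_def emb_def by (intro sum.cong refl) simp
    also have "\<dots> = (\<Sum>i<n. B $$ (i, j) *s p i)"
      unfolding p_def emb_scale by (simp add: emb_sum mult.commute)
    also have "\<dots> = (\<Sum>i<Suc j. B $$ (i, j) *s p i)"
      using j ut car by (intro sum.mono_neutral_right) (auto simp: upper_triangular_def)
    finally have "A (p j) - B $$ (j, j) *s p j = (\<Sum>i<j. B $$ (i, j) *s p i)" by simp
    also have "\<dots> \<in> W j" unfolding W_def by (intro vec.span_sum vec.span_scale vec.span_base) auto
    finally show ?thesis .
  qed
  have Wmono: "W i \<subseteq> W j" if "i \<le> j" for i j unfolding W_def using that by (intro vec.span_mono) auto
  have pW: "p i \<in> W j" if "i < j" for i j unfolding W_def using that by (intro vec.span_base) auto
  have Wsub: "vec.subspace (W j)" for j unfolding W_def by simp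
  have AW: "A x \<in> W j" if "x \<in> W j" "j \<le> n" for x j
    using that(1) unfolding W_def
  proof (induction rule: vec.span_induct_alt)
    case base
    have "A 0 = 0" using A_scale[of 0 0] by simp
    then show ?case by (simp add: vec.span_zero)
  next
    case (step a z y)
    then obtain i where i: "i < j" "z = p i" by auto
    have "A (p i) - B $$ (i, i) *s p i \<in> W j" using Ap[of i] Wmono[of i j] i that(2) by auto
    then have "(A (p i) - B $$ (i, i) *s p i) + B $$ (i, i) *s p i \<in> W j"
      by (intro vec.subspace_add vec.subspace_scale Wsub pW i)
    then have "A z \<in> vec.span (p ` {..<j})" using i by (simp add: W_def)
    then show ?case using step by (simp add: A_add A_scale vec.span_add vec.span_scale)
  qed
  have pnot: "p j \<notin> W j" if j: "j < n" for j
  proof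
    assume "p j \<in> W j"
    \<comment> \<open>The \<open>j\<close>-th row of the inverse matrix \<open>Q\<close> reads off
      the coefficient of \<open>p j\<close> and annihilates the earlier columns.\<close>
    define \<phi> where "\<phi> x = (\<Sum>\<alpha><n. Q $$ (j, \<alpha>) * x $ \<iota> \<alpha>)" for x
    have \<phi>p: "\<phi> (p i) = (if i = j then 1 else 0)" if i: "i < n" for i
    proof -
      have "\<phi> (p i) = (Q * P) $$ (j, i)"
        using i j car by (simp add: \<phi>_def p_def emb_nth scalar_prod_def lessThan_atLeast0)
      then show ?thesis using i j by (simp add: QP)
    qed
    have "\<phi> x = 0" if "x \<in> W j" for x
      using that unfolding W_def
    proof (induction rule: vec.span_induct_alt)
      case base
      then show ?case by (simp add: \<phi>_def)
    next
      case (step a z y)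
      then obtain i where i: "i < j" "z = p i" by auto
      have "\<phi> (a *s z + y) = a * \<phi> z + \<phi> y" by (simp add: \<phi>_def sum.distrib distrib_left sum_distrib_left mult.left_commute)
      then show ?case using step i \<phi>p[of i] j by simp
    qed
    then show False using \<open>p j \<in> W j\<close> \<phi>p[OF j] by auto
  qed
  have "\<exists>q. \<forall>j<n. p j - q j \<in> W j \<and> (\<forall>w\<in>W j. ?ip (q j) w = 0)"
  proof -
    have "\<exists>q. p j - q \<in> W j \<and> (\<forall>w\<in>W j. ?ip q w = 0)" for j
    proof -
      obtain y z where yz: "p j = y + z" "y \<in> W j" "\<And>w. w \<in> W j \<Longrightarrow> ?ip z w = 0" using hermitian_projection[OF Wsub] by metis
      then show ?thesis by (intro exI[of _ z]) auto
    qed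
    then show ?thesis by metis
  qed
  then obtain q where q: "\<And>j. j < n \<Longrightarrow> p j - q j \<in> W j" "\<And>j w. j < n \<Longrightarrow> w \<in> W j \<Longrightarrow> ?ip (q j) w = 0" by blast
  have qW: "q i \<in> W j" if "i < j" "j \<le> n" for i j
  proof -
    have "p i - q i \<in> W j" using q(1)[of i] Wmono[of i j] that by auto
    then have "p i - (p i - q i) \<in> W j" by (rule vec.subspace_diff[OF Wsub pW[OF that(1)]])
    then show ?thesis by simp
  qed
  have qn: "q j \<noteq> 0" if "j < n" for j using q(1)[OF that] pnot[OF that] by auto
  have qq: "?ip (q j) (q j) \<noteq> 0" "Re (?ip (q j) (q j)) > 0" if "j < n" for j
  proof -
    have "Re (?ip (q j) (q j)) = q j \<bullet> q j" by (simp only: inner_eq_Re_hf)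
    then show "Re (?ip (q j) (q j)) > 0" using qn[OF that] by simp
    then show "?ip (q j) (q j) \<noteq> 0" by auto
  qed
  have off: "?ip (A (q i)) (q j) = 0" if "i < j" "j < n" for i j
  proof -
    have "A (q i) \<in> W j" using AW qW that by simp
    then have "?ip (q j) (A (q i)) = 0" using q(2) that by simp
    then show ?thesis using hf.hermitian[of "\<lambda>_. 1" "A (q i)" "q j"] by simp
  qed
  have diag: "?ip (A (q j)) (q j) = B $$ (j, j) * ?ip (q j) (q j)" if j: "j < n" for j
  proof -
    have d: "q j = p j + (- 1) *s (p j - q j)" by simp
    have "A (q j) = A (p j) + (- 1) *s A (p j - q j)" by (subst d) (simp only: A_add A_scale)
    then have "A (q j) - B $$ (j, j) *s q j = (A (p j) - B $$ (j, j) *s p j) + (-1) *s A (p j - q j) + B $$ (j, j) *s (p j - q j)"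
      by (simp add: vec.scale_right_diff_distrib)
    also have "\<dots> \<in> W j"
      by (intro vec.subspace_add vec.subspace_scale Wsub Ap j AW q(1)) (use j in simp)
    finally have "?ip (q j) (A (q j) - B $$ (j, j) *s q j) = 0" using q(2)[OF j] by blast
    then have "?ip (A (q j) - B $$ (j, j) *s q j) (q j) = 0"
      using hf.hermitian[of "\<lambda>_. 1" "A (q j) - B $$ (j, j) *s q j" "q j"] by simp
    then show ?thesis by (simp add: hf.diff_left hf.scale_left)
  qed
  have Breal: "B $$ (j, j) = of_real (Re (B $$ (j, j)))" if j: "j < n" for j
  proof -
    have "?ip (A (q j)) (q j) = cnj (?ip (A (q j)) (q j))" by (rule A_herm)
    then have "B $$ (j, j) * ?ip (q j) (q j) = cnj (B $$ (j, j)) * ?ip (q j) (q j)"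
      unfolding diag[OF j] using hf.hermitian[of "\<lambda>_. 1" "q j" "q j"] by simp
    then have "B $$ (j, j) = cnj (B $$ (j, j))" using qq(1)[OF j] by simp
    then show ?thesis by (simp add: complex_eq_iff)
  qed
  define ev where "ev j = Re (B $$ (j, j)) * Re (?ip (q j) (q j))" for j
  \<comment> \<open>The conjugate matches the convention of the claim, where the first index of
    \<open>G\<close> is paired with an unconjugated coefficient.\<close>
  define w where "w i \<alpha> = cnj (q i $ \<iota> \<alpha>)" for i \<alpha>
  have as': "as = map (\<lambda>i. B $$ (i, i)) [0..<n]" using dg car by (simp add: diag_mat_def)
  have proots: "proots (char_poly G) = mset (map (\<lambda>i. B $$ (i, i)) [0..<n])" unfolding as proots_prod_linear as' ..
  have Bre: "B $$ (i, i) \<in> \<real>" if "i < n" for i using Breal[OF that] by (metis Reals_of_real)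
  show ?thesis
  proof (rule that[of w ev], intro allI impI)
    fix i j assume ij: "i < n" "j < n"
    have "(\<Sum>\<alpha><n. \<Sum>\<beta><n. w i \<alpha> * cnj (w j \<beta>) * G $$ (\<alpha>, \<beta>)) = ?ip (A (q j)) (q i)"
      by (simp add: w_def ip_A)
    also have "\<dots> = (if i = j then of_real (ev i) else 0)"
    proof (cases i j rule: linorder_cases)
      case less
      have "?ip (A (q j)) (q i) = cnj (?ip (A (q i)) (q j))" by (rule A_herm)
      then show ?thesis using off[OF less ij(2)] less by simp
    next
      case equal
      have "?ip (q j) (q j) = of_real (Re (?ip (q j) (q j)))" by (rule hf.diag_of_real)
      then have "?ip (A (q j)) (q j) = of_real (Re (B $$ (j, j))) * of_real (Re (?ip (q j) (q j)))"
        unfolding diag[OF ij(2)] using Breal[OF ij(2)] by simp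
      then show ?thesis using equal by (simp add: ev_def)
    next
      case greater
      then show ?thesis using off[OF greater ij(1)] by simp
    qed
    finally show "(\<Sum>\<alpha><n. \<Sum>\<beta><n. w i \<alpha> * cnj (w j \<beta>) * G $$ (\<alpha>, \<beta>)) = (if i = j then of_real (ev i) else 0)" .
  next
    show np: "num_pos_eigenvalues G = card {i. i < n \<and> ev i > 0}"
      unfolding num_pos_eigenvalues_def proots size_filter_diag
      by (rule arg_cong[of _ _ card]) (use Bre qq(2) in \<open>auto simp: ev_def zero_less_mult_iff dest: order.asym\<close>)
    show nn: "num_neg_eigenvalues G = card {i. i < n \<and> ev i < 0}"
      unfolding num_neg_eigenvalues_def proots size_filter_diag
      by (rule arg_cong[of _ _ card]) (use Bre qq(2) in \<open>auto simp: ev_def mult_less_0_iff dest: order.asym\<close>)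
    show "Determinant.det G \<noteq> 0 \<longrightarrow> num_pos_eigenvalues G + num_neg_eigenvalues G = n"
    proof
      assume det: "Determinant.det G \<noteq> 0"
      have "Determinant.det G = Determinant.det B" by (rule det_similar) (use sim in \<open>auto simp: similar_mat_def\<close>)
      also have "\<dots> = prod_list (map (\<lambda>i. B $$ (i, i)) [0..<n])" using det_upper_triangular[OF ut car(1)] dg as' by simp
      finally have "0 \<notin> set (map (\<lambda>i. B $$ (i, i)) [0..<n])" using det by (simp add: prod_list_zero_iff)
      then have B0: "B $$ (i, i) \<noteq> 0" if "i < n" for i using that by force
      have ev0: "ev i \<noteq> 0" if "i < n" for i
      proof
        assume "ev i = 0"
        then have "Re (B $$ (i, i)) = 0" using qq(2)[OF that] by (simp add: ev_def)
        then show False using B0[OF that] Breal[OF that] by simp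
      qed
      have "card ({i. i < n \<and> ev i > 0} \<union> {i. i < n \<and> ev i < 0}) = num_pos_eigenvalues G + num_neg_eigenvalues G"
        unfolding np nn by (rule card_Un_disjoint) auto
      moreover have "{i. i < n \<and> ev i > 0} \<union> {i. i < n \<and> ev i < 0} = {..<n}" using ev0 by (auto simp: neq_iff)
      ultimately show "num_pos_eigenvalues G + num_neg_eigenvalues G = n" by simp
    qed
  qed
qed

section \<open>Contact forms and the Levi form\<close>

lemma linear_scaleR_part:
  fixes \<theta> :: "complex^'m \<Rightarrow> real"
  assumes "linear \<theta>"
  shows "\<theta> (a *s e) = Re a * \<theta> e + Im a * \<theta> (\<i> *s e)"
proof -
  have "a *s e = Re a *\<^sub>R e + Im a *\<^sub>R (\<i> *s e)"
    by (simp add: cart_eq_iff scaleR_eq_smult) (simp add: complex_eq_iff)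
  then have "\<theta> (a *s e) = \<theta> (Re a *\<^sub>R e + Im a *\<^sub>R (\<i> *s e))" by simp
  also have "\<dots> = Re a * \<theta> e + Im a * \<theta> (\<i> *s e)"
    by (simp only: linear_add[OF assms] linear_scale[OF assms] real_scaleR_def)
  finally show ?thesis .
qed

lemma (in hermitian_form) levi_form_entry:
  assumes "\<And>x y. \<omega> x y = - 2 * c * Im (L x y)"
  shows "- \<i> * complexify2 \<omega> (part10 u) (part01 v) = of_real c * L u v"
proof -
  have half: "(1/2) *\<^sub>R x = complex_of_real (1/2) *s x" for x :: "complex^'a" by (rule scaleR_eq_smult)
  have 1: "- ((1/2) *\<^sub>R (\<i> *s x)) = (- \<i> / 2) *s x" "(1/2) *\<^sub>R (\<i> *s x) = (\<i> / 2) *s x" for x :: "complex^'a"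
    by (simp_all add: cart_eq_iff scaleR_eq_smult)
  have minus: "L (- x) y = - L x y" for x y using diff_left[of 0 x y] by simp
  show ?thesis
    unfolding complexify2_def part10_def part01_def fst_conv snd_conv 1 half assms scale_left scale_right
    by (simp add: complex_eq_iff minus scale_left)
qed

text \<open>\<open>S\<close> is a hypersurface of the affine space directed by \<open>X\<close>, and \<open>\<Phi>\<close> a lift of a holomorphic map that
  sends \<open>S\<close> into the cone \<open>hf s z z = 0\<close> and is transversal to it.\<close>

locale transversal_lift =
  fixes S V :: "(complex^'m) set" and \<theta> :: "'m form1" and X :: "(complex^'m) set"
    and \<Phi> :: "complex^'m \<Rightarrow> complex^'i" and s :: "'i::finite \<Rightarrow> real"
  assumes contact: "contact_form_on S V \<theta>" and \<Phi>: "holomorphic_map_on V \<Phi>" and X: "vec.subspace X"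
    and tangent: "\<And>x. x \<in> S \<Longrightarrow> x \<in> V \<Longrightarrow> tangent_space S x = {v \<in> X. Re (hf s (fd \<Phi> x v) (\<Phi> x)) = 0}"
    and null: "\<And>x. x \<in> S \<Longrightarrow> x \<in> V \<Longrightarrow> hf s (\<Phi> x) (\<Phi> x) = 0"
    and nonzero: "\<And>x. x \<in> S \<Longrightarrow> x \<in> V \<Longrightarrow> \<Phi> x \<noteq> 0"
    and s: "\<forall>i. s i \<noteq> 0"
begin

abbreviation "cf x v \<equiv> hf s (fd \<Phi> x v) (\<Phi> x)"

abbreviation "lf x u v \<equiv> hf s (fd \<Phi> x u) (fd \<Phi> x v)"

lemma V: "open V" and \<theta>_linear: "x \<in> V \<Longrightarrow> linear (\<theta> x)" and \<theta>_smooth: "smooth_on V (\<lambda>x. \<theta> x v)"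
  and \<theta>_kernel: "x \<in> S \<Longrightarrow> x \<in> V \<Longrightarrow> {v\<in>tangent_space S x. \<theta> x v = 0} = complex_tangent_space S x"
  using contact unfolding contact_form_on_def by auto

lemma lf_hermitian: "x \<in> V \<Longrightarrow> hermitian_form (lf x)"
  by unfold_locales (simp_all add: fd_add[OF \<Phi>] fd_scale[OF \<Phi>] hf.add_left hf.scale_left, rule hf.hermitian)

lemma cf_add: "x \<in> V \<Longrightarrow> cf x (u + v) = cf x u + cf x v" and cf_scale: "x \<in> V \<Longrightarrow> cf x (a *s v) = a * cf x v"
  by (simp_all add: fd_add[OF \<Phi>] fd_scale[OF \<Phi>] hf.add_left hf.scale_left)

lemma cf_diff: "x \<in> V \<Longrightarrow> cf x (u - v) = cf x u - cf x v"
  by (simp add: fd_diff[OF \<Phi>] hf.diff_left)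

lemma complex_tangent: "x \<in> S \<Longrightarrow> x \<in> V \<Longrightarrow> complex_tangent_space S x = {v \<in> X. cf x v = 0}"
  unfolding complex_tangent_space_def
  by (auto simp: tangent cf_scale complex_eq_iff intro: vec.subspace_scale[OF X])

lemma contact_on_kernel: "x \<in> S \<Longrightarrow> x \<in> V \<Longrightarrow> v \<in> X \<Longrightarrow> cf x v = 0 \<Longrightarrow> \<theta> x v = 0"
  using \<theta>_kernel complex_tangent by blast

text \<open>On the tangent space both \<open>\<theta>\<close> and the imaginary part of
  \<open>cf\<close> have the complex tangent space as kernel, so they are proportional; the factor
  is read off at \<open>\<i> *s e\<close>.\<close>

lemma contact_value:
  assumes x: "x \<in> S" "x \<in> V" and e: "e \<in> X" "cf x e = 1"
  shows "\<theta> x (\<i> *s e) \<noteq> 0" and "v \<in> X \<Longrightarrow> Re (cf x v) = 0 \<Longrightarrow> \<theta> x v = \<theta> x (\<i> *s e) * Im (cf x v)"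
proof -
  have "\<i> *s e \<in> X" by (rule vec.subspace_scale[OF X e(1)])
  moreover have "cf x (\<i> *s e) = \<i>" using e x by (simp add: cf_scale)
  ultimately have "\<i> *s e \<in> tangent_space S x" "\<i> *s e \<notin> complex_tangent_space S x"
    unfolding complex_tangent[OF x] tangent[OF x] by simp_all
  then show "\<theta> x (\<i> *s e) \<noteq> 0" using \<theta>_kernel[OF x] by blast
  show "\<theta> x v = \<theta> x (\<i> *s e) * Im (cf x v)" if v: "v \<in> X" "Re (cf x v) = 0"
  proof -
    have "cf x (v - cf x v *s e) = 0" using e x by (simp add: cf_diff cf_scale)
    then have "\<theta> x (v - cf x v *s e) = 0"
      by (rule contact_on_kernel[OF x, rotated]) (intro vec.subspace_diff vec.subspace_scale X v e)
    then have "\<theta> x v = \<theta> x (cf x v *s e)" by (simp add: linear_diff[OF \<theta>_linear[OF x(2)]])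
    also have "\<dots> = \<theta> x (\<i> *s e) * Im (cf x v)" using v linear_scaleR_part[OF \<theta>_linear[OF x(2)], of "cf x v" e] by simp
    finally show ?thesis .
  qed
qed

text \<open>Along a curve in \<open>S\<close> with velocity \<open>u\<close> the vector
  \<open>v - (cf v / cf e) *s e\<close> is complex tangent, so \<open>\<theta> v\<close> equals
  \<open>\<theta>\<close> of the multiple of \<open>e\<close>. Differentiating this identity is
  enough: \<open>cf v\<close> vanishes at the start, hence no derivative of \<open>\<theta>\<close>
  in direction \<open>e\<close> survives, and \<open>g\<close> is the derivative of the
  quotient.\<close>

lemma contact_derivative:
  assumes p: "p \<in> S" "p \<in> V" and e: "e \<in> X" "cf p e = 1"
    and u: "u \<in> X" "cf p u = 0" and v: "v \<in> X" "cf p v = 0"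
    and g: "g = hf s (fd (\<lambda>x. fd \<Phi> x v) p u) (\<Phi> p) + lf p v u"
  shows "fd (\<lambda>x. \<theta> x v) p u = Re g * \<theta> p e + Im g * \<theta> p (\<i> *s e)"
proof -
  have "u \<in> tangent_space S p" unfolding tangent[OF p] using u by simp
  then obtain \<gamma> \<epsilon> where \<gamma>: "\<epsilon> > 0" "\<gamma> ` {-\<epsilon><..<\<epsilon>} \<subseteq> S" "\<gamma> 0 = p" "(\<gamma> has_vector_derivative u) (at 0)"
    unfolding tangent_space_def by blast
  have d\<gamma>: "(\<gamma> has_derivative (\<lambda>h. h *\<^sub>R u)) (at 0)" using \<gamma>(4) by (simp add: has_vector_derivative_def)
  have d\<Phi>: "((\<lambda>t. \<Phi> (\<gamma> t)) has_derivative (\<lambda>h. fd \<Phi> p (h *\<^sub>R u))) (at 0)"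
    using has_derivative_compose[OF d\<gamma>, of \<Phi> "fd \<Phi> p"] holomorphic_map_has_derivative[OF \<Phi> p(2)] \<gamma>(3) by simp
  have dfd: "((\<lambda>t. fd \<Phi> (\<gamma> t) w) has_derivative (\<lambda>h. fd (\<lambda>x. fd \<Phi> x w) p (h *\<^sub>R u))) (at 0)" for w
    using has_derivative_compose[OF d\<gamma>, of "\<lambda>x. fd \<Phi> x w" "fd (\<lambda>x. fd \<Phi> x w) p"] \<gamma>(3)
      holomorphic_map_has_derivative[OF holomorphic_fd[OF \<Phi> V] p(2), of w] by simp
  have dc: "((\<lambda>t. cf (\<gamma> t) w) has_derivative
      (\<lambda>h. hf s (fd (\<lambda>x. fd \<Phi> x w) p (h *\<^sub>R u)) (\<Phi> p) + hf s (fd \<Phi> p w) (fd \<Phi> p (h *\<^sub>R u)))) (at 0)" for w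
    using has_derivative_hf[OF dfd d\<Phi>, of s w] \<gamma>(3) by (simp add: add.commute)
  have d\<theta>: "((\<lambda>t. \<theta> (\<gamma> t) w) has_derivative (\<lambda>h. fd (\<lambda>x. \<theta> x w) p (h *\<^sub>R u))) (at 0)" for w
    using has_derivative_compose[OF d\<gamma>, of "\<lambda>x. \<theta> x w" "fd (\<lambda>x. \<theta> x w) p"] \<gamma>(3)
      smooth_on_has_derivative[OF \<theta>_smooth p(2), of w] by simp
  let ?g = "\<lambda>t. cf (\<gamma> t) v / cf (\<gamma> t) e"
  have "((\<lambda>t. cf (\<gamma> t) e) \<longlongrightarrow> cf (\<gamma> 0) e) (at 0)" using has_derivative_continuous[OF dc, of e] by (simp add: continuous_at)
  then have ev1: "\<forall>\<^sub>F t in at 0. cf (\<gamma> t) e \<noteq> 0" by (rule tendsto_imp_eventually_ne) (simp add: \<gamma>(3) e)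
  have "(\<gamma> \<longlongrightarrow> p) (at 0)" using has_derivative_continuous[OF d\<gamma>] \<gamma>(3) by (simp add: continuous_at)
  then have ev2: "\<forall>\<^sub>F t in at 0. \<gamma> t \<in> V" using V p(2) by (rule topological_tendstoD)
  have ev3: "\<forall>\<^sub>F t in at 0. t \<in> {-\<epsilon><..<\<epsilon>}"
    by (rule eventually_at_topological[THEN iffD2]) (use \<gamma>(1) in \<open>auto intro!: exI[of _ "{-\<epsilon><..<\<epsilon>}"]\<close>)
  have eq: "\<forall>\<^sub>F t in at 0. Re (?g t) * \<theta> (\<gamma> t) e + Im (?g t) * \<theta> (\<gamma> t) (\<i> *s e) = \<theta> (\<gamma> t) v"
    using ev1 ev2 ev3
  proof eventually_elim
    case (elim t)
    have S: "\<gamma> t \<in> S" using elim(3) \<gamma>(2) by blast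
    have "cf (\<gamma> t) (v - ?g t *s e) = 0" using elim by (simp add: cf_diff cf_scale)
    then have "\<theta> (\<gamma> t) (v - ?g t *s e) = 0"
      by (rule contact_on_kernel[OF S elim(2), rotated]) (intro vec.subspace_diff vec.subspace_scale X v e)
    then show ?case using linear_scaleR_part[OF \<theta>_linear[OF elim(2)], of "?g t" e] by (simp add: linear_diff[OF \<theta>_linear[OF elim(2)]])
  qed
  have g0: "cf (\<gamma> 0) e = 1" "cf (\<gamma> 0) v = 0" using \<gamma>(3) e v by simp_all
  have dg: "(?g has_derivative (\<lambda>h. hf s (fd (\<lambda>x. fd \<Phi> x v) p (h *\<^sub>R u)) (\<Phi> p) + hf s (fd \<Phi> p v) (fd \<Phi> p (h *\<^sub>R u)))) (at 0)"
    using has_derivative_divide'[OF dc[of v] dc[of e]] by (simp add: g0)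
  have eq0: "Re (?g 0) * \<theta> (\<gamma> 0) e + Im (?g 0) * \<theta> (\<gamma> 0) (\<i> *s e) = \<theta> (\<gamma> 0) v"
    using contact_on_kernel[OF p v] \<gamma>(3) e v by (simp add: g0)
  let ?G = "\<lambda>h. hf s (fd (\<lambda>x. fd \<Phi> x v) p (h *\<^sub>R u)) (\<Phi> p) + hf s (fd \<Phi> p v) (fd \<Phi> p (h *\<^sub>R u))"
  have dR: "((\<lambda>t. Re (?g t)) has_derivative (\<lambda>h. Re (?G h))) (at 0)" and dI: "((\<lambda>t. Im (?g t)) has_derivative (\<lambda>h. Im (?G h))) (at 0)"
    by (rule bounded_linear.has_derivative[OF bounded_linear_Re dg], rule bounded_linear.has_derivative[OF bounded_linear_Im dg])
  have "((\<lambda>t. Re (?g t) * \<theta> (\<gamma> t) e + Im (?g t) * \<theta> (\<gamma> t) (\<i> *s e)) has_derivative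
      (\<lambda>h. Re (?G h) * \<theta> p e + Im (?G h) * \<theta> p (\<i> *s e))) (at 0)"
    using has_derivative_add[OF has_derivative_mult[OF dR d\<theta>[of e]] has_derivative_mult[OF dI d\<theta>[of "\<i> *s e"]]] \<gamma>(3) e v
    by (simp add: g0)
  then have "((\<lambda>t. \<theta> (\<gamma> t) v) has_derivative (\<lambda>h. Re (?G h) * \<theta> p e + Im (?G h) * \<theta> p (\<i> *s e))) (at 0)"
    by (rule has_derivative_transform_eventually[OF _ eq eq0]) simp
  from has_derivative_unique[OF this d\<theta>[of v]]
  have "Re (?G 1) * \<theta> p e + Im (?G 1) * \<theta> p (\<i> *s e) = fd (\<lambda>x. \<theta> x v) p (1 *\<^sub>R u)" by (rule fun_cong)
  then show ?thesis unfolding g by simp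
qed

text \<open>The second derivatives of the lift cancel by symmetry. What remains is
  \<open>lf p v u - lf p u v\<close>, which is purely imaginary, so the term with
  \<open>\<theta> p e\<close> disappears.\<close>

lemma ext_deriv_contact:
  assumes p: "p \<in> S" "p \<in> V" and e: "e \<in> X" "cf p e = 1"
    and u: "u \<in> X" "cf p u = 0" and v: "v \<in> X" "cf p v = 0"
  shows "ext_deriv \<theta> p u v = - 2 * \<theta> p (\<i> *s e) * Im (lf p u v)"
proof -
  have "ext_deriv \<theta> p u v = fd (\<lambda>x. \<theta> x v) p u - fd (\<lambda>x. \<theta> x u) p v" by (simp add: ext_deriv_def fd_def)
  moreover have "lf p v u = cnj (lf p u v)" by (rule hf.hermitian)
  ultimately show ?thesis
    unfolding contact_derivative[OF p e u v refl] contact_derivative[OF p e v u refl] fd_commute[OF \<Phi> V p(2), of v u]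
    by (simp add: algebra_simps)
qed

lemma levi_matrix_iff:
  assumes p: "p \<in> S" "p \<in> V" and e: "e \<in> X" "cf p e = 1"
  shows "levi_matrix S n \<theta> p G \<longleftrightarrow> (\<exists>u. inj_on u {..<n} \<and> vec.independent (u ` {..<n}) \<and>
    vec.span (u ` {..<n}) = {v\<in>X. cf p v = 0} \<and>
    G = mat n n (\<lambda>(\<alpha>, \<beta>). of_real (\<theta> p (\<i> *s e)) * lf p (u \<alpha>) (u \<beta>)))"
proof -
  interpret lf: hermitian_form "lf p" by (rule lf_hermitian[OF p(2)])
  have K: "complex_tangent_space S p = {v\<in>X. cf p v = 0}" by (rule complex_tangent[OF p])
  have "mat n n (\<lambda>(\<alpha>, \<beta>). - \<i> * complexify2 (ext_deriv \<theta> p) (part10 (u \<alpha>)) (part01 (u \<beta>)))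
      = mat n n (\<lambda>(\<alpha>, \<beta>). of_real (\<theta> p (\<i> *s e)) * lf p (u \<alpha>) (u \<beta>))"
    if sp: "vec.span (u ` {..<n}) = {v\<in>X. cf p v = 0}" for u
  proof (rule eq_matI)
    fix \<alpha> \<beta> assume "\<alpha> < dim_row (mat n n (\<lambda>(\<alpha>, \<beta>). of_real (\<theta> p (\<i> *s e)) * lf p (u \<alpha>) (u \<beta>)))"
      "\<beta> < dim_col (mat n n (\<lambda>(\<alpha>, \<beta>). of_real (\<theta> p (\<i> *s e)) * lf p (u \<alpha>) (u \<beta>)))"
    then have ab: "\<alpha> < n" "\<beta> < n" by simp_all
    then have uab: "u \<alpha> \<in> {v\<in>X. cf p v = 0}" "u \<beta> \<in> {v\<in>X. cf p v = 0}"
      unfolding sp[symmetric] by (auto intro: vec.span_base)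
    have sc: "(1/2) *\<^sub>R w = complex_of_real (1/2) *s w" for w :: "complex^'m" by (rule scaleR_eq_smult)
    have "x \<in> {v\<in>X. cf p v = 0} \<Longrightarrow> a *s x \<in> {v\<in>X. cf p v = 0}" for a x
      using p(2) by (simp add: cf_scale vec.subspace_scale[OF X])
    note K_scale = this
    have ne: "- (a *s x) = (- a) *s x" for a and x :: "complex^'m" by simp
    have parts: "fst (part10 (u \<alpha>)) \<in> {v\<in>X. cf p v = 0}" "snd (part10 (u \<alpha>)) \<in> {v\<in>X. cf p v = 0}"
      "fst (part01 (u \<beta>)) \<in> {v\<in>X. cf p v = 0}" "snd (part01 (u \<beta>)) \<in> {v\<in>X. cf p v = 0}"
      unfolding part10_def part01_def fst_conv snd_conv sc ne by (intro K_scale uab)+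
    have "complexify2 (ext_deriv \<theta> p) (part10 (u \<alpha>)) (part01 (u \<beta>))
        = complexify2 (\<lambda>x y. - 2 * \<theta> p (\<i> *s e) * Im (lf p x y)) (part10 (u \<alpha>)) (part01 (u \<beta>))"
      unfolding complexify2_def using parts by (simp add: ext_deriv_contact[OF p e])
    then show "mat n n (\<lambda>(\<alpha>, \<beta>). - \<i> * complexify2 (ext_deriv \<theta> p) (part10 (u \<alpha>)) (part01 (u \<beta>))) $$ (\<alpha>, \<beta>)
        = mat n n (\<lambda>(\<alpha>, \<beta>). of_real (\<theta> p (\<i> *s e)) * lf p (u \<alpha>) (u \<beta>)) $$ (\<alpha>, \<beta>)"
      using ab lf.levi_form_entry[of "\<lambda>x y. - 2 * \<theta> p (\<i> *s e) * Im (lf p x y)" "\<theta> p (\<i> *s e)" "u \<alpha>" "u \<beta>"] by simp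
  qed simp_all
  then show ?thesis unfolding levi_matrix_def K by (intro ex_cong1) auto
qed

text \<open>Nondegeneracy and signature quantify over all Levi matrices at a point; existence is
  what gives these conditions content.\<close>

lemma levi_matrix_exists:
  assumes p: "p \<in> S" "p \<in> V" and e: "e \<in> X" "cf p e = 1" and n: "vec.dim X = Suc n"
  shows "\<exists>G. levi_matrix S n \<theta> p G"
proof -
  let ?K = "{v\<in>X. cf p v = 0}"
  have sub: "vec.subspace ?K" and d: "vec.dim X \<le> vec.dim ?K + 1"
    using dim_kernel_functional[OF X, of "cf p"] cf_add[OF p(2)] cf_scale[OF p(2)] by auto
  have "vec.dim ?K \<noteq> vec.dim X"
  proof
    assume "vec.dim ?K = vec.dim X"
    then have "?K = X" by (intro vec.subspace_dim_equal sub X) auto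
    then have "e \<in> ?K" using e(1) by blast
    then show False using e(2) by simp
  qed
  moreover have "vec.dim ?K \<le> vec.dim X" by (rule vec.dim_subset) auto
  ultimately have dK: "vec.dim ?K = n" using d n by simp
  obtain B where B: "B \<subseteq> ?K" "vec.independent B" "?K \<subseteq> vec.span B" "card B = vec.dim ?K" using vec.basis_exists[of ?K] by blast
  have "finite B" using B(2) vec.finiteI_independent by blast
  then obtain u where u: "bij_betw u {..<n} B" using B(4) dK ex_bij_betw_nat_finite[of B] by (auto simp: lessThan_atLeast0)
  then have "u ` {..<n} = B" "inj_on u {..<n}" by (auto simp: bij_betw_def)
  moreover have "vec.span B = ?K" using B(1,3) sub vec.span_minimal[of B ?K] by blast
  ultimately show ?thesis unfolding levi_matrix_iff[OF p e] using B(2) by blast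
qed

text \<open>The coefficients of the diagonalization, applied to the frame, give Levi-orthogonal
  vectors whose signs are those of the eigenvalues. For the radical, the conjugated coordinates of a
  radical vector form a vector in the kernel of \<open>G\<close>.\<close>

lemma levi_subspaces:
  assumes p: "p \<in> S" "p \<in> V" and e: "e \<in> X" "cf p e = 1" and G: "levi_matrix S n \<theta> p G" and n: "n \<le> CARD('m)"
  shows "\<exists>A. vec.subspace A \<and> vec.dim A = num_pos_eigenvalues G \<and>
      (\<forall>u\<in>A. u \<in> X \<and> cf p u = 0 \<and> (u \<noteq> 0 \<longrightarrow> \<theta> p (\<i> *s e) * Re (lf p u u) > 0))"
    and "\<exists>A. vec.subspace A \<and> vec.dim A = num_neg_eigenvalues G \<and>
      (\<forall>u\<in>A. u \<in> X \<and> cf p u = 0 \<and> (u \<noteq> 0 \<longrightarrow> \<theta> p (\<i> *s e) * Re (lf p u u) < 0))"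
    and "Determinant.det G \<noteq> 0 \<Longrightarrow> u0 \<in> X \<Longrightarrow> cf p u0 = 0 \<Longrightarrow> (\<And>v. v \<in> X \<Longrightarrow> cf p v = 0 \<Longrightarrow> lf p u0 v = 0) \<Longrightarrow> u0 = 0"
    and "Determinant.det G \<noteq> 0 \<Longrightarrow> num_pos_eigenvalues G + num_neg_eigenvalues G = n"
proof -
  let ?K = "{v\<in>X. cf p v = 0}" and ?k = "\<theta> p (\<i> *s e)"
  interpret lf: hermitian_form "lf p" by (rule lf_hermitian[OF p(2)])
  define L where "L x y = of_real ?k * lf p x y" for x y
  interpret L: hermitian_form L
    by unfold_locales (auto simp: L_def lf.add_left lf.scale_left algebra_simps intro: lf.hermitian)
  obtain u where u: "inj_on u {..<n}" "vec.independent (u ` {..<n})" "vec.span (u ` {..<n}) = ?K"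
      "G = mat n n (\<lambda>(\<alpha>, \<beta>). L (u \<alpha>) (u \<beta>))"
    using G unfolding levi_matrix_iff[OF p e] L_def by blast
  have Gc: "G \<in> carrier_mat n n" and Ge: "\<And>i j. i < n \<Longrightarrow> j < n \<Longrightarrow> G $$ (i, j) = L (u i) (u j)" using u(4) by auto
  have herm: "G $$ (j, i) = cnj (G $$ (i, j))" if "i < n" "j < n" for i j
    unfolding Ge[OF that] Ge[OF that(2,1)] by (rule L.hermitian)
  obtain w ev where w: "\<forall>i<n. \<forall>j<n. (\<Sum>\<alpha><n. \<Sum>\<beta><n. w i \<alpha> * cnj (w j \<beta>) * G $$ (\<alpha>, \<beta>)) = (if i = j then of_real (ev i) else 0)"
    and np: "num_pos_eigenvalues G = card {i. i < n \<and> ev i > 0}" and nn: "num_neg_eigenvalues G = card {i. i < n \<and> ev i < 0}"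
      and sm: "Determinant.det G \<noteq> 0 \<longrightarrow> num_pos_eigenvalues G + num_neg_eigenvalues G = n"
    by (rule hermitian_diagonalization[OF Gc _ n]) (rule herm, assumption, assumption, rule that)
  define x where "x i = (\<Sum>\<alpha><n. w i \<alpha> *s u \<alpha>)" for i
  have subK: "vec.subspace ?K" using u(3) vec.subspace_span by metis
  have xK: "x i \<in> ?K" for i unfolding x_def u(3)[symmetric] by (intro vec.span_sum vec.span_scale vec.span_base) auto
  have Lx: "L (x i) (x j) = (if i = j then of_real (ev i) else 0)" if ij: "i < n" "j < n" for i j
  proof -
    have "L (x i) (x j) = (\<Sum>\<alpha><n. w i \<alpha> * L (u \<alpha>) (x j))" by (simp only: x_def[of i] L.sum_left L.scale_left)
    also have "\<dots> = (\<Sum>\<alpha><n. \<Sum>\<beta><n. w i \<alpha> * (cnj (w j \<beta>) * L (u \<alpha>) (u \<beta>)))"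
      by (simp only: x_def[of j] L.sum_right L.scale_right sum_distrib_left)
    also have "\<dots> = (\<Sum>\<alpha><n. \<Sum>\<beta><n. w i \<alpha> * cnj (w j \<beta>) * G $$ (\<alpha>, \<beta>))"
      by (intro sum.cong refl) (simp add: Ge)
    finally show ?thesis using w ij by simp
  qed
  have spK: "vec.span (x ` I) \<subseteq> ?K" for I using xK by (intro vec.span_minimal subK) auto
  interpret nL: hermitian_form "\<lambda>x y. - L x y" by (rule L.uminus)
  let ?P = "{i. i < n \<and> ev i > 0}" and ?N = "{i. i < n \<and> ev i < 0}"
  have P: "y \<in> vec.span (x ` ?P) \<Longrightarrow> y \<noteq> 0 \<Longrightarrow> Re (L y y) > 0" "vec.dim (vec.span (x ` ?P)) = card ?P" for y
    by (rule L.positive_span[of ?P x]; auto simp: Lx)+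
  have N: "y \<in> vec.span (x ` ?N) \<Longrightarrow> y \<noteq> 0 \<Longrightarrow> Re (- L y y) > 0" "vec.dim (vec.span (x ` ?N)) = card ?N" for y
    by (rule nL.positive_span[of ?N x]; auto simp: Lx)+
  show "\<exists>A. vec.subspace A \<and> vec.dim A = num_pos_eigenvalues G \<and>
      (\<forall>u\<in>A. u \<in> X \<and> cf p u = 0 \<and> (u \<noteq> 0 \<longrightarrow> ?k * Re (lf p u u) > 0))"
    using P(1) spK[of ?P] by (intro exI[of _ "vec.span (x ` ?P)"] conjI ballI vec.subspace_span) (auto simp: P(2) np L_def simp del: vec.dim_span)
  show "\<exists>A. vec.subspace A \<and> vec.dim A = num_neg_eigenvalues G \<and>
      (\<forall>u\<in>A. u \<in> X \<and> cf p u = 0 \<and> (u \<noteq> 0 \<longrightarrow> ?k * Re (lf p u u) < 0))"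
    using N(1) spK[of ?N] by (intro exI[of _ "vec.span (x ` ?N)"] conjI ballI vec.subspace_span) (auto simp: N(2) nn L_def simp del: vec.dim_span)
  show "Determinant.det G \<noteq> 0 \<Longrightarrow> num_pos_eigenvalues G + num_neg_eigenvalues G = n" using sm by simp
  show "u0 = 0" if det: "Determinant.det G \<noteq> 0" and u0: "u0 \<in> X" "cf p u0 = 0"
    and rad: "\<And>v. v \<in> X \<Longrightarrow> cf p v = 0 \<Longrightarrow> lf p u0 v = 0"
  proof -
    have "u0 \<in> vec.span (u ` {..<n})" using u(3) u0 by simp
    then obtain c where c: "u0 = (\<Sum>j\<in>{..<n}. c j *s u j)" using in_span_imageE[of "{..<n}" u0 u] by blast
    let ?c = "vec n (\<lambda>j. cnj (c j))"
    have "G *\<^sub>v ?c = 0\<^sub>v n"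
    proof (rule eq_vecI)
      fix i assume "i < dim_vec (0\<^sub>v n :: complex Matrix.vec)"
      then have i: "i < n" by simp
      have ui: "u i \<in> ?K" unfolding u(3)[symmetric] using i by (intro vec.span_base) auto
      then have "lf p u0 (u i) = 0" using rad by blast
      then have "L (u i) u0 = 0" using lf.hermitian[of "u i" u0] by (simp add: L_def)
      moreover have "vec_index (G *\<^sub>v ?c) i = (\<Sum>j<n. cnj (c j) * L (u i) (u j))"
        using i Gc by (simp add: scalar_prod_def lessThan_atLeast0 Ge mult.commute)
      moreover have "L (u i) u0 = (\<Sum>j<n. cnj (c j) * L (u i) (u j))"
        by (subst c) (simp only: L.sum_right L.scale_right)
      ultimately show "vec_index (G *\<^sub>v ?c) i = vec_index (0\<^sub>v n) i" using i by simp
    qed (use Gc in simp)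
    then have c0: "?c = 0\<^sub>v n" using det det_0_iff_vec_prod_zero[OF Gc] vec_carrier[of n "\<lambda>j. cnj (c j)"] by blast
    have "c j = 0" if "j < n" for j using that arg_cong[OF c0, of "\<lambda>v. vec_index v j"] by simp
    then show ?thesis by (simp add: c)
  qed
qed

text \<open>The image of a definite subspace together with the orthogonal null vector \<open>\<Phi> x\<close> is semidefinite.\<close>

lemma definite_dim_less:
  assumes x: "x \<in> S" "x \<in> V" and A: "vec.subspace A" "\<forall>u\<in>A. cf x u = 0 \<and> (u \<noteq> 0 \<longrightarrow> t * Re (lf x u u) > 0)" and t: "t \<noteq> 0"
  shows "vec.dim A < card {i. t * s i > 0}"
proof -
  let ?D = "fd \<Phi> x"
  have lin: "Vector_Spaces.linear (*s) (*s) ?D"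
    unfolding Vector_Spaces.linear_iff by (simp add: vec.vector_space_axioms fd_add[OF \<Phi> x(2)] fd_scale[OF \<Phi> x(2)])
  have inj: "inj_on ?D (vec.span A)"
    unfolding vec.span_eq_iff[THEN iffD2, OF A(1)]
  proof (rule inj_onI, rule ccontr)
    fix u v assume uv: "u \<in> A" "v \<in> A" "?D u = ?D v" "u \<noteq> v"
    then have "u - v \<in> A" "u - v \<noteq> 0" using vec.subspace_diff[OF A(1)] by auto
    then have "t * Re (lf x (u - v) (u - v)) > 0" using A(2) by blast
    then show False using uv(3) by (simp add: fd_diff[OF \<Phi> x(2)])
  qed
  have dim: "vec.dim (?D ` A) = vec.dim A" using vec.dim_image_eq[OF lin inj] .
  have sub: "vec.subspace (?D ` A)" using vec.linear_subspace_image[OF lin A(1)] .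
  have not_in: "\<Phi> x \<notin> ?D ` A"
  proof
    assume "\<Phi> x \<in> ?D ` A"
    then obtain u where u: "u \<in> A" "\<Phi> x = ?D u" by blast
    have "u \<noteq> 0" using u nonzero[OF x] fd_zero[OF \<Phi> x(2)] by auto
    then have "t * Re (lf x u u) > 0" using A u by blast
    then show False using null[OF x] u by simp
  qed
  let ?W = "vec.span (insert (\<Phi> x) (?D ` A))"
  have "vec.dim ?W = Suc (vec.dim (?D ` A))"
    using not_in vec.dim_insert[of "\<Phi> x" "?D ` A"] vec.span_eq_iff[THEN iffD2, OF sub] by simp
  moreover have "vec.dim ?W \<le> card {i. t * s i > 0}"
  proof (rule dim_nonneg_le)
    show "\<forall>y\<in>?W. 0 \<le> Re (hf (\<lambda>i. t * s i) y y)"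
    proof
      fix y assume "y \<in> ?W"
      then obtain a where "y - a *s \<Phi> x \<in> vec.span (?D ` A)" using vec.span_breakdown_eq by blast
      then obtain u where u: "u \<in> A" "y = a *s \<Phi> x + ?D u"
        using vec.span_eq_iff[THEN iffD2, OF sub] by (metis add.commute diff_add_cancel imageE)
      have c1: "hf s (?D u) (\<Phi> x) = 0" using A(2) u by blast
      then have c2: "hf s (\<Phi> x) (?D u) = 0" using hf.hermitian[of s "\<Phi> x" "?D u"] by simp
      have "hf s y y = lf x u u"
        unfolding u(2) by (simp add: hf.add_left hf.add_right hf.scale_left hf.scale_right c1 c2 null[OF x])
      then have "Re (hf (\<lambda>i. t * s i) y y) = t * Re (lf x u u)" by (simp add: hf_scale)
      also have "\<dots> \<ge> 0" using A(2) u fd_zero[OF \<Phi> x(2)] by (cases "u = 0") (auto intro: less_imp_le)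
      finally show "0 \<le> Re (hf (\<lambda>i. t * s i) y y)" .
    qed
  qed (use s t in auto)
  ultimately show ?thesis using dim by simp
qed

text \<open>The sign of the contact form is unknown, and for \<open>2 * l < n\<close> the signature
  alone would not tell which sign occurs \<open>l\<close> times. The quadric decides: it has at most
  \<open>l + 1\<close> negative squares and the null vector absorbs one, so a negative definite
  subspace has dimension at most \<open>l\<close>.\<close>

lemma definite_dims:
  assumes sig: "has_signature S n l" "levi_nondegenerate S n" "2 * l \<le> n"
    and s_neg: "card {i. s i < 0} \<le> l + 1" and n: "vec.dim X = Suc n" "n \<le> CARD('m)"
    and x: "x \<in> S" "x \<in> V" and e: "e \<in> X" "cf x e = 1"
  shows "\<exists>A. vec.subspace A \<and> vec.dim A = n - l \<and> (\<forall>u\<in>A. u \<in> X \<and> cf x u = 0 \<and> (u \<noteq> 0 \<longrightarrow> Re (lf x u u) > 0))"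
    and "\<exists>A. vec.subspace A \<and> vec.dim A = l \<and> (\<forall>u\<in>A. u \<in> X \<and> cf x u = 0 \<and> (u \<noteq> 0 \<longrightarrow> Re (lf x u u) < 0))"
    and "u0 \<in> X \<Longrightarrow> cf x u0 = 0 \<Longrightarrow> (\<And>v. v \<in> X \<Longrightarrow> cf x v = 0 \<Longrightarrow> lf x u0 v = 0) \<Longrightarrow> u0 = 0"
proof -
  obtain G where G: "levi_matrix S n \<theta> x G" using levi_matrix_exists[OF x e n(1)] by blast
  have rep: "levi_representative S n x G" unfolding levi_representative_def using x contact G by blast
  have det: "Determinant.det G \<noteq> 0" and mn: "min (num_pos_eigenvalues G) (num_neg_eigenvalues G) = l"
    using sig rep x(1) unfolding levi_nondegenerate_def has_signature_def by auto
  note L = levi_subspaces[OF x e G n(2)]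
  have sm: "num_pos_eigenvalues G + num_neg_eigenvalues G = n" by (rule L(4)[OF det])
  obtain A where A: "vec.subspace A" "vec.dim A = num_pos_eigenvalues G"
    "\<forall>u\<in>A. u \<in> X \<and> cf x u = 0 \<and> (u \<noteq> 0 \<longrightarrow> \<theta> x (\<i> *s e) * Re (lf x u u) > 0)" using L(1) by blast
  obtain B where B: "vec.subspace B" "vec.dim B = num_neg_eigenvalues G"
    "\<forall>u\<in>B. u \<in> X \<and> cf x u = 0 \<and> (u \<noteq> 0 \<longrightarrow> \<theta> x (\<i> *s e) * Re (lf x u u) < 0)" using L(2) by blast
  have neg: "vec.dim C \<le> l" if C: "vec.subspace C" "\<forall>u\<in>C. cf x u = 0 \<and> (u \<noteq> 0 \<longrightarrow> Re (lf x u u) < 0)" for C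
    using definite_dim_less[OF x C(1), of "-1"] C(2) s_neg by simp
  have "\<exists>P N. vec.subspace P \<and> vec.subspace N \<and> vec.dim P = n - l \<and> vec.dim N = l \<and>
      (\<forall>u\<in>P. u \<in> X \<and> cf x u = 0 \<and> (u \<noteq> 0 \<longrightarrow> Re (lf x u u) > 0)) \<and> (\<forall>u\<in>N. u \<in> X \<and> cf x u = 0 \<and> (u \<noteq> 0 \<longrightarrow> Re (lf x u u) < 0))"
  proof (cases "\<theta> x (\<i> *s e) > 0")
    case True
    then have *: "\<forall>u\<in>A. u \<in> X \<and> cf x u = 0 \<and> (u \<noteq> 0 \<longrightarrow> Re (lf x u u) > 0)" "\<forall>u\<in>B. u \<in> X \<and> cf x u = 0 \<and> (u \<noteq> 0 \<longrightarrow> Re (lf x u u) < 0)"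
      using A(3) B(3) by (auto simp: zero_less_mult_iff mult_less_0_iff)
    have "vec.dim B \<le> l" using neg[OF B(1)] *(2) by blast
    then have "vec.dim B = l" "vec.dim A = n - l" using A(2) B(2) sm mn sig(3) by (auto simp: min_def split: if_splits)
    then show ?thesis using A(1) B(1) * by blast
  next
    case False
    then have "\<theta> x (\<i> *s e) < 0" using contact_value(1)[OF x e] by simp
    then have *: "\<forall>u\<in>B. u \<in> X \<and> cf x u = 0 \<and> (u \<noteq> 0 \<longrightarrow> Re (lf x u u) > 0)" "\<forall>u\<in>A. u \<in> X \<and> cf x u = 0 \<and> (u \<noteq> 0 \<longrightarrow> Re (lf x u u) < 0)"
      using A(3) B(3) by (auto simp: zero_less_mult_iff mult_less_0_iff)
    have "vec.dim A \<le> l" using neg[OF A(1)] *(2) by blast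
    then have "vec.dim A = l" "vec.dim B = n - l" using A(2) B(2) sm mn sig(3) by (auto simp: min_def split: if_splits)
    then show ?thesis using A(1) B(1) * by blast
  qed
  then show "\<exists>A. vec.subspace A \<and> vec.dim A = n - l \<and> (\<forall>u\<in>A. u \<in> X \<and> cf x u = 0 \<and> (u \<noteq> 0 \<longrightarrow> Re (lf x u u) > 0))"
    and "\<exists>A. vec.subspace A \<and> vec.dim A = l \<and> (\<forall>u\<in>A. u \<in> X \<and> cf x u = 0 \<and> (u \<noteq> 0 \<longrightarrow> Re (lf x u u) < 0))" by blast+
  show "u0 \<in> X \<Longrightarrow> cf x u0 = 0 \<Longrightarrow> (\<And>v. v \<in> X \<Longrightarrow> cf x v = 0 \<Longrightarrow> lf x u0 v = 0) \<Longrightarrow> u0 = 0" by (rule L(3)[OF det])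
qed

text \<open>With the opposite sign the \<open>n - l\<close> positive eigenvalues would span a
  negative definite subspace for \<open>lf\<close>, of dimension larger than
  \<open>l\<close>.\<close>

lemma contact_form_of_type_positive:
  assumes type: "contact_form_of_type S V n l \<theta>" "2 * l < n"
    and s_neg: "card {i. s i < 0} \<le> l + 1" and n: "vec.dim X = Suc n" "n \<le> CARD('m)"
    and x: "x \<in> S" "x \<in> V" and e: "e \<in> X" "cf x e = 1"
  shows "\<theta> x (\<i> *s e) > 0"
proof (rule ccontr)
  assume "\<not> ?thesis"
  then have neg: "\<theta> x (\<i> *s e) < 0" using contact_value(1)[OF x e] by simp
  obtain G where G: "levi_matrix S n \<theta> x G" using levi_matrix_exists[OF x e n(1)] by blast
  have "num_pos_eigenvalues G = n - l" using type(1) x G unfolding contact_form_of_type_def by blast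
  then obtain A where A: "vec.subspace A" "vec.dim A = n - l"
    "\<forall>u\<in>A. u \<in> X \<and> cf x u = 0 \<and> (u \<noteq> 0 \<longrightarrow> \<theta> x (\<i> *s e) * Re (lf x u u) > 0)" using levi_subspaces(1)[OF x e G n(2)] by auto
  have "\<forall>u\<in>A. cf x u = 0 \<and> (u \<noteq> 0 \<longrightarrow> - 1 * Re (lf x u u) > 0)" using A(3) neg by (auto simp: zero_less_mult_iff)
  from definite_dim_less[OF x A(1) this] show False using A(2) s_neg type(2) by simp
qed

end

section \<open>Points of projective space and affine charts\<close>

lemma line_of_eq_span:
  assumes z: "z \<in> line_of L" "z \<noteq> 0"
  shows "line_of L = vec.span {z}"
proof -
  obtain y where y: "line_of L = vec.span {y}" "y \<noteq> 0" using line_of[of L] by blast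
  then obtain a where a: "z = a *s y" using z(1) by (auto simp: vec.span_singleton)
  with z(2) have "a \<noteq> 0" by auto
  then have "y = (1/a) *s z" by (simp add: a)
  then have "y \<in> vec.span {z}" by (metis vec.span_base vec.span_scale singletonI)
  then have "vec.span {y} \<subseteq> vec.span {z}" by (intro vec.span_minimal) auto
  moreover have "vec.span {z} \<subseteq> vec.span {y}" using z(1) y(1) by (intro vec.span_minimal) auto
  ultimately show ?thesis using y(1) by simp
qed

lemma chart_eq:
  assumes z: "z \<in> line_of L" "z $ k \<noteq> 0"
  shows "chart k L = (1 / z $ k) *s z" and "L \<in> chart_domain k" and "line_of L = vec.span {chart k L}"
    and "chart k L $ k = 1"
proof -
  have "z \<noteq> 0" using z(2) by auto
  note sp = line_of_eq_span[OF z(1) this]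
  have mem: "(1 / z $ k) *s z \<in> line_of L" unfolding sp by (intro vec.span_scale vec.span_base) simp
  show c: "chart k L = (1 / z $ k) *s z"
    unfolding chart_def
  proof (rule the_equality)
    fix w assume w: "w \<in> line_of L \<and> w $ k = 1"
    then obtain a where "w = a *s z" unfolding sp by (auto simp: vec.span_singleton)
    then show "w = (1 / z $ k) *s z" using w z(2) by (auto simp: field_simps)
  qed (use mem z(2) in simp)
  show "L \<in> chart_domain k" unfolding chart_domain_def using z by blast
  show "chart k L $ k = 1" using z(2) by (simp add: c)
  then have "chart k L \<noteq> 0" by auto
  with mem show "line_of L = vec.span {chart k L}" unfolding c by (rule line_of_eq_span)
qed

lemma chart_in_line:
  assumes "L \<in> chart_domain k"
  shows "line_of L = vec.span {chart k L}" "chart k L $ k = 1" "chart k L \<in> line_of L"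
proof -
  obtain z where z: "z \<in> line_of L" "z $ k \<noteq> 0" using assms by (auto simp: chart_domain_def)
  show 1: "line_of L = vec.span {chart k L}" "chart k L $ k = 1" using chart_eq[OF z] by auto
  show "chart k L \<in> line_of L" unfolding 1 by (simp add: vec.span_base)
qed

lemma chart_surj:
  assumes "w $ k = 1"
  shows "\<exists>L. line_of L = vec.span {w} \<and> L \<in> chart_domain k \<and> chart k L = w"
proof -
  have "w \<noteq> 0" using assms by auto
  then have l: "line_of (Abs_cproj (vec.span {w})) = vec.span {w}" by (intro Abs_cproj_inverse) blast
  then have "w \<in> line_of (Abs_cproj (vec.span {w}))" by (simp add: vec.span_base)
  from chart_eq[OF this, of k] assms l show ?thesis by (intro exI[of _ "Abs_cproj (vec.span {w})"]) simp
qed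

lemma line_of_subset_iff:
  "vec.subspace W \<Longrightarrow> L \<in> chart_domain k \<Longrightarrow> line_of L \<subseteq> W \<longleftrightarrow> chart k L \<in> W"
  unfolding chart_in_line(1) by (metis empty_subsetI insert_subset vec.span_base vec.span_minimal singletonI subsetD)

section \<open>Hyperquadrics\<close>

definition qsign :: "nat \<Rightarrow> 'b::{finite,linorder} \<Rightarrow> real" where
  "qsign l i = (if i \<in> (!) (sorted_list_of_set UNIV) ` {..l} then -1 else 1)"

lemma qsign_nonzero: "\<forall>i. qsign l i \<noteq> 0"
  by (simp add: qsign_def)

lemma bij_hcoord: "bij_betw ((!) (sorted_list_of_set (UNIV :: 'b::{finite,linorder} set))) {..<CARD('b)} UNIV"
  using bij_betw_nth[of "sorted_list_of_set (UNIV :: 'b set)" "{..<CARD('b)}" UNIV] by simp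

lemma qsign_nth: "j < CARD('b) \<Longrightarrow> l < CARD('b) \<Longrightarrow>
   qsign l (sorted_list_of_set (UNIV :: 'b::{finite,linorder} set) ! j) = (if j \<le> l then -1 else 1)"
  by (auto simp: qsign_def dest!: inj_onD[OF bij_betw_imp_inj_on[OF bij_hcoord]])

lemma card_qsign:
  assumes l: "l < CARD('b::{finite,linorder})"
  shows "card {i::'b. qsign l i < 0} = l + 1" "card {i::'b. qsign l i > 0} = CARD('b) - (l + 1)"
proof -
  have "{i::'b. qsign l i < 0} = (!) (sorted_list_of_set UNIV) ` {..l}" by (auto simp: qsign_def)
  moreover have "inj_on ((!) (sorted_list_of_set (UNIV :: 'b set))) {..l}"
    by (rule inj_on_subset[OF bij_betw_imp_inj_on[OF bij_hcoord]]) (use l in auto)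
  ultimately show 1: "card {i::'b. qsign l i < 0} = l + 1" by (simp add: card_image)
  have "{i::'b. qsign l i > 0} = UNIV - {i. qsign l i < 0}" using qsign_nonzero[of l] by (auto simp: qsign_def)
  then show "card {i::'b. qsign l i > 0} = CARD('b) - (l + 1)" using 1 by (simp add: card_Diff_subset)
qed

lemma hyperquadric_iff:
  assumes l: "l < CARD('b::{finite,linorder})"
  shows "(L :: 'b cproj) \<in> hyperquadric l \<longleftrightarrow> (\<forall>z\<in>line_of L. hf (qsign l) z z = 0)"
proof -
  have "- (\<Sum>j=0..l. (cmod (hcoord z j))\<^sup>2) + (\<Sum>k=l+1..CARD('b) - 1. (cmod (hcoord z k))\<^sup>2) = Re (hf (qsign l) z z)" for z :: "(complex, 'b) Finite_Cartesian_Product.vec"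
  proof -
    let ?n = "(!) (sorted_list_of_set (UNIV :: 'b set))"
    have "Re (hf (qsign l) z z) = (\<Sum>j<CARD('b). qsign l (?n j) * (cmod (z $ ?n j))\<^sup>2)"
      unfolding hf_diag by (rule sum.reindex_bij_betw[OF bij_hcoord, symmetric])
    also have "{..<CARD('b)} = {0..l} \<union> {l+1..CARD('b) - 1}" using l by auto
    also have "(\<Sum>j\<in>{0..l} \<union> {l+1..CARD('b) - 1}. qsign l (?n j) * (cmod (z $ ?n j))\<^sup>2)
       = (\<Sum>j=0..l. qsign l (?n j) * (cmod (z $ ?n j))\<^sup>2) + (\<Sum>j=l+1..CARD('b) - 1. qsign l (?n j) * (cmod (z $ ?n j))\<^sup>2)"
      by (rule sum.union_disjoint) auto
    also have "(\<Sum>j=0..l. qsign l (?n j) * (cmod (z $ ?n j))\<^sup>2) = (\<Sum>j=0..l. - (cmod (hcoord z j))\<^sup>2)"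
      using l by (intro sum.cong refl) (simp add: qsign_nth hcoord_def)
    also have "(\<Sum>j=l+1..CARD('b) - 1. qsign l (?n j) * (cmod (z $ ?n j))\<^sup>2) = (\<Sum>k=l+1..CARD('b) - 1. (cmod (hcoord z k))\<^sup>2)"
    proof (intro sum.cong refl)
      fix j assume "j \<in> {l+1..CARD('b) - 1}"
      then have "j < CARD('b)" "\<not> j \<le> l" using l by auto
      then show "qsign l (?n j) * (cmod (z $ ?n j))\<^sup>2 = (cmod (hcoord z j))\<^sup>2" using l by (simp add: qsign_nth hcoord_def)
    qed
    finally show ?thesis by (simp add: sum_negf)
  qed
  then show ?thesis unfolding hyperquadric_def by (simp add: complex_eq_iff hf.diag_real)
qed

lemma affine_part_hyperquadric:
  assumes l: "l < CARD('b::{finite,linorder})"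
  shows "affine_part k (hyperquadric l :: 'b cproj set) = {w. w $ k = 1 \<and> hf (qsign l) w w = 0}"
proof (intro Set.equalityI subsetI)
  fix w assume "w \<in> affine_part k (hyperquadric l :: 'b cproj set)"
  then obtain L where L: "L \<in> hyperquadric l" "L \<in> chart_domain k" "w = chart k L" unfolding affine_part_def by blast
  then show "w \<in> {w. w $ k = 1 \<and> hf (qsign l) w w = 0}"
    using chart_in_line(2,3)[OF L(2)] hyperquadric_iff[OF l] by blast
next
  fix w :: "(complex, 'b) Finite_Cartesian_Product.vec" assume w: "w \<in> {w. w $ k = 1 \<and> hf (qsign l) w w = 0}"
  then obtain L where L: "line_of L = vec.span {w}" "L \<in> chart_domain k" "chart k L = w" using chart_surj[of w k] by blast
  have "L \<in> hyperquadric l"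
    unfolding hyperquadric_iff[OF l] L(1) using w by (auto simp: vec.span_singleton hf.scale_left hf.scale_right)
  then show "w \<in> affine_part k (hyperquadric l)" unfolding affine_part_def using L(2,3) by blast
qed

lemma hermitian_square_derivative:
  "((\<lambda>w. Re (hf s w w)) has_derivative (\<lambda>v. 2 * Re (hf s v x))) (at x)"
proof -
  have "((\<lambda>w. hf s w w) has_derivative (\<lambda>v. hf s x v + hf s v x)) (at x)"
    by (rule has_derivative_hf[OF has_derivative_ident has_derivative_ident])
  then have "((\<lambda>w. Re (hf s w w)) has_derivative (\<lambda>v. Re (hf s x v + hf s v x))) (at x)"
    by (rule bounded_linear.has_derivative[OF bounded_linear_Re])
  moreover have "Re (hf s x v + hf s v x) = 2 * Re (hf s v x)" for v using hf.hermitian[of s x v] by simp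
  ultimately show ?thesis by simp
qed

lemma smooth_hermitian_square: "smooth_on UNIV (\<lambda>w. Re (hf s w w))"
  unfolding smooth_on_def
proof
  fix k
  have lin: "bounded_linear (\<lambda>x. 2 * Re (hf s v x))" for v
    using bounded_linear_compose[OF bounded_linear_Re bounded_bilinear.bounded_linear_right[OF bounded_bilinear_hf]]
    by (rule bounded_linear_const_mult)
  have "Ck_on (Suc k) UNIV (\<lambda>w. Re (hf s w w))" for k
    by (rule Ck_on_SucI[OF open_UNIV hermitian_square_derivative])
      (use smooth_on_linear[OF open_UNIV lin] in \<open>simp add: smooth_on_def\<close>)
  moreover have "Ck_on 0 UNIV (\<lambda>w. Re (hf s w w))"
    using hermitian_square_derivative by (auto intro!: continuous_at_imp_continuous_on has_derivative_continuous)
  ultimately show "Ck_on k UNIV (\<lambda>w. Re (hf s w w))" by (cases k) auto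
qed

text \<open>A null vector cannot have \<open>k\<close> as its only nonzero coordinate, since the
  form is diagonal with nonzero entries; another coordinate direction can be normalized without
  leaving the directions of the chart.\<close>

lemma quadric_transversal_vector:
  assumes s: "\<forall>i. s i \<noteq> 0" and p: "p $ k = 1" "hf s p p = 0"
  shows "\<exists>e. e $ k = 0 \<and> hf s e p = 1"
proof -
  have "\<exists>j. j \<noteq> k \<and> p $ j \<noteq> 0"
  proof (rule ccontr)
    assume "\<not> ?thesis"
    then have "hf s p p = (\<Sum>i\<in>UNIV. if i = k then of_real (s k) else 0)"
      unfolding hf_def using p(1) by (intro sum.cong refl) auto
    then show False using p(2) s by simp
  qed
  then obtain j where j: "j \<noteq> k" "p $ j \<noteq> 0" by blast
  have "hf s (axis j a) p = of_real (s j) * a * cnj (p $ j)" for a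
  proof -
    have "hf s (axis j a) p = (\<Sum>i\<in>UNIV. if i = j then of_real (s j) * a * cnj (p $ j) else 0)"
      unfolding hf_def by (intro sum.cong refl) (auto simp: axis_def)
    then show ?thesis by simp
  qed
  then have "hf s (axis j (1 / (of_real (s j) * cnj (p $ j)))) p = 1" using s j by simp
  moreover have "axis j (1 / (of_real (s j) * cnj (p $ j))) $ k = 0" using j by (simp add: axis_def)
  ultimately show ?thesis by blast
qed

text \<open>The quadric sits in the hyperplane of the chart, not in an open set. The curve of
  \<open>hypersurface_curve\<close> nevertheless stays in that hyperplane because both
  \<open>v\<close> and the correcting direction \<open>e\<close> have zero coordinate at
  \<open>k\<close>.\<close>

lemma tangent_space_quadric:
  assumes s: "\<forall>i. s i \<noteq> 0" and p: "p $ k = 1" "hf s p p = 0"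
  shows "tangent_space {w. w $ k = 1 \<and> hf s w w = 0} p = {v. v $ k = 0 \<and> Re (hf s v p) = 0}"
proof (intro Set.equalityI subsetI)
  fix v assume "v \<in> tangent_space {w. w $ k = 1 \<and> hf s w w = 0} p"
  then obtain \<gamma> \<epsilon> where \<gamma>: "\<epsilon> > 0" "\<gamma> ` {-\<epsilon><..<\<epsilon>} \<subseteq> {w. w $ k = 1 \<and> hf s w w = 0}" "\<gamma> 0 = p" "(\<gamma> has_vector_derivative v) (at 0)"
    unfolding tangent_space_def by blast
  have d: "(\<gamma> has_derivative (\<lambda>h. h *\<^sub>R v)) (at 0)" using \<gamma>(4) by (simp add: has_vector_derivative_def)
  have \<gamma>S: "\<gamma> t $ k = 1" "hf s (\<gamma> t) (\<gamma> t) = 0" if "t \<in> {-\<epsilon><..<\<epsilon>}" for t using \<gamma>(2) that by blast+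
  have o: "open {-\<epsilon><..<\<epsilon>}" "0 \<in> {-\<epsilon><..<\<epsilon>}" using \<gamma>(1) by auto
  have 1: "((\<lambda>t. \<gamma> t $ k) has_derivative (\<lambda>h. (h *\<^sub>R v) $ k)) (at 0)"
    by (rule bounded_linear.has_derivative[OF bounded_linear_vec_nth d])
  have "((\<lambda>t. \<gamma> t $ k) has_derivative (\<lambda>h. 0)) (at 0)"
    by (rule has_derivative_transform_within_open[OF has_derivative_const o, of 1]) (simp add: \<gamma>S)
  from fun_cong[OF has_derivative_unique[OF 1 this], of 1] have vk: "v $ k = 0" by simp
  have 2: "((\<lambda>t. Re (hf s (\<gamma> t) (\<gamma> t))) has_derivative (\<lambda>h. 2 * Re (hf s (h *\<^sub>R v) p))) (at 0)"
    using has_derivative_compose[OF d, of "\<lambda>w. Re (hf s w w)"] hermitian_square_derivative[of s] \<gamma>(3) by blast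
  have "((\<lambda>t. Re (hf s (\<gamma> t) (\<gamma> t))) has_derivative (\<lambda>h. 0)) (at 0)"
    by (rule has_derivative_transform_within_open[OF has_derivative_const o, of 0]) (simp add: \<gamma>S)
  from fun_cong[OF has_derivative_unique[OF 2 this], of 1] vk
  show "v \<in> {v. v $ k = 0 \<and> Re (hf s v p) = 0}" by simp
next
  fix v assume v: "v \<in> {v. v $ k = 0 \<and> Re (hf s v p) = 0}"
  obtain e where e: "e $ k = 0" "hf s e p = 1" using quadric_transversal_vector[OF s p] by blast
  have fd: "fd (\<lambda>w. Re (hf s w w)) p u = 2 * Re (hf s u p)" for u using fd_eq[OF hermitian_square_derivative] by metis
  have u1: "fd (\<lambda>w. Re (hf s w w)) p e \<noteq> 0" "fd (\<lambda>w. Re (hf s w w)) p v = 0" unfolding fd using e v by simp_all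
  obtain \<sigma> \<epsilon> where c: "0 < \<epsilon>" "smooth_on {-\<epsilon><..<\<epsilon>} (\<lambda>t. (p + t *\<^sub>R v) + \<sigma> t *\<^sub>R e)" "\<sigma> 0 = 0"
     "\<forall>t\<in>{-\<epsilon><..<\<epsilon>}. (p + t *\<^sub>R v) + \<sigma> t *\<^sub>R e \<in> UNIV \<and> Re (hf s ((p + t *\<^sub>R v) + \<sigma> t *\<^sub>R e) ((p + t *\<^sub>R v) + \<sigma> t *\<^sub>R e)) = 0"
     "((\<lambda>t. (p + t *\<^sub>R v) + \<sigma> t *\<^sub>R e) has_vector_derivative v) (at 0)"
    using hypersurface_curve[OF open_UNIV UNIV_I smooth_hermitian_square _ u1] p(2) by auto
  have "(p + t *\<^sub>R v + \<sigma> t *\<^sub>R e) $ k = 1" for t using v e p by simp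
  moreover have "hf s (p + t *\<^sub>R v + \<sigma> t *\<^sub>R e) (p + t *\<^sub>R v + \<sigma> t *\<^sub>R e) = 0" if "t \<in> {-\<epsilon><..<\<epsilon>}" for t
    using c(4) that by (simp add: complex_eq_iff hf.diag_real)
  ultimately show "v \<in> tangent_space {w. w $ k = 1 \<and> hf s w w = 0} p"
    unfolding tangent_space_def mem_Collect_eq
    using c by (intro exI[of _ "\<lambda>t. (p + t *\<^sub>R v) + \<sigma> t *\<^sub>R e"] exI[of _ \<epsilon>]) auto
qed

lemma dim_coordinate_hyperplane: "vec.subspace {v :: complex^'b. v $ k = 0}" "vec.dim {v :: complex^'b. v $ k = 0} + 1 = CARD('b)"
proof -
  have d: "vec.dim (UNIV :: (complex^'b) set) = CARD('b)" by (simp add: vec.dim_UNIV vec_dim_card card_cart_basis)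
  have K: "vec.subspace {v :: complex^'b. v $ k = 0}" "CARD('b) \<le> vec.dim {v :: complex^'b. v $ k = 0} + 1"
    using dim_kernel_functional[of UNIV "\<lambda>v :: complex^'b. v $ k"] d by auto
  have "vec.dim {v :: complex^'b. v $ k = 0} \<noteq> CARD('b)"
  proof
    assume "vec.dim {v :: complex^'b. v $ k = 0} = CARD('b)"
    then have "{v :: complex^'b. v $ k = 0} = UNIV" using d by (intro vec.subspace_dim_equal K(1) vec.subspace_UNIV) auto
    then have "axis k 1 \<in> {v :: complex^'b. v $ k = 0}" by simp
    then show False by simp
  qed
  moreover have "vec.dim {v :: complex^'b. v $ k = 0} \<le> CARD('b)" using vec.dim_subset[of _ UNIV] d by (metis subset_UNIV)
  ultimately show "vec.dim {v :: complex^'b. v $ k = 0} + 1 = CARD('b)" using K(2) by linarith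
  show "vec.subspace {v :: complex^'b. v $ k = 0}" by (rule K(1))
qed

section \<open>Holomorphic maps into projective space\<close>

text \<open>Holomorphy of \<open>f\<close> provides some chart near \<open>p\<close>, while contact
  forms on the target come with a prescribed one; dividing by the coordinate \<open>k\<close>
  changes charts.\<close>

lemma holomorphic_chart:
  assumes f: "holomorphic_cproj_on U f" and p: "p \<in> U" "f p \<in> chart_domain k"
  shows "\<exists>V. open V \<and> p \<in> V \<and> V \<subseteq> U \<and> f ` V \<subseteq> chart_domain k \<and> holomorphic_map_on V (\<lambda>x. chart k (f x))"
proof -
  obtain V0 k0 where V0: "open V0" "p \<in> V0" "V0 \<subseteq> U" "f ` V0 \<subseteq> chart_domain k0" and hol: "holomorphic_map_on V0 (\<lambda>x. chart k0 (f x))"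
    using f[unfolded holomorphic_cproj_on_def, rule_format, OF p(1)] by (elim exE conjE) (rule that)
  define G where "G x = chart k0 (f x)" for x
  have G: "holomorphic_map_on V0 G" using hol by (simp add: G_def[abs_def])
  have line: "line_of (f x) = vec.span {G x}" if "x \<in> V0" for x using chart_in_line(1) V0(4) that unfolding G_def by blast
  define V where "V = V0 \<inter> (\<lambda>x. G x $ k) -` (- {0})"
  have "continuous_on V0 (\<lambda>x. G x $ k)" by (intro continuous_on_component holomorphic_map_continuous G)
  then have V: "open V" unfolding V_def by (rule continuous_open_preimage) (auto simp: V0)
  have Gp: "G p $ k \<noteq> 0"
  proof
    assume 0: "G p $ k = 0"
    obtain z where "z \<in> line_of (f p)" "z $ k \<noteq> 0" using p(2) unfolding chart_domain_def by blast
    then show False unfolding line[OF V0(2)] using 0 by (auto simp: vec.span_singleton)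
  qed
  have mem: "G x \<in> line_of (f x)" if "x \<in> V0" for x using line[OF that] by (simp add: vec.span_base)
  have eq: "chart k (f x) = (1 / G x $ k) *s G x" and dom: "f x \<in> chart_domain k" if "x \<in> V" for x
    using chart_eq(1,2)[OF mem] that unfolding V_def by auto
  have GV: "holomorphic_map_on V G" by (rule holomorphic_map_on_subset[OF G]) (simp add: V_def)
  have nz: "G x $ k \<noteq> 0" if "x \<in> V" for x using that by (simp add: V_def)
  have d: "((\<lambda>x. inverse (G x $ k)) has_derivative (\<lambda>v. - (inverse (G x $ k) * fd G x v $ k * inverse (G x $ k)))) (at x)" if "x \<in> V" for x
    by (rule Deriv.has_derivative_inverse[OF nz[OF that] bounded_linear.has_derivative[OF bounded_linear_vec_nth holomorphic_map_has_derivative[OF GV that]]])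
  have "holomorphic_map_on V (\<lambda>x. inverse (G x $ k) *s G x)"
    by (rule holomorphic_map_scale(1)[OF GV d]) (auto simp: fd_scale[OF GV])
  then have "holomorphic_map_on V (\<lambda>x. chart k (f x))"
  proof -
    assume h: "holomorphic_map_on V (\<lambda>x. inverse (G x $ k) *s G x)"
    show ?thesis
    proof (rule holomorphic_map_onI)
      fix x assume x: "x \<in> V"
      show "((\<lambda>x. chart k (f x)) has_derivative fd (\<lambda>x. inverse (G x $ k) *s G x) x) (at x)"
        by (rule has_derivative_transform_within_open[OF holomorphic_map_has_derivative[OF h x] V x]) (simp add: eq inverse_eq_divide)
    qed (rule fd_scale[OF h])
  qed
  then show ?thesis using V V0 Gp dom by (intro exI[of _ V]) (auto simp: V_def)
qed

text \<open>The interior of the set where the inclusion holds is relatively closed: in a chart, let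
  \<open>z\<close> be the part of the value at \<open>y\<close> orthogonal to \<open>W\<close>. The
  product of the lift with \<open>z\<close>, along the complex line from a nearby point
  \<open>y0\<close> of the interior to \<open>y\<close>, vanishes near the start and hence at
  \<open>y\<close>, where it is the square of the norm of \<open>z\<close>.\<close>

lemma identity_theorem_cproj:
  assumes f: "holomorphic_cproj_on U f" and U: "open U" "connected U" and W: "vec.subspace W"
    and D: "open D" "D \<noteq> {}" "D \<subseteq> U" "\<forall>x\<in>D. line_of (f x) \<subseteq> W"
  shows "\<forall>x\<in>U. line_of (f x) \<subseteq> W"
proof -
  define A where "A = interior {x\<in>U. line_of (f x) \<subseteq> W}"
  have oA: "open A" and AU: "A \<subseteq> {x\<in>U. line_of (f x) \<subseteq> W}" unfolding A_def by (rule open_interior, rule interior_subset)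
  have DA: "D \<subseteq> A" unfolding A_def using D by (intro interior_maximal) auto
  have cl: "x \<in> A" if x: "x \<in> U" "x \<in> closure A" for x
  proof -
    obtain V k where V: "open V" "x \<in> V" "V \<subseteq> U" "f ` V \<subseteq> chart_domain k" and hol: "holomorphic_map_on V (\<lambda>x. chart k (f x))"
      using f[unfolded holomorphic_cproj_on_def, rule_format, OF x(1)] by (elim exE conjE) (rule that)
    define G where "G x = chart k (f x)" for x
    have G: "holomorphic_map_on V G" using hol by (simp add: G_def[abs_def])
    have GW: "line_of (f y) \<subseteq> W \<longleftrightarrow> G y \<in> W" if "y \<in> V" for y
      unfolding G_def by (rule line_of_subset_iff[OF W]) (use V(4) that in blast)
    obtain r where r: "0 < r" "ball x r \<subseteq> V" using V open_contains_ball by blast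
    obtain y0 where y0: "y0 \<in> A" "y0 \<in> ball x r" using x(2) r(1) by (auto simp: closure_approachable dist_commute)
    have "line_of (f y) \<subseteq> W" if y: "y \<in> ball x r" for y
    proof -
      obtain y' z where yz: "G y = y' + z" "y' \<in> W" "\<And>w. w \<in> W \<Longrightarrow> hf (\<lambda>_. 1) z w = 0"
        using hermitian_projection[OF W, of "G y"] by blast
      let ?l = "\<lambda>\<zeta>::complex. y0 + \<zeta> *s (y - y0)"
      define Z where "Z = {\<zeta>. ?l \<zeta> \<in> ball x r}"
      have lc: "continuous_on UNIV ?l" using has_derivative_affine_line(1) by (intro continuous_at_imp_continuous_on ballI has_derivative_continuous) blast
      have Z: "open Z" unfolding Z_def using open_vimage[OF open_ball lc, of x r] by (simp add: vimage_def)
      have "convex Z"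
        unfolding convex_def
      proof (intro ballI allI impI)
        fix a b and u v :: real assume *: "a \<in> Z" "b \<in> Z" "0 \<le> u" "0 \<le> v" "u + v = 1"
        have "?l (u *\<^sub>R a + v *\<^sub>R b) = (u + v) *\<^sub>R y0 + (u *\<^sub>R a + v *\<^sub>R b) *s (y - y0)" using * by simp
        also have "\<dots> = u *\<^sub>R ?l a + v *\<^sub>R ?l b"
          by (simp add: scaleR_eq_smult scaleR_conv_of_real vector_sadd_rdistrib vector_add_ldistrib vec.scale_scale)
        also have "\<dots> \<in> ball x r" using * convex_ball[of x r] unfolding Z_def convex_def by blast
        finally show "u *\<^sub>R a + v *\<^sub>R b \<in> Z" by (simp add: Z_def)
      qed
      then have conn: "connected Z" by (rule convex_connected)
      have 01: "0 \<in> Z" "1 \<in> Z" unfolding Z_def using y y0 by simp_all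
      define h where "h \<zeta> = hf (\<lambda>_. 1) (G (?l \<zeta>)) z" for \<zeta>
      have hh: "h holomorphic_on Z"
        unfolding h_def hf_def using r(2) by (intro holomorphic_intros holomorphic_map_line_on[OF G]) (auto simp: Z_def)
      define Z0 where "Z0 = Z \<inter> ?l -` A"
      have Z0: "open Z0" "0 \<in> Z0" unfolding Z0_def using Z open_vimage[OF oA lc] 01 y0 by auto
      have h0: "h \<zeta> = 0" if \<zeta>: "\<zeta> \<in> Z0" for \<zeta>
      proof -
        have "?l \<zeta> \<in> A" "?l \<zeta> \<in> V" using \<zeta> r(2) unfolding Z0_def Z_def by auto
        then have "G (?l \<zeta>) \<in> W" using AU GW by blast
        then have "hf (\<lambda>_. 1) z (G (?l \<zeta>)) = 0" by (rule yz(3))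
        then show ?thesis using hf.hermitian[of "\<lambda>_. 1" "G (?l \<zeta>)" z] by (simp add: h_def)
      qed
      have "h 1 = 0"
        by (rule analytic_continuation_open[where s = Z0 and s' = Z and f = h and g = "\<lambda>_. 0"])
          (use Z0 Z conn hh h0 01(2) in \<open>auto simp: Z0_def\<close>)
      then have "hf (\<lambda>_. 1) (y' + z) z = 0" using yz(1) by (simp add: h_def)
      moreover have "hf (\<lambda>_. 1) y' z = 0" using yz(3)[OF yz(2)] hf.hermitian[of "\<lambda>_. 1" y' z] by simp
      ultimately have "z \<bullet> z = 0" by (simp add: hf.add_left inner_eq_Re_hf)
      then have "G y \<in> W" using yz(1,2) by simp
      then show ?thesis using GW[of y] y r(2) by blast
    qed
    then have "ball x r \<subseteq> A" unfolding A_def using r(2) V(3) by (intro interior_maximal open_ball) blast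
    then show ?thesis using r(1) by auto
  qed
  have "A \<inter> U = {} \<or> (- closure A) \<inter> U = {}"
    by (rule connectedD[OF U(2) oA]) (use cl closure_subset[of A] in auto)
  moreover have "A \<inter> U \<noteq> {}" using D DA by blast
  ultimately show ?thesis using cl AU by blast
qed

text \<open>In the real direction of \<open>e\<close> the function \<open>\<rho>\<close> changes
  sign, and this persists after small translations. For every small imaginary part \<open>b\<close>
  of the parameter the intermediate value theorem gives a zero, and different \<open>b\<close> give
  different zeros.\<close>

lemma zeros_near_hypersurface:
  fixes \<rho> :: "complex^'m \<Rightarrow> real"
  assumes W: "open W" "p \<in> W" and \<rho>: "continuous_on W \<rho>" "\<rho> p = 0" "(\<rho> has_derivative L) (at p)" "L e > 0" and r: "0 < r"
  shows "\<exists>\<delta>>0. \<forall>h. norm h < \<delta> \<longrightarrow> infinite {t. cmod t < r \<and> p + h + t *s e \<in> W \<and> \<rho> (p + h + t *s e) = 0}"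
proof -
  obtain R where R: "0 < R" "ball p R \<subseteq> W" using W open_contains_ball by blast
  have "((\<lambda>a. \<rho> (p + a *\<^sub>R e)) has_derivative (\<lambda>h. L (h *\<^sub>R e))) (at 0)"
  proof -
    have "((\<lambda>a::real. p + a *\<^sub>R e) has_derivative (\<lambda>h. h *\<^sub>R e)) (at 0)" by (auto intro!: derivative_eq_intros)
    from has_derivative_compose[OF this, of \<rho> L] show ?thesis using \<rho>(3) by simp
  qed
  moreover have "linear L" using \<rho>(3) by (rule has_derivative_linear)
  ultimately have d: "((\<lambda>a. \<rho> (p + a *\<^sub>R e)) has_real_derivative L e) (at 0)"
    by (simp add: has_field_derivative_def linear_scale mult_commute_abs)
  obtain d1 where d1: "d1 > 0" "\<And>h. 0 < h \<Longrightarrow> h < d1 \<Longrightarrow> 0 < \<rho> (p + h *\<^sub>R e)"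
    using DERIV_pos_inc_right[OF d \<rho>(4)] \<rho>(2) by auto
  obtain d2 where d2: "d2 > 0" "\<And>h. 0 < h \<Longrightarrow> h < d2 \<Longrightarrow> \<rho> (p + (- h) *\<^sub>R e) < 0"
    using DERIV_pos_inc_left[OF d \<rho>(4)] \<rho>(2) by auto
  have e0: "0 < norm e"
  proof -
    have "L 0 = 0" using \<open>linear L\<close> by (rule linear_0)
    then show ?thesis using \<rho>(4) by auto
  qed
  define m where "m = Min {d1, d2, r/2, R / (2 * norm e)}"
  define a where "a = m / 2"
  have "0 < m" unfolding m_def using d1 d2 r R e0 by simp
  moreover have "m \<le> d1" "m \<le> d2" "m \<le> r/2" "m \<le> R / (2 * norm e)" unfolding m_def by auto
  ultimately have a: "0 < a" "a < d1" "a < d2" "a < r/2" "a < R / (2 * norm e)" by (auto simp: a_def)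
  then have aR: "a * norm e < R / 2" using e0 by (simp add: field_simps)
  have in_W: "p + w + b *\<^sub>R e \<in> W" if w: "norm w < R/2" and b: "\<bar>b\<bar> \<le> a" for w b
  proof -
    have "norm (b *\<^sub>R e) \<le> a * norm e" using b by (simp add: mult_right_mono)
    then have "norm (w + b *\<^sub>R e) < R" using norm_triangle_ineq[of w "b *\<^sub>R e"] w aR by linarith
    moreover have "dist p (p + w + b *\<^sub>R e) = norm (w + b *\<^sub>R e)"
      using norm_minus_cancel[of "w + b *\<^sub>R e"] by (simp add: dist_norm)
    ultimately have "p + w + b *\<^sub>R e \<in> ball p R" by simp
    then show ?thesis using R(2) by blast
  qed
  have cont: "isCont \<rho> x" if "x \<in> W" for x using continuous_on_interior[OF \<rho>(1)] interior_open[OF W(1)] that by simp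
  have lim: "((\<lambda>w. \<rho> (p + w + b *\<^sub>R e)) \<longlongrightarrow> \<rho> (p + b *\<^sub>R e)) (nhds 0)" if b: "\<bar>b\<bar> \<le> a" for b
  proof -
    have "p + 0 + b *\<^sub>R e \<in> W" using in_W[of 0 b] b R(1) by simp
    then have "(\<rho> \<longlongrightarrow> \<rho> (p + 0 + b *\<^sub>R e)) (nhds (p + 0 + b *\<^sub>R e))"
      using cont unfolding isCont_def tendsto_at_iff_tendsto_nhds by blast
    moreover have "((\<lambda>w. p + w + b *\<^sub>R e) \<longlongrightarrow> p + 0 + b *\<^sub>R e) (nhds 0)"
      by (intro tendsto_intros filterlim_ident)
    ultimately show ?thesis using filterlim_compose by fastforce
  qed
  have "\<forall>\<^sub>F w in nhds 0. 0 < \<rho> (p + w + a *\<^sub>R e)"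
    using order_tendstoD(1)[OF lim[of a], of 0] d1(2)[of a] a by simp
  moreover have "\<forall>\<^sub>F w in nhds 0. \<rho> (p + w + (- a) *\<^sub>R e) < 0"
    using order_tendstoD(2)[OF lim[of "-a"], of 0] d2(2)[of a] a by simp
  ultimately have "\<forall>\<^sub>F w in nhds 0. 0 < \<rho> (p + w + a *\<^sub>R e) \<and> \<rho> (p + w + (- a) *\<^sub>R e) < 0" by (rule eventually_conj)
  then obtain \<eta> where \<eta>: "0 < \<eta>" "\<And>w. norm w < \<eta> \<Longrightarrow> 0 < \<rho> (p + w + a *\<^sub>R e) \<and> \<rho> (p + w + (- a) *\<^sub>R e) < 0"
    unfolding eventually_nhds_metric by (auto simp: dist_norm)
  define m' where "m' = min \<eta> (R/2)"
  define b1 where "b1 = min (r/2) (m' / (2 * norm e))"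
  have m': "0 < m'" "m' \<le> \<eta>" "m' \<le> R/2" using \<eta>(1) R(1) by (auto simp: m'_def)
  then have b1: "0 < b1" "b1 \<le> r/2" "b1 \<le> m' / (2 * norm e)" using r e0 by (auto simp: b1_def)
  show ?thesis
  proof (intro exI[of _ "m'/2"] conjI allI impI)
    fix h :: "complex^'m" assume h: "norm h < m'/2"
    let ?T = "{t. cmod t < r \<and> p + h + t *s e \<in> W \<and> \<rho> (p + h + t *s e) = 0}"
    have "b \<in> Im ` ?T" if b: "b \<in> {0<..<b1}" for b
    proof -
      let ?w = "h + complex_of_real b *s (\<i> *s e)"
      have "norm (complex_of_real b *s (\<i> *s e)) = b * norm e" using b by (simp only: norm_smult norm_of_real) simp
      also have "\<dots> < b1 * norm e" using b e0 by simp
      also have "\<dots> \<le> m' / 2" using b1(3) e0 by (simp add: field_simps)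
      finally have w: "norm ?w < m'" using h norm_triangle_ineq[of h "complex_of_real b *s (\<i> *s e)"] by linarith
      let ?g = "\<lambda>t. \<rho> (p + ?w + t *\<^sub>R e)"
      have "\<exists>t\<ge>-a. t \<le> a \<and> ?g t = 0"
      proof (rule IVT)
        show "?g (- a) \<le> 0" "0 \<le> ?g a" "- a \<le> a" using \<eta>(2)[of ?w] w m' a(1) by (auto intro: less_imp_le)
        show "\<forall>x. - a \<le> x \<and> x \<le> a \<longrightarrow> isCont ?g x"
        proof (intro allI impI)
          fix x assume "- a \<le> x \<and> x \<le> a"
          then have "p + ?w + x *\<^sub>R e \<in> W" by (intro in_W) (use w m' in auto)
          then have c: "isCont \<rho> (p + ?w + x *\<^sub>R e)" by (rule cont)
          have "isCont (\<lambda>t. p + ?w + t *\<^sub>R e) x" by (intro continuous_intros)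
          from isCont_o2[OF this c] show "isCont ?g x" .
        qed
      qed
      then obtain t where t: "-a \<le> t" "t \<le> a" "?g t = 0" by blast
      have eq: "p + ?w + t *\<^sub>R e = p + h + Complex t b *s e"
      proof -
        have "Complex t b = complex_of_real t + complex_of_real b * \<i>" by (simp add: complex_eq_iff)
        then show ?thesis by (simp add: scaleR_eq_smult vector_sadd_rdistrib vec.scale_scale ac_simps)
      qed
      have "p + ?w + t *\<^sub>R e \<in> W" by (intro in_W) (use w m' t in auto)
      moreover have "cmod (Complex t b) < r" using cmod_le[of "Complex t b"] t b a(4) b1(2) by auto
      ultimately have "Complex t b \<in> ?T" using t(3) unfolding eq by simp
      then show ?thesis by (rule rev_image_eqI) simp
    qed
    then have "{0<..<b1} \<subseteq> Im ` ?T" by blast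
    then show "infinite ?T" using b1(1) infinite_Ioo[of 0 b1] finite_subset by blast
  qed (use m'(1) in simp)
qed

section \<open>From contact forms to proportional lifts\<close>

lemma functional_proportional:
  fixes d L :: "'x::real_vector \<Rightarrow> real"
  assumes "linear d" "linear L" "d \<noteq> (\<lambda>v. 0)" and ker: "\<And>v. d v = 0 \<Longrightarrow> L v = 0"
  shows "\<exists>\<kappa>. \<forall>v. L v = \<kappa> * d v"
proof -
  obtain w where w: "d w \<noteq> 0" using assms(3) by auto
  have "L v = L w / d w * d v" for v
  proof -
    have "d (v - (d v / d w) *\<^sub>R w) = 0" using w by (simp add: linear_diff[OF assms(1)] linear_scale[OF assms(1)])
    then have "L (v - (d v / d w) *\<^sub>R w) = 0" by (rule ker)
    then show ?thesis by (simp add: linear_diff[OF assms(2)] linear_scale[OF assms(2)])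
  qed
  then show ?thesis by blast
qed

text \<open>The identity is a lift of the quadric to its own cone, so contact forms on the target
  are covered by the same results as those on \<open>M\<close>.\<close>

lemma quadric_transversal_lift:
  assumes l: "l < CARD('b::{finite,linorder})" and c: "contact_form_on (affine_part k (hyperquadric l :: 'b cproj set)) W \<theta>"
  shows "transversal_lift (affine_part k (hyperquadric l :: 'b cproj set)) W \<theta> {v. v $ k = 0} (\<lambda>x. x) (qsign l)"
proof
  have id: "fd (\<lambda>x. x) x = (\<lambda>v. v)" for x :: "(complex, 'b) Finite_Cartesian_Product.vec" by (rule fd_eq) (rule has_derivative_ident)
  show "holomorphic_map_on W (\<lambda>x :: (complex, 'b) Finite_Cartesian_Product.vec. x)" by (rule holomorphic_map_onI[OF has_derivative_ident]) simp
  show "vec.subspace {v :: (complex, 'b) Finite_Cartesian_Product.vec. v $ k = 0}" by (rule dim_coordinate_hyperplane)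
  fix x :: "(complex, 'b) Finite_Cartesian_Product.vec" assume x: "x \<in> affine_part k (hyperquadric l)" "x \<in> W"
  then have xk: "x $ k = 1" "hf (qsign l) x x = 0" unfolding affine_part_hyperquadric[OF l] by auto
  then show "hf (qsign l) x x = 0" "x \<noteq> 0" by auto
  show "tangent_space (affine_part k (hyperquadric l)) x = {v \<in> {v. v $ k = 0}. Re (hf (qsign l) (fd (\<lambda>x. x) x v) x) = 0}"
    unfolding affine_part_hyperquadric[OF l] tangent_space_quadric[OF qsign_nonzero xk] id by simp
qed (use c qsign_nonzero in auto)

lemma contact_form_on_subset: "contact_form_on S V \<theta> \<Longrightarrow> open V' \<Longrightarrow> V' \<subseteq> V \<Longrightarrow> contact_form_on S V' \<theta>"
  unfolding contact_form_on_def using smooth_on_subset by blast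

text \<open>The kernel has odd real dimension and so cannot be a complex subspace; the witness
  rotates a vector outside the kernel and projects it back.\<close>

lemma no_complex_hyperplane:
  fixes d :: "complex^'m \<Rightarrow> real"
  assumes d: "linear d" "d \<noteq> (\<lambda>v. 0)"
  shows "\<exists>v. d v = 0 \<and> d (\<i> *s v) \<noteq> 0"
proof -
  obtain w where w: "d w \<noteq> 0" using d(2) by auto
  let ?r = "d (\<i> *s w) / d w"
  have "d (\<i> *s w - ?r *\<^sub>R w) = 0" using w by (simp add: linear_diff[OF d(1)] linear_scale[OF d(1)])
  moreover have "d (\<i> *s (\<i> *s w - ?r *\<^sub>R w)) \<noteq> 0"
  proof -
    have "\<i> *s (\<i> *s w - ?r *\<^sub>R w) = - w - ?r *\<^sub>R (\<i> *s w)" by (simp add: cart_eq_iff algebra_simps)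
    then have "d (\<i> *s (\<i> *s w - ?r *\<^sub>R w)) = - d w - ?r * d (\<i> *s w)"
      by (simp add: linear_diff[OF d(1)] linear_neg[OF d(1)] linear_scale[OF d(1)])
    also have "\<dots> = - (((d w)\<^sup>2 + (d (\<i> *s w))\<^sup>2) / d w)" using w by (simp add: field_simps power2_eq_square)
    finally show ?thesis using w by (simp add: add_nonneg_eq_0_iff)
  qed
  ultimately show ?thesis by blast
qed

text \<open>This turns transversality, given by contact forms, into a condition on the lift. The
  first conclusion is independent of contact forms; the second keeps the value of \<open>a\<close>
  for the comparison of sides.\<close>

lemma transversal_pullback:
  fixes f :: "complex^'m \<Rightarrow> 'b::{finite,linorder} cproj"
  assumes l: "l < CARD('b)"
    and \<rho>: "linear d" "d \<noteq> (\<lambda>v. 0)" "tangent_space M x = {v. d v = 0}"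
    and \<theta>: "contact_form_on M V \<theta>" and \<theta>': "contact_form_on (affine_part k (hyperquadric l)) W \<theta>'"
    and pb: "pulls_back_on M V \<theta> W \<theta>' k f a" and x: "x \<in> M" "x \<in> V" "a x \<noteq> 0"
    and F: "holomorphic_map_on B (\<lambda>x. chart k (f x))" "x \<in> B" and fM: "f ` M \<subseteq> hyperquadric l"
  shows "\<exists>\<kappa>. \<kappa> \<noteq> 0 \<and> (\<forall>v. Re (hf (qsign l) (fd (\<lambda>x. chart k (f x)) x v) (chart k (f x))) = \<kappa> * d v)"
    and "\<exists>e. e $ k = 0 \<and> hf (qsign l) e (chart k (f x)) = 1 \<and> chart k (f x) \<in> affine_part k (hyperquadric l) \<and> chart k (f x) \<in> W \<and>
      (\<forall>v. d v = 0 \<longrightarrow> a x * \<theta> x v = \<theta>' (chart k (f x)) (\<i> *s e) * Im (hf (qsign l) (fd (\<lambda>x. chart k (f x)) x v) (chart k (f x))))"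
proof -
  define F where "F = (\<lambda>x. chart k (f x))"
  interpret Q: transversal_lift "affine_part k (hyperquadric l :: 'b cproj set)" W \<theta>' "{v. v $ k = 0}" "\<lambda>x. x" "qsign l"
    by (rule quadric_transversal_lift[OF l \<theta>'])
  have id: "fd (\<lambda>x. x) y = (\<lambda>v. v)" for y :: "(complex, 'b) Finite_Cartesian_Product.vec" by (rule fd_eq) (rule has_derivative_ident)
  have hol: "holomorphic_map_on B F" using F(1) by (simp add: F_def)
  have FQ: "F y \<in> affine_part k (hyperquadric l)" "F y $ k = 1" "hf (qsign l) (F y) (F y) = 0" if "y \<in> M" "y \<in> V" for y
  proof -
    have "f y \<in> chart_domain k" using pb that unfolding pulls_back_on_def by blast
    then show "F y \<in> affine_part k (hyperquadric l)" unfolding affine_part_def F_def using fM that by blast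
    then show "F y $ k = 1" "hf (qsign l) (F y) (F y) = 0" unfolding affine_part_hyperquadric[OF l] by auto
  qed
  have FW: "F x \<in> W" using pb x unfolding pulls_back_on_def F_def by blast
  have oV: "open V" and lin\<theta>: "linear (\<theta> x)" and ker\<theta>: "{v\<in>tangent_space M x. \<theta> x v = 0} = complex_tangent_space M x"
    using \<theta> x unfolding contact_form_on_def by auto
  obtain e where e: "e $ k = 0" "hf (qsign l) e (F x) = 1" using quadric_transversal_vector[OF qsign_nonzero FQ(2,3)[OF x(1,2)]] by blast
  define \<mu> where "\<mu> = \<theta>' (F x) (\<i> *s e)"
  have "\<mu> \<noteq> 0" unfolding \<mu>_def using Q.contact_value(1)[OF FQ(1)[OF x(1,2)] FW, of e] e by (simp add: id)
  have tan: "fd F x v $ k = 0 \<and> Re (hf (qsign l) (fd F x v) (F x)) = 0" if v: "d v = 0" for v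
  proof -
    have "v \<in> tangent_space M x" using \<rho>(3) v by simp
    then obtain \<gamma> \<epsilon> where \<gamma>: "\<epsilon> > 0" "\<gamma> ` {-\<epsilon><..<\<epsilon>} \<subseteq> M" "\<gamma> 0 = x" "(\<gamma> has_vector_derivative v) (at 0)"
      unfolding tangent_space_def by blast
    have d\<gamma>: "(\<gamma> has_derivative (\<lambda>h. h *\<^sub>R v)) (at 0)" using \<gamma>(4) by (simp add: has_vector_derivative_def)
    have dF: "((\<lambda>t. F (\<gamma> t)) has_derivative (\<lambda>h. fd F x (h *\<^sub>R v))) (at 0)"
      using has_derivative_compose[OF d\<gamma>, of F "fd F x"] holomorphic_map_has_derivative[OF hol F(2)] \<gamma>(3) by simp
    have "(\<gamma> \<longlongrightarrow> x) (at 0)" using has_derivative_continuous[OF d\<gamma>] \<gamma>(3) by (simp add: continuous_at)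
    then have "\<forall>\<^sub>F t in at 0. \<gamma> t \<in> V" using oV x(2) by (rule topological_tendstoD)
    moreover have "\<forall>\<^sub>F t in at 0. t \<in> {-\<epsilon><..<\<epsilon>}"
      by (rule eventually_at_topological[THEN iffD2]) (use \<gamma>(1) in \<open>auto intro!: exI[of _ "{-\<epsilon><..<\<epsilon>}"]\<close>)
    ultimately have ev: "\<forall>\<^sub>F t in at 0. F (\<gamma> t) $ k = 1 \<and> Re (hf (qsign l) (F (\<gamma> t)) (F (\<gamma> t))) = 0"
    proof eventually_elim
      case (elim t)
      then have "\<gamma> t \<in> M" using \<gamma>(2) by blast
      then show ?case using FQ elim by simp
    qed
    have 1: "((\<lambda>t. F (\<gamma> t) $ k) has_derivative (\<lambda>h. fd F x (h *\<^sub>R v) $ k)) (at 0)"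
      by (rule bounded_linear.has_derivative[OF bounded_linear_vec_nth dF])
    have "((\<lambda>t. F (\<gamma> t) $ k) has_derivative (\<lambda>h. 0)) (at 0)"
      by (rule has_derivative_transform_eventually[OF has_derivative_const[of 1]])
        (use ev \<gamma>(3) FQ x in \<open>auto elim: eventually_mono\<close>)
    from fun_cong[OF has_derivative_unique[OF 1 this], of 1] have k0: "fd F x v $ k = 0" by simp
    have dF0: "((\<lambda>t. F (\<gamma> t)) has_derivative (\<lambda>h. fd F x (h *\<^sub>R v))) (at 0)" by (rule dF)
    have 2: "((\<lambda>t. Re (hf (qsign l) (F (\<gamma> t)) (F (\<gamma> t)))) has_derivative (\<lambda>h. 2 * Re (hf (qsign l) (fd F x (h *\<^sub>R v)) (F x)))) (at 0)"
      using has_derivative_compose[OF dF, of "\<lambda>w. Re (hf (qsign l) w w)"] hermitian_square_derivative[of "qsign l"] \<gamma>(3) by blast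
    have "((\<lambda>t. Re (hf (qsign l) (F (\<gamma> t)) (F (\<gamma> t)))) has_derivative (\<lambda>h. 0)) (at 0)"
      by (rule has_derivative_transform_eventually[OF has_derivative_const[of 0]])
        (use ev \<gamma>(3) FQ x in \<open>auto elim: eventually_mono\<close>)
    from fun_cong[OF has_derivative_unique[OF 2 this], of 1] k0 show ?thesis by simp
  qed
  have val: "a x * \<theta> x v = \<mu> * Im (hf (qsign l) (fd F x v) (F x))" if v: "d v = 0" for v
  proof -
    have "\<theta>' (F x) (fd F x v) = a x * \<theta> x v"
      using pb x v \<rho>(3) unfolding pulls_back_on_def F_def fd_def by blast
    moreover have "\<theta>' (F x) (fd F x v) = \<mu> * Im (hf (qsign l) (fd F x v) (F x))"
      using Q.contact_value(2)[OF FQ(1)[OF x(1,2)] FW, of e "fd F x v"] tan[OF v] e by (simp add: id \<mu>_def)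
    ultimately show ?thesis by simp
  qed
  then show "\<exists>e. e $ k = 0 \<and> hf (qsign l) e (chart k (f x)) = 1 \<and> chart k (f x) \<in> affine_part k (hyperquadric l) \<and> chart k (f x) \<in> W \<and>
      (\<forall>v. d v = 0 \<longrightarrow> a x * \<theta> x v = \<theta>' (chart k (f x)) (\<i> *s e) * Im (hf (qsign l) (fd (\<lambda>x. chart k (f x)) x v) (chart k (f x))))"
    using e FQ(1)[OF x(1,2)] FW unfolding \<mu>_def F_def by blast
  let ?c = "\<lambda>v. hf (qsign l) (fd F x v) (F x)"
  have lin: "linear (\<lambda>v. Re (?c v))"
    by (rule linearI) (simp_all add: fd_add[OF hol F(2)] hf.add_left scaleR_eq_smult fd_scale[OF hol F(2)] hf.scale_left)
  obtain \<kappa> where \<kappa>: "\<And>v. Re (?c v) = \<kappa> * d v"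
    using functional_proportional[OF \<rho>(1) lin \<rho>(2)] tan by blast
  \<comment> \<open>Otherwise the real part vanishes for all \<open>v\<close>, with
    \<open>\<i> *s v\<close> in place of \<open>v\<close> also the imaginary part, and then
    \<open>\<theta>\<close> on the tangent space. The latter would be a complex subspace, which a
    real hyperplane is not.\<close>
  have "\<kappa> \<noteq> 0"
  proof
    assume "\<kappa> = 0"
    then have Re0: "Re (?c v) = 0" for v using \<kappa> by simp
    have "Im (?c v) = 0" for v using Re0[of "\<i> *s v"] by (simp add: fd_scale[OF hol F(2)] hf.scale_left)
    then have "\<theta> x v = 0" if "d v = 0" for v using val[OF that] x(3) by simp
    then have "{v. d v = 0} = complex_tangent_space M x" using ker\<theta> \<rho>(3) by auto
    then have "d v = 0 \<Longrightarrow> d (\<i> *s v) = 0" for v unfolding complex_tangent_space_def \<rho>(3) by auto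
    then show False using no_complex_hyperplane[OF \<rho>(1,2)] by blast
  qed
  then show "\<exists>\<kappa>. \<kappa> \<noteq> 0 \<and> (\<forall>v. Re (hf (qsign l) (fd (\<lambda>x. chart k (f x)) x v) (chart k (f x))) = \<kappa> * d v)"
    using \<kappa> unfolding F_def by blast
qed

lemma normalized_transversal_vector:
  assumes L0: "transversal_lift M V \<theta> UNIV F0 s0" and x: "x \<in> M" "x \<in> V" and d: "d \<noteq> (\<lambda>v. 0)"
    and \<kappa>0: "\<exists>\<kappa>. \<kappa> \<noteq> 0 \<and> (\<forall>v. Re (hf s0 (fd F0 x v) (F0 x)) = \<kappa> * d v)"
  shows "\<exists>e. hf s0 (fd F0 x e) (F0 x) = 1"
proof -
  interpret L0: transversal_lift M V \<theta> UNIV F0 s0 by (rule L0)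
  let ?c0 = "\<lambda>v. hf s0 (fd F0 x v) (F0 x)"
  obtain \<kappa> where \<kappa>: "\<kappa> \<noteq> 0" "\<forall>v. Re (?c0 v) = \<kappa> * d v" using \<kappa>0 by blast
  obtain v where v: "d v \<noteq> 0" using d by auto
  have "?c0 v \<noteq> 0"
  proof
    assume "?c0 v = 0"
    then have "\<kappa> * d v = 0" using \<kappa>(2)[rule_format, of v] by simp
    then show False using v \<kappa>(1) by simp
  qed
  then have "?c0 ((1 / ?c0 v) *s v) = 1" by (subst L0.cf_scale[OF x(2)]) simp
  then show ?thesis by blast
qed

text \<open>Both real parts are multiples of the same functional \<open>d\<close>, and complex
  linearity transfers the factor to the imaginary parts. For the Levi forms, the exterior derivative
  of the one form \<open>\<theta>\<close> is computed with either lift; this compares imaginary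
  parts, and replacing \<open>u\<close> by \<open>\<i> *s u\<close> compares real parts.\<close>

lemma transversal_lifts_proportional:
  assumes L0: "transversal_lift M V \<theta> UNIV F0 s0" and L1: "transversal_lift M V \<theta> UNIV F1 s1"
    and x: "x \<in> M" "x \<in> V" and d: "d \<noteq> (\<lambda>v. 0)"
    and \<kappa>0: "\<exists>\<kappa>. \<kappa> \<noteq> 0 \<and> (\<forall>v. Re (hf s0 (fd F0 x v) (F0 x)) = \<kappa> * d v)"
    and \<kappa>1: "\<exists>\<kappa>. \<kappa> \<noteq> 0 \<and> (\<forall>v. Re (hf s1 (fd F1 x v) (F1 x)) = \<kappa> * d v)"
  shows "\<exists>t. t \<noteq> 0 \<and> (\<forall>v. hf s1 (fd F1 x v) (F1 x) = of_real t * hf s0 (fd F0 x v) (F0 x)) \<and>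
    (\<forall>u v. hf s0 (fd F0 x u) (F0 x) = 0 \<longrightarrow> hf s0 (fd F0 x v) (F0 x) = 0 \<longrightarrow>
      hf s1 (fd F1 x u) (fd F1 x v) = of_real t * hf s0 (fd F0 x u) (fd F0 x v))"
proof -
  interpret L0: transversal_lift M V \<theta> UNIV F0 s0 by (rule L0)
  interpret L1: transversal_lift M V \<theta> UNIV F1 s1 by (rule L1)
  let ?c0 = "\<lambda>x v. hf s0 (fd F0 x v) (F0 x)" and ?c1 = "\<lambda>x v. hf s1 (fd F1 x v) (F1 x)"
  have "\<exists>t. t \<noteq> 0 \<and> (\<forall>v. ?c1 x v = of_real t * ?c0 x v)"
  proof -
    obtain \<kappa> \<kappa>' where \<kappa>: "\<kappa> \<noteq> 0" "\<And>v. Re (?c0 x v) = \<kappa> * d v" "\<kappa>' \<noteq> 0" "\<And>v. Re (?c1 x v) = \<kappa>' * d v"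
      using \<kappa>0 \<kappa>1 by blast
    have Re: "Re (?c1 x v) = \<kappa>' / \<kappa> * Re (?c0 x v)" for v using \<kappa>(1) by (simp add: \<kappa>(2,4))
    have "Im (?c1 x v) = \<kappa>' / \<kappa> * Im (?c0 x v)" for v
      using Re[of "\<i> *s v"] by (simp add: L0.cf_scale[OF x(2)] L1.cf_scale[OF x(2)])
    then have "?c1 x v = of_real (\<kappa>' / \<kappa>) * ?c0 x v" for v using Re by (simp add: complex_eq_iff)
    then show ?thesis using \<kappa>(1,3) by (intro exI[of _ "\<kappa>' / \<kappa>"]) simp
  qed
  then obtain t where t: "t \<noteq> 0" "\<And>v. ?c1 x v = of_real t * ?c0 x v" by blast
  obtain e where e: "?c0 x e = 1" using normalized_transversal_vector[OF L0 x d \<kappa>0] by blast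
  have levi: "hf s1 (fd F1 x u) (fd F1 x v) = of_real t * hf s0 (fd F0 x u) (fd F0 x v)"
    if u: "?c0 x u = 0" and v: "?c0 x v = 0" for u v
  proof -
    let ?e = "complex_of_real (1 / t) *s e"
    have e1: "?c1 x ?e = 1" using e t(1) by (simp add: L0.cf_scale[OF x(2)] t(2))
    have \<theta>e: "\<theta> x (\<i> *s ?e) = \<theta> x (\<i> *s e) / t"
    proof -
      have "\<i> *s ?e = (1 / t) *\<^sub>R (\<i> *s e)" by (simp add: scaleR_eq_smult vec.scale_scale mult.commute)
      then show ?thesis by (simp add: linear_scale[OF L0.\<theta>_linear[OF x(2)]])
    qed
    have \<theta>0: "\<theta> x (\<i> *s e) \<noteq> 0" using L0.contact_value(1)[OF x _ e] by simp
    have Im: "Im (hf s1 (fd F1 x u) (fd F1 x v)) = t * Im (hf s0 (fd F0 x u) (fd F0 x v))"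
      if u: "?c0 x u = 0" for u
    proof -
      have "?c1 x u = 0" "?c1 x v = 0" using u v t(2) by simp_all
      then have "ext_deriv \<theta> x u v = - 2 * \<theta> x (\<i> *s ?e) * Im (hf s1 (fd F1 x u) (fd F1 x v))"
        using L1.ext_deriv_contact[OF x _ e1, of u v] by simp
      moreover have "ext_deriv \<theta> x u v = - 2 * \<theta> x (\<i> *s e) * Im (hf s0 (fd F0 x u) (fd F0 x v))"
        using L0.ext_deriv_contact[OF x _ e, of u v] u v by simp
      ultimately show ?thesis using \<theta>0 t(1) unfolding \<theta>e by (simp add: field_simps)
    qed
    have "Re (hf s1 (fd F1 x u) (fd F1 x v)) = t * Re (hf s0 (fd F0 x u) (fd F0 x v))"
      using Im[of "\<i> *s u"] u
      by (simp add: L0.cf_scale[OF x(2)] fd_scale[OF L0.\<Phi> x(2)] fd_scale[OF L1.\<Phi> x(2)] hf.scale_left)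
    then show ?thesis using Im[OF u] by (simp add: complex_eq_iff)
  qed
  show ?thesis using t levi by blast
qed

text \<open>\<open>\<epsilon>\<close> records the sign of the ratio at \<open>p\<close>, and
  \<open>\<sigma>\<close> selects whether squares are counted for the target form or its negative.
  Scaling the forms by \<open>\<sigma> * \<epsilon>\<close> and \<open>\<sigma>\<close> makes the
  ratio \<open>\<epsilon> * \<tau>\<close> positive, as \<open>segre_pair\<close> requires.\<close>

lemma local_dimension_bound:
  fixes F0 :: "complex^'m \<Rightarrow> complex^'a" and F1 :: "complex^'m \<Rightarrow> complex^'b" and \<rho> :: "complex^'m \<Rightarrow> real"
  assumes L0: "transversal_lift M V \<theta> UNIV F0 s0" and L1: "transversal_lift M V \<theta> UNIV F1 s1"
    and p: "p \<in> M" "p \<in> V" and \<rho>: "smooth_on V \<rho>" "M \<inter> V = {x\<in>V. \<rho> x = 0}" "\<And>x. x \<in> V \<Longrightarrow> fd \<rho> x \<noteq> (\<lambda>v. 0)"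
    and \<kappa>0: "\<And>x. x \<in> M \<Longrightarrow> x \<in> V \<Longrightarrow> \<exists>\<kappa>. \<kappa> \<noteq> 0 \<and> (\<forall>v. Re (hf s0 (fd F0 x v) (F0 x)) = \<kappa> * fd \<rho> x v)"
    and \<kappa>1: "\<And>x. x \<in> M \<Longrightarrow> x \<in> V \<Longrightarrow> \<exists>\<kappa>. \<kappa> \<noteq> 0 \<and> (\<forall>v. Re (hf s1 (fd F1 x v) (F1 x)) = \<kappa> * fd \<rho> x v)"
    and pos: "\<And>x. x \<in> M \<Longrightarrow> x \<in> V \<Longrightarrow> \<exists>P. vec.subspace P \<and> Suc q \<le> vec.dim P \<and>
        (\<forall>u\<in>P. hf s0 (fd F0 x u) (F0 x) = 0 \<and> (u \<noteq> 0 \<longrightarrow> Re (hf s0 (fd F0 x u) (fd F0 x u)) > 0))"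
    and neg: "\<And>x. x \<in> M \<Longrightarrow> x \<in> V \<Longrightarrow> \<exists>P. vec.subspace P \<and> Suc q \<le> vec.dim P \<and>
        (\<forall>u\<in>P. hf s0 (fd F0 x u) (F0 x) = 0 \<and> (u \<noteq> 0 \<longrightarrow> Re (hf s0 (fd F0 x u) (fd F0 x u)) < 0))"
    and nondeg: "\<And>x u. x \<in> M \<Longrightarrow> x \<in> V \<Longrightarrow> hf s0 (fd F0 x u) (F0 x) = 0 \<Longrightarrow>
        (\<And>v. hf s0 (fd F0 x v) (F0 x) = 0 \<Longrightarrow> hf s0 (fd F0 x u) (fd F0 x v) = 0) \<Longrightarrow> u = 0"
    and t: "\<And>v. hf s1 (fd F1 p v) (F1 p) = of_real t * hf s0 (fd F0 p v) (F0 p)" "\<epsilon> * t > 0"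
    and \<epsilon>\<sigma>: "\<epsilon> = 1 \<or> \<epsilon> = -1" "\<sigma> = 1 \<or> \<sigma> = -1"
    and signs: "card {i. \<sigma> * s1 i > 0} + card {i. \<sigma> * \<epsilon> * s0 i < 0} < CARD('m) + 1 + Suc q"
  shows "\<exists>D. open D \<and> D \<noteq> {} \<and> D \<subseteq> V \<and>
      vec.dim (vec.span (F1 ` D)) \<le> card {i. \<sigma> * s1 i < 0} + card {i. \<sigma> * \<epsilon> * s0 i > 0} \<and>
      vec.dim (vec.span (F1 ` D)) \<le> card {i. \<sigma> * s1 i > 0} + card {i. \<sigma> * \<epsilon> * s0 i < 0}"
proof -
  interpret L0: transversal_lift M V \<theta> UNIV F0 s0 by (rule L0)
  interpret L1: transversal_lift M V \<theta> UNIV F1 s1 by (rule L1)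
  let ?c0 = "\<lambda>x v. hf s0 (fd F0 x v) (F0 x)" and ?c1 = "\<lambda>x v. hf s1 (fd F1 x v) (F1 x)"
  have ex: "\<exists>e. ?c0 x e = 1" if x: "x \<in> M" "x \<in> V" for x
    by (rule normalized_transversal_vector[OF L0 x \<rho>(3)[OF x(2)] \<kappa>0[OF x]])
  have "\<forall>x\<in>M \<inter> V. \<exists>t. t \<noteq> 0 \<and> (\<forall>v. ?c1 x v = of_real t * ?c0 x v) \<and>
      (\<forall>u v. ?c0 x u = 0 \<longrightarrow> ?c0 x v = 0 \<longrightarrow> hf s1 (fd F1 x u) (fd F1 x v) = of_real t * hf s0 (fd F0 x u) (fd F0 x v))"
    using transversal_lifts_proportional[OF L0 L1 _ _ \<rho>(3) \<kappa>0 \<kappa>1] by blast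
  from bchoice[OF this] obtain \<tau> where \<tau>': "\<forall>x\<in>M \<inter> V. \<tau> x \<noteq> 0 \<and> (\<forall>v. ?c1 x v = of_real (\<tau> x) * ?c0 x v) \<and>
      (\<forall>u v. ?c0 x u = 0 \<longrightarrow> ?c0 x v = 0 \<longrightarrow> hf s1 (fd F1 x u) (fd F1 x v) = of_real (\<tau> x) * hf s0 (fd F0 x u) (fd F0 x v))"
    by (rule exE)
  have \<tau>: "\<tau> x \<noteq> 0" "?c1 x v = of_real (\<tau> x) * ?c0 x v" if "x \<in> M" "x \<in> V" for x v using \<tau>' that by auto
  have levi: "hf s1 (fd F1 x u) (fd F1 x v) = of_real (\<tau> x) * hf s0 (fd F0 x u) (fd F0 x v)"
    if "x \<in> M" "x \<in> V" "?c0 x u = 0" "?c0 x v = 0" for x u v using \<tau>' that by auto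
  obtain e where e: "?c0 p e = 1" using ex[OF p] by blast
  define \<eta> where "\<eta> = \<sigma> * \<epsilon>"
  have \<eta>: "\<eta> * \<eta> = 1" "\<eta> = 1 \<or> \<eta> = -1" using \<epsilon>\<sigma> by (auto simp: \<eta>_def)
  \<comment> \<open>Continuity of both real parts at the fixed vector \<open>e\<close> keeps the
    sign of the ratio constant near \<open>p\<close>, although \<open>\<tau>\<close> itself comes
    from a pointwise choice.\<close>
  define V' where "V' = V \<inter> (\<lambda>x. (Re (?c0 x e), \<epsilon> * Re (?c1 x e))) -` ({0<..} \<times> {0<..})"
  have "continuous_on V (\<lambda>x. (Re (?c0 x e), \<epsilon> * Re (?c1 x e)))"
    by (intro continuous_intros continuous_on_hf continuous_on_fd holomorphic_map_continuous L0.V L0.\<Phi> L1.\<Phi>)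
  then have V': "open V'" unfolding V'_def by (rule continuous_open_preimage[OF _ L0.V]) (intro open_Times open_greaterThan)
  have V'V: "V' \<subseteq> V" by (auto simp: V'_def)
  have pV': "p \<in> V'" using p t e by (simp add: V'_def)
  have \<tau>_pos: "\<epsilon> * \<tau> x > 0" if x: "x \<in> M" "x \<in> V'" for x
  proof -
    have "0 < Re (?c0 x e)" "0 < \<epsilon> * \<tau> x * Re (?c0 x e)" using x \<tau>(2)[of x e] V'V by (auto simp: V'_def)
    then show ?thesis by (simp add: zero_less_mult_iff)
  qed
  obtain \<kappa> where \<kappa>: "\<kappa> \<noteq> 0" "\<And>v. Re (?c0 p v) = \<kappa> * fd \<rho> p v" using \<kappa>0[OF p] by blast
  have d\<rho>: "(\<rho> has_derivative fd \<rho> p) (at p)" by (rule smooth_on_has_derivative[OF \<rho>(1) p(2)])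
  let ?e = "complex_of_real \<eta> *s e"
  have c0e: "?c0 p ?e = of_real \<eta>" using e by (simp add: L0.cf_scale[OF p(2)])
  have \<rho>p: "\<rho> p = 0" using \<rho>(2) p by blast
  have many: "\<exists>\<delta>>0. \<forall>h. norm h < \<delta> \<longrightarrow> infinite {t. cmod t < r \<and> p + h + t *s ?e \<in> M}" if r: "0 < r" for r
  proof -
    have ne: "fd \<rho> p ?e \<noteq> 0"
    proof
      assume "fd \<rho> p ?e = 0"
      then have "Re (?c0 p ?e) = 0" using \<kappa>(2) by simp
      then show False using \<eta>(2) by (auto simp: c0e)
    qed
    \<comment> \<open>\<open>zeros_near_hypersurface\<close> wants \<open>\<rho>\<close> to increase
      in the transversal direction; its sign may be changed because only zeros matter.\<close>
    define g where "g = sgn (fd \<rho> p ?e)"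
    have g: "g * fd \<rho> p ?e > 0" "g \<noteq> 0" using ne by (auto simp: g_def sgn_if)
    have "\<exists>\<delta>>0. \<forall>h. norm h < \<delta> \<longrightarrow> infinite {t. cmod t < r \<and> p + h + t *s ?e \<in> V \<and> g * \<rho> (p + h + t *s ?e) = 0}"
      by (rule zeros_near_hypersurface[where L = "\<lambda>v. g * fd \<rho> p v" and \<rho> = "\<lambda>x. g * \<rho> x" and e = ?e, OF L0.V p(2) _ _ _ g(1) r])
        (intro continuous_on_mult_left smooth_on_continuous \<rho>(1), simp add: \<rho>p, rule has_derivative_mult_right[OF d\<rho>])
    then obtain \<delta> where \<delta>: "\<delta> > 0" "\<forall>h. norm h < \<delta> \<longrightarrow> infinite {t. cmod t < r \<and> p + h + t *s ?e \<in> V \<and> g * \<rho> (p + h + t *s ?e) = 0}" by blast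
    have "{t. cmod t < r \<and> p + h + t *s ?e \<in> V \<and> g * \<rho> (p + h + t *s ?e) = 0} \<subseteq> {t. cmod t < r \<and> p + h + t *s ?e \<in> M}" for h
      using \<rho>(2) g(2) by auto
    then show ?thesis using \<delta> infinite_super by blast
  qed
  interpret segre_hypersurface "\<lambda>i. \<sigma> * \<epsilon> * s0 i" "\<lambda>i. \<sigma> * s1 i" F0 F1 V' M p ?e q "\<lambda>x. \<epsilon> * \<tau> x" \<rho> V "\<eta> / \<kappa>"
  proof unfold_locales
    have hf0: "hf (\<lambda>i. \<sigma> * \<epsilon> * s0 i) x y = of_real \<eta> * hf s0 x y" for x y unfolding \<eta>_def by (rule hf_scale)
    have hf1: "hf (\<lambda>i. \<sigma> * s1 i) x y = of_real \<sigma> * hf s1 x y" for x y by (rule hf_scale)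
    have \<sigma>\<eta>: "\<epsilon> * \<eta> = \<sigma>" using \<epsilon>\<sigma> by (auto simp: \<eta>_def)
    have \<eta>0: "complex_of_real \<eta> \<noteq> 0" using \<eta>(2) by auto
    show "open V'" "p \<in> V'" "p \<in> M" "open V" "p \<in> V" by (fact V' pV' p L0.V)+
    show "holomorphic_map_on V' F0" "holomorphic_map_on V' F1"
      by (rule holomorphic_map_on_subset[OF L0.\<Phi> V'V], rule holomorphic_map_on_subset[OF L1.\<Phi> V'V])
    show "M \<inter> V = {x\<in>V. \<rho> x = 0}" by (rule \<rho>(2))
    show "continuous_on V \<rho>" by (rule smooth_on_continuous[OF \<rho>(1)])
    show "\<eta> / \<kappa> \<noteq> 0" using \<kappa>(1) \<eta>(2) by auto
    have "fd \<rho> p v = \<eta> / \<kappa> * Re (hf (\<lambda>i. \<sigma> * \<epsilon> * s0 i) (fd F0 p v) (F0 p))" for v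
    proof -
      have "\<eta> / \<kappa> * Re (hf (\<lambda>i. \<sigma> * \<epsilon> * s0 i) (fd F0 p v) (F0 p)) = \<eta> * \<eta> / \<kappa> * Re (?c0 p v)" by (simp add: hf0)
      then show ?thesis using \<kappa>(1) by (simp add: \<eta>(1) \<kappa>(2))
    qed
    then have "fd \<rho> p = (\<lambda>v. \<eta> / \<kappa> * Re (hf (\<lambda>i. \<sigma> * \<epsilon> * s0 i) (fd F0 p v) (F0 p)))" by (rule ext)
    then show "(\<rho> has_derivative (\<lambda>v. \<eta> / \<kappa> * Re (hf (\<lambda>i. \<sigma> * \<epsilon> * s0 i) (fd F0 p v) (F0 p)))) (at p)" using d\<rho> by simp
    show "\<forall>i. \<sigma> * \<epsilon> * s0 i \<noteq> 0" "\<forall>i. \<sigma> * s1 i \<noteq> 0" using L0.s L1.s \<epsilon>\<sigma> by auto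
    show "card {i. \<sigma> * s1 i > 0} + card {i. \<sigma> * \<epsilon> * s0 i < 0} < CARD('m) + 1 + Suc q" by (rule signs)
    show "hf (\<lambda>i. \<sigma> * \<epsilon> * s0 i) (fd F0 p ?e) (F0 p) = 1"
      unfolding hf0 c0e using \<eta>(1) by (metis of_real_1 of_real_mult)
    show "\<exists>\<delta>>0. \<forall>h. hf (\<lambda>i. \<sigma> * \<epsilon> * s0 i) (fd F0 p h) (F0 p) = 0 \<and> norm h < \<delta> \<longrightarrow> infinite {t. cmod t < r \<and> p + h + t *s ?e \<in> M}"
      if "0 < r" for r using many[OF that] by blast
    fix x assume x: "x \<in> M" "x \<in> V'"
    then have xV: "x \<in> V" using V'V by blast
    show "hf (\<lambda>i. \<sigma> * \<epsilon> * s0 i) (F0 x) (F0 x) = 0" "hf (\<lambda>i. \<sigma> * s1 i) (F1 x) (F1 x) = 0"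
      using L0.null[OF x(1) xV] L1.null[OF x(1) xV] by (simp_all add: hf0 hf1)
    show "0 < \<epsilon> * \<tau> x" by (rule \<tau>_pos[OF x])
    have \<tau>\<eta>: "complex_of_real \<sigma> * (of_real (\<tau> x) * z) = of_real (\<epsilon> * \<tau> x) * (of_real \<eta> * z)" for z
      unfolding \<sigma>\<eta>[symmetric] by simp
    show "hf (\<lambda>i. \<sigma> * s1 i) (fd F1 x v) (F1 x) = of_real (\<epsilon> * \<tau> x) * hf (\<lambda>i. \<sigma> * \<epsilon> * s0 i) (fd F0 x v) (F0 x)" for v
      unfolding hf0 hf1 \<tau>(2)[OF x(1) xV] by (rule \<tau>\<eta>)
    show "\<exists>v. hf (\<lambda>i. \<sigma> * \<epsilon> * s0 i) (fd F0 x v) (F0 x) \<noteq> 0"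
    proof -
      obtain v where "?c0 x v = 1" using ex[OF x(1) xV] by blast
      then show ?thesis using \<eta>0 by (intro exI[of _ v]) (simp add: hf0)
    qed
    show "hf (\<lambda>i. \<sigma> * s1 i) (fd F1 x u) (fd F1 x v) = of_real (\<epsilon> * \<tau> x) * hf (\<lambda>i. \<sigma> * \<epsilon> * s0 i) (fd F0 x u) (fd F0 x v)"
      if "hf (\<lambda>i. \<sigma> * \<epsilon> * s0 i) (fd F0 x u) (F0 x) = 0" "hf (\<lambda>i. \<sigma> * \<epsilon> * s0 i) (fd F0 x v) (F0 x) = 0" for u v
    proof -
      have "?c0 x u = 0" "?c0 x v = 0" using that \<eta>0 by (simp_all add: hf0)
      then show ?thesis unfolding hf0 hf1 levi[OF x(1) xV \<open>?c0 x u = 0\<close> \<open>?c0 x v = 0\<close>] by (intro \<tau>\<eta>)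
    qed
    show "u = 0" if "hf (\<lambda>i. \<sigma> * \<epsilon> * s0 i) (fd F0 x u) (F0 x) = 0"
      "\<And>v. hf (\<lambda>i. \<sigma> * \<epsilon> * s0 i) (fd F0 x v) (F0 x) = 0 \<Longrightarrow> hf (\<lambda>i. \<sigma> * \<epsilon> * s0 i) (fd F0 x u) (fd F0 x v) = 0" for u
      by (rule nondeg[OF x(1) xV]) (use that \<eta>0 in \<open>simp_all add: hf0\<close>)
    \<comment> \<open>Negating the form exchanges the positive and the negative subspaces, so one
      statement with a sign \<open>z\<close> covers both.\<close>
    have flip: "\<exists>P. vec.subspace P \<and> Suc q \<le> vec.dim P \<and> (\<forall>u\<in>P. hf (\<lambda>i. \<sigma> * \<epsilon> * s0 i) (fd F0 x u) (F0 x) = 0 \<and>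
          (u \<noteq> 0 \<longrightarrow> z * Re (hf (\<lambda>i. \<sigma> * \<epsilon> * s0 i) (fd F0 x u) (fd F0 x u)) > 0))" if z: "z = 1 \<or> z = -1" for z
    proof (cases "z * \<eta> = 1")
      case True
      obtain P where "vec.subspace P" "Suc q \<le> vec.dim P" and P: "\<forall>u\<in>P. ?c0 x u = 0 \<and> (u \<noteq> 0 \<longrightarrow> Re (hf s0 (fd F0 x u) (fd F0 x u)) > 0)"
        using pos[OF x(1) xV] by blast
      moreover have eq: "z * Re (hf (\<lambda>i. \<sigma> * \<epsilon> * s0 i) y y) = Re (hf s0 y y)" for y
      proof -
        have "z * Re (hf (\<lambda>i. \<sigma> * \<epsilon> * s0 i) y y) = (z * \<eta>) * Re (hf s0 y y)" by (simp add: hf0)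
        then show ?thesis unfolding True by simp
      qed
      ultimately show ?thesis unfolding eq by (intro exI[of _ P]) (auto simp: hf0)
    next
      case False
      then have zn: "z * \<eta> = -1" using z \<eta>(2) by auto
      obtain P where "vec.subspace P" "Suc q \<le> vec.dim P" and P: "\<forall>u\<in>P. ?c0 x u = 0 \<and> (u \<noteq> 0 \<longrightarrow> Re (hf s0 (fd F0 x u) (fd F0 x u)) < 0)"
        using neg[OF x(1) xV] by blast
      moreover have eq: "z * Re (hf (\<lambda>i. \<sigma> * \<epsilon> * s0 i) y y) = - Re (hf s0 y y)" for y
      proof -
        have "z * Re (hf (\<lambda>i. \<sigma> * \<epsilon> * s0 i) y y) = (z * \<eta>) * Re (hf s0 y y)" by (simp add: hf0)
        then show ?thesis unfolding zn by simp
      qed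
      ultimately show ?thesis unfolding eq by (intro exI[of _ P]) (auto simp: hf0)
    qed
    show "\<exists>P. vec.subspace P \<and> Suc q \<le> vec.dim P \<and> (\<forall>u\<in>P. hf (\<lambda>i. \<sigma> * \<epsilon> * s0 i) (fd F0 x u) (F0 x) = 0 \<and>
          (u \<noteq> 0 \<longrightarrow> Re (hf (\<lambda>i. \<sigma> * \<epsilon> * s0 i) (fd F0 x u) (fd F0 x u)) > 0))"
      using flip[of 1] by simp
    show "\<exists>P. vec.subspace P \<and> Suc q \<le> vec.dim P \<and> (\<forall>u\<in>P. hf (\<lambda>i. \<sigma> * \<epsilon> * s0 i) (fd F0 x u) (F0 x) = 0 \<and>
          (u \<noteq> 0 \<longrightarrow> Re (hf (\<lambda>i. \<sigma> * \<epsilon> * s0 i) (fd F0 x u) (fd F0 x u)) < 0))"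
      using flip[of "-1"] by simp
  qed
  obtain D where "open D" "D \<noteq> {}" "D \<subseteq> V'"
      "vec.dim (vec.span (F1 ` D)) \<le> card {i. \<sigma> * s1 i < 0} + card {i. \<sigma> * \<epsilon> * s0 i > 0}"
      "vec.dim (vec.span (F1 ` D)) \<le> card {i. \<sigma> * s1 i > 0} + card {i. \<sigma> * \<epsilon> * s0 i < 0}"
    by (rule span_bound)
  then show ?thesis using V'V by (intro exI[of _ D]) blast
qed

section \<open>Both maps together, globalization and the final count\<close>

lemma subspace_of_dim:
  fixes S :: "(complex^'b) set"
  assumes k: "vec.dim (vec.span S) \<le> k" "k \<le> CARD('b)"
  shows "\<exists>W. vec.subspace W \<and> S \<subseteq> W \<and> vec.dim W = k"
proof -
  have d: "vec.dim (UNIV :: (complex^'b) set) = CARD('b)" by (simp add: vec.dim_UNIV vec_dim_card card_cart_basis)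
  obtain B where B: "B \<subseteq> S" "vec.independent B" "S \<subseteq> vec.span B" "card B = vec.dim S" using vec.basis_exists[of S] by blast
  obtain C where C: "B \<subseteq> C" "C \<subseteq> UNIV" "vec.independent C" "UNIV \<subseteq> vec.span C"
    by (rule vec.maximal_independent_subset_extend[OF subset_UNIV B(2)])
  have fC: "finite C" using C(3) vec.finiteI_independent by blast
  have "card C = CARD('b)" using vec.dim_eq_card_independent[OF C(3)] vec.dim_span[of C] top.extremum_uniqueI[OF C(4)] d by simp
  moreover have "card B \<le> k" using k(1) B(4) by simp
  ultimately obtain E where E: "B \<subseteq> E" "E \<subseteq> C" "card E = k"
    using exists_subset_between[OF _ _ C(1) fC, of k] k(2) by auto
  have ind: "vec.independent E" using vec.independent_mono[OF C(3) E(2)] .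
  have "vec.dim (vec.span E) = k" using vec.dim_eq_card_independent[OF ind] E(3) by simp
  moreover have "S \<subseteq> vec.span E" using B(3) vec.span_mono[OF E(1)] by blast
  ultimately show ?thesis by (intro exI[of _ "vec.span E"]) simp
qed

text \<open>The contact form in the last clause is left free so that the lifts of both maps can be
  attached to the same one.\<close>

lemma local_lift:
  fixes f :: "complex^'m \<Rightarrow> 'b::{finite,linorder} cproj"
  assumes U: "open U" "M \<subseteq> U" and f: "holomorphic_cproj_on U f" "f ` M \<subseteq> hyperquadric l" and l: "l < CARD('b)"
    and \<rho>: "open V0" "p \<in> V0" "smooth_on V0 \<rho>" "M \<inter> V0 = {x\<in>V0. \<rho> x = 0}" "\<And>x. x \<in> V0 \<Longrightarrow> fd \<rho> x \<noteq> (\<lambda>v. 0)"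
    and \<theta>: "contact_form_on M V \<theta>" and \<theta>': "contact_form_on (affine_part k (hyperquadric l)) W \<theta>'"
    and pb: "pulls_back_on M V \<theta> W \<theta>' k f a" and p: "p \<in> M" "p \<in> V" and a: "\<forall>x\<in>M \<inter> V. a x \<noteq> 0"
  shows "\<exists>B. open B \<and> p \<in> B \<and> B \<subseteq> V \<inter> V0 \<inter> U \<and> f ` B \<subseteq> chart_domain k \<and>
      holomorphic_map_on B (\<lambda>x. chart k (f x)) \<and>
      (\<forall>x\<in>M \<inter> B. \<exists>\<kappa>. \<kappa> \<noteq> 0 \<and> (\<forall>v. Re (hf (qsign l) (fd (\<lambda>x. chart k (f x)) x v) (chart k (f x))) = \<kappa> * fd \<rho> x v)) \<and>
      (\<forall>C \<theta>\<^sub>1. contact_form_on M C \<theta>\<^sub>1 \<and> C \<subseteq> B \<longrightarrow> transversal_lift M C \<theta>\<^sub>1 UNIV (\<lambda>x. chart k (f x)) (qsign l))"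
proof -
  let ?F = "\<lambda>x. chart k (f x)"
  have fp: "f p \<in> chart_domain k" using pb p unfolding pulls_back_on_def by blast
  have pU: "p \<in> U" using U p by blast
  obtain B0 where B0: "open B0" "p \<in> B0" "B0 \<subseteq> U" "f ` B0 \<subseteq> chart_domain k" "holomorphic_map_on B0 ?F"
    using holomorphic_chart[OF f(1) pU fp] by (elim exE conjE) (rule that)
  have oV: "open V" using \<theta> unfolding contact_form_on_def by blast
  define B where "B = B0 \<inter> V \<inter> V0"
  have B: "open B" "p \<in> B" "B \<subseteq> V \<inter> V0 \<inter> U" "f ` B \<subseteq> chart_domain k"
    unfolding B_def using B0 oV \<rho> p by auto
  have F: "holomorphic_map_on B ?F" by (rule holomorphic_map_on_subset[OF B0(5)]) (auto simp: B_def)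
  have tan: "tangent_space M x = {v. fd \<rho> x v = 0}" if x: "x \<in> M" "x \<in> B" for x
    by (rule tangent_space_hypersurface[OF \<rho>(1,3,5,4) x(1)]) (use x(2) B(3) in auto)
  have \<kappa>: "\<exists>\<kappa>. \<kappa> \<noteq> 0 \<and> (\<forall>v. Re (hf (qsign l) (fd ?F x v) (?F x)) = \<kappa> * fd \<rho> x v)" if x: "x \<in> M" "x \<in> B" for x
  proof -
    have xV: "x \<in> V" "x \<in> V0" using x B(3) by auto
    have "linear (fd \<rho> x)" using smooth_on_has_derivative[OF \<rho>(3) xV(2)] by (rule has_derivative_linear)
    moreover have "a x \<noteq> 0" using a x xV by blast
    ultimately show ?thesis
      using transversal_pullback(1)[OF l _ \<rho>(5)[OF xV(2)] tan[OF x] \<theta> \<theta>' pb x(1) xV(1) _ F x(2) f(2)] by blast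
  qed
  have FQ: "?F x \<in> affine_part k (hyperquadric l)" if "x \<in> M" "x \<in> B" for x
    unfolding affine_part_def using that B(4) f(2) by blast
  have "transversal_lift M C \<theta>\<^sub>1 UNIV ?F (qsign l)" if C: "contact_form_on M C \<theta>\<^sub>1" "C \<subseteq> B" for C \<theta>\<^sub>1
  proof
    show "contact_form_on M C \<theta>\<^sub>1" by (rule C(1))
    show "holomorphic_map_on C ?F" by (rule holomorphic_map_on_subset[OF F C(2)])
    show "vec.subspace (UNIV :: (complex^'m) set)" by (rule vec.subspace_UNIV)
    show "\<forall>i. qsign l (i :: 'b) \<noteq> 0" by (rule qsign_nonzero)
    fix x assume x: "x \<in> M" "x \<in> C"
    then have xB: "x \<in> B" using C(2) by blast
    obtain \<kappa> where "\<kappa> \<noteq> 0" "\<forall>v. Re (hf (qsign l) (fd ?F x v) (?F x)) = \<kappa> * fd \<rho> x v" using \<kappa>[OF x(1) xB] by blast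
    then show "tangent_space M x = {v \<in> UNIV. Re (hf (qsign l) (fd ?F x v) (?F x)) = 0}" unfolding tan[OF x(1) xB] by simp
    have "?F x $ k = 1" "hf (qsign l) (?F x) (?F x) = 0" using FQ[OF x(1) xB] unfolding affine_part_hyperquadric[OF l] by auto
    then show "hf (qsign l) (?F x) (?F x) = 0" "?F x \<noteq> 0" by auto
  qed
  then show ?thesis using B F \<kappa> by (intro exI[of _ B] conjI) blast+
qed

text \<open>\<open>\<epsilon>\<close> is the sign of the ratio of the two lifts at \<open>p\<close>.
  The Levi forms have the same ratio, so the definite subspaces of dimension \<open>n - l\<close>
  and \<open>l\<close> reappear in the target with sign \<open>\<epsilon>\<close>, each enlarged by
  a null vector; hence the strict inequalities. \<open>d\<close> is a linear dimension, cut off at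
  that of the ambient space.\<close>

lemma transversal_pair:
  fixes M U :: "(complex^'m) set"
    and f\<^sub>0 :: "complex^'m \<Rightarrow> 'a::{finite,linorder} cproj" and f :: "complex^'m \<Rightarrow> 'b::{finite,linorder} cproj"
  assumes card: "CARD('m) = n + 1" "CARD('a) = N\<^sub>0 + 2" "CARD('b) = N + 2"
    and M: "smooth_real_hypersurface M" "levi_nondegenerate M n" "has_signature M n l"
    and le: "2 * l \<le> n" "2 * l \<le> N\<^sub>0" "2 * l' \<le> N" and U: "open U" "connected U" "M \<subseteq> U"
    and f0: "holomorphic_cproj_on U f\<^sub>0" "f\<^sub>0 ` M \<subseteq> hyperquadric l" "cr_transversal M f\<^sub>0 (hyperquadric l)"
    and f: "holomorphic_cproj_on U f" "f ` M \<subseteq> hyperquadric l'"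
    and \<theta>: "contact_form_on M V \<theta>" and \<theta>': "contact_form_on (affine_part k (hyperquadric l' :: 'b cproj set)) W \<theta>'"
    and pb: "pulls_back_on M V \<theta> W \<theta>' k f a" and p: "p \<in> M" "p \<in> V" and a: "\<forall>x\<in>M \<inter> V. a x \<noteq> 0"
  shows "\<exists>\<epsilon>::real. (\<epsilon> = 1 \<or> \<epsilon> = -1) \<and>
      (contact_form_of_type M V n l \<theta> \<and> contact_form_of_type (affine_part k (hyperquadric l' :: 'b cproj set)) W N l' \<theta>' \<and>
         2 * l < n \<and> 2 * l' < N \<longrightarrow> \<epsilon> * a p > 0) \<and>
      n \<le> N\<^sub>0 \<and> n - l < card {i::'b. \<epsilon> * qsign l' i > 0} \<and> l < card {i::'b. \<epsilon> * qsign l' i < 0} \<and>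
      (\<forall>\<sigma> d. (\<sigma> = 1 \<or> \<sigma> = -1) \<and> 1 \<le> l \<and> card {i::'b. \<sigma> * qsign l' i > 0} + card {i::'a. \<sigma> * \<epsilon> * qsign l i < 0} < n + 2 + l \<and>
         (card {i::'b. \<sigma> * qsign l' i < 0} + card {i::'a. \<sigma> * \<epsilon> * qsign l i > 0} \<le> d \<or>
          card {i::'b. \<sigma> * qsign l' i > 0} + card {i::'a. \<sigma> * \<epsilon> * qsign l i < 0} \<le> d) \<longrightarrow>
         (\<exists>P. projective_plane (int (min d (N + 2)) - 1) P \<and> f ` M \<subseteq> P))"
proof -
  have lt: "l < CARD('a)" "l' < CARD('b)" using le card by auto
  obtain V0 and \<rho> :: "complex^'m \<Rightarrow> real" where \<rho>': "open V0" "p \<in> V0" "smooth_on V0 \<rho>"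
      "\<forall>x\<in>V0. frechet_derivative \<rho> (at x) \<noteq> (\<lambda>v. 0)" "M \<inter> V0 = {x\<in>V0. \<rho> x = 0}"
    using M(1)[unfolded smooth_real_hypersurface_def, rule_format, OF p(1)] by (elim exE conjE) (rule that)
  have "fd \<rho> x = frechet_derivative \<rho> (at x)" for x by (rule ext) (simp add: fd_def)
  then have \<rho>: "open V0" "p \<in> V0" "smooth_on V0 \<rho>" "\<And>x. x \<in> V0 \<Longrightarrow> fd \<rho> x \<noteq> (\<lambda>v. 0)" "M \<inter> V0 = {x\<in>V0. \<rho> x = 0}"
    using \<rho>' by auto
  obtain V\<^sub>0 \<theta>\<^sub>0 k\<^sub>0 W\<^sub>0 \<theta>\<^sub>0' a\<^sub>0 where c0: "p \<in> V\<^sub>0" "contact_form_on M V\<^sub>0 \<theta>\<^sub>0" "contact_form_on (affine_part k\<^sub>0 (hyperquadric l :: 'a cproj set)) W\<^sub>0 \<theta>\<^sub>0'"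
     "pulls_back_on M V\<^sub>0 \<theta>\<^sub>0 W\<^sub>0 \<theta>\<^sub>0' k\<^sub>0 f\<^sub>0 a\<^sub>0" "\<forall>x\<in>M \<inter> V\<^sub>0. a\<^sub>0 x \<noteq> 0"
    using f0(3)[unfolded cr_transversal_def, rule_format, OF p(1)] by (elim exE conjE) (rule that)
  define F0 where "F0 = (\<lambda>x. chart k\<^sub>0 (f\<^sub>0 x))"
  define F1 where "F1 = (\<lambda>x. chart k (f x))"
  obtain B\<^sub>0 where B\<^sub>0: "open B\<^sub>0" "p \<in> B\<^sub>0"
      "\<forall>x\<in>M \<inter> B\<^sub>0. \<exists>\<kappa>. \<kappa> \<noteq> 0 \<and> (\<forall>v. Re (hf (qsign l) (fd F0 x v) (F0 x)) = \<kappa> * fd \<rho> x v)"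
      "\<forall>C \<theta>\<^sub>1. contact_form_on M C \<theta>\<^sub>1 \<and> C \<subseteq> B\<^sub>0 \<longrightarrow> transversal_lift M C \<theta>\<^sub>1 UNIV F0 (qsign l)"
    using local_lift[OF U(1,3) f0(1,2) lt(1) \<rho>(1-3,5,4) c0(2-4) p(1) c0(1,5)] unfolding F0_def by blast
  obtain B\<^sub>1 where B\<^sub>1: "open B\<^sub>1" "p \<in> B\<^sub>1" "B\<^sub>1 \<subseteq> V \<inter> V0 \<inter> U" "f ` B\<^sub>1 \<subseteq> chart_domain k" "holomorphic_map_on B\<^sub>1 F1"
      "\<forall>x\<in>M \<inter> B\<^sub>1. \<exists>\<kappa>. \<kappa> \<noteq> 0 \<and> (\<forall>v. Re (hf (qsign l') (fd F1 x v) (F1 x)) = \<kappa> * fd \<rho> x v)"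
      "\<forall>C \<theta>\<^sub>1. contact_form_on M C \<theta>\<^sub>1 \<and> C \<subseteq> B\<^sub>1 \<longrightarrow> transversal_lift M C \<theta>\<^sub>1 UNIV F1 (qsign l')"
    using local_lift[OF U(1,3) f lt(2) \<rho>(1-3,5,4) \<theta> \<theta>' pb p a] unfolding F1_def by blast
  define C where "C = B\<^sub>0 \<inter> B\<^sub>1"
  have C: "open C" "p \<in> C" "C \<subseteq> V" "C \<subseteq> V0" "C \<subseteq> U" "C \<subseteq> B\<^sub>0" "C \<subseteq> B\<^sub>1" using B\<^sub>0 B\<^sub>1 by (auto simp: C_def)
  have \<theta>C: "contact_form_on M C \<theta>" by (rule contact_form_on_subset[OF \<theta> C(1,3)])
  have L0: "transversal_lift M C \<theta> UNIV F0 (qsign l)" and L1: "transversal_lift M C \<theta> UNIV F1 (qsign l')"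
    using B\<^sub>0(4) B\<^sub>1(7) \<theta>C C by blast+
  interpret L0: transversal_lift M C \<theta> UNIV F0 "qsign l" by (rule L0)
  interpret L1: transversal_lift M C \<theta> UNIV F1 "qsign l'" by (rule L1)
  have \<kappa>0: "\<exists>\<kappa>. \<kappa> \<noteq> 0 \<and> (\<forall>v. Re (hf (qsign l) (fd F0 x v) (F0 x)) = \<kappa> * fd \<rho> x v)"
    and \<kappa>1: "\<exists>\<kappa>. \<kappa> \<noteq> 0 \<and> (\<forall>v. Re (hf (qsign l') (fd F1 x v) (F1 x)) = \<kappa> * fd \<rho> x v)"
    and nz: "fd \<rho> x \<noteq> (\<lambda>v. 0)" if "x \<in> M" "x \<in> C" for x
    using that B\<^sub>0(3) B\<^sub>1(6) \<rho>(4) C by blast+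
  have dim: "vec.dim (UNIV :: (complex^'m) set) = Suc n" "n \<le> CARD('m)"
    using card by (simp_all add: vec.dim_UNIV vec_dim_card card_cart_basis)
  note cq = card_qsign[OF lt(1)] card_qsign[OF lt(2)]
  have dd: "\<exists>A. vec.subspace A \<and> vec.dim A = n - l \<and> (\<forall>u\<in>A. L0.cf x u = 0 \<and> (u \<noteq> 0 \<longrightarrow> Re (L0.lf x u u) > 0))"
     "\<exists>A. vec.subspace A \<and> vec.dim A = l \<and> (\<forall>u\<in>A. L0.cf x u = 0 \<and> (u \<noteq> 0 \<longrightarrow> Re (L0.lf x u u) < 0))"
     "\<And>u0. L0.cf x u0 = 0 \<Longrightarrow> (\<And>v. L0.cf x v = 0 \<Longrightarrow> L0.lf x u0 v = 0) \<Longrightarrow> u0 = 0" if x: "x \<in> M" "x \<in> C" for x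
  proof -
    obtain e where e: "L0.cf x e = 1" using normalized_transversal_vector[OF L0 x nz[OF x] \<kappa>0[OF x]] by blast
    note D = L0.definite_dims[OF M(3,2) le(1) _ dim x UNIV_I e]
    show "\<exists>A. vec.subspace A \<and> vec.dim A = n - l \<and> (\<forall>u\<in>A. L0.cf x u = 0 \<and> (u \<noteq> 0 \<longrightarrow> Re (L0.lf x u u) > 0))"
      using D(1) cq by auto
    show "\<exists>A. vec.subspace A \<and> vec.dim A = l \<and> (\<forall>u\<in>A. L0.cf x u = 0 \<and> (u \<noteq> 0 \<longrightarrow> Re (L0.lf x u u) < 0))"
      using D(2) cq by auto
    show "u0 = 0" if "L0.cf x u0 = 0" "\<And>v. L0.cf x v = 0 \<Longrightarrow> L0.lf x u0 v = 0" for u0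
      by (rule D(3)) (use that cq in auto)
  qed
  obtain t where t: "t \<noteq> 0" "\<And>v. L1.cf p v = of_real t * L0.cf p v"
      "\<And>u v. L0.cf p u = 0 \<Longrightarrow> L0.cf p v = 0 \<Longrightarrow> L1.lf p u v = of_real t * L0.lf p u v"
    using transversal_lifts_proportional[OF L0 L1 p(1) C(2) nz[OF p(1) C(2)] \<kappa>0[OF p(1) C(2)] \<kappa>1[OF p(1) C(2)]] by blast
  define \<epsilon> where "\<epsilon> = sgn t"
  have \<epsilon>: "\<epsilon> = 1 \<or> \<epsilon> = -1" "\<epsilon> * t > 0" using t(1) by (auto simp: \<epsilon>_def sgn_if)
  obtain A where A: "vec.subspace A" "vec.dim A = n - l" "\<forall>u\<in>A. L0.cf p u = 0 \<and> (u \<noteq> 0 \<longrightarrow> Re (L0.lf p u u) > 0)"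
    using dd(1)[OF p(1) C(2)] by blast
  obtain A' where A': "vec.subspace A'" "vec.dim A' = l" "\<forall>u\<in>A'. L0.cf p u = 0 \<and> (u \<noteq> 0 \<longrightarrow> Re (L0.lf p u u) < 0)"
    using dd(2)[OF p(1) C(2)] by blast
  have "n - l < card {i::'a. 1 * qsign l i > 0}"
    using L0.definite_dim_less[OF p(1) C(2) A(1), of 1] A by simp
  then have nN0: "n \<le> N\<^sub>0" using cq(2) card le by simp
  have d1: "n - l < card {i::'b. \<epsilon> * qsign l' i > 0}"
    unfolding A(2)[symmetric]
  proof (rule L1.definite_dim_less[OF p(1) C(2) A(1)])
    show "\<forall>u\<in>A. L1.cf p u = 0 \<and> (u \<noteq> 0 \<longrightarrow> 0 < \<epsilon> * Re (L1.lf p u u))"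
    proof (intro ballI conjI impI)
      fix u assume u: "u \<in> A"
      then have c: "L0.cf p u = 0" using A(3) by blast
      then show "L1.cf p u = 0" by (simp add: t(2))
      assume "u \<noteq> 0"
      then have "0 < Re (L0.lf p u u)" using A(3) u by blast
      then have "0 < (\<epsilon> * t) * Re (L0.lf p u u)" by (rule mult_pos_pos[OF \<epsilon>(2)])
      then show "0 < \<epsilon> * Re (L1.lf p u u)" by (simp add: t(3)[OF c c] mult.assoc)
    qed
  qed (use \<epsilon> in auto)
  have "l < card {i::'b. - \<epsilon> * qsign l' i > 0}"
    unfolding A'(2)[symmetric]
  proof (rule L1.definite_dim_less[OF p(1) C(2) A'(1)])
    show "\<forall>u\<in>A'. L1.cf p u = 0 \<and> (u \<noteq> 0 \<longrightarrow> 0 < - \<epsilon> * Re (L1.lf p u u))"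
    proof (intro ballI conjI impI)
      fix u assume u: "u \<in> A'"
      then have c: "L0.cf p u = 0" using A'(3) by blast
      then show "L1.cf p u = 0" by (simp add: t(2))
      assume "u \<noteq> 0"
      then have "(\<epsilon> * t) * Re (L0.lf p u u) < 0" using A'(3) u \<epsilon>(2) by (intro mult_pos_neg) auto
      then show "0 < - \<epsilon> * Re (L1.lf p u u)" by (simp add: t(3)[OF c c] mult.assoc)
    qed
  qed (use \<epsilon> in auto)
  then have d2: "l < card {i::'b. \<epsilon> * qsign l' i < 0}" by simp
  have sgn: "\<epsilon> * a p > 0" if type: "contact_form_of_type M V n l \<theta>" "contact_form_of_type (affine_part k (hyperquadric l' :: 'b cproj set)) W N l' \<theta>'"
     "2 * l < n" "2 * l' < N"
  proof -
    obtain e where e: "L0.cf p e = 1" using normalized_transversal_vector[OF L0 p(1) C(2) nz[OF p(1) C(2)] \<kappa>0[OF p(1) C(2)]] by blast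
    have typeC: "contact_form_of_type M C n l \<theta>" using type(1) \<theta>C C(3) unfolding contact_form_of_type_def by blast
    have \<theta>_pos: "\<theta> p (\<i> *s e) > 0"
      by (rule L0.contact_form_of_type_positive[OF typeC type(3) _ dim p(1) C(2) UNIV_I e]) (use cq in simp)
    have lin: "linear (fd \<rho> p)" using smooth_on_has_derivative[OF \<rho>(3,2)] by (rule has_derivative_linear)
    have tan: "tangent_space M p = {v. fd \<rho> p v = 0}" by (rule tangent_space_hypersurface[OF \<rho>(1,3,4,5) p(1) \<rho>(2)])
    have ap: "a p \<noteq> 0" using a p by blast
    obtain e' where e': "e' $ k = 0" "hf (qsign l') e' (F1 p) = 1" "F1 p \<in> affine_part k (hyperquadric l')" "F1 p \<in> W"
        "\<forall>v. fd \<rho> p v = 0 \<longrightarrow> a p * \<theta> p v = \<theta>' (F1 p) (\<i> *s e') * Im (L1.cf p v)"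
      using transversal_pullback(2)[OF lt(2) lin nz[OF p(1) C(2)] tan \<theta> \<theta>' pb p ap _ B\<^sub>1(2) f(2)] B\<^sub>1(5) unfolding F1_def by blast
    interpret Q: transversal_lift "affine_part k (hyperquadric l' :: 'b cproj set)" W \<theta>' "{v. v $ k = 0}" "\<lambda>x. x" "qsign l'"
      by (rule quadric_transversal_lift[OF lt(2) \<theta>'])
    have id: "fd (\<lambda>x. x) y = (\<lambda>v. v)" for y :: "(complex, 'b) Finite_Cartesian_Product.vec" by (rule fd_eq) (rule has_derivative_ident)
    have dimk: "vec.dim {v :: (complex, 'b) Finite_Cartesian_Product.vec. v $ k = 0} = Suc N" using dim_coordinate_hyperplane(2)[of k] card(3) by simp
    have \<mu>: "\<theta>' (F1 p) (\<i> *s e') > 0"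
      by (rule Q.contact_form_of_type_positive[OF type(2,4) _ dimk _ e'(3,4)]) (use e' cq card in \<open>simp_all add: id\<close>)
    \<comment> \<open>The tangent vector \<open>\<i> *s e\<close> tests the sign: both contact forms
      are positive there by their type, so \<open>a p\<close> has the sign of
      \<open>t\<close>.\<close>
    have "L0.cf p (\<i> *s e) = \<i>" using e by (simp add: L0.cf_scale[OF C(2)])
    moreover obtain \<kappa> where "\<kappa> \<noteq> 0" "\<forall>v. Re (L0.cf p v) = \<kappa> * fd \<rho> p v" using \<kappa>0[OF p(1) C(2)] by blast
    ultimately have "fd \<rho> p (\<i> *s e) = 0" "L1.cf p (\<i> *s e) = of_real t * \<i>"
      by (metis complex_i_mult_minus imaginary_unit.sel(1) mult_eq_0_iff, simp add: t(2))
    then have "a p * \<theta> p (\<i> *s e) = \<theta>' (F1 p) (\<i> *s e') * t" using e'(5) by simp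
    then have "(\<epsilon> * a p) * \<theta> p (\<i> *s e) = \<theta>' (F1 p) (\<i> *s e') * (\<epsilon> * t)" by simp
    also have "\<dots> > 0" using \<mu> \<epsilon>(2) by simp
    finally show ?thesis using \<theta>_pos by (simp add: zero_less_mult_iff)
  qed
  have plane: "\<exists>P. projective_plane (int (min d (N + 2)) - 1) P \<and> f ` M \<subseteq> P"
    if \<sigma>: "\<sigma> = 1 \<or> \<sigma> = -1" and l1: "1 \<le> l"
      and signs: "card {i::'b. \<sigma> * qsign l' i > 0} + card {i::'a. \<sigma> * \<epsilon> * qsign l i < 0} < n + 2 + l"
      and d: "card {i::'b. \<sigma> * qsign l' i < 0} + card {i::'a. \<sigma> * \<epsilon> * qsign l i > 0} \<le> d \<or>
          card {i::'b. \<sigma> * qsign l' i > 0} + card {i::'a. \<sigma> * \<epsilon> * qsign l i < 0} \<le> d" for \<sigma> d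
  proof -
    \<comment> \<open>The largest \<open>q\<close> for which \<open>Suc q\<close> directions of
      either sign exist: there are \<open>l\<close> negative ones and \<open>n - l \<ge> l\<close>
      positive ones.\<close>
    have q: "Suc (l - 1) = l" using l1 by simp
    have \<rho>C: "smooth_on C \<rho>" by (rule smooth_on_subset[OF \<rho>(3) C(4)])
    have MC: "M \<inter> C = {x\<in>C. \<rho> x = 0}" using \<rho>(5) C(4) by blast
    have nzC: "fd \<rho> x \<noteq> (\<lambda>v. 0)" if "x \<in> C" for x using \<rho>(4) C(4) that by blast
    have pos: "\<exists>P. vec.subspace P \<and> Suc (l - 1) \<le> vec.dim P \<and> (\<forall>u\<in>P. L0.cf x u = 0 \<and> (u \<noteq> 0 \<longrightarrow> Re (L0.lf x u u) > 0))"
      if x: "x \<in> M" "x \<in> C" for x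
    proof -
      have "l \<le> n - l" using le by simp
      then show ?thesis unfolding q using dd(1)[OF x] by metis
    qed
    have neg: "\<exists>P. vec.subspace P \<and> Suc (l - 1) \<le> vec.dim P \<and> (\<forall>u\<in>P. L0.cf x u = 0 \<and> (u \<noteq> 0 \<longrightarrow> Re (L0.lf x u u) < 0))"
      if x: "x \<in> M" "x \<in> C" for x
      unfolding q using dd(2)[OF x] by (metis order_refl)
    have signs': "card {i::'b. \<sigma> * qsign l' i > 0} + card {i::'a. \<sigma> * \<epsilon> * qsign l i < 0} < CARD('m) + 1 + Suc (l - 1)"
      using signs card(1) q by simp
    have "\<exists>D. open D \<and> D \<noteq> {} \<and> D \<subseteq> C \<and>
        vec.dim (vec.span (F1 ` D)) \<le> card {i::'b. \<sigma> * qsign l' i < 0} + card {i::'a. \<sigma> * \<epsilon> * qsign l i > 0} \<and>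
        vec.dim (vec.span (F1 ` D)) \<le> card {i::'b. \<sigma> * qsign l' i > 0} + card {i::'a. \<sigma> * \<epsilon> * qsign l i < 0}"
    proof (rule local_dimension_bound[OF L0 L1 p(1) C(2) \<rho>C MC _ _ _ _ _ _ t(2) \<epsilon>(2,1) \<sigma> signs'])
      fix x assume x: "x \<in> C"
      show "fd \<rho> x \<noteq> (\<lambda>v. 0)" by (rule nzC[OF x])
      assume xM: "x \<in> M"
      show "\<exists>\<kappa>. \<kappa> \<noteq> 0 \<and> (\<forall>v. Re (L0.cf x v) = \<kappa> * fd \<rho> x v)" by (rule \<kappa>0[OF xM x])
      show "\<exists>\<kappa>. \<kappa> \<noteq> 0 \<and> (\<forall>v. Re (L1.cf x v) = \<kappa> * fd \<rho> x v)" by (rule \<kappa>1[OF xM x])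
      show "\<exists>P. vec.subspace P \<and> Suc (l - 1) \<le> vec.dim P \<and> (\<forall>u\<in>P. L0.cf x u = 0 \<and> (u \<noteq> 0 \<longrightarrow> Re (L0.lf x u u) > 0))"
        by (rule pos[OF xM x])
      show "\<exists>P. vec.subspace P \<and> Suc (l - 1) \<le> vec.dim P \<and> (\<forall>u\<in>P. L0.cf x u = 0 \<and> (u \<noteq> 0 \<longrightarrow> Re (L0.lf x u u) < 0))"
        by (rule neg[OF xM x])
      show "u = 0" if "L0.cf x u = 0" "\<And>v. L0.cf x v = 0 \<Longrightarrow> L0.lf x u v = 0" for u
        by (rule dd(3)[OF xM x that])
    qed
    then obtain D where D: "open D" "D \<noteq> {}" "D \<subseteq> C"
        "vec.dim (vec.span (F1 ` D)) \<le> card {i::'b. \<sigma> * qsign l' i < 0} + card {i::'a. \<sigma> * \<epsilon> * qsign l i > 0}"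
        "vec.dim (vec.span (F1 ` D)) \<le> card {i::'b. \<sigma> * qsign l' i > 0} + card {i::'a. \<sigma> * \<epsilon> * qsign l i < 0}"
      by (elim exE conjE) (rule that)
    have "vec.dim (UNIV :: (complex, 'b) Finite_Cartesian_Product.vec set) = CARD('b)"
      by (simp add: vec.dim_UNIV vec_dim_card card_cart_basis)
    then have "vec.dim (vec.span (F1 ` D)) \<le> CARD('b)" using vec.dim_subset[OF subset_UNIV] by metis
    then have "vec.dim (vec.span (F1 ` D)) \<le> min d (N + 2)" using d D(4,5) card(3) by auto
    then obtain Y where Y: "vec.subspace Y" "F1 ` D \<subseteq> Y" "vec.dim Y = min d (N + 2)"
      using subspace_of_dim[of "F1 ` D" "min d (N + 2)"] card(3) by auto
    have "\<forall>x\<in>D. line_of (f x) \<subseteq> Y"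
    proof
      fix x assume x: "x \<in> D"
      then have "f x \<in> chart_domain k" using D(3) C(7) B\<^sub>1(4) by blast
      moreover have "chart k (f x) \<in> Y" using Y(2) x unfolding F1_def by blast
      ultimately show "line_of (f x) \<subseteq> Y" using line_of_subset_iff[OF Y(1)] by blast
    qed
    then have "\<forall>x\<in>U. line_of (f x) \<subseteq> Y"
      using identity_theorem_cproj[OF f(1) U(1,2) Y(1) D(1,2)] D(3) C(5) by blast
    moreover have "projective_plane (int (min d (N + 2)) - 1) {L. line_of L \<subseteq> Y}"
      unfolding projective_plane_def using Y(1,3) by (intro exI[of _ Y]) simp
    ultimately show ?thesis using U(3) by (intro exI[of _ "{L. line_of L \<subseteq> Y}"]) blast
  qed
  show ?thesis
    by (rule exI[of _ \<epsilon>]) (intro conjI allI impI, use \<epsilon> sgn nN0 d1 d2 plane in \<open>blast+\<close>)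
qed

text \<open>The outer minimum with \<open>int N + 1\<close> caps the dimension at that of the
  ambient projective space: when the bound exceeds it, the plane is the whole space.\<close>

theorem theorem1p2:
  fixes n N\<^sub>0 N l l' :: nat
    and M U :: "(complex ^ 'm) set"
    and f\<^sub>0 :: "complex ^ 'm \<Rightarrow> 'a::{finite,linorder} cproj"
    and f :: "complex ^ 'm \<Rightarrow> 'b::{finite,linorder} cproj"
  assumes "CARD('m) = n + 1" and "CARD('a) = N\<^sub>0 + 2" and "CARD('b) = N + 2"
    and "smooth_real_hypersurface M" and "connected M" and "M \<noteq> {}"
    and "levi_nondegenerate M n" and "has_signature M n l"
    and "2 * l \<le> n" and "2 * l \<le> N\<^sub>0" and "2 * l' \<le> N"
    and "open U" and "connected U" and "M \<subseteq> U"
    and "holomorphic_cproj_on U f\<^sub>0" and "f\<^sub>0 ` M \<subseteq> hyperquadric l"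
    and "cr_transversal M f\<^sub>0 (hyperquadric l)"
    and "holomorphic_cproj_on U f" and "f ` M \<subseteq> hyperquadric l'"
    and "cr_transversal M f (hyperquadric l')"
  shows "(2 * l = n \<or> side_preserving n l N l' M f (hyperquadric l') \<longrightarrow>
            l' \<ge> l \<and> N - l' \<ge> n - l \<and>
            ((int N\<^sub>0 - int n) + (int l' - int l) < int l \<or>
             (int N\<^sub>0 - int n) + min (int l' - int l) ((int N - int l') - (int n - int l)) < int n \<and>
             (int N - int l') - (int n - int l) < int l \<longrightarrow>
             (\<exists>P. projective_plane
                   (min ((int N\<^sub>0 + 1) + min (int l' - int l) ((int N - int l') - (int n - int l)))
                        (int N + 1)) P \<and>
                  f ` M \<subseteq> hyperquadric l' \<inter> P)))
       \<and> (side_reversing n l N l' M f (hyperquadric l') \<longrightarrow>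
            N - l' \<ge> l \<and> l' \<ge> n - l \<and>
            (l' < n \<and> (int N\<^sub>0 - int n) + (int l' + int l - int n) < int n \<longrightarrow>
             (\<exists>P. projective_plane
                   (min ((int N\<^sub>0 + 1) + (int l' + int l - int n)) (int N + 1)) P \<and>
                  f ` M \<subseteq> hyperquadric l' \<inter> P)))"
proof -
  let ?Q = "hyperquadric l' :: 'b cproj set"
  note card = assms(1-3) and le = assms(9-11)
  obtain p where p: "p \<in> M" using assms(6) by blast
  have lt: "l < CARD('a)" "l' < CARD('b)" using le card by auto
  note cq = card_qsign[OF lt(1)] card_qsign[OF lt(2)]
  define R where "R \<epsilon> \<longleftrightarrow> n \<le> N\<^sub>0 \<and> n - l < card {i::'b. \<epsilon> * qsign l' i > 0} \<and> l < card {i::'b. \<epsilon> * qsign l' i < 0} \<and>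
      (\<forall>\<sigma> d. (\<sigma> = 1 \<or> \<sigma> = -1) \<and> 1 \<le> l \<and> card {i::'b. \<sigma> * qsign l' i > 0} + card {i::'a. \<sigma> * \<epsilon> * qsign l i < 0} < n + 2 + l \<and>
         (card {i::'b. \<sigma> * qsign l' i < 0} + card {i::'a. \<sigma> * \<epsilon> * qsign l i > 0} \<le> d \<or>
          card {i::'b. \<sigma> * qsign l' i > 0} + card {i::'a. \<sigma> * \<epsilon> * qsign l i < 0} \<le> d) \<longrightarrow>
         (\<exists>P. projective_plane (int (min d (N + 2)) - 1) P \<and> f ` M \<subseteq> P))" for \<epsilon> :: real
  have pair: "\<exists>\<epsilon>. (\<epsilon> = 1 \<or> \<epsilon> = -1) \<and>
      (contact_form_of_type M V n l \<theta> \<and> contact_form_of_type (affine_part k ?Q) W N l' \<theta>' \<and> 2 * l < n \<and> 2 * l' < N \<longrightarrow> \<epsilon> * a p > 0) \<and> R \<epsilon>"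
    if "p \<in> V" "contact_form_on M V \<theta>" "contact_form_on (affine_part k ?Q) W \<theta>'" "pulls_back_on M V \<theta> W \<theta>' k f a" "\<forall>x\<in>M \<inter> V. a x \<noteq> 0"
    for V \<theta> k W \<theta>' a
    unfolding R_def
    by (rule transversal_pair[OF card assms(4,7,8) le assms(12,13,14,15,16,17,18,19) that(2,3,4) p that(1,5)])
  have plane: "\<exists>P. projective_plane D P \<and> f ` M \<subseteq> ?Q \<inter> P"
    if "\<exists>P. projective_plane (int (min d (N + 2)) - 1) P \<and> f ` M \<subseteq> P" "D = int (min d (N + 2)) - 1" for d D
    using that assms(19) by blast
  \<comment> \<open>\<open>\<sigma> = 1\<close> turns the count of squares into
    \<open>N - l' < n\<close>, that is \<open>(N - l') - (n - l) < l\<close>;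
    \<open>\<sigma> = -1\<close> turns it into condition (i). For either choice both sums of signs
    bound the dimension of the span.\<close>
  have R1: "n \<le> N\<^sub>0 \<and> l \<le> l' \<and> n - l \<le> N - l' \<and> (\<forall>d. 1 \<le> l \<and>
      ((N + 1 - l') + (l + 1) < n + 2 + l \<or> (l' + 1) + (N\<^sub>0 + 1 - l) < n + 2 + l) \<and>
      ((l' + 1) + (N\<^sub>0 + 1 - l) \<le> d \<or> (N + 1 - l') + (l + 1) \<le> d) \<longrightarrow>
      (\<exists>P. projective_plane (int (min d (N + 2)) - 1) P \<and> f ` M \<subseteq> P))" if R: "R 1"
  proof (intro conjI allI impI)
    show "n \<le> N\<^sub>0" "l \<le> l'" "n - l \<le> N - l'" using R le card cq unfolding R_def by auto
    fix d assume d: "1 \<le> l \<and> ((N + 1 - l') + (l + 1) < n + 2 + l \<or> (l' + 1) + (N\<^sub>0 + 1 - l) < n + 2 + l) \<and>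
      ((l' + 1) + (N\<^sub>0 + 1 - l) \<le> d \<or> (N + 1 - l') + (l + 1) \<le> d)"
    note R' = R[unfolded R_def, THEN conjunct2, THEN conjunct2, THEN conjunct2, rule_format, of _ d]
    show "\<exists>P. projective_plane (int (min d (N + 2)) - 1) P \<and> f ` M \<subseteq> P"
    proof (cases "(N + 1 - l') + (l + 1) < n + 2 + l")
      case True
      then show ?thesis by (intro R'[of 1]) (use d cq card in auto)
    next
      case False
      then show ?thesis by (intro R'[of "-1"]) (use d cq card in auto)
    qed
  qed
  have R2: "n \<le> N\<^sub>0 \<and> l \<le> N - l' \<and> n - l \<le> l' \<and> (\<forall>d. 1 \<le> l \<and> l' < n \<and> l' + l + 2 \<le> d \<longrightarrow>
      (\<exists>P. projective_plane (int (min d (N + 2)) - 1) P \<and> f ` M \<subseteq> P))" if R: "R (-1)"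
  proof (intro conjI allI impI)
    show "n \<le> N\<^sub>0" "l \<le> N - l'" "n - l \<le> l'" using R le card cq unfolding R_def by auto
    fix d assume d: "1 \<le> l \<and> l' < n \<and> l' + l + 2 \<le> d"
    note R' = R[unfolded R_def, THEN conjunct2, THEN conjunct2, THEN conjunct2, rule_format, of _ d]
    show "\<exists>P. projective_plane (int (min d (N + 2)) - 1) P \<and> f ` M \<subseteq> P"
      by (intro R'[of "-1"]) (use d cq card in auto)
  qed
  show ?thesis
  proof (intro conjI impI)
    assume A: "2 * l = n \<or> side_preserving n l N l' M f ?Q"
    \<comment> \<open>Side preservation excludes \<open>\<epsilon> = -1\<close>. For
      \<open>2 * l = n\<close> the contact form on \<open>M\<close> has no preferred sign, and both
      cases are carried along.\<close>
    have "\<exists>\<epsilon>. (\<epsilon> = 1 \<or> \<epsilon> = -1 \<and> 2 * l = n) \<and> R \<epsilon>"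
    proof (cases "side_preserving n l N l' M f ?Q")
      case True
      then have two: "2 * l < n" "2 * l' < N" unfolding side_preserving_def by auto
      have ex: "\<exists>V \<theta> k W \<theta>' a. p \<in> V \<and> contact_form_of_type M V n l \<theta> \<and> contact_form_of_type (affine_part k ?Q) W N l' \<theta>' \<and>
          pulls_back_on M V \<theta> W \<theta>' k f a \<and> (\<forall>x\<in>M \<inter> V. a x > 0)"
        using True p unfolding side_preserving_def by blast
      obtain V \<theta> k W \<theta>' a where s: "p \<in> V" "contact_form_of_type M V n l \<theta>" "contact_form_of_type (affine_part k ?Q) W N l' \<theta>'"
          "pulls_back_on M V \<theta> W \<theta>' k f a" "\<forall>x\<in>M \<inter> V. a x > 0"
        using ex by (elim exE conjE) (rule that)
      have con: "contact_form_on M V \<theta>" "contact_form_on (affine_part k ?Q) W \<theta>'" using s(2,3) unfolding contact_form_of_type_def by auto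
      have a0: "\<forall>x\<in>M \<inter> V. a x \<noteq> 0" using s(5) by force
      obtain \<epsilon> where \<epsilon>: "\<epsilon> = 1 \<or> \<epsilon> = -1" "\<epsilon> * a p > 0" "R \<epsilon>" using pair[OF s(1) con s(4) a0] s(2,3) two by blast
      moreover have "a p > 0" using s(1,5) p by blast
      ultimately show ?thesis by (intro exI[of _ \<epsilon>]) auto
    next
      case False
      obtain V \<theta> k W \<theta>' a where s: "p \<in> V" "contact_form_on M V \<theta>" "contact_form_on (affine_part k ?Q) W \<theta>'"
          "pulls_back_on M V \<theta> W \<theta>' k f a" "\<forall>x\<in>M \<inter> V. a x \<noteq> 0"
        using assms(20)[unfolded cr_transversal_def, rule_format, OF p] by (elim exE conjE) (rule that)
      then show ?thesis using pair[OF s] A False by blast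
    qed
    then obtain \<epsilon> where \<epsilon>: "\<epsilon> = 1 \<or> \<epsilon> = -1 \<and> 2 * l = n" "R \<epsilon>" by blast
    have ineq: "n \<le> N\<^sub>0" "l \<le> l'" "n - l \<le> N - l'" using \<epsilon> R1 R2 by auto
    show "l' \<ge> l" "N - l' \<ge> n - l" by (rule ineq)+
    assume cond: "(int N\<^sub>0 - int n) + (int l' - int l) < int l \<or>
             (int N\<^sub>0 - int n) + min (int l' - int l) ((int N - int l') - (int n - int l)) < int n \<and>
             (int N - int l') - (int n - int l) < int l"
    \<comment> \<open>A linear dimension, one more than that of the plane. The subtractions are
      exact by the inequalities just obtained.\<close>
    define d where "d = N\<^sub>0 + 2 + min (l' - l) ((N - l') - (n - l))"
    have d: "int d = int N\<^sub>0 + 2 + min (int l' - int l) ((int N - int l') - (int n - int l))"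
    proof -
      have "int (l' - l) = int l' - int l" "int ((N - l') - (n - l)) = (int N - int l') - (int n - int l)" using ineq le by linarith+
      then show ?thesis unfolding d_def by linarith
    qed
    \<comment> \<open>For \<open>l = 0\<close> either alternative contradicts
      \<open>ineq\<close>.\<close>
    have l1: "1 \<le> l" using cond ineq le by linarith
    show "\<exists>P. projective_plane (min ((int N\<^sub>0 + 1) + min (int l' - int l) ((int N - int l') - (int n - int l))) (int N + 1)) P \<and>
                  f ` M \<subseteq> ?Q \<inter> P"
    proof (rule plane)
      show "min ((int N\<^sub>0 + 1) + min (int l' - int l) ((int N - int l') - (int n - int l))) (int N + 1) = int (min d (N + 2)) - 1"
        using d by linarith
      show "\<exists>P. projective_plane (int (min d (N + 2)) - 1) P \<and> f ` M \<subseteq> P"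
        using \<epsilon>(1)
      proof
        assume "\<epsilon> = 1"
        then have "R 1" using \<epsilon>(2) by simp
        moreover have "(N + 1 - l') + (l + 1) < n + 2 + l \<or> (l' + 1) + (N\<^sub>0 + 1 - l) < n + 2 + l"
          using cond ineq le by linarith
        moreover have "(l' + 1) + (N\<^sub>0 + 1 - l) \<le> d \<or> (N + 1 - l') + (l + 1) \<le> d"
          using d ineq le by linarith
        ultimately show ?thesis using R1 l1 by blast
      next
        assume e: "\<epsilon> = -1 \<and> 2 * l = n"
        then have "R (-1)" using \<epsilon>(2) by simp
        moreover have "l' < n" using cond ineq le e by linarith
        moreover have "l' + l + 2 \<le> d" using d ineq le e by linarith
        ultimately show ?thesis using R2 l1 by blast
      qed
    qed
  next
    assume A: "side_reversing n l N l' M f ?Q"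
    then have two: "2 * l < n" "2 * l' < N" unfolding side_reversing_def by auto
    have ex: "\<exists>V \<theta> k W \<theta>' a. p \<in> V \<and> contact_form_of_type M V n l \<theta> \<and> contact_form_of_type (affine_part k ?Q) W N l' \<theta>' \<and>
        pulls_back_on M V \<theta> W \<theta>' k f a \<and> (\<forall>x\<in>M \<inter> V. a x < 0)"
      using A p unfolding side_reversing_def by blast
    obtain V \<theta> k W \<theta>' a where s: "p \<in> V" "contact_form_of_type M V n l \<theta>" "contact_form_of_type (affine_part k ?Q) W N l' \<theta>'"
        "pulls_back_on M V \<theta> W \<theta>' k f a" "\<forall>x\<in>M \<inter> V. a x < 0"
      using ex by (elim exE conjE) (rule that)
    have con: "contact_form_on M V \<theta>" "contact_form_on (affine_part k ?Q) W \<theta>'" using s(2,3) unfolding contact_form_of_type_def by auto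
    have a0: "\<forall>x\<in>M \<inter> V. a x \<noteq> 0" using s(5) by force
    obtain \<epsilon> where \<epsilon>: "\<epsilon> = 1 \<or> \<epsilon> = -1" "\<epsilon> * a p > 0" "R \<epsilon>" using pair[OF s(1) con s(4) a0] s(2,3) two by blast
    moreover have "a p < 0" using s(1,5) p by blast
    ultimately have R: "R (-1)" by auto
    then have ineq: "n \<le> N\<^sub>0" "l \<le> N - l'" "n - l \<le> l'" using R2 by auto
    show "N - l' \<ge> l" "l' \<ge> n - l" by (rule ineq)+
    assume cond: "l' < n \<and> (int N\<^sub>0 - int n) + (int l' + int l - int n) < int n"
    have l1: "1 \<le> l" using cond ineq by linarith
    define d where "d = N\<^sub>0 + 2 + (l' + l - n)"
    have d: "int d = int N\<^sub>0 + 2 + (int l' + int l - int n)" unfolding d_def using ineq le by simp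
    show "\<exists>P. projective_plane (min ((int N\<^sub>0 + 1) + (int l' + int l - int n)) (int N + 1)) P \<and> f ` M \<subseteq> ?Q \<inter> P"
    proof (rule plane)
      show "min ((int N\<^sub>0 + 1) + (int l' + int l - int n)) (int N + 1) = int (min d (N + 2)) - 1" using d by linarith
      have "l' + l + 2 \<le> d" using d ineq by linarith
      then show "\<exists>P. projective_plane (int (min d (N + 2)) - 1) P \<and> f ` M \<subseteq> P" using R2[OF R] l1 cond by blast
    qed
  qed
qed

end
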